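(* Given any embedded graph $G$ in $\mathbb{R}^3$, there exists a Legendrian realization of $G$ in $(\mathbb{R}^3,\xi_{std})$; that is, there exists a Legendrian graph in $(\mathbb{R}^3,\xi_{std})$ that is ambient isotopic to the given embedded graph.
   Context: The standard contact structure on $\mathbb{R}^3$ is $\xi_{std}=\ker(dz-y\,dx)$. A curve is Legendrian if it is everywhere tangent to the contact planes. A Legendrian graph is a graph embedded in $\mathbb{R}^3$ in such a way that all its edges are Legendrian curves that are non-tangent to each other at the vertices, meaning: when all edges at a vertex are oriented outward, no two of their tangent vectors at the vertex have the same direction in the contact plane (opposite directions are allowed). Graphs may have loops and multiple edges. Two embedded graphs $f(G)$ and $\bar f(G)$ are ambient isotopic if there is an isotopy $h_t:\mathbb{R}^3\to\mathbb{R}^3$ with $h_0=\mathrm{id}$ and $h_1(f(G))=\bar f(G)$.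
   Formalization: The embedded graph is assumed finite and tame (ambient isotopic to a finite union of straight segments); for wild embeddings, such as a Fox–Artin arc, the claim fails, since every Legendrian graph is tame. *)

theory Defs
  imports "HOL-Analysis.Analysis" "Graph_Theory.Digraph"
begin

text \<open>
  A finite graph, possibly with loops and multiple edges, is given by a \<^const>\<open>fin_digraph\<close>.
  The direction of an arc has no geometric meaning: it only says which end of the edge is
  parametrised by \<open>0\<close> and which by \<open>1\<close>.

  A map of the graph into \<open>\<real>\<^sup>3\<close> consists of the positions \<open>p\<close> of its vertices and of a
  parametrisation \<open>\<gamma> e\<close>, over the unit interval, of every edge \<open>e\<close>.
\<close>

definition graph_image ::
  "('v, 'e) pre_digraph \<Rightarrow> ('v \<Rightarrow> real^3) \<Rightarrow> ('e \<Rightarrow> real \<Rightarrow> real^3) \<Rightarrow> (real^3) set" where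
  "graph_image G p \<gamma> = p ` verts G \<union> (\<Union>e\<in>arcs G. path_image (\<gamma> e))"

text \<open>
  Injectivity of the induced continuous map on the geometric realisation of \<open>G\<close>; the realisation
  of a finite graph being compact, such a map is a topological embedding.
\<close>

definition embedded_graph ::
  "('v, 'e) pre_digraph \<Rightarrow> ('v \<Rightarrow> real^3) \<Rightarrow> ('e \<Rightarrow> real \<Rightarrow> real^3) \<Rightarrow> bool" where
  "embedded_graph G p \<gamma> \<longleftrightarrow>
     fin_digraph G \<and>
     inj_on p (verts G) \<and>
     (\<forall>e\<in>arcs G. simple_path (\<gamma> e) \<and>
        pathstart (\<gamma> e) = p (tail G e) \<and> pathfinish (\<gamma> e) = p (head G e)) \<and>
     (\<forall>e\<in>arcs G. \<gamma> e ` {0<..<1} \<inter> p ` verts G = {}) \<and>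
     (\<forall>e\<in>arcs G. \<forall>e'\<in>arcs G. e \<noteq> e' \<longrightarrow> \<gamma> e ` {0<..<1} \<inter> \<gamma> e' ` {0<..<1} = {})"

definition ambient_isotopic :: "'a::topological_space set \<Rightarrow> 'a set \<Rightarrow> bool" where
  "ambient_isotopic A B \<longleftrightarrow>
     (\<exists>\<phi>. homotopic_with_canon (\<lambda>h. \<exists>k. homeomorphism UNIV UNIV h k) UNIV UNIV id \<phi> \<and> \<phi> ` A = B)"

text \<open>
  Tameness is the usual standing convention for spatial graphs. It cannot be dropped, since a wild
  embedding is not ambient isotopic to any graph with regular smooth edges that are pairwise
  non-tangent at the vertices. Degenerate segments \<open>a = b\<close> account for isolated vertices.
\<close>

definition tame :: "'a::real_normed_vector set \<Rightarrow> bool" where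
  "tame A \<longleftrightarrow>
     (\<exists>S :: ('a \<times> 'a) set. finite S \<and> ambient_isotopic A (\<Union>(a, b)\<in>S. closed_segment a b))"

text \<open>The plane of the contact structure \<open>ker (dz - y dx)\<close> at \<open>q\<close>, in coordinates \<open>(x, y, z)\<close>.\<close>

definition xi_std :: "real^3 \<Rightarrow> (real^3) set" where
  "xi_std q = {v. v$3 - q$2 * v$1 = 0}"

text \<open>All derivatives, one-sided ones at the end points, exist on the closed unit interval.\<close>

definition smooth_curve :: "(real \<Rightarrow> 'a::real_normed_vector) \<Rightarrow> bool" where
  "smooth_curve g \<longleftrightarrow>
     (\<exists>D :: nat \<Rightarrow> real \<Rightarrow> 'a. D 0 = g \<and>
        (\<forall>k. \<forall>t\<in>{0..1}. (D k has_vector_derivative D (Suc k) t) (at t within {0..1})))"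

definition velocity :: "(real \<Rightarrow> 'a::real_normed_vector) \<Rightarrow> real \<Rightarrow> 'a" where
  "velocity g t = vector_derivative g (at t within {0..1})"

definition legendrian_curve :: "(real \<Rightarrow> real^3) \<Rightarrow> bool" where
  "legendrian_curve g \<longleftrightarrow>
     smooth_curve g \<and> (\<forall>t\<in>{0..1}. velocity g t \<noteq> 0 \<and> velocity g t \<in> xi_std (g t))"

text \<open>
  An edge \<open>e\<close> has two ends, \<open>(e, False)\<close> at its tail and \<open>(e, True)\<close> at its head; both ends of a
  loop lie at the same vertex.
\<close>

definition end_vertex :: "('v, 'e) pre_digraph \<Rightarrow> 'e \<times> bool \<Rightarrow> 'v" where
  "end_vertex G = (\<lambda>(e, b). if b then head G e else tail G e)"

definition outward_tangent :: "('e \<Rightarrow> real \<Rightarrow> 'a::real_normed_vector) \<Rightarrow> 'e \<times> bool \<Rightarrow> 'a" where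
  "outward_tangent \<gamma> = (\<lambda>(e, b). if b then - velocity (\<gamma> e) 1 else velocity (\<gamma> e) 0)"

definition same_direction :: "'a::real_vector \<Rightarrow> 'a \<Rightarrow> bool" where
  "same_direction u v \<longleftrightarrow> (\<exists>c>0. u = c *\<^sub>R v)"

definition legendrian_graph ::
  "('v, 'e) pre_digraph \<Rightarrow> ('v \<Rightarrow> real^3) \<Rightarrow> ('e \<Rightarrow> real \<Rightarrow> real^3) \<Rightarrow> bool" where
  "legendrian_graph G p \<gamma> \<longleftrightarrow>
     embedded_graph G p \<gamma> \<and>
     (\<forall>e\<in>arcs G. legendrian_curve (\<gamma> e)) \<and>
     (\<forall>a\<in>arcs G \<times> UNIV. \<forall>b\<in>arcs G \<times> UNIV.
        a \<noteq> b \<and> end_vertex G a = end_vertex G b \<longrightarrow>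
        \<not> same_direction (outward_tangent \<gamma> a) (outward_tangent \<gamma> b))"

end

(*
  An ambient isotopy makes the graph polygonal, and a generic linear map makes every
  segment non-horizontal in z and non-degenerate in x, with distinct xy-directions of the
  segments at each node. Rescaling x and y by small factors makes the planes ker (dz - y dx)
  look almost horizontal compared with the segments, so that each segment can be replaced by a
  nearby curve satisfying the contact condition to first order: the projection to the xy-plane runs
  along the segment with many small loops (trochoids), whose signed areas provide the
  required height. Replacing the edges by curves that are close and whose differences are Lipschitz
  controlled by the distances of the points is realised by an ambient isotopy, the straight-line one.
  The resulting curves are still only piecewise smooth. They are smoothed by Bernstein polynomials of
  x and y, integrating y dx to obtain z; positivity of the Bernstein operators turns "locally expanding
  in a planar direction" into a nonvanishing planar velocity.
*)
theory Submission
  imports Defs "HOL-Computational_Algebra.Polynomial" "HOL-Real_Asymp.Real_Asymp"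
begin

section \<open>Ambient isotopies\<close>

text \<open>The delicate point is the control of the straight-line isotopies at the nodes. There two
  strands come arbitrarily close, so closeness of the new curves to the old ones is not enough; the
  bound comes from the planar directions at the node, which is why these must differ after
  projection and why planar displacements are kept below a small multiple of the distance to the
  node. Displacements in height cannot be made arbitrarily small: they contain the integral of
  \<open>y dx\<close> along the segment, of size length times \<open>Y\<close>, where
  \<open>Y\<close> bounds the absolute value of \<open>y\<close>. Scaling \<open>x\<close> by
  \<open>s\<close> and \<open>y\<close> by \<open>t\<close> makes this of order
  \<open>s * t\<close>, while disjoint segments stay at a distance at least of order
  \<open>t\<close>, so a small \<open>s\<close> suffices. Contact condition and regularity are
  expressed by increments instead of derivatives, since both have to make sense at the corners where
  strands are joined. Integrating \<open>y dx\<close> along a smoothed edge misses the prescribed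
  height of its end by a small amount; a multiple of a polynomial fixed in advance is added to
  \<open>y\<close> to repair this, and it vanishes at both ends to keep the vertices in
  place.\<close>

definition isotopic_id :: "('a::topological_space \<Rightarrow> 'a) \<Rightarrow> bool" where
  "isotopic_id \<phi> \<longleftrightarrow>
     homotopic_with_canon (\<lambda>h. \<exists>k. homeomorphism UNIV UNIV h k) UNIV UNIV id \<phi>"

lemma isotopic_id_imp_homeomorphism:
  "isotopic_id \<phi> \<Longrightarrow> \<exists>k. homeomorphism UNIV UNIV \<phi> k"
  unfolding isotopic_id_def using homotopic_with_imp_property by blast

lemma isotopic_id_id: "isotopic_id id"
  unfolding isotopic_id_def
  by (intro homotopic_with_refl[THEN iffD2] conjI exI[of _ id]) (auto simp: homeomorphism_def)

text \<open>The isotopy of \<open>\<psi>\<close> is precomposed with the homeomorphism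
  \<open>\<phi>\<close> and appended to that of \<open>\<phi>\<close>; all intermediate maps stay
  homeomorphisms.\<close>

lemma isotopic_id_compose:
  assumes "isotopic_id \<phi>" "isotopic_id \<psi>"
  shows "isotopic_id (\<psi> \<circ> \<phi>)"
proof -
  obtain k where k: "homeomorphism UNIV UNIV \<phi> k"
    using assms(1) isotopic_id_imp_homeomorphism by blast
  have "homotopic_with_canon (\<lambda>h. \<exists>k. homeomorphism UNIV UNIV h k) UNIV UNIV (id \<circ> \<phi>) (\<psi> \<circ> \<phi>)"
  proof (rule homotopic_with_compose_continuous_right)
    show "homotopic_with_canon (\<lambda>f. \<exists>k. homeomorphism UNIV UNIV (f \<circ> \<phi>) k) UNIV UNIV id \<psi>"
    proof (rule homotopic_with_mono[OF assms(2)[unfolded isotopic_id_def]])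
      fix h :: "'a \<Rightarrow> 'a" assume "\<exists>k. homeomorphism UNIV UNIV h k"
      then show "\<exists>k. homeomorphism UNIV UNIV (h \<circ> \<phi>) k"
        using homeomorphism_compose[OF k] by blast
    qed
    show "continuous_on UNIV \<phi>" using k by (simp add: homeomorphism_def)
  qed auto
  then show ?thesis
    using assms(1) homotopic_with_trans unfolding isotopic_id_def by fastforce
qed

lemma ambient_isotopic_iff: "ambient_isotopic A B \<longleftrightarrow> (\<exists>\<phi>. isotopic_id \<phi> \<and> \<phi> ` A = B)"
  unfolding ambient_isotopic_def isotopic_id_def ..

section \<open>Lipschitz extensions and perturbations of the identity\<close>

text \<open>McShane's formula: an infimum of the cones \<open>d a + k * dist x a\<close> over
  \<open>a \<in> X\<close> inherits their Lipschitz constant, and at a point of \<open>X\<close> the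
  cone with that apex is the lowest one.\<close>

lemma lipschitz_real_extension:
  fixes d :: "'a::metric_space \<Rightarrow> real"
  assumes "\<And>x y. x \<in> X \<Longrightarrow> y \<in> X \<Longrightarrow> \<bar>d x - d y\<bar> \<le> k * dist x y" and "k \<ge> 0"
  obtains d' where "\<And>x y. \<bar>d' x - d' y\<bar> \<le> k * dist x y" "\<And>x. x \<in> X \<Longrightarrow> d' x = d x"
proof (cases "X = {}")
  case True
  then show ?thesis using that[of "\<lambda>_. 0"] assms(2) by auto
next
  case False
  define d' where "d' x = (INF a\<in>X. d a + k * dist x a)" for x
  obtain a0 where a0: "a0 \<in> X" using False by blast
  have bdd: "bdd_below ((\<lambda>a. d a + k * dist x a) ` X)" for x
  proof (rule bdd_belowI2)
    fix a assume a: "a \<in> X"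
    have "d a0 - d a \<le> k * dist a0 a" using assms(1)[OF a0 a] by linarith
    also have "\<dots> \<le> k * (dist x a0 + dist x a)"
      using assms(2) by (intro mult_left_mono) (metis dist_commute dist_triangle)
    finally show "d a0 - k * dist x a0 \<le> d a + k * dist x a" by (simp add: algebra_simps)
  qed
  have le: "d' x \<le> d' y + k * dist x y" for x y
  proof -
    have "d' x - k * dist x y \<le> d a + k * dist y a" if a: "a \<in> X" for a
    proof -
      have "d' x \<le> d a + k * dist x a" unfolding d'_def by (rule cINF_lower[OF bdd a])
      also have "\<dots> \<le> d a + k * (dist x y + dist y a)"
        using assms(2) by (intro add_left_mono mult_left_mono dist_triangle)
      finally show ?thesis by (simp add: algebra_simps)
    qed
    then have "d' x - k * dist x y \<le> d' y" unfolding d'_def[of y] by (intro cINF_greatest False)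
    then show ?thesis by simp
  qed
  have "\<bar>d' x - d' y\<bar> \<le> k * dist x y" for x y
    using le[of x y] le[of y x] by (simp add: dist_commute)
  moreover have "d' x = d x" if x: "x \<in> X" for x
  proof (rule antisym)
    show "d' x \<le> d x" using cINF_lower[OF bdd x, of x] by (simp add: d'_def)
    show "d x \<le> d' x" unfolding d'_def
    proof (intro cINF_greatest False)
      fix a assume a: "a \<in> X"
      show "d x \<le> d a + k * dist x a" using assms(1)[OF x a] by linarith
    qed
  qed
  ultimately show ?thesis using that by blast
qed

text \<open>McShane's extension is applied to each coordinate; the factor \<open>DIM('b)\<close>
  lost in this way is absorbed later by shortening the time step of the isotopy.\<close>

lemma lipschitz_extension:
  fixes d :: "'a::metric_space \<Rightarrow> 'b::euclidean_space"
  assumes "\<And>x y. x \<in> X \<Longrightarrow> y \<in> X \<Longrightarrow> norm (d x - d y) \<le> k * dist x y" and "k \<ge> 0"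
  shows "\<exists>d'. (\<forall>x y. norm (d' x - d' y) \<le> (real DIM('b) * k) * dist x y) \<and> (\<forall>x\<in>X. d' x = d x)"
proof -
  have "\<exists>f. (\<forall>x y. \<bar>f x - f y\<bar> \<le> k * dist x y) \<and> (\<forall>x\<in>X. f x = d x \<bullet> i)" if i: "i \<in> Basis" for i
  proof -
    have "\<bar>d x \<bullet> i - d y \<bullet> i\<bar> \<le> k * dist x y" if "x \<in> X" "y \<in> X" for x y
      using assms(1)[OF that] Basis_le_norm[OF i, of "d x - d y"] by (simp add: inner_diff_left)
    then show ?thesis using lipschitz_real_extension[of X "\<lambda>x. d x \<bullet> i" k] assms(2) by metis
  qed
  then obtain f where f: "\<And>i x y. i \<in> Basis \<Longrightarrow> \<bar>f i x - f i y\<bar> \<le> k * dist x y"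
    and fX: "\<And>i x. i \<in> Basis \<Longrightarrow> x \<in> X \<Longrightarrow> f i x = d x \<bullet> i"
    by metis
  define d' where "d' x = (\<Sum>i\<in>Basis. f i x *\<^sub>R i)" for x :: 'a
  show ?thesis
  proof (intro exI[of _ d'] conjI allI ballI)
    fix x y
    have "d' x - d' y = (\<Sum>i\<in>Basis. (f i x - f i y) *\<^sub>R i)"
      by (simp add: d'_def sum_subtractf scaleR_diff_left)
    also have "norm \<dots> \<le> (\<Sum>i\<in>(Basis::'b set). k * dist x y)"
      by (rule sum_norm_le) (simp add: f)
    finally show "norm (d' x - d' y) \<le> (real DIM('b) * k) * dist x y" by simp
  next
    fix x assume "x \<in> X"
    then show "d' x = d x" by (simp add: d'_def fX euclidean_representation)
  qed
qed

text \<open>Solving \<open>x + d x = y\<close> is a fixed point problem for the contraction sending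
  \<open>x\<close> to \<open>y - d x\<close>, and the bound \<open>low\<close> makes the inverse
  Lipschitz with constant \<open>1 / (1 - k)\<close>.\<close>

lemma homeomorphism_id_plus_lipschitz:
  fixes d :: "'a::euclidean_space \<Rightarrow> 'a"
  assumes d: "\<And>x y. norm (d x - d y) \<le> k * norm (x - y)" and k: "0 \<le> k" "k < 1"
  shows "\<exists>g. homeomorphism UNIV UNIV (\<lambda>x. x + d x) g"
proof -
  let ?h = "\<lambda>x. x + d x"
  have low: "(1 - k) * norm (x - y) \<le> norm (?h x - ?h y)" for x y
  proof -
    have "norm (x - y) - norm (d x - d y) \<le> norm ((x - y) + (d x - d y))"
      by (metis diff_minus_eq_add norm_minus_cancel norm_triangle_ineq2)
    then show ?thesis using d[of x y] by (simp add: algebra_simps)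
  qed
  have "\<exists>x. ?h x = y" for y
  proof -
    have "\<exists>!x. y - d x = x"
      by (rule banach_fix_type[OF k]) (use d in \<open>auto simp: dist_norm norm_minus_commute\<close>)
    then obtain x where "y - d x = x" by blast
    then show ?thesis by (metis diff_add_cancel)
  qed
  then obtain g where g: "\<And>y. ?h (g y) = y" by metis
  have gh: "g (?h x) = x" for x
    using low[of "g (?h x)" x] k by (simp add: g mult_le_0_iff)
  have "continuous_on UNIV d"
    by (rule lipschitz_on_continuous_on[of k]) (use d k in \<open>auto intro!: lipschitz_onI simp: dist_norm\<close>)
  then have "continuous_on UNIV ?h" by (intro continuous_intros)
  moreover have "continuous_on UNIV g"
  proof (rule lipschitz_on_continuous_on[of "1 / (1 - k)"], rule lipschitz_onI)
    fix x y
    show "dist (g x) (g y) \<le> 1 / (1 - k) * dist x y"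
      using low[of "g x" "g y"] k g[of x] g[of y] by (simp add: dist_norm field_simps)
  qed (use k in auto)
  ultimately show ?thesis
    by (intro exI[of _ g]) (auto simp: homeomorphism_def g gh intro: rangeI[of ?h "g _", unfolded g] rangeI[of g "?h _", unfolded gh])
qed

text \<open>At time \<open>t\<close> the displacement is \<open>t\<close> times \<open>d\<close>,
  which has Lipschitz constant at most \<open>k\<close> again, so every stage of the homotopy is a
  homeomorphism.\<close>

lemma isotopic_id_small_lipschitz:
  fixes d :: "'a::euclidean_space \<Rightarrow> 'a"
  assumes d: "\<And>x y. norm (d x - d y) \<le> k * norm (x - y)" and k: "0 \<le> k" "k < 1"
  shows "isotopic_id (\<lambda>x. x + d x)"
proof -
  have "continuous_on UNIV d"
    by (rule lipschitz_on_continuous_on[of k]) (use d k in \<open>auto intro!: lipschitz_onI simp: dist_norm\<close>)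
  then have c: "continuous_on ({0..1} \<times> UNIV) (\<lambda>p. snd p + (fst p::real) *\<^sub>R d (snd p))"
    by (intro continuous_intros continuous_on_compose2[OF _ continuous_on_snd[OF continuous_on_id]]) auto
  show ?thesis unfolding isotopic_id_def homotopic_with_def
  proof (intro exI[of _ "\<lambda>p. snd p + fst p *\<^sub>R d (snd p)"] conjI ballI allI)
    fix t :: real assume t: "t \<in> {0..1}"
    have "norm (t *\<^sub>R d x - t *\<^sub>R d y) \<le> k * norm (x - y)" for x y
    proof -
      have "norm (t *\<^sub>R d x - t *\<^sub>R d y) = t * norm (d x - d y)"
        using t by (simp flip: scaleR_diff_right)
      also have "\<dots> \<le> 1 * norm (d x - d y)" using t by (intro mult_right_mono) auto
      finally show ?thesis using d[of x y] by simp
    qed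
    from homeomorphism_id_plus_lipschitz[OF this k]
    show "\<exists>g. homeomorphism UNIV UNIV (\<lambda>x. snd (t, x) + fst (t, x) *\<^sub>R d (snd (t, x))) g" by simp
  qed (use c in \<open>auto simp: prod_topology_subtopology\<close>)
qed

text \<open>The homotopy is cut into steps so short that each displacement is a small Lipschitz function
  of the current position.\<close>

lemma isotopic_id_straight_line:
  fixes F D :: "'i \<Rightarrow> 'a::euclidean_space"
  assumes "\<And>a b s. a \<in> I \<Longrightarrow> b \<in> I \<Longrightarrow> 0 \<le> s \<Longrightarrow> s \<le> 1 \<Longrightarrow>
             norm (D a - D b) \<le> K * norm ((F a + s *\<^sub>R D a) - (F b + s *\<^sub>R D b))"
  obtains \<phi> where "isotopic_id \<phi>" "\<And>a. a \<in> I \<Longrightarrow> \<phi> (F a) = F a + D a"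
proof -
  \<comment> \<open>With this many steps, the displacement of a single step extends to a map of
    Lipschitz constant at most 1/2, the factor \<open>DIM('a)\<close> included; the added 1 keeps
    \<open>N\<close> positive.\<close>
  define N where "N = nat \<lceil>2 * real DIM('a) * max K 0\<rceil> + 1"
  have N: "real N \<ge> 2 * (real DIM('a) * max K 0)" "N > 0"
    unfolding N_def by linarith+
  let ?F = "\<lambda>s a. F a + s *\<^sub>R D a"
  have step: "\<exists>\<psi>. isotopic_id \<psi> \<and> (\<forall>a\<in>I. \<psi> (?F s a) = ?F (s + 1/N) a)"
    if s: "0 \<le> s" "s \<le> 1" for s
  proof -
    have lip: "norm (D a - D b) \<le> max K 0 * norm (?F s a - ?F s b)" if "a \<in> I" "b \<in> I" for a b
      using assms[OF that s] mult_right_mono[of K "max K 0" "norm (?F s a - ?F s b)"] by force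
    \<comment> \<open>The displacement is rewritten as a function of the current position. The
      choice of a preimage is harmless: by \<open>lip\<close>, indices with equal position have
      equal displacement.\<close>
    define e where "e x = (1/N) *\<^sub>R D (inv_into I (?F s) x)" for x
    have e: "e (?F s a) = (1/N) *\<^sub>R D a" if a: "a \<in> I" for a
    proof -
      let ?b = "inv_into I (?F s) (?F s a)"
      have "?b \<in> I" "?F s ?b = ?F s a"
        using a by (auto intro: inv_into_into f_inv_into_f)
      then have "D ?b = D a" using lip[of ?b a] a by simp
      then show ?thesis by (simp add: e_def)
    qed
    have "norm (e x - e y) \<le> max K 0 / N * dist x y" if xy: "x \<in> ?F s ` I" "y \<in> ?F s ` I" for x y
    proof -
      obtain a b where ab: "a \<in> I" "x = ?F s a" "b \<in> I" "y = ?F s b" using xy by blast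
      have "norm (e x - e y) = norm (D a - D b) / N"
        unfolding ab(2,4) e[OF ab(1)] e[OF ab(3)] by (simp flip: scaleR_diff_right)
      also have "\<dots> \<le> max K 0 * norm (?F s a - ?F s b) / N"
        using lip[OF ab(1,3)] by (intro divide_right_mono) auto
      finally show ?thesis by (simp add: ab dist_norm)
    qed
    from lipschitz_extension[of "?F s ` I" e "max K 0 / N", OF this] obtain e' where e': "\<And>x y. norm (e' x - e' y) \<le> (real DIM('a) * (max K 0 / N)) * dist x y"
        "\<And>x. x \<in> ?F s ` I \<Longrightarrow> e' x = e x"
      by auto
    have "real DIM('a) * (max K 0 / N) \<le> 1/2"
      using N by (simp add: field_simps)
    then have lt: "real DIM('a) * (max K 0 / N) < 1" by linarith
    have "isotopic_id (\<lambda>x. x + e' x)"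
      by (rule isotopic_id_small_lipschitz[OF e'(1)[unfolded dist_norm] _ lt]) simp
    then show ?thesis
      by (intro exI[of _ "\<lambda>x. x + e' x"]) (auto simp: e' e algebra_simps)
  qed
  have "\<exists>\<phi>. isotopic_id \<phi> \<and> (\<forall>a\<in>I. \<phi> (F a) = ?F (real m / N) a)" if "m \<le> N" for m
    using that
  proof (induction m)
    case 0
    show ?case by (intro exI[of _ id] conjI isotopic_id_id) auto
  next
    case (Suc m)
    then obtain \<phi> where \<phi>: "isotopic_id \<phi>" "\<forall>a\<in>I. \<phi> (F a) = ?F (real m / N) a" by auto
    obtain \<psi> where \<psi>: "isotopic_id \<psi>" "\<forall>a\<in>I. \<psi> (?F (real m / N) a) = ?F (real m / N + 1 / N) a"
      using step[of "real m / N"] Suc.prems by auto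
    have "real m / N + 1 / N = real (Suc m) / N" by (simp add: add_divide_distrib)
    then show ?case using \<phi>(2) \<psi>(2)
      by (intro exI[of _ "\<psi> \<circ> \<phi>"] conjI isotopic_id_compose[OF \<phi>(1) \<psi>(1)]) auto
  qed
  from this[of N] show ?thesis using that N(2) by auto
qed

text \<open>If no map on the segment from the identity to \<open>T\<close> has a kernel, compactness
  of the time interval times the unit sphere bounds all these maps from below by one constant, which
  is the control required by the straight-line isotopy.\<close>

lemma isotopic_id_linear:
  fixes T :: "'a::euclidean_space \<Rightarrow> 'a"
  assumes T: "linear T" and inj: "\<And>s v. 0 \<le> s \<Longrightarrow> s \<le> 1 \<Longrightarrow> (1 - s) *\<^sub>R v + s *\<^sub>R T v = 0 \<Longrightarrow> v = 0"
  shows "isotopic_id T"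
proof -
  let ?S = "{0..1::real} \<times> sphere (0::'a) 1"
  let ?g = "\<lambda>(s, v). (1 - s) *\<^sub>R v + s *\<^sub>R T v"
  have cT: "continuous_on A T" for A
    using T by (simp add: linear_continuous_on linear_conv_bounded_linear)
  obtain B where B: "B > 0" "\<And>v. norm (T v - v) \<le> B * norm v"
    using linear_bounded_pos[OF linear_compose_sub[OF T linear_ident]] by (auto simp: id_def)
  have "\<exists>c>0. \<forall>q\<in>?S. c \<le> norm (?g q)"
  proof -
    have "continuous_on ?S (\<lambda>q. norm (?g q))"
      unfolding case_prod_beta
      by (intro continuous_intros continuous_on_compose2[OF cT continuous_on_snd[OF continuous_on_id]]) auto
    moreover have "compact ?S" by (intro compact_Times) auto
    moreover have "?S \<noteq> {}" by (auto simp: vector_choose_size)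
    ultimately obtain q where q: "q \<in> ?S" "\<And>q'. q' \<in> ?S \<Longrightarrow> norm (?g q) \<le> norm (?g q')"
      using continuous_attains_inf[of ?S "\<lambda>q. norm (?g q)"] by blast
    have "?g q \<noteq> 0" using q(1) inj[of "fst q" "snd q"] by auto
    then show ?thesis using q(2) by (intro exI[of _ "norm (?g q)"]) auto
  qed
  then obtain c where c: "c > 0" "\<And>q. q \<in> ?S \<Longrightarrow> c \<le> norm (?g q)" by blast
  have low: "c * norm v \<le> norm ((1 - s) *\<^sub>R v + s *\<^sub>R T v)" if s: "0 \<le> s" "s \<le> 1" for s v
  proof (cases "v = 0")
    case False
    have "?g (s, (1 / norm v) *\<^sub>R v) = (1 / norm v) *\<^sub>R ?g (s, v)"
      by (simp add: linear_scale[OF T] scaleR_add_right mult.commute)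
    then have "c \<le> norm (?g (s, v)) / norm v"
      using c(2)[of "(s, (1 / norm v) *\<^sub>R v)"] s False by simp
    then show ?thesis using False by (simp add: field_simps)
  qed (use c in auto)
  obtain \<phi> where "isotopic_id \<phi>" "\<And>a. a \<in> UNIV \<Longrightarrow> \<phi> (id a) = id a + (T a - a)"
  proof (rule isotopic_id_straight_line[of UNIV "\<lambda>a. T a - a" "B / c" id])
    fix a b :: 'a and s :: real assume s: "0 \<le> s" "s \<le> 1"
    have eq: "(id a + s *\<^sub>R (T a - a)) - (id b + s *\<^sub>R (T b - b)) = (1 - s) *\<^sub>R (a - b) + s *\<^sub>R T (a - b)"
      by (simp add: linear_diff[OF T] algebra_simps)
    have "norm ((T a - a) - (T b - b)) = norm (T (a - b) - (a - b))"
      by (simp add: linear_diff[OF T] algebra_simps)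
    also have "\<dots> \<le> B * norm (a - b)" by (rule B)
    also have "\<dots> \<le> B * (norm ((1 - s) *\<^sub>R (a - b) + s *\<^sub>R T (a - b)) / c)"
      using low[OF s, of "a - b"] B c by (intro mult_left_mono) (auto simp: field_simps)
    finally show "norm ((T a - a) - (T b - b)) \<le> B / c *
        norm ((id a + s *\<^sub>R (T a - a)) - (id b + s *\<^sub>R (T b - b)))"
      unfolding eq by simp
  qed auto
  moreover from this have "\<phi> = T" by auto
  ultimately show ?thesis by simp
qed

lemma embedded_graph_homeomorphic_image:
  assumes "embedded_graph G p \<gamma>" and h: "homeomorphism UNIV UNIV \<phi> k"
  shows "embedded_graph G (\<phi> \<circ> p) (\<lambda>e. \<phi> \<circ> \<gamma> e)"
proof -
  have cont: "continuous_on UNIV \<phi>" and inj: "inj \<phi>"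
    using h by (auto simp: homeomorphism_def intro: inj_on_inverseI)
  have sp: "simple_path (\<phi> \<circ> \<gamma> e)" if "simple_path (\<gamma> e)" for e
    by (rule simple_path_continuous_image[OF that]) (use cont inj in \<open>auto intro: continuous_on_subset inj_on_subset\<close>)
  have im: "(\<lambda>x. \<phi> (f x)) ` A \<inter> (\<lambda>x. \<phi> (g x)) ` B = {} \<longleftrightarrow> f ` A \<inter> g ` B = {}"
    for f :: "real \<Rightarrow> real^3" and g :: "'c \<Rightarrow> real^3" and A B
    using inj by (auto dest: injD)
  have "inj_on (\<phi> \<circ> p) (verts G)" if "inj_on p (verts G)"
    using that inj by (simp add: comp_inj_on inj_on_subset)
  then show ?thesis
    using assms(1) unfolding embedded_graph_def comp_def
    by (simp add: im sp[unfolded comp_def] pathstart_def pathfinish_def)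
qed

lemma graph_image_comp: "graph_image G (\<phi> \<circ> p) (\<lambda>e. \<phi> \<circ> \<gamma> e) = \<phi> ` graph_image G p \<gamma>"
  unfolding graph_image_def path_image_def by (auto simp: image_comp[symmetric])

section \<open>Polygonal graphs\<close>

lemma closed_segment_param: "closed_segment a b = (\<lambda>u. a + u *\<^sub>R (b - a)) ` {0..1}"
proof -
  have "(1 - u) *\<^sub>R a + u *\<^sub>R b = a + u *\<^sub>R (b - a)" for u by (simp add: algebra_simps)
  then show ?thesis unfolding closed_segment_def by auto
qed

text \<open>Segments of the union may cross or overlap. The intersection of two is compact, convex
  and collinear, hence empty or again a segment, possibly a single point; the ends of all these
  overlaps are added to the nodes.\<close>

lemma finite_segment_nodes:
  fixes S :: "('a::euclidean_space \<times> 'a) set"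
  assumes "finite S" "finite V"
  obtains V0 where "finite V0" "V \<subseteq> V0" "\<And>a b. (a, b) \<in> S \<Longrightarrow> a \<in> V0 \<and> b \<in> V0"
    "\<And>a b c d. (a, b) \<in> S \<Longrightarrow> (c, d) \<in> S \<Longrightarrow> closed_segment a b \<inter> closed_segment c d = {} \<or>
       (\<exists>u\<in>V0. \<exists>v\<in>V0. closed_segment a b \<inter> closed_segment c d = closed_segment u v)"
proof -
  let ?I = "\<lambda>q. closed_segment (fst (fst q)) (snd (fst q)) \<inter> closed_segment (fst (snd q)) (snd (snd q))"
  define R where "R q w \<longleftrightarrow> ?I q = {} \<or> ?I q = closed_segment (fst w) (snd w)" for q and w :: "'a \<times> 'a"
  have "\<exists>w. R q w" for q
  proof (cases "?I q = {}")
    case False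
    have "compact (?I q)" "convex (?I q)" "collinear (?I q)"
      by (auto intro!: compact_Int convex_Int intro: collinear_subset[OF collinear_closed_segment])
    then obtain u v where "?I q = closed_segment u v" using compact_convex_collinear_segment[OF False] by metis
    then show ?thesis by (auto simp: R_def intro!: exI[of _ "(u, v)"])
  qed (auto simp: R_def)
  then obtain w where w: "\<And>q. R q (w q)" by metis
  define V0 where "V0 = V \<union> fst ` S \<union> snd ` S \<union> (fst \<circ> w) ` (S \<times> S) \<union> (snd \<circ> w) ` (S \<times> S)"
  show ?thesis
  proof (rule that[of V0])
    show "finite V0" using assms by (simp add: V0_def)
    show "V \<subseteq> V0" by (auto simp: V0_def)
    show "a \<in> V0 \<and> b \<in> V0" if "(a, b) \<in> S" for a b
      using that by (force simp: V0_def)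
    fix a b c d assume ab: "(a, b) \<in> S" and cd: "(c, d) \<in> S"
    have "fst (w ((a, b), (c, d))) \<in> V0" "snd (w ((a, b), (c, d))) \<in> V0"
      using ab cd by (auto simp: V0_def intro!: image_eqI[of _ _ "((a, b), (c, d))"])
    then show "closed_segment a b \<inter> closed_segment c d = {} \<or>
       (\<exists>u\<in>V0. \<exists>v\<in>V0. closed_segment a b \<inter> closed_segment c d = closed_segment u v)"
      using w[of "((a, b), (c, d))"] unfolding R_def fst_conv snd_conv by blast
  qed
qed

text \<open>Away from the nodes, each segment is both closed and relatively open in the union.\<close>

lemma connected_subset_single_segment:
  fixes S :: "('a::euclidean_space \<times> 'a) set"
  assumes "finite S"
    and ends: "\<And>a b. (a, b) \<in> S \<Longrightarrow> a \<in> V0 \<and> b \<in> V0"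
    and int: "\<And>a b c d. (a, b) \<in> S \<Longrightarrow> (c, d) \<in> S \<Longrightarrow> closed_segment a b \<inter> closed_segment c d = {} \<or>
       (\<exists>u\<in>V0. \<exists>v\<in>V0. closed_segment a b \<inter> closed_segment c d = closed_segment u v)"
    and C: "connected C" "C \<subseteq> (\<Union>(a, b)\<in>S. closed_segment a b)" "C \<inter> V0 = {}"
    and ab: "(a, b) \<in> S" "C \<inter> closed_segment a b \<noteq> {}"
  shows "C \<subseteq> closed_segment a b"
proof -
  let ?T = "closed_segment a b"
  have "closedin (top_of_set C) (C \<inter> ?T)" by (simp add: closedin_closed_Int)
  moreover have "openin (top_of_set C) (C \<inter> ?T)"
    unfolding openin_euclidean_subtopology_iff
  proof (intro conjI ballI)
    fix x assume x: "x \<in> C \<inter> ?T"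
    have "\<exists>e>0. \<forall>y\<in>closed_segment (fst q) (snd q). dist y x < e \<longrightarrow> y \<in> ?T" if q: "q \<in> S" for q
    proof -
      obtain c d where cd: "q = (c, d)" by (cases q)
      show ?thesis
      proof (cases "x \<in> closed_segment c d")
        case False
        then have "\<exists>e>0. \<forall>y\<in>closed_segment c d. e \<le> dist x y"
          by (intro separate_point_closed) auto
        then show ?thesis unfolding cd by (metis dist_commute fst_conv not_le snd_conv)
      next
        case True
        then obtain u v where uv: "u \<in> V0" "v \<in> V0" "?T \<inter> closed_segment c d = closed_segment u v"
          using int[OF ab(1), of c d] q cd x by blast
        have xuv: "x \<in> closed_segment u v" using uv(3) True x by blast
        moreover have "x \<noteq> u" "x \<noteq> v" using uv(1,2) x C(3) by auto
        ultimately have xo: "x \<in> open_segment u v" and ne: "u \<noteq> v"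
          by (auto simp: open_segment_def)
        \<comment> \<open>As \<open>x\<close> is no node, it is interior to the overlap from
          \<open>u\<close> to \<open>v\<close>. The other segment lies on the line through
          \<open>u\<close> and \<open>v\<close>, so its points near \<open>x\<close> belong to the
          overlap as well.\<close>
        have "openin (top_of_set (affine hull {u, v})) (open_segment u v)"
          using openin_rel_interior[of "closed_segment u v"] ne
          unfolding rel_interior_closed_segment by (simp add: segment_convex_hull affine_hull_convex_hull)
        then obtain e where e: "e > 0" "\<And>y. y \<in> affine hull {u, v} \<Longrightarrow> dist y x < e \<Longrightarrow> y \<in> open_segment u v"
          using xo unfolding openin_euclidean_subtopology_iff by blast
        have "y \<in> affine hull {u, v}" if "y \<in> closed_segment c d" for y
        proof -
          have "{u, v, y} \<subseteq> closed_segment c d" using uv(3) that by auto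
          then have "collinear {u, v, y}" by (rule collinear_subset[OF collinear_closed_segment])
          then show ?thesis using collinear_3_affine_hull[OF ne] by blast
        qed
        then have "\<forall>y\<in>closed_segment c d. dist y x < e \<longrightarrow> y \<in> ?T"
          using e(2) uv(3) by (metis IntE open_closed_segment)
        then show ?thesis using e(1) cd by auto
      qed
    qed
    then obtain e where e: "\<And>q. q \<in> S \<Longrightarrow> e q > 0"
      "\<And>q y. q \<in> S \<Longrightarrow> y \<in> closed_segment (fst q) (snd q) \<Longrightarrow> dist y x < e q \<Longrightarrow> y \<in> ?T"
      by metis
    have "Min (e ` S) > 0" using assms(1) ab(1) e(1) by (subst Min_gr_iff) auto
    moreover have "y \<in> ?T" if y: "y \<in> C" "dist y x < Min (e ` S)" for y
    proof -
      obtain q where q: "q \<in> S" "y \<in> closed_segment (fst q) (snd q)" using y(1) C(2) by force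
      have "Min (e ` S) \<le> e q" using q(1) assms(1) by simp
      then have "dist y x < e q" using y(2) by linarith
      then show ?thesis using e(2) q by blast
    qed
    ultimately show "\<exists>e>0. \<forall>x'\<in>C. dist x' x < e \<longrightarrow> x' \<in> C \<inter> ?T" by blast
  qed auto
  ultimately show ?thesis
    using C(1) ab(2) unfolding connected_clopen by blast
qed

lemma closed_segment_affine_image:
  "(\<lambda>r. a + r *\<^sub>R v) ` closed_segment r s = closed_segment (a + r *\<^sub>R v) (a + s *\<^sub>R v)" for r s :: real
proof -
  have "(\<lambda>r. a + r *\<^sub>R v) ` closed_segment r s = (+) a ` (\<lambda>r. r *\<^sub>R v) ` closed_segment r s"
    by (simp add: image_comp comp_def)
  also have "(\<lambda>r. r *\<^sub>R v) ` closed_segment r s = closed_segment (r *\<^sub>R v) (s *\<^sub>R v)"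
    by (rule closed_segment_linear_image[symmetric]) (auto intro: linearI simp: algebra_simps)
  finally show ?thesis by (simp add: closed_segment_translation)
qed

text \<open>Injectivity is assumed only up to the right end because an edge may be a closed path; a
  closed path inside a segment would have to run back over its own image. In the coordinate
  \<open>h\<close> along the segment this is the intermediate value theorem.\<close>

lemma path_within_segment:
  fixes g :: "real \<Rightarrow> 'a::euclidean_space"
  assumes "continuous_on {s..t} g" "inj_on g {s..<t}" "s < t" "g ` {s..t} \<subseteq> closed_segment a b"
  shows "inj_on g {s..t}" "g ` {s..t} = closed_segment (g s) (g t)"
proof -
  have ne: "a \<noteq> b"
  proof
    assume "a = b"
    have m: "s \<in> {s..<t}" "(s + t) / 2 \<in> {s..<t}" using assms(3) by auto
    moreover have "g s = g ((s + t) / 2)"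
      using assms(4) \<open>a = b\<close> m by (auto simp: image_subset_iff)
    ultimately have "s = (s + t) / 2" using inj_onD[OF assms(2)] by blast
    then show False using assms(3) by simp
  qed
  define h where "h y = ((y - a) \<bullet> (b - a)) / ((b - a) \<bullet> (b - a))" for y
  have hk: "a + h y *\<^sub>R (b - a) = y" if y: "y \<in> closed_segment a b" for y
  proof -
    obtain u where "y = a + u *\<^sub>R (b - a)" using y by (auto simp: closed_segment_param)
    then show ?thesis using ne by (simp add: h_def)
  qed
  let ?f = "h \<circ> g"
  have gf: "a + ?f r *\<^sub>R (b - a) = g r" if "r \<in> {s..t}" for r
    using hk assms(4) that by (auto simp: image_subset_iff)
  have cf: "continuous_on {s..t} ?f"
    unfolding h_def comp_def using ne by (intro continuous_intros assms(1)) auto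
  have injf: "inj_on ?f X" if "inj_on g X" "X \<subseteq> {s..t}" for X
    using that gf by (smt (verit, best) inj_onD inj_onI subsetD)
  show inj: "inj_on g {s..t}"
  proof (rule ccontr)
    assume "\<not> ?thesis"
    then obtain r where r: "r \<in> {s..<t}" "g r = g t"
      using assms(2,3) unfolding inj_on_def by (metis atLeastAtMost_iff atLeastLessThan_iff order_le_less)
    \<comment> \<open>If \<open>g r = g t\<close>, the values between \<open>?f r\<close> and
      \<open>?f m'\<close> are taken before \<open>m'\<close> and, on the way back to
      \<open>?f t = ?f r\<close>, once more after it.\<close>
    define m where "m = (r + t) / 2"
    have rm: "r < m" "m < t" using r by (auto simp: m_def)
    define m' where "m' = (m + t) / 2"
    have m': "m < m'" "m' < t" using rm by (auto simp: m'_def)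
    have "?f m \<in> ?f ` closed_segment r m'" using rm m' by (auto simp: closed_segment_eq_real_ivl)
    also have "?f ` closed_segment r m' = closed_segment (?f r) (?f m')"
      using rm r m' by (intro continuous_injective_image_segment_1 continuous_on_subset[OF cf] injf inj_on_subset[OF assms(2)])
        (auto simp: closed_segment_eq_real_ivl)
    also have "\<dots> = closed_segment (?f m') (?f t)" using r by (simp add: closed_segment_commute)
    also have "\<dots> \<subseteq> ?f ` closed_segment m' t"
      using rm r m' by (intro subset_continuous_image_segment_1 continuous_on_subset[OF cf])
        (auto simp: closed_segment_eq_real_ivl)
    finally have "?f m \<in> ?f ` closed_segment m' t" .
    then obtain x where x: "x \<in> {m'..t}" "?f x = ?f m" using m' by (auto simp: closed_segment_eq_real_ivl)
    have "x \<in> {s..t}" "m \<in> {s..t}" using x rm r m' by auto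
    from gf[OF this(1)] gf[OF this(2)] have gm: "g x = g m" using x(2) by metis
    show False
    proof (cases "x = t")
      case True
      then have "g m = g r" using gm r by simp
      then show False using inj_onD[OF assms(2), of m r] rm r by auto
    next
      case False
      then show False using inj_onD[OF assms(2) gm] x rm r m' by auto
    qed
  qed
  have "?f ` closed_segment s t = closed_segment (?f s) (?f t)"
    using assms(3) by (intro continuous_injective_image_segment_1 cf injf inj continuous_on_subset[OF cf])
      (auto simp: closed_segment_eq_real_ivl inj intro!: injf[OF inj])
  then have "?f ` {s..t} = closed_segment (?f s) (?f t)"
    using assms(3) by (simp add: closed_segment_eq_real_ivl)
  then have "(\<lambda>r. a + r *\<^sub>R (b - a)) ` ?f ` {s..t} = closed_segment (a + ?f s *\<^sub>R (b - a)) (a + ?f t *\<^sub>R (b - a))"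
    by (simp only: closed_segment_affine_image)
  moreover have "(\<lambda>r. a + r *\<^sub>R (b - a)) ` ?f ` {s..t} = g ` {s..t}"
    unfolding image_image by (rule image_cong) (use gf in auto)
  ultimately show "g ` {s..t} = closed_segment (g s) (g t)"
    using gf[of s] gf[of t] assms(3) by simp
qed

lemma finite_set_breakpoints:
  fixes T :: "real set"
  assumes "finite T" "0 \<in> T" "1 \<in> T" "T \<subseteq> {0..1}"
  obtains n t where "n > 0" "t 0 = 0" "t n = 1" "\<And>i. i < n \<Longrightarrow> t i < t (Suc i)"
    "\<And>i. i < n \<Longrightarrow> T \<inter> {t i<..<t (Suc i)} = {}" "\<And>i. i \<le> n \<Longrightarrow> t i \<in> T"
proof -
  define xs where "xs = sorted_list_of_set T"
  have xs: "set xs = T" "sorted xs" "distinct xs" using assms(1) by (auto simp: xs_def)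
  have sxs: "sorted_wrt (<) xs" unfolding xs_def by simp
  define n where "n = length xs - 1"
  have "card T \<ge> 2" using card_mono[OF assms(1), of "{0,1}"] assms by auto
  then have len: "length xs \<ge> 2" using xs distinct_card by fastforce
  have mono: "xs ! i < xs ! j" if "i < j" "j < length xs" for i j
    using sorted_wrt_nth_less[OF sxs that] .
  have mono': "xs ! i \<le> xs ! j" if "i \<le> j" "j < length xs" for i j
    using mono[of i j] that by (cases "i = j") auto
  have idx: "\<exists>j<length xs. xs ! j = x" if "x \<in> T" for x using that xs(1) by (metis in_set_conv_nth)
  have mem: "xs ! i \<in> T" if "i \<le> n" for i using that xs(1) len by (auto simp: n_def)
  show ?thesis
  proof (rule that[of n "\<lambda>i. xs ! i"])
    show "n > 0" using len by (simp add: n_def)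
    obtain j where "j < length xs" "xs ! j = 0" using idx assms(2) by blast
    then show "xs ! 0 = 0" using mono'[of 0 j] mem[of 0] assms(4) by force
    obtain j where "j < length xs" "xs ! j = 1" using idx assms(3) by blast
    then show "xs ! n = 1" using mono'[of j n] mem[of n] assms(4) len by (force simp: n_def)
    show "xs ! i < xs ! Suc i" if "i < n" for i using mono[of i "Suc i"] that by (auto simp: n_def)
    show "T \<inter> {xs ! i<..<xs ! Suc i} = {}" if i: "i < n" for i
    proof (rule ccontr)
      assume "\<not> ?thesis"
      then obtain j where j: "j < length xs" "xs ! i < xs ! j" "xs ! j < xs ! Suc i"
        using idx by (metis disjoint_iff greaterThanLessThan_iff)
      then have "i < j" "j < Suc i" using mono'[of j i] mono'[of "Suc i" j] i by (force simp: n_def)+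
      then show False by simp
    qed
    show "xs ! i \<in> T" if "i \<le> n" for i using mem that .
  qed
qed

text \<open>The path is cut wherever it hits a node. An open piece between consecutive cuts is
  connected and avoids the nodes, so it stays on one segment, and there an injective path covers
  exactly the segment between its end values.\<close>

lemma simple_path_in_segments_breakpoints:
  fixes g :: "real \<Rightarrow> 'a::euclidean_space" and S :: "('a \<times> 'a) set"
  assumes "finite S" and g: "simple_path g" and sub: "path_image g \<subseteq> (\<Union>(a, b)\<in>S. closed_segment a b)"
  obtains n t where "n > 0" "t 0 = 0" "t n = 1" "\<And>i. i < n \<Longrightarrow> t i < t (Suc i)"
    "\<And>i. i < n \<Longrightarrow> inj_on g {t i..t (Suc i)}"
    "\<And>i. i < n \<Longrightarrow> g ` {t i..t (Suc i)} = closed_segment (g (t i)) (g (t (Suc i)))"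
proof -
  obtain V0 where V0: "finite V0" "{g 0, g 1} \<subseteq> V0" "\<And>a b. (a, b) \<in> S \<Longrightarrow> a \<in> V0 \<and> b \<in> V0"
    "\<And>a b c d. (a, b) \<in> S \<Longrightarrow> (c, d) \<in> S \<Longrightarrow> closed_segment a b \<inter> closed_segment c d = {} \<or>
       (\<exists>u\<in>V0. \<exists>v\<in>V0. closed_segment a b \<inter> closed_segment c d = closed_segment u v)"
    using finite_segment_nodes[OF assms(1), of "{g 0, g 1}"] by (metis finite.emptyI finite.insertI)
  have lf: "\<And>x y. x \<in> {0..1} \<Longrightarrow> y \<in> {0..1} \<Longrightarrow> g x = g y \<Longrightarrow> x = y \<or> x = 0 \<and> y = 1 \<or> x = 1 \<and> y = 0"
    and cg: "continuous_on {0..1} g"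
    using g by (auto simp: simple_path_def loop_free_def path_def)
  have injh: "inj_on g {0..<1}" using lf by (force simp: inj_on_def)
  \<comment> \<open>Finiteness rests on injectivity, which for a closed path fails when 1 is
    included; this parameter is adjoined separately.\<close>
  have fin: "finite ({s \<in> {0..<1}. g s \<in> V0} \<union> {0, 1})"
    using finite_vimage_IntI[OF V0(1) injh] by (simp add: vimage_def Int_def conj_commute)
  obtain n t where nt: "n > 0" "t 0 = 0" "t n = 1" "\<And>i. i < n \<Longrightarrow> t i < t (Suc i)"
    "\<And>i. i < n \<Longrightarrow> ({s \<in> {0..<1}. g s \<in> V0} \<union> {0, 1}) \<inter> {t i<..<t (Suc i)} = {}"
    "\<And>i. i \<le> n \<Longrightarrow> t i \<in> {s \<in> {0..<1}. g s \<in> V0} \<union> {0, 1}"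
    by (rule finite_set_breakpoints[OF fin]) auto
  have t01: "t i \<in> {0..1}" if "i \<le> n" for i using nt(6)[OF that] by auto
  have *: "inj_on g {t i..t (Suc i)} \<and> g ` {t i..t (Suc i)} = closed_segment (g (t i)) (g (t (Suc i)))"
    if i: "i < n" for i
  proof -
    let ?C = "g ` {t i<..<t (Suc i)}"
    have sub01: "{t i..t (Suc i)} \<subseteq> {0..1}" using t01[of i] t01[of "Suc i"] i by auto
    have C: "connected ?C"
      by (intro connected_continuous_image continuous_on_subset[OF cg sub01[THEN order_trans[rotated]]]) auto
    have CV: "?C \<inter> V0 = {}"
    proof -
      have "g s \<notin> V0" if s: "s \<in> {t i<..<t (Suc i)}" for s
      proof -
        have "s \<in> {0..1}" using sub01 s by (meson greaterThanLessThan_subseteq_atLeastAtMost_iff order_refl subsetD)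
        then show ?thesis using nt(5)[OF i] s by fastforce
      qed
      then show ?thesis by blast
    qed
    have "{t i<..<t (Suc i)} \<subseteq> {0..1}"
      using sub01 by (meson greaterThanLessThan_subseteq_atLeastAtMost_iff order_refl order_trans)
    then have CS: "?C \<subseteq> (\<Union>(a, b)\<in>S. closed_segment a b)"
      using sub unfolding path_image_def by (meson image_mono order_trans)
    define m where "m = (t i + t (Suc i)) / 2"
    have m: "m \<in> {t i<..<t (Suc i)}" using nt(4)[OF i] by (simp add: m_def)
    then obtain a b where ab: "(a, b) \<in> S" "g m \<in> closed_segment a b" using CS by force
    have Cab: "?C \<subseteq> closed_segment a b"
      by (rule connected_subset_single_segment[OF assms(1) V0(3,4) C CS CV ab(1)]) (use ab imageI[OF m, of g] in auto)
    have "g ` closure {t i<..<t (Suc i)} \<subseteq> closed_segment a b"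
      using nt(4)[OF i] by (intro image_closure_subset Cab closed_segment continuous_on_subset[OF cg]) (use sub01 in auto)
    then have im: "g ` {t i..t (Suc i)} \<subseteq> closed_segment a b"
      using nt(4)[OF i] by simp
    have "inj_on g {t i..<t (Suc i)}"
      by (rule inj_on_subset[OF injh]) (use t01[of i] t01[of "Suc i"] i in auto)
    then show ?thesis
      using path_within_segment[OF continuous_on_subset[OF cg sub01] _ nt(4)[OF i] im] by blast
  qed
  show ?thesis by (rule that[of n t]) (use nt * in auto)
qed

section \<open>Piecewise linear parametrisation of the edges\<close>

text \<open>Each piece takes time \<open>1 / n\<close>. At \<open>t = 1\<close> the index is
  \<open>n\<close> and the coefficient of \<open>W (Suc n) - W n\<close> vanishes, so the formula
  covers the right end as well.\<close>

definition plpath :: "nat \<Rightarrow> (nat \<Rightarrow> 'a::real_vector) \<Rightarrow> real \<Rightarrow> 'a" where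
  "plpath n W t = (let i = nat \<lfloor>real n * t\<rfloor> in W i + (real n * t - i) *\<^sub>R (W (Suc i) - W i))"

lemma plpath_piece:
  assumes "i < n" "real i \<le> real n * t" "real n * t \<le> real (Suc i)"
  shows "plpath n W t = W i + (real n * t - i) *\<^sub>R (W (Suc i) - W i)"
proof (cases "real n * t = real (Suc i)")
  case True
  have "nat \<lfloor>real n * t\<rfloor> = Suc i" unfolding True by simp
  then show ?thesis by (simp add: plpath_def True)
next
  case False
  then have "nat \<lfloor>real n * t\<rfloor> = i" using assms by linarith
  then show ?thesis by (simp add: plpath_def)
qed

text \<open>A breakpoint is assigned to the piece on its right, except that 1 goes to the last
  piece. The strict inequality below 1 is what keeps different pieces apart in the
  reparametrisation.\<close>

lemma unit_interval_piece:
  assumes "n > 0" "t \<in> {0..1::real}"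
  obtains i where "i < n" "real i \<le> real n * t" "real n * t \<le> real (Suc i)" "t < 1 \<Longrightarrow> real n * t < real (Suc i)"
    "t = 1 \<Longrightarrow> i = n - 1"
proof (cases "t = 1")
  case True
  then show ?thesis using that[of "n - 1"] assms(1) by (auto simp: of_nat_diff)
next
  case False
  then have "real n * t < n" using assms by auto
  moreover have "real n * t \<ge> 0" using assms by auto
  ultimately show ?thesis using that[of "nat \<lfloor>real n * t\<rfloor>"] False by (auto; linarith)
qed

lemma plpath_continuous:
  fixes W :: "nat \<Rightarrow> 'a::real_normed_vector"
  assumes "n > 0"
  shows "continuous_on {0..1} (plpath n W)"
proof -
  have "continuous_on (\<Union>i\<in>{..<n}. {real i / n..real (Suc i) / n}) (plpath n W)"
  proof (rule continuous_on_closed_Union)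
    fix i assume i: "i \<in> {..<n}"
    have "continuous_on {real i / n..real (Suc i) / n} (\<lambda>t. W i + (real n * t - i) *\<^sub>R (W (Suc i) - W i))"
      by (intro continuous_intros)
    then show "continuous_on {real i / n..real (Suc i) / n} (plpath n W)"
      by (rule continuous_on_cong[THEN iffD1, rotated -1])
        (use i assms in \<open>auto simp: plpath_piece field_simps\<close>)
  qed auto
  moreover have "{0..1} \<subseteq> (\<Union>i\<in>{..<n}. {real i / n..real (Suc i) / n})"
  proof
    fix t :: real assume "t \<in> {0..1}"
    then obtain i where "i < n" "real i \<le> real n * t" "real n * t \<le> real (Suc i)"
      using unit_interval_piece[OF assms] by metis
    then show "t \<in> (\<Union>i\<in>{..<n}. {real i / n..real (Suc i) / n})"
      using assms by (auto simp: field_simps intro!: bexI[of _ i])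
  qed
  ultimately show ?thesis by (rule continuous_on_subset)
qed

lemma plpath_ends:
  assumes "n > 0"
  shows "plpath n W 0 = W 0" "plpath n W 1 = W n"
  using plpath_piece[of 0 n 0 W] plpath_piece[of "n - 1" n 1 W] assms by (auto simp: of_nat_diff)

lemma path_image_plpath:
  assumes "n > 0"
  shows "path_image (plpath n W) = (\<Union>i<n. closed_segment (W i) (W (Suc i)))"
proof (intro equalityI subsetI)
  fix x assume "x \<in> path_image (plpath n W)"
  then obtain t where t: "t \<in> {0..1}" "x = plpath n W t" by (auto simp: path_image_def)
  obtain i where "i < n" "real i \<le> real n * t" "real n * t \<le> real (Suc i)"
    using unit_interval_piece[OF assms t(1)] by metis
  then show "x \<in> (\<Union>i<n. closed_segment (W i) (W (Suc i)))"
    using t plpath_piece[of i n t W]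
    unfolding closed_segment_param by (intro UN_I[of i] image_eqI[of _ _ "real n * t - real i"]) auto
next
  fix x assume "x \<in> (\<Union>i<n. closed_segment (W i) (W (Suc i)))"
  then obtain i u where iu: "i < n" "u \<in> {0..1}" "x = W i + u *\<^sub>R (W (Suc i) - W i)"
    by (auto simp: closed_segment_param)
  define t where "t = (real i + u) / real n"
  have t: "real n * t = real i + u" using assms by (simp add: t_def)
  have "x = plpath n W t" using plpath_piece[of i n t W] iu t by auto
  moreover have "t \<in> {0..1}" using iu assms by (auto simp: t_def field_simps)
  ultimately show "x \<in> path_image (plpath n W)" by (auto simp: path_image_def)
qed

text \<open>Both paths sweep the same segments in the same order, so every value of \<open>P\<close>
  is a value of \<open>g\<close> within the corresponding piece. \<open>\<theta>\<close> is chosen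
  pointwise, without continuity; its injectivity transfers simplicity from \<open>g\<close> to
  \<open>P\<close>.\<close>

lemma plpath_reparametrisation:
  fixes g :: "real \<Rightarrow> 'a::euclidean_space"
  assumes n: "n > 0" and t0: "t 0 = 0" and tn: "t n = 1" and inc: "\<And>i. i < n \<Longrightarrow> t i < t (Suc i)"
    and inj: "\<And>i. i < n \<Longrightarrow> inj_on g {t i..t (Suc i)}"
    and im: "\<And>i. i < n \<Longrightarrow> g ` {t i..t (Suc i)} = closed_segment (g (t i)) (g (t (Suc i)))"
  defines "P \<equiv> plpath n (\<lambda>i. g (t i))"
  obtains \<theta> where "inj_on \<theta> {0..1}" "\<theta> 0 = 0" "\<theta> 1 = 1" "\<theta> ` {0..1} \<subseteq> {0..1}"
    "\<And>s. s \<in> {0..1} \<Longrightarrow> P s = g (\<theta> s)"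
proof -
  have mono: "t i \<le> t j" if "i \<le> j" "j \<le> n" for i j
    using that
  proof (induction j)
    case (Suc j)
    then show ?case using inc[of j] by (cases "i = Suc j") auto
  qed auto
  have ne: "g (t i) \<noteq> g (t (Suc i))" if "i < n" for i
    using inj_onD[OF inj[OF that], of "t i" "t (Suc i)"] inc[OF that] by auto
  have "\<exists>r i. i < n \<and> real i \<le> real n * s \<and> real n * s \<le> real (Suc i) \<and> r \<in> {t i..t (Suc i)} \<and> P s = g r \<and>
      (s < 1 \<longrightarrow> r < t (Suc i) \<and> real n * s < real (Suc i)) \<and> (s = 1 \<longrightarrow> r = 1) \<and> (s = 0 \<longrightarrow> r = 0)"
    if s: "s \<in> {0..1}" for s
  proof -
    obtain i where i: "i < n" "real i \<le> real n * s" "real n * s \<le> real (Suc i)"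
      "s < 1 \<Longrightarrow> real n * s < real (Suc i)" "s = 1 \<Longrightarrow> i = n - 1"
      using unit_interval_piece[OF n s] by metis
    have P: "P s = g (t i) + (real n * s - real i) *\<^sub>R (g (t (Suc i)) - g (t i))"
      unfolding P_def using plpath_piece i(1-3) by blast
    then have "P s \<in> closed_segment (g (t i)) (g (t (Suc i)))"
      unfolding closed_segment_param using i by (intro image_eqI[of _ _ "real n * s - real i"]) auto
    then obtain r where r: "r \<in> {t i..t (Suc i)}" "P s = g r" using im[OF i(1)] by (metis imageE)
    \<comment> \<open>Excluding the right end makes the parameter ranges belonging to different
      pieces disjoint.\<close>
    have "r < t (Suc i)" if "s < 1"
    proof (rule ccontr)
      assume "\<not> ?thesis"
      then have "r = t (Suc i)" using r by auto
      then have "(1 - (real n * s - real i)) *\<^sub>R (g (t (Suc i)) - g (t i)) = 0"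
        using P r by (simp add: algebra_simps)
      then show False using ne[OF i(1)] i(4)[OF that] by simp
    qed
    moreover have "r = 1" if "s = 1"
    proof -
      have S: "Suc i = n" using i(5)[OF that] n by simp
      have "P s = g (t n)" unfolding P_def that by (rule plpath_ends(2)[OF n])
      then show ?thesis using inj_onD[OF inj[OF i(1)], of r "t n"] r S tn inc[OF i(1)] by auto
    qed
    moreover have "r = 0" if "s = 0"
    proof -
      have S: "i = 0" using i(2) that by simp
      have "P s = g (t 0)" unfolding P_def that by (rule plpath_ends(1)[OF n])
      then show ?thesis using inj_onD[OF inj[OF i(1)], of r "t 0"] r S t0 inc[OF i(1)] by auto
    qed
    ultimately show ?thesis using i r by blast
  qed
  then obtain \<theta> \<iota> where \<theta>: "\<And>s. s \<in> {0..1} \<Longrightarrow> \<iota> s < n \<and> real (\<iota> s) \<le> real n * s \<and> real n * s \<le> real (Suc (\<iota> s)) \<and>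
      \<theta> s \<in> {t (\<iota> s)..t (Suc (\<iota> s))} \<and> P s = g (\<theta> s) \<and>
      (s < 1 \<longrightarrow> \<theta> s < t (Suc (\<iota> s)) \<and> real n * s < real (Suc (\<iota> s))) \<and> (s = 1 \<longrightarrow> \<theta> s = 1) \<and> (s = 0 \<longrightarrow> \<theta> s = 0)"
    by metis
  have lt1: "\<theta> s < 1" if "s \<in> {0..1}" "s < 1" for s
    using \<theta>[OF that(1)] that(2) mono[of "Suc (\<iota> s)" n] tn by force
  show ?thesis
  proof (rule that[of \<theta>])
    show "inj_on \<theta> {0..1}"
    proof (rule inj_onI)
      fix s s' assume s: "s \<in> {0..1}" "s' \<in> {0..1}" "\<theta> s = \<theta> s'"
      show "s = s'"
      proof (cases "s = 1 \<or> s' = 1")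
        case True
        then show ?thesis using s lt1[of s] lt1[of s'] \<theta>[of 1] by force
      next
        case False
        then have lt: "s < 1" "s' < 1" using s by auto
        have "\<not> \<iota> a < \<iota> b" if "a \<in> {0..1}" "b \<in> {0..1}" "a < 1" "\<theta> a = \<theta> b" for a b
        proof
          assume "\<iota> a < \<iota> b"
          then have "t (Suc (\<iota> a)) \<le> t (\<iota> b)" using mono \<theta>[OF that(2)] by auto
          then show False using \<theta>[OF that(1)] \<theta>[OF that(2)] that(3,4) by force
        qed
        then have ii: "\<iota> s = \<iota> s'" using s lt by (metis linorder_neqE_nat)
        have P: "P s = P s'" using \<theta> s by metis
        let ?i = "\<iota> s" let ?v = "g (t (Suc ?i)) - g (t ?i)"
        have "P s = g (t ?i) + (real n * s - real ?i) *\<^sub>R ?v" "P s' = g (t ?i) + (real n * s' - real ?i) *\<^sub>R ?v"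
          unfolding P_def using plpath_piece[of ?i n _ "\<lambda>i. g (t i)"] \<theta>[OF s(1)] \<theta>[OF s(2)] ii by auto
        with P have "(real n * s - real ?i) *\<^sub>R ?v = (real n * s' - real ?i) *\<^sub>R ?v" by simp
        then show ?thesis using ne[of "\<iota> s"] \<theta>[OF s(1)] n by simp
      qed
    qed
    show "\<theta> ` {0..1} \<subseteq> {0..1}"
    proof
      fix x assume "x \<in> \<theta> ` {0..1}"
      then obtain s where s: "s \<in> {0..1}" "x = \<theta> s" by blast
      show "x \<in> {0..1}"
        using \<theta>[OF s(1)] s(2) mono[of 0 "\<iota> s"] mono[of "Suc (\<iota> s)" n] t0 tn by auto
    qed
    show "\<theta> 0 = 0" "\<theta> 1 = 1" using \<theta>[of 0] \<theta>[of 1] by auto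
    show "P s = g (\<theta> s)" if "s \<in> {0..1}" for s using \<theta>[OF that] by blast
  qed
qed

text \<open>An injective change of parameter that fixes 0 and 1 maps the open interval into itself,
  so the new edge interiors lie in the old ones and no new coincidences appear.\<close>

lemma embedded_graph_reparametrisation:
  assumes emb: "embedded_graph G p \<gamma>"
    and c: "\<And>e. e \<in> arcs G \<Longrightarrow> continuous_on {0..1} (\<delta> e)"
    and \<theta>: "\<And>e. e \<in> arcs G \<Longrightarrow> inj_on (\<theta> e) {0..1} \<and> \<theta> e 0 = 0 \<and> \<theta> e 1 = (1::real) \<and> \<theta> e ` {0..1} \<subseteq> {0..1} \<and>
       (\<forall>s\<in>{0..1}. \<delta> e s = \<gamma> e (\<theta> e s))"
  shows "embedded_graph G p \<delta>"
proof -
  have sub: "\<delta> e ` {0<..<1} \<subseteq> \<gamma> e ` {0<..<1}" if e: "e \<in> arcs G" for e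
  proof
    fix x assume "x \<in> \<delta> e ` {0<..<1}"
    then obtain s where s: "s \<in> {0<..<1}" "x = \<delta> e s" by blast
    have i: "inj_on (\<theta> e) {0..1}" and ends: "\<theta> e 0 = 0" "\<theta> e 1 = 1" and d: "\<delta> e s = \<gamma> e (\<theta> e s)"
      and m: "\<theta> e s \<in> {0..1}"
      using \<theta>[OF e] s by (auto simp: image_subset_iff)
    have "\<theta> e s \<noteq> 0" "\<theta> e s \<noteq> 1"
      using inj_onD[OF i, of s 0] inj_onD[OF i, of s 1] ends s by auto
    then show "x \<in> \<gamma> e ` {0<..<1}" using s d m by auto
  qed
  have sp: "simple_path (\<delta> e)" if e: "e \<in> arcs G" for e
  proof -
    have lf: "\<And>x y. x \<in> {0..1} \<Longrightarrow> y \<in> {0..1} \<Longrightarrow> \<gamma> e x = \<gamma> e y \<Longrightarrow> x = y \<or> x = 0 \<and> y = 1 \<or> x = 1 \<and> y = 0"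
      using emb e by (auto simp: embedded_graph_def simple_path_def loop_free_def)
    have i: "inj_on (\<theta> e) {0..1}" and ends: "\<theta> e 0 = 0" "\<theta> e 1 = 1" and d: "\<And>s. s \<in> {0..1} \<Longrightarrow> \<delta> e s = \<gamma> e (\<theta> e s)"
      and m: "\<And>s. s \<in> {0..1} \<Longrightarrow> \<theta> e s \<in> {0..1}"
      using \<theta>[OF e] by (auto simp: image_subset_iff)
    have "x = y \<or> x = 0 \<and> y = 1 \<or> x = 1 \<and> y = 0" if xy: "x \<in> {0..1}" "y \<in> {0..1}" "\<delta> e x = \<delta> e y" for x y
    proof -
      have inj: "x = y" if "x \<in> {0..1}" "y \<in> {0..1}" "\<theta> e x = \<theta> e y" for x y
        using inj_onD[OF i] that by blast
      have "\<theta> e x = \<theta> e y \<or> \<theta> e x = 0 \<and> \<theta> e y = 1 \<or> \<theta> e x = 1 \<and> \<theta> e y = 0"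
        using lf[OF m m] d xy by metis
      then show ?thesis
        using inj[of x y] inj[of x 0] inj[of y 1] inj[of x 1] inj[of y 0] xy ends by auto
    qed
    then show ?thesis using c[OF e] by (auto simp: simple_path_def loop_free_def path_def)
  qed
  have ends: "\<delta> e 0 = \<gamma> e 0" "\<delta> e 1 = \<gamma> e 1" if "e \<in> arcs G" for e using \<theta>[OF that] by auto
  have a: "fin_digraph G" "inj_on p (verts G)"
    and b: "\<And>e. e \<in> arcs G \<Longrightarrow> \<gamma> e 0 = p (tail G e) \<and> \<gamma> e 1 = p (head G e)"
    and c: "\<And>e. e \<in> arcs G \<Longrightarrow> \<gamma> e ` {0<..<1} \<inter> p ` verts G = {}"
    and d: "\<And>e e'. e \<in> arcs G \<Longrightarrow> e' \<in> arcs G \<Longrightarrow> e \<noteq> e' \<Longrightarrow> \<gamma> e ` {0<..<1} \<inter> \<gamma> e' ` {0<..<1} = {}"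
    using emb unfolding embedded_graph_def pathstart_def pathfinish_def by auto
  show ?thesis unfolding embedded_graph_def pathstart_def pathfinish_def
  proof (intro conjI ballI impI)
    fix e e' assume e: "e \<in> arcs G" "e' \<in> arcs G" "e \<noteq> e'"
    show "\<delta> e ` {0<..<1} \<inter> \<delta> e' ` {0<..<1} = {}"
      using sub[OF e(1)] sub[OF e(2)] d[OF e] by blast
  next
    fix e assume e: "e \<in> arcs G"
    show "\<delta> e ` {0<..<1} \<inter> p ` verts G = {}" using sub[OF e] c[OF e] by blast
  qed (use a b sp ends in auto)
qed

text \<open>Tameness only describes the image as a union of segments; here each single edge is
  recovered as a polygonal path, with its vertices kept.\<close>

lemma embedded_graph_polygonal:
  assumes emb: "embedded_graph G p \<gamma>" and S: "finite S"
    and img: "graph_image G p \<gamma> = (\<Union>(a, b)\<in>S. closed_segment a b)"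
  obtains n W where "\<And>e. e \<in> arcs G \<Longrightarrow> n e > 0" "\<And>e i. e \<in> arcs G \<Longrightarrow> i < n e \<Longrightarrow> W e i \<noteq> W e (Suc i)"
    "embedded_graph G p (\<lambda>e. plpath (n e) (W e))"
    "graph_image G p (\<lambda>e. plpath (n e) (W e)) = graph_image G p \<gamma>"
proof -
  define Q where "Q e n t \<longleftrightarrow> n > 0 \<and> t 0 = 0 \<and> t n = 1 \<and> (\<forall>i<n. t i < t (Suc i) \<and> inj_on (\<gamma> e) {t i..t (Suc i)} \<and>
      \<gamma> e ` {t i..t (Suc i)} = closed_segment (\<gamma> e (t i)) (\<gamma> e (t (Suc i))))" for e n t
  have "\<exists>n t. Q e n t" if e: "e \<in> arcs G" for e
  proof -
    have "simple_path (\<gamma> e)" using emb e by (auto simp: embedded_graph_def)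
    moreover have "path_image (\<gamma> e) \<subseteq> (\<Union>(a, b)\<in>S. closed_segment a b)"
      using img e by (auto simp: graph_image_def)
    ultimately show ?thesis
      unfolding Q_def using simple_path_in_segments_breakpoints[OF S] by metis
  qed
  then obtain n where "\<And>e. e \<in> arcs G \<Longrightarrow> \<exists>t. Q e (n e) t" by metis
  then obtain t where "\<And>e. e \<in> arcs G \<Longrightarrow> Q e (n e) (t e)" by metis
  then have nt: "\<And>e. e \<in> arcs G \<Longrightarrow> n e > 0" "\<And>e. e \<in> arcs G \<Longrightarrow> t e 0 = 0" "\<And>e. e \<in> arcs G \<Longrightarrow> t e (n e) = 1"
    "\<And>e i. e \<in> arcs G \<Longrightarrow> i < n e \<Longrightarrow> t e i < t e (Suc i)"
    "\<And>e i. e \<in> arcs G \<Longrightarrow> i < n e \<Longrightarrow> inj_on (\<gamma> e) {t e i..t e (Suc i)}"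
    "\<And>e i. e \<in> arcs G \<Longrightarrow> i < n e \<Longrightarrow> \<gamma> e ` {t e i..t e (Suc i)} = closed_segment (\<gamma> e (t e i)) (\<gamma> e (t e (Suc i)))"
    by (auto simp: Q_def)
  define W where "W e i = \<gamma> e (t e i)" for e i
  let ?P = "\<lambda>e. plpath (n e) (W e)"
  have "\<exists>\<theta>. inj_on \<theta> {0..1} \<and> \<theta> 0 = 0 \<and> \<theta> 1 = (1::real) \<and> \<theta> ` {0..1} \<subseteq> {0..1} \<and> (\<forall>s\<in>{0..1}. ?P e s = \<gamma> e (\<theta> s))"
    if e: "e \<in> arcs G" for e
  proof -
    have "W e = (\<lambda>i. \<gamma> e (t e i))" by (auto simp: W_def)
    moreover obtain \<theta> where "inj_on \<theta> {0..1}" "\<theta> 0 = 0" "\<theta> 1 = 1" "\<theta> ` {0..1} \<subseteq> {0..1}"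
        "\<And>s. s \<in> {0..1} \<Longrightarrow> plpath (n e) (\<lambda>i. \<gamma> e (t e i)) s = \<gamma> e (\<theta> s)"
      using plpath_reparametrisation[OF nt(1-3)[OF e] nt(4-6)[OF e]] by metis
    ultimately show ?thesis by (intro exI[of _ \<theta>] conjI ballI) simp_all
  qed
  then obtain \<theta> where \<theta>: "\<And>e. e \<in> arcs G \<Longrightarrow> inj_on (\<theta> e) {0..1} \<and> \<theta> e 0 = 0 \<and> \<theta> e 1 = (1::real) \<and> \<theta> e ` {0..1} \<subseteq> {0..1} \<and>
       (\<forall>s\<in>{0..1}. ?P e s = \<gamma> e (\<theta> e s))" by metis
  have pim: "path_image (?P e) = path_image (\<gamma> e)" if e: "e \<in> arcs G" for e
  proof -
    have "path_image (?P e) = (\<Union>i<n e. \<gamma> e ` {t e i..t e (Suc i)})"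
      unfolding path_image_plpath[OF nt(1)[OF e]] using nt(6)[OF e] by (simp add: W_def)
    also have "\<dots> = \<gamma> e ` (\<Union>i<n e. {t e i..t e (Suc i)})" by blast
    also have "(\<Union>i<m. {t e i..t e (Suc i)}) = {0..t e m}" if "0 < m" "m \<le> n e" for m
      using that
    proof (induction m)
      case (Suc m)
      have nn: "0 \<le> t e k" if "k \<le> n e" for k
        using that
      proof (induction k)
        case (Suc k)
        then show ?case using nt(4)[OF e, of k] by simp
      qed (simp add: nt(2)[OF e])
      have le: "0 \<le> t e m" "t e m \<le> t e (Suc m)" using nn[of m] nt(4)[OF e, of m] Suc.prems by auto
      show ?case
      proof (cases "m = 0")
        case True
        then show ?thesis using nt(2)[OF e] by (simp add: lessThan_Suc)
      next
        case False
        then have "(\<Union>i<m. {t e i..t e (Suc i)}) = {0..t e m}" using Suc by simp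
        moreover have "{0..t e m} \<union> {t e m..t e (Suc m)} = {0..t e (Suc m)}"
          by (rule ivl_disj_un_two_touch(4)[OF le])
        ultimately show ?thesis by (simp add: lessThan_Suc Un_commute)
      qed
    qed auto
    then have "(\<Union>i<n e. {t e i..t e (Suc i)}) = {0..1}" using nt(1,3)[OF e] by simp
    finally show ?thesis by (simp add: path_image_def)
  qed
  show ?thesis
  proof (rule that[of n W])
    show "n e > 0" if "e \<in> arcs G" for e using nt(1) that .
    show "W e i \<noteq> W e (Suc i)" if "e \<in> arcs G" "i < n e" for e i
      using inj_onD[OF nt(5)[OF that], of "t e i" "t e (Suc i)"] nt(4)[OF that] by (auto simp: W_def)
    show "embedded_graph G p (\<lambda>e. plpath (n e) (W e))"
      by (rule embedded_graph_reparametrisation[OF emb plpath_continuous[OF nt(1)] \<theta>])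
    show "graph_image G p (\<lambda>e. plpath (n e) (W e)) = graph_image G p \<gamma>"
      using pim by (simp add: graph_image_def)
  qed
qed

section \<open>Horizontal strands over a segment\<close>

text \<open>\<open>4/3\<close> cannot exceed \<open>pi / 2\<close>, because the double angle formula
  with \<open>sin (2/3) \<le> 2/3\<close> makes \<open>cos (4/3)\<close> at least 1/9. The value 8/3
  is what the case of a long phase interval below requires.\<close>

lemma pi_ge_8_3: "8 / 3 \<le> pi"
proof (rule ccontr)
  assume "\<not> ?thesis"
  then have "cos (4/3) \<le> cos (pi/2)"
    using pi_ge_two by (intro cos_monotone_0_pi_le) auto
  moreover have "\<bar>sin (2/3)\<bar> \<le> (2/3::real)" using abs_sin_x_le_abs_x[of "2/3"] by simp
  then have "(sin (2/3))\<^sup>2 \<le> (2/3::real)\<^sup>2" by (metis abs_le_square_iff abs_of_nonneg zero_le_divide_iff zero_le_numeral)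
  then have "cos (4/3::real) \<ge> 1 - 2 * (2/3)\<^sup>2" using cos_double_sin[of "2/3::real"] by simp
  ultimately show False by (simp add: power2_eq_square)
qed

lemma sin_lipschitz: "\<bar>sin b - sin a\<bar> \<le> \<bar>b - a :: real\<bar>"
proof -
  have "\<bar>sin b - sin a\<bar> = 2 * (\<bar>sin ((b - a) / 2)\<bar> * \<bar>cos ((b + a) / 2)\<bar>)"
    by (simp add: sin_diff_sin abs_mult)
  also have "\<dots> \<le> 2 * (\<bar>(b - a) / 2\<bar> * 1)"
    by (intro mult_left_mono mult_mono abs_sin_x_le_abs_x) auto
  finally show ?thesis by simp
qed

lemma cos_lipschitz: "\<bar>cos b - cos a\<bar> \<le> \<bar>b - a :: real\<bar>"
  using sin_lipschitz[of "pi/2 - b" "pi/2 - a"] by (simp add: sin_diff)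

text \<open>Up to 1 the cubic Taylor estimate gives slope 5/6. Beyond 1,
  \<open>sin x \<ge> sin 1 \<ge> 5/6\<close> while \<open>x \<le> 2\<close>, and
  \<open>2/5 * 2\<close> is still smaller.\<close>

lemma sin_ge_linear:
  fixes x :: real
  assumes "0 \<le> x" "x \<le> pi / 2"
  shows "2/5 * x \<le> sin x"
proof -
  have *: "5/6 * y \<le> sin y" if "0 \<le> y" "y \<le> 1" for y :: real
  proof -
    have "\<bar>sin y - y\<bar> \<le> 1/6 * \<bar>y\<bar> ^ 3"
      using Maclaurin_sin_bound[of y 3] by (simp add: eval_nat_numeral sin_coeff_def fact_numeral)
    moreover have "\<bar>y\<bar> ^ 3 \<le> y * 1"
      using that by (simp add: power3_eq_cube mult_le_one mult.assoc mult_left_le)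
    ultimately show ?thesis by linarith
  qed
  show ?thesis
  proof (cases "x \<le> 1")
    case True
    then show ?thesis using *[of x] assms(1) by linarith
  next
    case False
    have "sin 1 \<le> sin x" using False assms by (intro sin_monotone_2pi_le) (use pi_gt_zero in linarith)+
    moreover have "x \<le> 2" using assms(2) pi_less_4 by linarith
    ultimately show ?thesis using *[of 1] by linarith
  qed
qed

text \<open>\<open>G\<close> is a primitive of \<open>(\<beta> + r * cos \<phi>)\<^sup>2\<close>. It
  can stall only near the zeros of this square, where \<open>cos \<phi> = - \<beta> / r\<close> is
  small, so that \<open>sin \<phi>\<close> is large and \<open>cos\<close> itself changes fast.
  Hence over any interval one of the two moves at a linear rate.\<close>

lemma trochoid_expanding_cases:
  fixes a b r \<beta> :: real
  assumes ab: "a \<le> b" and \<beta>: "0 \<le> \<beta>" "8 * \<beta> \<le> r"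
  defines "G \<equiv> \<lambda>\<phi>. (\<beta>\<^sup>2 + r\<^sup>2 / 2) * \<phi> + 2 * \<beta> * r * sin \<phi> + r\<^sup>2 / 4 * sin (2 * \<phi>)"
  shows "r\<^sup>2 / 8 * (b - a) \<le> G b - G a \<or> 1 / 4 * (b - a) \<le> \<bar>cos a - cos b\<bar>"
proof -
  define T where "T = b - a"
  define M where "M = (a + b) / 2"
  have T: "T \<ge> 0" using ab by (simp add: T_def)
  have abM: "a = M - T/2" "b = M + T/2" by (auto simp: M_def T_def field_simps)
  have r: "r \<ge> 0" using \<beta> by simp
  have s1: "sin b - sin a = 2 * cos M * sin (T/2)"
    unfolding abM by (simp add: sin_add sin_diff)
  have s2: "sin (2*b) - sin (2*a) = 2 * cos (2*M) * sin T"
  proof -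
    have "2*b = 2*M + T" "2*a = 2*M - T" by (auto simp: M_def T_def field_simps)
    then show ?thesis by (simp add: sin_add sin_diff)
  qed
  have c1: "\<bar>cos a - cos b\<bar> = 2 * \<bar>sin M\<bar> * \<bar>sin (T/2)\<bar>"
    unfolding abM by (simp add: cos_add cos_diff abs_mult)
  have G: "G b - G a = \<beta>\<^sup>2 * T + r\<^sup>2/2 * (T + cos (2*M) * sin T) + 4 * \<beta> * r * cos M * sin (T/2)"
  proof -
    have "G b - G a = (\<beta>\<^sup>2 + r\<^sup>2 / 2) * T + 2 * \<beta> * r * (sin b - sin a) + r\<^sup>2 / 4 * (sin (2*b) - sin (2*a))"
      by (simp add: G_def T_def field_simps)
    then show ?thesis unfolding s1 s2 by (simp add: algebra_simps)
  qed
  have br: "8 * (\<beta> * r) \<le> r\<^sup>2" using mult_right_mono[OF \<beta>(2) r] by (simp add: power2_eq_square)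
  have br0: "0 \<le> \<beta> * r" using \<beta> r by simp
  have low: "G b - G a \<ge> r\<^sup>2/2 * (T + cos (2*M) * sin T) - 4 * (\<beta> * r) * \<bar>sin (T/2)\<bar>"
  proof -
    have "\<bar>cos M * sin (T/2)\<bar> \<le> \<bar>sin (T/2)\<bar>"
      using mult_right_mono[OF abs_cos_le_one[of M], of "\<bar>sin (T/2)\<bar>"] by (simp add: abs_mult)
    then have "- \<bar>sin (T/2)\<bar> \<le> cos M * sin (T/2)" by linarith
    then have "(4 * (\<beta> * r)) * (- \<bar>sin (T/2)\<bar>) \<le> (4 * (\<beta> * r)) * (cos M * sin (T/2))"
      using br0 by (intro mult_left_mono) auto
    moreover have "0 \<le> \<beta>\<^sup>2 * T" using T by simp
    moreover have "4 * \<beta> * r * cos M * sin (T/2) = (4 * (\<beta> * r)) * (cos M * sin (T/2))" by simp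
    ultimately show ?thesis unfolding G by linarith
  qed
  \<comment> \<open>On long intervals the oscillating terms are dominated by the linear one. On
    short ones with midpoint \<open>M\<close>, \<open>cos (2 * M) \<ge> 0\<close> keeps the mean of
    the square of order \<open>r\<^sup>2\<close>; otherwise \<open>\<bar>sin M\<bar>\<close> is at
    least 7/10 and \<open>cos\<close> has a large increment.\<close>
  consider "T \<ge> pi" | "T \<le> pi" "cos (2*M) \<ge> 0" | "T \<le> pi" "cos (2*M) \<le> 0" by linarith
  then show ?thesis
  proof cases
    case 1
    have "\<bar>cos (2*M) * sin T\<bar> \<le> 1 * 1"
      unfolding abs_mult by (intro mult_mono) auto
    then have "r\<^sup>2/2 * (T + cos (2*M) * sin T) \<ge> r\<^sup>2/2 * (T - 1)"
      by (intro mult_left_mono) auto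
    moreover have "4 * (\<beta> * r) * \<bar>sin (T/2)\<bar> \<le> 4 * (\<beta> * r) * 1"
      using br0 by (intro mult_left_mono) auto
    ultimately have "G b - G a \<ge> r\<^sup>2/2 * (T - 1) - r\<^sup>2 / 2" using low br by linarith
    moreover have "r\<^sup>2/2 * (T - 1) - r\<^sup>2 / 2 - r\<^sup>2/8 * T = r\<^sup>2/8 * (3 * T - 8)" by (simp add: field_simps)
    moreover have "r\<^sup>2/8 * (3 * T - 8) \<ge> 0" using 1 pi_ge_8_3 by simp
    ultimately have "r\<^sup>2/8 * T \<le> G b - G a" by linarith
    then show ?thesis by (simp add: T_def)
  next
    case 2
    have "sin T \<ge> 0" using 2 T by (simp add: sin_ge_zero)
    then have "r\<^sup>2/2 * (T + cos (2*M) * sin T) \<ge> r\<^sup>2/2 * T"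
      using 2 by (intro mult_left_mono) auto
    moreover have "\<bar>sin (T/2)\<bar> \<le> T/2" using abs_sin_x_le_abs_x[of "T/2"] T by simp
    then have "4 * (\<beta> * r) * \<bar>sin (T/2)\<bar> \<le> 4 * (\<beta> * r) * (T/2)"
      using br0 by (intro mult_left_mono) auto
    moreover have "8 * (\<beta> * r) * T \<le> r\<^sup>2 * T" using br T by (rule mult_right_mono)
    moreover have "0 \<le> r\<^sup>2 * T" using T by simp
    ultimately have "r\<^sup>2/8 * T \<le> G b - G a" using low by linarith
    then show ?thesis by (simp add: T_def)
  next
    case 3
    have "cos (2*M) = 1 - 2 * (sin M)\<^sup>2" by (rule cos_double_sin)
    then have "(sin M)\<^sup>2 \<ge> 1/2" using 3 by simp
    then have "(sin M)\<^sup>2 \<ge> (7/10)\<^sup>2" by (simp add: power2_eq_square)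
    then have sM: "\<bar>sin M\<bar> \<ge> 7/10" by (simp add: abs_le_square_iff[symmetric])
    have "sin (T/2) \<ge> 2/5 * (T/2)" using sin_ge_linear[of "T/2"] T 3 by simp
    then have "2 * \<bar>sin M\<bar> * \<bar>sin (T/2)\<bar> \<ge> 2 * (7/10) * (2/5 * (T/2))"
      using sM T by (intro mult_mono) auto
    then have "2 * \<bar>sin M\<bar> * \<bar>sin (T/2)\<bar> \<ge> 1/4 * T" using T by simp
    then show ?thesis unfolding c1 T_def by simp
  qed
qed

lemma norm_le_sum_components3: "norm (v :: real^3) \<le> \<bar>v$1\<bar> + \<bar>v$2\<bar> + \<bar>v$3\<bar>"
  using norm_le_l1_cart[of v] by (simp add: sum_3)

lemma component_abs_le_norm: "\<bar>(v :: real^'n) $ i\<bar> \<le> norm v"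
  by (rule component_le_norm_cart)

lemma inner_vec3: "(v :: real^3) \<bullet> w = v$1 * w$1 + v$2 * w$2 + v$3 * w$3"
  by (simp add: inner_vec_def sum_3)

lemma positive_derivative_imp_expanding:
  fixes h :: "real \<Rightarrow> real"
  assumes "\<And>t. (h has_real_derivative h' t) (at t)" "isCont h' x" "h' x > 0"
  obtains \<rho> where "\<rho> > 0" "\<And>a b. \<bar>a - x\<bar> < \<rho> \<Longrightarrow> \<bar>b - x\<bar> < \<rho> \<Longrightarrow> a \<le> b \<Longrightarrow> h' x / 2 * (b - a) \<le> h b - h a"
proof -
  have "\<forall>\<^sub>F t in nhds x. h' t > h' x / 2"
    using assms(2,3) by (intro order_tendstoD) (auto simp: isCont_def tendsto_at_iff_tendsto_nhds)
  then obtain \<rho> where \<rho>: "\<rho> > 0" "\<And>t. \<bar>t - x\<bar> < \<rho> \<Longrightarrow> h' t > h' x / 2"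
    unfolding eventually_nhds_metric by (auto simp: dist_real_def)
  show ?thesis
  proof (rule that[OF \<rho>(1)])
    fix a b assume ab: "\<bar>a - x\<bar> < \<rho>" "\<bar>b - x\<bar> < \<rho>" "a \<le> b"
    have "(\<lambda>t. h t - h' x / 2 * t) a \<le> (\<lambda>t. h t - h' x / 2 * t) b"
    proof (rule DERIV_nonneg_imp_nondecreasing[OF ab(3)])
      fix t assume "a \<le> t" "t \<le> b"
      then have "\<bar>t - x\<bar> < \<rho>" using ab by linarith
      then have "h' t - h' x / 2 \<ge> 0" using \<rho>(2)[of t] by linarith
      moreover have "((\<lambda>t. h t - h' x / 2 * t) has_real_derivative h' t - h' x / 2) (at t)"
        by (auto intro!: derivative_eq_intros assms(1))
      ultimately show "\<exists>y. ((\<lambda>t. h t - h' x / 2 * t) has_real_derivative y) (at t) \<and> 0 \<le> y" by blast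
    qed
    then show "h' x / 2 * (b - a) \<le> h b - h a" by (simp add: right_diff_distrib)
  qed
qed

text \<open>The curve \<open>\<Psi>\<close> replaces the segment from \<open>(xA, yA, zA)\<close> with direction \<open>(1, m, w)\<close>. Its projection
  to the \<open>xy\<close>-plane runs along the projected segment with \<open>n\<close> small loops of a drifting circle of
  radius \<open>r\<close> added; \<open>r\<close> is fitted so that the height gained equals the one along the segment.\<close>

locale trochoid =
  fixes xA yA zA L m w Y l r \<beta> H \<epsilon> :: real and n :: nat
  assumes l: "0 < l" "4 * l \<le> L" and m: "\<bar>m\<bar> \<le> 1/4" and w: "w \<noteq> 0" "4 * Y \<le> \<bar>w\<bar>"
    and Y: "\<And>u. 0 \<le> u \<Longrightarrow> u \<le> L \<Longrightarrow> \<bar>yA + m * u\<bar> \<le> Y"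
    and n: "n > 0" and \<beta>: "\<beta> = (L - 2 * l) / (2 * pi * n)" and r: "8 * \<beta> \<le> r" "r \<le> l" "r \<le> 1"
    and H: "H = w * L - (yA * L + m * L\<^sup>2 / 2)" and \<epsilon>: "\<epsilon> = - sgn w"
    and rH: "pi * n * r\<^sup>2 - r * (L - 2 * l) = - \<epsilon> * H"
begin

text \<open>The angle of the rotating circle. It is frozen near both ends, where the projection
  therefore coincides with the segment, and makes \<open>n\<close> full turns on the middle part of
  length \<open>L - 2 * l\<close>.\<close>

definition "phase u = max 0 (min (2 * pi * n) ((u - l) / \<beta>))"
definition "X u = u + r * sin (phase u)"
definition "V u = \<epsilon> * r * (1 - cos (phase u))"
text \<open>The integral of \<open>yA + m * x\<close>, that is, of \<open>y dx\<close> along the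
  projected line itself.\<close>

definition "Q x = yA * x + m * x\<^sup>2 / 2"
text \<open>The integral of \<open>V dX\<close> over the phase, where
  \<open>dX = (\<beta> + r * cos \<phi>) d\<phi>\<close> on the looping part; together with
  \<open>Q (X u)\<close> it makes the third coordinate of \<open>\<Psi>\<close> the integral of
  \<open>y dx\<close>. The linear terms \<open>r * \<beta>\<close> and
  \<open>- r\<^sup>2 / 2\<close> are the mean gain per unit angle.\<close>

definition "\<zeta> u = \<epsilon> * (r * \<beta> * (phase u - sin (phase u)) +
   r\<^sup>2 * (sin (phase u) - phase u / 2 - sin (2 * phase u) / 4))"
definition base :: "real \<Rightarrow> real^3" where "base u = vector [xA + u, yA + m * u, zA + w * u]"
definition \<Psi> :: "real \<Rightarrow> real^3" where "\<Psi> u = vector [xA + X u, yA + m * X u + V u, zA + Q (X u) + \<zeta> u]"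

lemma L_pos: "L > 0" and L2: "L - 2 * l > 0" "L - 2 * l \<ge> L / 2" using l by auto
lemma \<beta>_pos: "\<beta> > 0" unfolding \<beta> using L2 n by (intro divide_pos_pos) auto
lemma r_pos: "r > 0" using \<beta>_pos r by linarith
lemma \<epsilon>_sq: "\<epsilon> * \<epsilon> = 1" "\<bar>\<epsilon>\<bar> = 1" using w by (auto simp: \<epsilon> sgn_if)
lemma \<epsilon>w: "- \<epsilon> * w = \<bar>w\<bar>" using w by (auto simp: \<epsilon> sgn_if)
lemma n\<beta>: "2 * pi * n * \<beta> = L - 2 * l" unfolding \<beta> using n by simp
lemma Y_nonneg: "Y \<ge> 0" using Y[of 0] L_pos by force

lemma Q_diff: "Q b - Q a = (b - a) * (yA + m * ((a + b) / 2))"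
  by (simp add: Q_def field_simps power2_eq_square)

lemma Q_lipschitz: "a \<in> {0..L} \<Longrightarrow> b \<in> {0..L} \<Longrightarrow> \<bar>Q b - Q a\<bar> \<le> Y * \<bar>b - a\<bar>"
  unfolding Q_diff abs_mult using mult_left_mono[OF Y[of "(a + b) / 2"], of "\<bar>b - a\<bar>"]
  by (auto simp: mult.commute)

lemma phase_eq_low: "u \<le> l \<Longrightarrow> phase u = 0"
  using \<beta>_pos divide_nonpos_pos[of "u - l" \<beta>] unfolding phase_def by linarith

lemma phase_eq_high: "L - l \<le> u \<Longrightarrow> phase u = 2 * pi * n"
proof -
  assume "L - l \<le> u"
  then have "2 * pi * n * \<beta> \<le> u - l" using n\<beta> by simp
  then have "2 * pi * n \<le> (u - l) / \<beta>" using \<beta>_pos by (simp add: field_simps)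
  then show ?thesis using n by (simp add: phase_def)
qed

lemma phase_eq_mid: "l \<le> u \<Longrightarrow> u \<le> L - l \<Longrightarrow> phase u = (u - l) / \<beta>"
proof -
  assume "l \<le> u" "u \<le> L - l"
  then have "u - l \<le> 2 * pi * n * \<beta>" "0 \<le> u - l" using n\<beta> by simp_all
  then have "(u - l) / \<beta> \<le> 2 * pi * n" "0 \<le> (u - l) / \<beta>" using \<beta>_pos by (simp_all add: field_simps)
  then show ?thesis by (simp add: phase_def)
qed

lemma trig_ends: "sin (2 * pi * real n) = 0" "cos (2 * pi * real n) = 1" "sin (4 * pi * real n) = 0"
  using sin_2npi[of n] cos_2npi[of n] sin_2npi[of "2 * n"] by (simp_all add: mult.commute mult.left_commute)

lemma phase_mono: "u \<le> u' \<Longrightarrow> phase u \<le> phase u'"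
proof -
  assume "u \<le> u'"
  then have "(u - l) / \<beta> \<le> (u' - l) / \<beta>" using \<beta>_pos by (intro divide_right_mono) auto
  then show ?thesis unfolding phase_def by linarith
qed

lemma phase_lipschitz: "u \<le> u' \<Longrightarrow> phase u' - phase u \<le> (u' - u) / \<beta>"
proof -
  assume "u \<le> u'"
  then have "(u' - u) / \<beta> \<ge> 0" using \<beta>_pos by simp
  moreover have "(u' - l) / \<beta> - (u - l) / \<beta> = (u' - u) / \<beta>" by (simp add: diff_divide_distrib)
  ultimately show ?thesis unfolding phase_def by linarith
qed

lemma phase_lipschitz_abs: "\<bar>phase u' - phase u\<bar> \<le> \<bar>u' - u\<bar> / \<beta>"
  using phase_lipschitz[of u u'] phase_lipschitz[of u' u] phase_mono[of u u'] phase_mono[of u' u]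
  by (cases "u \<le> u'") auto

lemma slack_mono: "u \<le> u' \<Longrightarrow> u - \<beta> * phase u \<le> u' - \<beta> * phase u'"
  using phase_lipschitz[of u u', unfolded pos_le_divide_eq[OF \<beta>_pos]] by (simp add: algebra_simps)

lemma phase_end_cases:
  assumes "u \<le> l \<or> L - l \<le> u"
  shows "sin (phase u) = 0" "cos (phase u) = 1" "sin (2 * phase u) = 0"
  using assms phase_eq_low[of u] phase_eq_high[of u] trig_ends by (auto simp: mult.assoc[symmetric])

lemma X_near: "u \<in> {0..L} \<Longrightarrow> \<bar>X u - u\<bar> \<le> r" "u \<le> l \<or> L - l \<le> u \<Longrightarrow> X u = u"
  using r_pos mult_left_mono[OF abs_sin_le_one[of "phase u"], of r] phase_end_cases[of u]
  by (auto simp: X_def abs_mult)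

lemma X_range: "u \<in> {0..L} \<Longrightarrow> X u \<in> {0..L}"
  using X_near[of u] r by (cases "u \<le> l \<or> L - l \<le> u") auto

lemma V_near: "\<bar>V u\<bar> \<le> 2 * r" "u \<le> l \<or> L - l \<le> u \<Longrightarrow> V u = 0"
proof -
  have "\<bar>1 - cos (phase u)\<bar> \<le> 2" using abs_cos_le_one[of "phase u"] by linarith
  then show "\<bar>V u\<bar> \<le> 2 * r" using r_pos \<epsilon>_sq mult_left_mono[of "\<bar>1 - cos (phase u)\<bar>" 2 r]
    by (simp add: V_def abs_mult)
  show "u \<le> l \<or> L - l \<le> u \<Longrightarrow> V u = 0" using phase_end_cases[of u] by (simp add: V_def)
qed

lemma \<zeta>_0: "\<zeta> 0 = 0" using phase_eq_low[of 0] l by (simp add: \<zeta>_def)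

text \<open>The equation \<open>rH\<close> is made for this: it fits the radius so that
  \<open>n\<close> turns gain exactly \<open>H\<close>. As \<open>r\<close> is much larger than
  \<open>\<beta>\<close>, the negative area term wins, hence the sign
  \<open>\<epsilon> = - sgn w\<close>.\<close>

lemma total_height: "\<epsilon> * (r * \<beta> - r\<^sup>2 / 2) * (2 * pi * n) = H"
proof -
  have "\<epsilon> * (r * \<beta> - r\<^sup>2 / 2) * (2 * pi * n) = \<epsilon> * (r * (2 * pi * n * \<beta>) - pi * n * r\<^sup>2)"
    by (simp add: algebra_simps)
  also have "\<dots> = - \<epsilon> * (pi * n * r\<^sup>2 - r * (L - 2 * l))" unfolding n\<beta> by (simp add: algebra_simps)
  also have "\<dots> = (\<epsilon> * \<epsilon>) * H" unfolding rH by simp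
  finally show ?thesis using \<epsilon>_sq by simp
qed

lemma \<zeta>_L: "\<zeta> L = H"
proof -
  have "\<zeta> L = \<epsilon> * (r * \<beta> - r\<^sup>2 / 2) * (2 * pi * n)"
    using phase_eq_high[of L] phase_end_cases[of L] l by (simp add: \<zeta>_def algebra_simps)
  then show ?thesis using total_height by simp
qed

lemma \<Psi>_0: "\<Psi> 0 = base 0"
  using X_near(2)[of 0] V_near(2)[of 0] \<zeta>_0 l by (simp add: \<Psi>_def base_def Q_def)

lemma \<Psi>_L: "\<Psi> L = base L"
  using X_near(2)[of L] V_near(2)[of L] \<zeta>_L l by (simp add: \<Psi>_def base_def Q_def H)

lemma \<Psi>_ends: "u \<le> l \<or> L - l \<le> u \<Longrightarrow> \<Psi> u $ 1 = base u $ 1 \<and> \<Psi> u $ 2 = base u $ 2"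
  using X_near(2)[of u] V_near(2)[of u] by (simp add: \<Psi>_def base_def)

lemma \<Psi>_near_xy:
  assumes "u \<in> {0..L}"
  shows "\<bar>\<Psi> u $ 1 - base u $ 1\<bar> \<le> 3 * r" "\<bar>\<Psi> u $ 2 - base u $ 2\<bar> \<le> 3 * r"
proof -
  show "\<bar>\<Psi> u $ 1 - base u $ 1\<bar> \<le> 3 * r" using X_near(1)[OF assms] r_pos by (simp add: \<Psi>_def base_def)
  have "\<bar>m * (X u - u)\<bar> \<le> 1/4 * r"
    unfolding abs_mult using m X_near(1)[OF assms] by (intro mult_mono) auto
  then have "\<bar>m * (X u - u) + V u\<bar> \<le> 3 * r" using V_near(1)[of u] r_pos by linarith
  then show "\<bar>\<Psi> u $ 2 - base u $ 2\<bar> \<le> 3 * r" by (simp add: \<Psi>_def base_def algebra_simps)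
qed

lemma phase_uniform:
  assumes "u \<in> {0..L}"
  shows "\<bar>phase u / (2 * pi * n) - u / L\<bar> \<le> 2 * l / L"
proof -
  have pn: "2 * pi * real n > 0" using n by simp
  consider "u \<le> l" | "L - l \<le> u" | "l \<le> u" "u \<le> L - l" by linarith
  then show ?thesis
  proof cases
    case 1
    have "u / L \<le> 2 * l / L" using 1 l L_pos by (intro divide_right_mono) auto
    then show ?thesis using phase_eq_low[OF 1] assms L_pos by simp
  next
    case 2
    have "1 - u / L = (L - u) / L" using L_pos by (simp add: field_simps)
    also have "\<dots> \<le> 2 * l / L" using 2 l L_pos by (intro divide_right_mono) auto
    finally have "1 - u / L \<le> 2 * l / L" .
    moreover have "u / L \<le> 1" using assms L_pos by simp
    moreover have "phase u / (2 * pi * n) = 1" using phase_eq_high[OF 2] n by simp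
    ultimately show ?thesis by linarith
  next
    case 3
    have "phase u / (2 * pi * n) = (u - l) / (2 * pi * n * \<beta>)"
      using phase_eq_mid[OF 3] by simp
    then have "phase u / (2 * pi * n) - u / L = (u - l) / (L - 2 * l) - u / L" unfolding n\<beta> by simp
    also have "\<dots> = l * (2 * u - L) / ((L - 2 * l) * L)"
      using L2 L_pos by (simp add: field_simps)
    finally have "\<bar>phase u / (2 * pi * n) - u / L\<bar> = \<bar>l * (2 * u - L)\<bar> / ((L - 2 * l) * L)"
      using L2 L_pos by (simp add: abs_mult)
    also have "\<dots> \<le> (l * L) / ((L / 2) * L)"
    proof (rule frac_le)
      have "\<bar>2 * u - L\<bar> \<le> L" using assms by auto
      then show "\<bar>l * (2 * u - L)\<bar> \<le> l * L" using l by (simp add: abs_mult)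
      show "L / 2 * L \<le> (L - 2 * l) * L" using L2 L_pos by (intro mult_right_mono) auto
    qed (use l L_pos in auto)
    also have "\<dots> = 2 * l / L" using L_pos by simp
    finally show ?thesis .
  qed
qed

lemma H_bound: "\<bar>H\<bar> \<le> (\<bar>w\<bar> + Y) * L" "\<bar>H - w * L\<bar> \<le> Y * L"
proof -
  have "H - w * L = - (Q L - Q 0)" by (simp add: H Q_def)
  then show 2: "\<bar>H - w * L\<bar> \<le> Y * L" using Q_lipschitz[of 0 L] L_pos by simp
  have "\<bar>H\<bar> \<le> \<bar>H - w * L\<bar> + \<bar>w * L\<bar>" by linarith
  then show "\<bar>H\<bar> \<le> (\<bar>w\<bar> + Y) * L" using 2 L_pos by (simp add: abs_mult algebra_simps)
qed

text \<open>\<open>\<zeta>\<close> is \<open>H\<close> times the fraction of completed turns plus an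
  oscillation of order \<open>r\<close>. Only the term \<open>2 * L * Y\<close> escapes the control
  of \<open>r\<close> and \<open>l\<close>: it comes from \<open>Q\<close> and from the difference
  of \<open>H\<close> and \<open>w * L\<close>.\<close>

lemma \<Psi>_near:
  assumes u: "u \<in> {0..L}"
  shows "norm (\<Psi> u - base u) \<le> 2 * L * Y + 10 * r + 2 * (\<bar>w\<bar> + Y) * l"
proof -
  let ?p = "phase u"
  have "\<zeta> u = \<epsilon> * (r * \<beta> - r\<^sup>2 / 2) * ?p + \<epsilon> * (r\<^sup>2 * sin ?p - r * \<beta> * sin ?p - r\<^sup>2 / 4 * sin (2 * ?p))"
    by (simp add: \<zeta>_def algebra_simps)
  moreover have "\<epsilon> * (r * \<beta> - r\<^sup>2 / 2) * ?p = H * (?p / (2 * pi * n))"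
    unfolding total_height[symmetric] using n by simp
  ultimately have \<zeta>: "\<zeta> u = H * (?p / (2 * pi * n)) + \<epsilon> * (r\<^sup>2 * sin ?p - r * \<beta> * sin ?p - r\<^sup>2 / 4 * sin (2 * ?p))"
    by simp
  have rr: "r\<^sup>2 \<le> r" using r_pos r by (simp add: power2_eq_square mult_left_le)
  have rb: "r * \<beta> \<le> r" "0 \<le> r * \<beta>" using r_pos r \<beta>_pos by (auto simp: mult_left_le)
  have "\<bar>r\<^sup>2 * sin ?p\<bar> \<le> r\<^sup>2 * 1" "\<bar>r * \<beta> * sin ?p\<bar> \<le> r * \<beta> * 1" "\<bar>r\<^sup>2 / 4 * sin (2 * ?p)\<bar> \<le> r\<^sup>2 / 4 * 1"
    unfolding abs_mult using r_pos \<beta>_pos by (intro mult_mono; simp)+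
  then have "\<bar>r\<^sup>2 * sin ?p - r * \<beta> * sin ?p - r\<^sup>2 / 4 * sin (2 * ?p)\<bar> \<le> 4 * r" using rr rb by linarith
  then have e1: "\<bar>\<epsilon> * (r\<^sup>2 * sin ?p - r * \<beta> * sin ?p - r\<^sup>2 / 4 * sin (2 * ?p))\<bar> \<le> 4 * r"
    by (simp add: abs_mult \<epsilon>_sq)
  have "\<bar>H * (?p / (2 * pi * n) - u / L)\<bar> \<le> ((\<bar>w\<bar> + Y) * L) * (2 * l / L)"
    unfolding abs_mult using H_bound(1) phase_uniform[OF u] L_pos Y_nonneg by (intro mult_mono) auto
  then have e2: "\<bar>H * (?p / (2 * pi * n)) - H * (u / L)\<bar> \<le> 2 * (\<bar>w\<bar> + Y) * l"
    using L_pos by (simp add: algebra_simps)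
  have "H * (u / L) - w * u = (H - w * L) * (u / L)" using L_pos by (simp add: field_simps)
  then have "\<bar>H * (u / L) - w * u\<bar> \<le> (Y * L) * 1"
    unfolding abs_mult using H_bound(2) u L_pos Y_nonneg by (simp only: abs_mult) (intro mult_mono; simp)
  moreover have "\<bar>Q (X u)\<bar> \<le> Y * L"
    using Q_lipschitz[of 0 "X u"] X_range[OF u] mult_left_mono[of "X u" L Y] Y_nonneg L_pos by (auto simp: Q_def)
  ultimately have "\<bar>Q (X u) + \<zeta> u - w * u\<bar> \<le> 2 * L * Y + 4 * r + 2 * (\<bar>w\<bar> + Y) * l"
    using e1 e2 unfolding \<zeta> by (simp only: mult.commute[of L Y] mult.assoc)
  then have "\<bar>(\<Psi> u - base u) $ 3\<bar> \<le> 2 * L * Y + 4 * r + 2 * (\<bar>w\<bar> + Y) * l"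
    by (simp add: \<Psi>_def base_def algebra_simps)
  moreover have "\<bar>(\<Psi> u - base u) $ 1\<bar> \<le> 3 * r" "\<bar>(\<Psi> u - base u) $ 2\<bar> \<le> 3 * r"
    using \<Psi>_near_xy[OF u] by auto
  ultimately show ?thesis using norm_le_sum_components3[of "\<Psi> u - base u"] by linarith
qed

section \<open>Monotone quantities along the strand and along the homotopy\<close>

lemma sin_sq_lipschitz: "\<bar>(sin b)\<^sup>2 - (sin a)\<^sup>2\<bar> \<le> \<bar>b - a :: real\<bar>"
proof -
  have "(sin b)\<^sup>2 - (sin a)\<^sup>2 = sin (b + a) * sin (b - a)"
  proof -
    have "sin (b + a) * sin (b - a) = (sin b)\<^sup>2 * (cos a)\<^sup>2 - (cos b)\<^sup>2 * (sin a)\<^sup>2"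
      by (simp add: sin_add sin_diff algebra_simps power2_eq_square)
    then show ?thesis unfolding cos_squared_eq by (simp add: algebra_simps)
  qed
  then have "\<bar>(sin b)\<^sup>2 - (sin a)\<^sup>2\<bar> = \<bar>sin (b + a)\<bar> * \<bar>sin (b - a)\<bar>" by (simp add: abs_mult)
  also have "\<dots> \<le> 1 * \<bar>b - a\<bar>"
    by (intro mult_mono abs_sin_x_le_abs_x) auto
  finally show ?thesis by simp
qed

text \<open>In suitable local coordinates the contact form is \<open>d\<zeta> - V dX\<close>. Since the trochoid satisfies
  \<open>V = r + \<beta> - dX/d\<phi>\<close> up to the sign \<open>\<epsilon>\<close>, the function \<open>(r + \<beta>) X - \<epsilon> \<zeta>\<close> has the
  nonnegative derivative \<open>(dX/d\<phi>)\<^sup>2\<close> along it.\<close>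

definition "rising u = (r + \<beta>) * X u - \<epsilon> * \<zeta> u"

lemma rising_eq: "rising u = (r + \<beta>) * (u - \<beta> * phase u) +
   ((\<beta>\<^sup>2 + r\<^sup>2 / 2) * phase u + 2 * \<beta> * r * sin (phase u) + r\<^sup>2 / 4 * sin (2 * phase u))"
proof -
  have "\<epsilon> * \<zeta> u = (\<epsilon> * \<epsilon>) * (r * \<beta> * (phase u - sin (phase u)) +
   r\<^sup>2 * (sin (phase u) - phase u / 2 - sin (2 * phase u) / 4))" by (simp add: \<zeta>_def)
  then show ?thesis unfolding rising_def X_def \<epsilon>_sq by (simp add: algebra_simps power2_eq_square)
qed

lemma rising_mono_phase:
  assumes "a \<le> b"
  shows "(\<beta>\<^sup>2 + r\<^sup>2 / 2) * a + 2 * \<beta> * r * sin a + r\<^sup>2 / 4 * sin (2 * a) \<le>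
    (\<beta>\<^sup>2 + r\<^sup>2 / 2) * b + 2 * \<beta> * r * sin b + r\<^sup>2 / 4 * sin (2 * b)"
proof (rule DERIV_nonneg_imp_nondecreasing[OF assms], intro exI conjI)
  fix x
  show "((\<lambda>x. (\<beta>\<^sup>2 + r\<^sup>2 / 2) * x + 2 * \<beta> * r * sin x + r\<^sup>2 / 4 * sin (2 * x)) has_real_derivative
      (\<beta> + r * cos x)\<^sup>2) (at x)"
  proof -
    have "(\<beta> + r * cos x)\<^sup>2 = (\<beta>\<^sup>2 + r\<^sup>2 / 2) + 2 * \<beta> * r * cos x + r\<^sup>2 / 4 * (cos (2 * x) * 2)"
      unfolding cos_double_cos by (simp add: power2_eq_square field_simps)
    then show ?thesis by (auto intro!: derivative_eq_intros)
  qed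
qed simp

text \<open>\<open>rising\<close> may stall within a loop, but only while \<open>V\<close> moves
  fast. The trochoid estimate covers the phase increment, and the coefficient
  \<open>r + \<beta>\<close> covers the slack increment. The minimum with 2 serves the second case
  of the estimate, where \<open>2 * \<beta> \<le> r / 4\<close> is used.\<close>

lemma rising_or_moving:
  assumes "u \<le> u'"
  shows "0 \<le> rising u' - rising u" "min r 2 * (u' - u) \<le> (rising u' - rising u) + \<bar>V u' - V u\<bar>"
proof -
  define p where "p = (u' - \<beta> * phase u') - (u - \<beta> * phase u)"
  define q where "q = phase u' - phase u"
  have pq: "p \<ge> 0" "q \<ge> 0" using slack_mono[OF assms] phase_mono[OF assms] by (auto simp: p_def q_def)
  have du: "u' - u = p + \<beta> * q" by (simp add: p_def q_def algebra_simps)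
  let ?G = "\<lambda>\<phi>. (\<beta>\<^sup>2 + r\<^sup>2 / 2) * \<phi> + 2 * \<beta> * r * sin \<phi> + r\<^sup>2 / 4 * sin (2 * \<phi>)"
  define g where "g = ?G (phase u') - ?G (phase u)"
  have rd: "rising u' - rising u = (r + \<beta>) * p + g"
    unfolding rising_eq p_def g_def by (simp add: algebra_simps)
  have g0: "g \<ge> 0" using rising_mono_phase[OF phase_mono[OF assms]] by (simp add: g_def)
  show "0 \<le> rising u' - rising u" unfolding rd using g0 pq r_pos \<beta>_pos by simp
  have Vd: "\<bar>V u' - V u\<bar> = r * \<bar>cos (phase u) - cos (phase u')\<bar>"
  proof -
    have "V u' - V u = \<epsilon> * (r * (cos (phase u) - cos (phase u')))" by (simp add: V_def algebra_simps)
    then show ?thesis using r_pos by (simp add: abs_mult \<epsilon>_sq)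
  qed
  have p1: "min r 2 * p \<le> (r + \<beta>) * p" using pq \<beta>_pos by (intro mult_right_mono) auto
  have q1: "min r 2 * (\<beta> * q) \<le> g + r * \<bar>cos (phase u) - cos (phase u')\<bar>"
    using trochoid_expanding_cases[OF phase_mono[OF assms] less_imp_le[OF \<beta>_pos] r(1)]
  proof (elim disjE)
    assume "r\<^sup>2 / 8 * (phase u' - phase u) \<le> ?G (phase u') - ?G (phase u)"
    then have gq: "r\<^sup>2 / 8 * q \<le> g" by (simp add: g_def q_def)
    have "r * \<beta> * 8 \<le> r * r" using mult_right_mono[OF r(1), of r] r_pos by (simp add: mult_ac)
    then have "r * \<beta> * q \<le> r\<^sup>2 / 8 * q" using pq by (intro mult_right_mono) (auto simp: power2_eq_square)
    moreover have "min r 2 * (\<beta> * q) \<le> r * (\<beta> * q)" using pq \<beta>_pos by (intro mult_right_mono) auto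
    moreover have "0 \<le> r * \<bar>cos (phase u) - cos (phase u')\<bar>" using r_pos by simp
    moreover have "r * (\<beta> * q) = r * \<beta> * q" by simp
    ultimately show ?thesis using gq by linarith
  next
    assume "1 / 4 * (phase u' - phase u) \<le> \<bar>cos (phase u) - cos (phase u')\<bar>"
    then have "r * (1 / 4 * q) \<le> r * \<bar>cos (phase u) - cos (phase u')\<bar>" unfolding q_def
      using r_pos by (intro mult_left_mono) auto
    moreover have "min r 2 * (\<beta> * q) \<le> 2 * (\<beta> * q)" using pq \<beta>_pos by (intro mult_right_mono) auto
    moreover have "2 * \<beta> * q \<le> r / 4 * q" using r pq by (intro mult_right_mono) auto
    ultimately show ?thesis using g0 by simp
  qed
  show "min r 2 * (u' - u) \<le> (rising u' - rising u) + \<bar>V u' - V u\<bar>"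
    unfolding rd Vd du using p1 q1 by (simp add: algebra_simps)
qed

text \<open>This is the share of the straight segment in the monotone function of the homotopy at
  time \<open>s\<close>. The slope \<open>\<bar>w\<bar>\<close> has to beat the variation of
  \<open>Q\<close>, of size \<open>Y\<close>, and that of the square term; the fitting equation
  bounds the latter by about half of \<open>\<bar>w\<bar>\<close>, and
  \<open>4 * Y \<le> \<bar>w\<bar>\<close> leaves room for both.\<close>

lemma straight_part_rising:
  assumes u: "u \<in> {0..L}" "u' \<in> {0..L}" "u \<le> u'" and s: "0 \<le> s" "s \<le> 1"
  shows "\<beta> * (u' - u) \<le> ((r + \<beta>) * u' + \<bar>w\<bar> * u' + \<epsilon> * Q u' - s * \<epsilon> * (m/2) * r\<^sup>2 * (sin (phase u'))\<^sup>2)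
     - ((r + \<beta>) * u + \<bar>w\<bar> * u + \<epsilon> * Q u - s * \<epsilon> * (m/2) * r\<^sup>2 * (sin (phase u))\<^sup>2)"
proof -
  define d where "d = u' - u"
  have d: "d \<ge> 0" using u by (simp add: d_def)
  have "\<bar>\<epsilon> * (Q u' - Q u)\<bar> \<le> Y * d" using Q_lipschitz[OF u(1,2)] u(3) by (simp add: abs_mult \<epsilon>_sq d_def)
  then have e1: "\<epsilon> * Q u' - \<epsilon> * Q u \<ge> - Y * d" by (simp add: algebra_simps)
  define S where "S = (sin (phase u'))\<^sup>2 - (sin (phase u))\<^sup>2"
  have "\<bar>S\<bar> \<le> d / \<beta>" unfolding S_def d_def
    using order_trans[OF sin_sq_lipschitz phase_lipschitz_abs[of u' u]] u(3) by simp
  have sm: "\<bar>s * \<epsilon> * (m/2)\<bar> \<le> 1/8"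
    using mult_mono[of "\<bar>s\<bar>" 1 "\<bar>m\<bar>/2" "1/8"] s m by (simp add: abs_mult \<epsilon>_sq)
  have "\<bar>s * \<epsilon> * (m/2) * (r\<^sup>2 * S)\<bar> \<le> 1/8 * (r\<^sup>2 * (d / \<beta>))"
    unfolding abs_mult[of "s * \<epsilon> * (m/2)"] using sm mult_left_mono[OF \<open>\<bar>S\<bar> \<le> d / \<beta>\<close>, of "r\<^sup>2"]
    by (intro mult_mono) (auto simp: abs_mult)
  moreover have "r\<^sup>2 * (d / \<beta>) \<le> (4 * (\<bar>w\<bar> + Y) + 2 * r) * d"
  proof -
    \<comment> \<open>Radius and drift are linked by \<open>rH\<close>: up to constants,
      \<open>r\<^sup>2 / \<beta>\<close> is bounded by \<open>\<bar>w\<bar> + Y\<close> and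
      \<open>r\<close>, whatever the number of turns.\<close>
    have "pi * n * r\<^sup>2 = - \<epsilon> * H + r * (2 * pi * n * \<beta>)" using rH n\<beta> by simp
    also have "- \<epsilon> * H \<le> (\<bar>w\<bar> + Y) * L"
      using H_bound(1) abs_ge_self[of "- \<epsilon> * H"] by (simp add: abs_mult \<epsilon>_sq)
    also have "(\<bar>w\<bar> + Y) * L \<le> (\<bar>w\<bar> + Y) * (2 * (2 * pi * n * \<beta>))"
      unfolding n\<beta> using L2 Y_nonneg by (intro mult_left_mono) auto
    finally have "(pi * n) * r\<^sup>2 \<le> (pi * n) * ((4 * (\<bar>w\<bar> + Y) + 2 * r) * \<beta>)" by (simp add: algebra_simps)
    then have "r\<^sup>2 \<le> (4 * (\<bar>w\<bar> + Y) + 2 * r) * \<beta>" using n by (simp add: mult_le_cancel_left_pos)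
    then have "r\<^sup>2 * (d / \<beta>) \<le> ((4 * (\<bar>w\<bar> + Y) + 2 * r) * \<beta>) * (d / \<beta>)"
      using d \<beta>_pos by (intro mult_right_mono) auto
    then show ?thesis using \<beta>_pos by simp
  qed
  ultimately have e2: "\<bar>s * \<epsilon> * (m/2) * (r\<^sup>2 * S)\<bar> \<le> ((\<bar>w\<bar> + Y) / 2 + r / 4) * d"
  proof -
    have "1/8 * ((4 * (\<bar>w\<bar> + Y) + 2 * r) * d) = ((\<bar>w\<bar> + Y) / 2 + r / 4) * d" by (simp add: field_simps)
    then show "\<bar>s * \<epsilon> * (m/2) * (r\<^sup>2 * S)\<bar> \<le> 1/8 * (r\<^sup>2 * (d / \<beta>)) \<Longrightarrow>
      r\<^sup>2 * (d / \<beta>) \<le> (4 * (\<bar>w\<bar> + Y) + 2 * r) * d \<Longrightarrow> ?thesis" by linarith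
  qed
  have "(\<bar>w\<bar> / 2 - 3 / 2 * Y + 3 / 4 * r) * d \<ge> 0"
    using w r_pos d Y_nonneg by (intro mult_nonneg_nonneg) auto
  then have "(r + \<beta>) * d + \<bar>w\<bar> * d - Y * d - ((\<bar>w\<bar> + Y) / 2 + r / 4) * d \<ge> \<beta> * d"
    by (simp add: field_simps)
  then have "(r + \<beta>) * d + \<bar>w\<bar> * d + (\<epsilon> * Q u' - \<epsilon> * Q u) - s * \<epsilon> * (m/2) * (r\<^sup>2 * S) \<ge> \<beta> * d"
    using e1 e2 by linarith
  then show ?thesis by (simp add: d_def S_def algebra_simps)
qed

text \<open>The function \<open>g\<close> combines \<open>x\<close> with the height above
  \<open>Q\<close>. It depends only on the moving point and is Lipschitz in it, yet along the curve
  at time \<open>s\<close> it is a convex combination of two nondecreasing functions. Where it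
  stalls, \<open>V\<close> moves, and \<open>V\<close> is read off from
  \<open>y - m * x\<close>.\<close>

lemma interpolation_expanding:
  assumes u: "u \<in> {0..L}" "u' \<in> {0..L}" and s: "0 \<le> s" "s \<le> 1"
  shows "min \<beta> (min r 2) * \<bar>u' - u\<bar> \<le> (r + \<beta> + Y + 4) *
     norm ((base u' + s *\<^sub>R (\<Psi> u' - base u')) - (base u + s *\<^sub>R (\<Psi> u - base u)))"
  using u
proof (induction u u' rule: linorder_wlog)
  case (sym u u')
  then show ?case by (simp add: norm_minus_commute abs_minus_commute)
next
  case (le u u')
  then have u: "u \<in> {0..L}" "u' \<in> {0..L}" "u \<le> u'" by auto
  define F where "F u = base u + s *\<^sub>R (\<Psi> u - base u)" for u
  define x where "x u = (1 - s) * u + s * X u" for u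
  define g where "g u = (r + \<beta>) * x u - \<epsilon> * (F u $ 3 - zA - Q (x u))" for u
  have F1: "F u $ 1 = xA + x u" for u by (simp add: F_def base_def \<Psi>_def x_def algebra_simps)
  have F2: "F u $ 2 = yA + m * x u + s * V u" for u by (simp add: F_def base_def \<Psi>_def x_def algebra_simps)
  have xr: "x u \<in> {0..L}" if "u \<in> {0..L}" for u
    using convexD[OF convex_real_interval(5)[of 0 L] that X_range[OF that], of "1 - s" s] s by (simp add: x_def)
  have g: "g u = (1 - s) * ((r + \<beta>) * u + \<bar>w\<bar> * u + \<epsilon> * Q u - s * \<epsilon> * (m/2) * r\<^sup>2 * (sin (phase u))\<^sup>2) + s * rising u" for u
  proof -
    \<comment> \<open>\<open>Q\<close> is quadratic, so at the convex combination \<open>x u\<close>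
      of \<open>u\<close> and \<open>X u\<close> it misses the affine interpolation by this multiple
      of \<open>(X u - u)\<^sup>2\<close>.\<close>
    have "Q (x u) = (1 - s) * Q u + s * Q (X u) - (m/2) * s * (1 - s) * (X u - u)\<^sup>2"
      by (simp add: Q_def x_def power2_eq_square field_simps)
    then have qx: "Q (x u) = (1 - s) * Q u + s * Q (X u) - (m/2) * s * (1 - s) * (r\<^sup>2 * (sin (phase u))\<^sup>2)"
      by (simp add: X_def power_mult_distrib)
    have F3: "F u $ 3 = zA + (1 - s) * (w * u) + s * (Q (X u) + \<zeta> u)"
      by (simp add: F_def base_def \<Psi>_def algebra_simps)
    show ?thesis unfolding g_def F3 qx unfolding \<epsilon>w[symmetric] rising_def x_def by (simp add: algebra_simps)
  qed
  have gd: "\<beta> * (1 - s) * (u' - u) + s * (rising u' - rising u) \<le> g u' - g u"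
    using mult_left_mono[OF straight_part_rising[OF u s], of "1 - s"] s unfolding g by (simp add: algebra_simps)
  let ?N = "norm (F u' - F u)"
  have c: "\<bar>F u' $ i - F u $ i\<bar> \<le> ?N" for i using component_abs_le_norm[of "F u' - F u" i] by simp
  have xd: "\<bar>x u' - x u\<bar> \<le> ?N" using c[of 1] by (simp add: F1)
  have "\<bar>m * (x u' - x u)\<bar> \<le> 1 * ?N" unfolding abs_mult using m xd by (intro mult_mono) auto
  moreover have "s * (V u' - V u) = (F u' $ 2 - F u $ 2) - m * (x u' - x u)" by (simp add: F2 algebra_simps)
  ultimately have "\<bar>s * (V u' - V u)\<bar> \<le> 2 * ?N" using c[of 2] by linarith
  then have Vd: "s * \<bar>V u' - V u\<bar> \<le> 2 * ?N" using s by (simp add: abs_mult)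
  have "g u' - g u \<le> (r + \<beta> + Y + 1) * ?N"
  proof -
    have "g u' - g u = (r + \<beta>) * (x u' - x u) - \<epsilon> * (F u' $ 3 - F u $ 3) + \<epsilon> * (Q (x u') - Q (x u))"
      by (simp add: g_def algebra_simps)
    moreover have "(r + \<beta>) * (x u' - x u) \<le> (r + \<beta>) * ?N"
      using xd r_pos \<beta>_pos by (intro mult_left_mono) auto
    moreover have "\<bar>\<epsilon> * (F u' $ 3 - F u $ 3)\<bar> \<le> ?N" using c[of 3] by (simp add: abs_mult \<epsilon>_sq)
    moreover have "\<bar>\<epsilon> * (Q (x u') - Q (x u))\<bar> \<le> Y * ?N"
      using Q_lipschitz[OF xr xr, OF u(1,2)] mult_left_mono[OF xd Y_nonneg] by (simp add: abs_mult \<epsilon>_sq)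
    ultimately show ?thesis by (simp add: algebra_simps)
  qed
  moreover have "min \<beta> (min r 2) * (u' - u) \<le> (g u' - g u) + s * \<bar>V u' - V u\<bar>"
  proof -
    have "s * (min \<beta> (min r 2) * (u' - u)) \<le> s * ((rising u' - rising u) + \<bar>V u' - V u\<bar>)"
    proof (rule mult_left_mono[OF _ s(1)])
      have "min \<beta> (min r 2) * (u' - u) \<le> min r 2 * (u' - u)" using u(3) by (intro mult_right_mono) auto
      then show "min \<beta> (min r 2) * (u' - u) \<le> (rising u' - rising u) + \<bar>V u' - V u\<bar>"
        using rising_or_moving(2)[OF u(3)] by linarith
    qed
    moreover have "(1 - s) * (min \<beta> (min r 2) * (u' - u)) \<le> (1 - s) * (\<beta> * (u' - u))"
      using u(3) s by (intro mult_left_mono mult_right_mono) auto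
    ultimately show ?thesis using gd by (simp add: algebra_simps)
  qed
  moreover have "(r + \<beta> + Y + 4) * ?N = (r + \<beta> + Y + 1) * ?N + 3 * ?N" by (simp add: algebra_simps)
  moreover have "0 \<le> ?N" by simp
  ultimately have "min \<beta> (min r 2) * (u' - u) \<le> (r + \<beta> + Y + 4) * ?N" using Vd by linarith
  then show ?case using u(3) by (simp add: F_def)
qed

section \<open>Regularity and horizontality of the strand\<close>

lemma X_lipschitz: "\<bar>X u' - X u\<bar> \<le> (1 + r / \<beta>) * \<bar>u' - u\<bar>"
proof -
  have "\<bar>sin (phase u') - sin (phase u)\<bar> \<le> \<bar>phase u' - phase u\<bar>"
    by (rule sin_lipschitz)
  also have "\<dots> \<le> \<bar>u' - u\<bar> / \<beta>" by (rule phase_lipschitz_abs)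
  finally have "\<bar>r * (sin (phase u') - sin (phase u))\<bar> \<le> r * (\<bar>u' - u\<bar> / \<beta>)"
    using r_pos unfolding abs_mult by (intro mult_mono) auto
  then show ?thesis by (simp add: X_def algebra_simps)
qed

lemma V_lipschitz: "\<bar>V u' - V u\<bar> \<le> r / \<beta> * \<bar>u' - u\<bar>"
proof -
  have "V u' - V u = \<epsilon> * (r * (cos (phase u) - cos (phase u')))" by (simp add: V_def algebra_simps)
  then have "\<bar>V u' - V u\<bar> = r * \<bar>cos (phase u) - cos (phase u')\<bar>" using r_pos by (simp add: abs_mult \<epsilon>_sq)
  also have "\<dots> \<le> r * (\<bar>u' - u\<bar> / \<beta>)"
    using cos_lipschitz[of "phase u'" "phase u"] phase_lipschitz_abs[of u' u] r_pos
    by (intro mult_left_mono) (auto simp: abs_minus_commute)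
  finally show ?thesis by simp
qed

text \<open>As functions of the phase, \<open>Z\<close> has derivative \<open>V\<close> times that
  of \<open>X\<close>. Freezing \<open>V\<close> at \<open>a\<close> leaves an integrand bounded by
  a multiple of the length of the interval, so the remainder is quadratic.\<close>

lemma height_horizontal_phase:
  defines "Z \<equiv> \<lambda>\<phi>. \<epsilon> * (r * \<beta> * (\<phi> - sin \<phi>) + r\<^sup>2 * (sin \<phi> - \<phi> / 2 - sin (2 * \<phi>) / 4))"
  shows "\<bar>Z b - Z a - \<epsilon> * r * (1 - cos a) * ((\<beta> * b + r * sin b) - (\<beta> * a + r * sin a))\<bar> \<le> r * (\<beta> + r) * (b - a)\<^sup>2"
proof -
  define h where "h t = Z t - \<epsilon> * r * (1 - cos a) * (\<beta> * t + r * sin t)" for t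
  have d: "(h has_real_derivative \<epsilon> * r * (cos a - cos t) * (\<beta> + r * cos t)) (at t)" for t
  proof -
    have c: "r\<^sup>2 * (cos t - 1/2 - cos (2 * t) / 2) = r\<^sup>2 * cos t * (1 - cos t)"
      unfolding cos_double_cos by (simp add: power2_eq_square field_simps)
    have "(h has_real_derivative \<epsilon> * (r * \<beta> * (1 - cos t) + r\<^sup>2 * (cos t - 1/2 - cos (2 * t) / 2))
        - \<epsilon> * r * (1 - cos a) * (\<beta> + r * cos t)) (at t)"
      unfolding h_def Z_def by (auto intro!: derivative_eq_intros simp: algebra_simps)
    then show ?thesis unfolding c by (simp add: power2_eq_square algebra_simps)
  qed
  have "norm (h b - h a) \<le> (\<bar>r\<bar> * (\<beta> + r) * \<bar>b - a\<bar>) * norm (b - a)"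
  proof (rule field_differentiable_bound[of "closed_segment a b"])
    fix t assume t: "t \<in> closed_segment a b"
    show "(h has_field_derivative \<epsilon> * r * (cos a - cos t) * (\<beta> + r * cos t)) (at t within closed_segment a b)"
      using d by (rule has_field_derivative_at_within)
    have "\<bar>cos a - cos t\<bar> \<le> \<bar>b - a\<bar>"
      using cos_lipschitz[of a t] t by (auto simp: closed_segment_eq_real_ivl split: if_splits)
    moreover have "\<bar>\<beta> + r * cos t\<bar> \<le> \<beta> + r"
    proof -
      have "\<bar>r * cos t\<bar> \<le> r * 1" unfolding abs_mult using r_pos by (intro mult_mono) auto
      then show ?thesis using \<beta>_pos by linarith
    qed
    ultimately have "\<bar>cos a - cos t\<bar> * \<bar>\<beta> + r * cos t\<bar> \<le> \<bar>b - a\<bar> * (\<beta> + r)"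
      by (intro mult_mono) auto
    then have "r * (\<bar>cos a - cos t\<bar> * \<bar>\<beta> + r * cos t\<bar>) \<le> r * (\<bar>b - a\<bar> * (\<beta> + r))"
      using r_pos by (intro mult_left_mono) auto
    then show "norm (\<epsilon> * r * (cos a - cos t) * (\<beta> + r * cos t)) \<le> \<bar>r\<bar> * (\<beta> + r) * \<bar>b - a\<bar>"
      using r_pos by (simp add: abs_mult \<epsilon>_sq mult_ac)
  qed auto
  moreover have "h b - h a = Z b - Z a - \<epsilon> * r * (1 - cos a) * ((\<beta> * b + r * sin b) - (\<beta> * a + r * sin a))"
    by (simp add: h_def algebra_simps)
  ultimately show ?thesis using r_pos by (simp add: power2_eq_square abs_mult_self_eq mult.assoc)
qed

lemma V_slack: "\<bar>V u * ((u' - \<beta> * phase u') - (u - \<beta> * phase u))\<bar> \<le> r / \<beta> * (u' - u)\<^sup>2"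
proof -
  let ?p = "(u' - \<beta> * phase u') - (u - \<beta> * phase u)"
  have p: "\<bar>?p\<bar> \<le> \<bar>u' - u\<bar>"
    using slack_mono[of u u'] slack_mono[of u' u] phase_mono[of u u'] phase_mono[of u' u]
      mult_left_mono[of "phase u" "phase u'" \<beta>] mult_left_mono[of "phase u'" "phase u" \<beta>] \<beta>_pos
    by (cases "u \<le> u'") auto
  have "\<bar>V u\<bar> \<le> r / \<beta> * \<bar>u' - u\<bar> \<or> ?p = 0"
  proof (cases "u \<le> l \<or> L - l \<le> u")
    case True
    then show ?thesis using V_near(2) r_pos \<beta>_pos by simp
  next
    case False
    consider "u' \<le> l" | "L - l \<le> u'" | "l < u'" "u' < L - l" by linarith
    then show ?thesis
    proof cases
      case 1
      have "\<bar>V u\<bar> \<le> r / \<beta> * \<bar>u - l\<bar>" using V_lipschitz[of u l] V_near(2)[of l] by simp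
      also have "\<dots> \<le> r / \<beta> * \<bar>u' - u\<bar>" using 1 False r_pos \<beta>_pos by (intro mult_left_mono) auto
      finally show ?thesis ..
    next
      case 2
      have "\<bar>V u\<bar> \<le> r / \<beta> * \<bar>u - (L - l)\<bar>" using V_lipschitz[of u "L - l"] V_near(2)[of "L - l"] by simp
      also have "\<dots> \<le> r / \<beta> * \<bar>u' - u\<bar>" using 2 False r_pos \<beta>_pos by (intro mult_left_mono) auto
      finally show ?thesis ..
    next
      case 3
      then show ?thesis using False phase_eq_mid[of u] phase_eq_mid[of u'] \<beta>_pos by simp
    qed
  qed
  then show ?thesis
  proof
    assume "\<bar>V u\<bar> \<le> r / \<beta> * \<bar>u' - u\<bar>"
    then have "\<bar>V u\<bar> * \<bar>?p\<bar> \<le> (r / \<beta> * \<bar>u' - u\<bar>) * \<bar>u' - u\<bar>"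
      using p r_pos \<beta>_pos by (intro mult_mono) auto
    then show ?thesis by (simp add: abs_mult power2_eq_square mult.assoc abs_mult_self_eq)
  next
    assume "?p = 0"
    then show ?thesis using r_pos \<beta>_pos by simp
  qed
qed

text \<open>The remainder splits into that of the quadratic \<open>Q\<close>, that of the loops in
  terms of the phase, and \<open>V\<close> times the increment of the slack; each is of second
  order.\<close>

lemma \<Psi>_horizontal:
  "\<bar>\<Psi> u' $ 3 - \<Psi> u $ 3 - \<Psi> u $ 2 * (\<Psi> u' $ 1 - \<Psi> u $ 1)\<bar> \<le>
     ((1 + r / \<beta>)\<^sup>2 + r * (\<beta> + r) / \<beta>\<^sup>2 + r / \<beta>) * (u' - u)\<^sup>2"
proof -
  let ?a = "phase u" and ?b = "phase u'"
  let ?p = "(u' - \<beta> * phase u') - (u - \<beta> * phase u)"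
  let ?E = "\<zeta> u' - \<zeta> u - V u * ((\<beta> * ?b + r * sin ?b) - (\<beta> * ?a + r * sin ?a))"
  have "\<Psi> u' $ 3 - \<Psi> u $ 3 - \<Psi> u $ 2 * (\<Psi> u' $ 1 - \<Psi> u $ 1) =
    (Q (X u') - Q (X u) - (yA + m * X u) * (X u' - X u)) + (\<zeta> u' - \<zeta> u - V u * (X u' - X u))"
    by (simp add: \<Psi>_def algebra_simps)
  also have "Q (X u') - Q (X u) - (yA + m * X u) * (X u' - X u) = m / 2 * (X u' - X u)\<^sup>2"
    by (simp add: Q_def power2_eq_square field_simps)
  also have "\<zeta> u' - \<zeta> u - V u * (X u' - X u) = ?E - V u * ?p"
    by (simp add: X_def algebra_simps)
  finally have eq: "\<Psi> u' $ 3 - \<Psi> u $ 3 - \<Psi> u $ 2 * (\<Psi> u' $ 1 - \<Psi> u $ 1) =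
     m / 2 * (X u' - X u)\<^sup>2 + (?E - V u * ?p)" .
  have "\<bar>m / 2 * (X u' - X u)\<^sup>2\<bar> \<le> 1 * ((1 + r / \<beta>) * \<bar>u' - u\<bar>)\<^sup>2"
    unfolding abs_mult using m power_mono[OF X_lipschitz[of u' u], of 2] by (intro mult_mono) auto
  then have e1: "\<bar>m / 2 * (X u' - X u)\<^sup>2\<bar> \<le> (1 + r / \<beta>)\<^sup>2 * (u' - u)\<^sup>2" by (simp add: power_mult_distrib)
  have "\<bar>?E\<bar> \<le> r * (\<beta> + r) * (?b - ?a)\<^sup>2"
    using height_horizontal_phase[of ?b ?a] by (simp add: \<zeta>_def V_def)
  also have "\<dots> \<le> r * (\<beta> + r) * (\<bar>u' - u\<bar> / \<beta>)\<^sup>2"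
    using power_mono[OF phase_lipschitz_abs[of u' u], of 2] r_pos \<beta>_pos by (intro mult_left_mono) auto
  finally have e2: "\<bar>?E\<bar> \<le> r * (\<beta> + r) / \<beta>\<^sup>2 * (u' - u)\<^sup>2" by (simp add: power_divide)
  show ?thesis unfolding eq using e1 e2 V_slack[of u u'] by (simp only: distrib_right)
qed

lemma \<Psi>_lipschitz:
  assumes "u \<in> {0..L}" "u' \<in> {0..L}"
  shows "norm (\<Psi> u' - \<Psi> u) \<le> ((2 + Y) * (1 + r / \<beta>) + r / \<beta> + (2 * r * \<beta> + 2 * r\<^sup>2) / \<beta>) * \<bar>u' - u\<bar>"
proof -
  have x: "\<bar>(\<Psi> u' - \<Psi> u) $ 1\<bar> \<le> (1 + r / \<beta>) * \<bar>u' - u\<bar>" using X_lipschitz by (simp add: \<Psi>_def)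
  have "\<bar>m * (X u' - X u)\<bar> \<le> 1 * ((1 + r / \<beta>) * \<bar>u' - u\<bar>)"
    unfolding abs_mult using m X_lipschitz by (intro mult_mono) auto
  then have y: "\<bar>(\<Psi> u' - \<Psi> u) $ 2\<bar> \<le> (1 + r / \<beta>) * \<bar>u' - u\<bar> + r / \<beta> * \<bar>u' - u\<bar>"
    using V_lipschitz[of u' u] by (simp add: \<Psi>_def algebra_simps)
  have "\<bar>Q (X u') - Q (X u)\<bar> \<le> Y * ((1 + r / \<beta>) * \<bar>u' - u\<bar>)"
    using Q_lipschitz[OF X_range X_range, OF assms] mult_left_mono[OF X_lipschitz[of u' u] Y_nonneg] by linarith
  moreover have "\<bar>\<zeta> u' - \<zeta> u\<bar> \<le> (2 * r * \<beta> + 2 * r\<^sup>2) / \<beta> * \<bar>u' - u\<bar>"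
  proof -
    let ?a = "phase u" and ?b = "phase u'"
    define D where "D = \<bar>?b - ?a\<bar>"
    have s: "\<bar>sin ?b - sin ?a\<bar> \<le> D" "\<bar>sin (2 * ?b) - sin (2 * ?a)\<bar> \<le> 2 * D"
    proof -
      have "2 * ?b - 2 * ?a = 2 * (?b - ?a)" by simp
      then have "\<bar>2 * ?b - 2 * ?a\<bar> = 2 * D" by (simp only: D_def abs_mult abs_numeral)
      then show "\<bar>sin ?b - sin ?a\<bar> \<le> D" "\<bar>sin (2 * ?b) - sin (2 * ?a)\<bar> \<le> 2 * D"
        using sin_lipschitz[of ?b ?a] sin_lipschitz[of "2 * ?b" "2 * ?a"] by (simp_all add: D_def)
    qed
    define e1 e2 where "e1 = (?b - ?a) - (sin ?b - sin ?a)"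
      and "e2 = (sin ?b - sin ?a) - (?b - ?a) / 2 - (sin (2 * ?b) - sin (2 * ?a)) / 4"
    have e: "\<bar>e1\<bar> \<le> 2 * D" unfolding e1_def using s D_def by linarith
    have tri: "\<bar>x - y / 2 - z / 4\<bar> \<le> 2 * d" if "\<bar>x\<bar> \<le> d" "\<bar>y\<bar> \<le> d" "\<bar>z\<bar> \<le> 2 * d" for x y z d :: real
      using that unfolding abs_le_iff by linarith
    have e': "\<bar>e2\<bar> \<le> 2 * D" unfolding e2_def by (rule tri[OF s(1) _ s(2)]) (simp add: D_def)
    have "\<zeta> u' - \<zeta> u = \<epsilon> * (r * \<beta> * e1 + r\<^sup>2 * e2)"
      by (simp add: \<zeta>_def e1_def e2_def field_simps)
    then have "\<bar>\<zeta> u' - \<zeta> u\<bar> = \<bar>r * \<beta> * e1 + r\<^sup>2 * e2\<bar>" by (simp add: abs_mult \<epsilon>_sq)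
    also have "\<dots> \<le> \<bar>r * \<beta> * e1\<bar> + \<bar>r\<^sup>2 * e2\<bar>" by (rule abs_triangle_ineq)
    also have "\<dots> \<le> r * \<beta> * (2 * D) + r\<^sup>2 * (2 * D)"
      using e e' r_pos \<beta>_pos by (intro add_mono) (auto simp: abs_mult intro!: mult_left_mono)
    also have "\<dots> = (2 * r * \<beta> + 2 * r\<^sup>2) * D" by (simp add: algebra_simps)
    also have "\<dots> \<le> (2 * r * \<beta> + 2 * r\<^sup>2) * (\<bar>u' - u\<bar> / \<beta>)"
      using phase_lipschitz_abs[of u' u] r_pos \<beta>_pos by (intro mult_left_mono) (auto simp: D_def)
    finally show ?thesis by simp
  qed
  ultimately have z: "\<bar>(\<Psi> u' - \<Psi> u) $ 3\<bar> \<le> Y * ((1 + r / \<beta>) * \<bar>u' - u\<bar>) + (2 * r * \<beta> + 2 * r\<^sup>2) / \<beta> * \<bar>u' - u\<bar>"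
    by (simp add: \<Psi>_def)
  have "((2 + Y) * a + b + k) * t = a * t + (a * t + b * t) + (Y * (a * t) + k * t)" for a b k t
    by (simp add: algebra_simps)
  then show ?thesis using norm_le_sum_components3[of "\<Psi> u' - \<Psi> u"] x y z by simp
qed

text \<open>While \<open>cos (phase u) > 0\<close>, \<open>x\<close> increases, even across the
  kinks of \<open>phase\<close>, where the cosine is 1. All other points are interior to the looping
  part: where the cosine is -1, \<open>x\<close> runs backwards because \<open>\<beta> < r\<close>,
  and elsewhere \<open>V\<close> changes, which the functional \<open>y - m * x\<close>, up to sign,
  isolates.\<close>

lemma \<Psi>_locally_expanding:
  obtains \<nu> c \<rho> where "(\<nu> :: real^3) $ 3 = 0" "c > 0" "\<rho> > 0"
    "\<And>a b. \<bar>a - u\<bar> < \<rho> \<Longrightarrow> \<bar>b - u\<bar> < \<rho> \<Longrightarrow> a \<le> b \<Longrightarrow> c * (b - a) \<le> \<nu> \<bullet> (\<Psi> b - \<Psi> a)"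
proof -
  have near: "\<exists>\<rho>>0. \<forall>t. \<bar>t - u\<bar> < \<rho> \<longrightarrow> \<bar>phase t - phase u\<bar> < \<delta>" if "\<delta> > 0" for \<delta>
  proof (intro exI conjI allI impI)
    show "\<delta> * \<beta> > 0" using that \<beta>_pos by simp
    fix t assume "\<bar>t - u\<bar> < \<delta> * \<beta>"
    then have "\<bar>t - u\<bar> / \<beta> < \<delta>" using \<beta>_pos by (simp add: pos_divide_less_eq)
    then show "\<bar>phase t - phase u\<bar> < \<delta>" using phase_lipschitz_abs[of t u] by linarith
  qed
  show ?thesis
  proof (cases "cos (phase u) > 0")
    case True
    have "isCont cos (phase u)" by (rule isCont_cos)
    then have "\<forall>\<^sub>F t in nhds (phase u). cos t > 0"
      using True by (intro order_tendstoD) (auto simp: isCont_def tendsto_at_iff_tendsto_nhds)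
    then obtain \<delta> where \<delta>: "\<delta> > 0" "\<And>t. \<bar>t - phase u\<bar> < \<delta> \<Longrightarrow> cos t > 0"
      unfolding eventually_nhds_metric by (auto simp: dist_real_def)
    obtain \<rho> where \<rho>: "\<rho> > 0" "\<And>t. \<bar>t - u\<bar> < \<rho> \<Longrightarrow> \<bar>phase t - phase u\<bar> < \<delta>" using near[OF \<delta>(1)] by blast
    show ?thesis
    proof (rule that[of "vector [1, 0, 0]" 1 \<rho>])
      fix a b assume ab: "\<bar>a - u\<bar> < \<rho>" "\<bar>b - u\<bar> < \<rho>" "a \<le> b"
      have "sin (phase a) \<le> sin (phase b)"
      proof (rule DERIV_nonneg_imp_nondecreasing[OF phase_mono[OF ab(3)]])
        fix t assume "phase a \<le> t" "t \<le> phase b"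
        then have "\<bar>t - phase u\<bar> < \<delta>" using \<rho>(2)[OF ab(1)] \<rho>(2)[OF ab(2)] by linarith
        then show "\<exists>y. (sin has_real_derivative y) (at t) \<and> 0 \<le> y"
          using \<delta>(2)[of t] by (intro exI[of _ "cos t"]) (auto intro!: derivative_eq_intros)
      qed
      then have "r * sin (phase a) \<le> r * sin (phase b)" using r_pos by simp
      then show "1 * (b - a) \<le> vector [1, 0, 0] \<bullet> (\<Psi> b - \<Psi> a)"
        by (simp add: inner_vec3 \<Psi>_def X_def)
    qed (use \<rho> in auto)
  next
    case False
    then have u: "l < u" "u < L - l" using phase_end_cases(2)[of u] by force+
    define \<rho>0 where "\<rho>0 = min (u - l) (L - l - u)"
    have \<rho>0: "\<rho>0 > 0" "\<And>t. \<bar>t - u\<bar> < \<rho>0 \<Longrightarrow> phase t = (t - l) / \<beta>"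
      using u by (auto simp: \<rho>0_def intro!: phase_eq_mid)
    have phu: "phase u = (u - l) / \<beta>" using \<rho>0 by simp
    show ?thesis
    proof (cases "sin (phase u) = 0")
      case True
      then have c: "cos (phase u) = -1" using False sin_cos_squared_add[of "phase u"] by (auto simp: power2_eq_1_iff)
      let ?h = "\<lambda>t. - (t + r * sin ((t - l) / \<beta>))" and ?h' = "\<lambda>t. - (1 + r * (cos ((t - l) / \<beta>) / \<beta>))"
      have pos: "?h' u > 0" using c phu r \<beta>_pos by (simp add: field_simps)
      have cont: "isCont ?h' u" using \<beta>_pos by (intro continuous_intros) auto
      have der: "(?h has_real_derivative ?h' t) (at t)" for t
        using \<beta>_pos by (auto intro!: derivative_eq_intros simp: field_simps)
      obtain \<rho> where \<rho>: "\<rho> > 0" "\<And>a b. \<bar>a - u\<bar> < \<rho> \<Longrightarrow> \<bar>b - u\<bar> < \<rho> \<Longrightarrow> a \<le> b \<Longrightarrow> ?h' u / 2 * (b - a) \<le> ?h b - ?h a"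
        using positive_derivative_imp_expanding[of ?h ?h', OF der cont pos] by metis
      show ?thesis
      proof (rule that[of "vector [-1, 0, 0]" "?h' u / 2" "min \<rho> \<rho>0"])
        fix a b assume "\<bar>a - u\<bar> < min \<rho> \<rho>0" "\<bar>b - u\<bar> < min \<rho> \<rho>0" "a \<le> b"
        then show "?h' u / 2 * (b - a) \<le> vector [-1, 0, 0] \<bullet> (\<Psi> b - \<Psi> a)"
          using \<rho>(2)[of a b] \<rho>0(2)[of a] \<rho>0(2)[of b] by (simp add: inner_vec3 \<Psi>_def X_def)
      qed (use half_gt_zero[OF pos] \<rho> \<rho>0 in auto)
    next
      case False
      define k where "k = \<epsilon> * r * sgn (\<epsilon> * sin (phase u))"
      have kpos: "k * sin (phase u) > 0"
      proof -
        have "k * sin (phase u) = r * \<bar>\<epsilon> * sin (phase u)\<bar>" by (simp add: k_def sgn_if)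
        then show ?thesis using False r_pos by (simp add: abs_mult \<epsilon>_sq)
      qed
      let ?h = "\<lambda>t. k * (1 - cos ((t - l) / \<beta>))" and ?h' = "\<lambda>t. k * (sin ((t - l) / \<beta>) / \<beta>)"
      have pos: "?h' u > 0" using kpos phu \<beta>_pos by simp
      have cont: "isCont ?h' u" using \<beta>_pos by (intro continuous_intros) auto
      have der: "(?h has_real_derivative ?h' t) (at t)" for t
        using \<beta>_pos by (auto intro!: derivative_eq_intros simp: field_simps)
      obtain \<rho> where \<rho>: "\<rho> > 0" "\<And>a b. \<bar>a - u\<bar> < \<rho> \<Longrightarrow> \<bar>b - u\<bar> < \<rho> \<Longrightarrow> a \<le> b \<Longrightarrow> ?h' u / 2 * (b - a) \<le> ?h b - ?h a"
        using positive_derivative_imp_expanding[of ?h ?h', OF der cont pos] by metis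
      let ?s = "sgn (\<epsilon> * sin (phase u))"
      show ?thesis
      proof (rule that[of "vector [- m * ?s, ?s, 0]" "?h' u / 2" "min \<rho> \<rho>0"])
        fix a b assume ab: "\<bar>a - u\<bar> < min \<rho> \<rho>0" "\<bar>b - u\<bar> < min \<rho> \<rho>0" "a \<le> b"
        have "vector [- m * ?s, ?s, 0] \<bullet> (\<Psi> b - \<Psi> a) = ?s * (V b - V a)"
          by (simp add: inner_vec3 \<Psi>_def algebra_simps)
        also have "\<dots> = ?h b - ?h a"
          using ab \<rho>0(2)[of a] \<rho>0(2)[of b] by (simp add: V_def k_def algebra_simps)
        finally show "?h' u / 2 * (b - a) \<le> vector [- m * ?s, ?s, 0] \<bullet> (\<Psi> b - \<Psi> a)"
          using \<rho>(2)[of a b] ab by simp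
      qed (use half_gt_zero[OF pos] \<rho> \<rho>0 in auto)
    qed
  qed
qed

end

section \<open>Strands of prescribed accuracy\<close>

definition straight :: "real^3 \<Rightarrow> real \<Rightarrow> real \<Rightarrow> real \<Rightarrow> real^3" where
  "straight A m w u = vector [A$1 + u, A$2 + m * u, A$3 + w * u]"

text \<open>The contact condition \<open>dz = y dx\<close> as a quadratic bound on increments: in
  this form it makes sense for piecewise smooth curves and survives gluing at corners.\<close>

definition horizontal_on :: "real set \<Rightarrow> (real \<Rightarrow> real^3) \<Rightarrow> real \<Rightarrow> bool" where
  "horizontal_on T F C \<longleftrightarrow>
     (\<forall>u\<in>T. \<forall>u'\<in>T. \<bar>F u' $ 3 - F u $ 3 - F u $ 2 * (F u' $ 1 - F u $ 1)\<bar> \<le> C * (u' - u)\<^sup>2)"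

text \<open>A substitute for nonvanishing planar velocity that admits corners. Being a lower bound
  on increments, it passes to averages of difference quotients, hence to derivatives of Bernstein
  polynomials.\<close>

definition locally_expanding_on :: "real set \<Rightarrow> (real \<Rightarrow> real^3) \<Rightarrow> bool" where
  "locally_expanding_on T F \<longleftrightarrow>
     (\<forall>u\<in>T. \<exists>\<nu> c \<rho>. \<nu> $ 3 = 0 \<and> c > 0 \<and> \<rho> > 0 \<and>
        (\<forall>a\<in>T. \<forall>b\<in>T. \<bar>a - u\<bar> < \<rho> \<and> \<bar>b - u\<bar> < \<rho> \<and> a \<le> b \<longrightarrow> c * (b - a) \<le> \<nu> \<bullet> (F b - F a)))"

text \<open>At radius \<open>L' / (pi * n)\<close> the quadratic expression vanishes, and at a fixed
  small radius it exceeds \<open>H\<close> once \<open>n\<close> is large; the intermediate value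
  theorem gives a solution in between.\<close>

lemma small_trochoid_radius:
  fixes L' H \<eta> :: real
  assumes "L' > 0" "H > 0" "\<eta> > 0"
  obtains n :: nat and r where "n > 0" "r \<le> \<eta>" "8 * (L' / (2 * pi * n)) \<le> r" "pi * n * r\<^sup>2 - r * L' = H"
proof -
  \<comment> \<open>The cap \<open>H / (4 * L')\<close> forces \<open>4 * L' * r \<le> H\<close>,
    and the equation then gives \<open>4 * L' \<le> pi * n * r\<close>: the drift per radian is at
    most an eighth of the radius.\<close>
  define \<eta>' where "\<eta>' = min \<eta> (H / (4 * L'))"
  have \<eta>': "\<eta>' > 0" "\<eta>' \<le> \<eta>" "\<eta>' \<le> H / (4 * L')" using assms by (auto simp: \<eta>'_def)
  obtain n :: nat where n: "real n > (H + \<eta>' * L') / (pi * \<eta>'\<^sup>2) + L' / (pi * \<eta>')"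
    using reals_Archimedean2 by blast
  have t: "(H + \<eta>' * L') / (pi * \<eta>'\<^sup>2) > 0" "L' / (pi * \<eta>') > 0"
    using assms \<eta>'(1) by (auto intro!: divide_pos_pos add_pos_pos)
  then have "real n > 0" "real n > (H + \<eta>' * L') / (pi * \<eta>'\<^sup>2)" "real n > L' / (pi * \<eta>')" using n by linarith+
  then have n0: "n > 0" and n1: "pi * n * \<eta>'\<^sup>2 > H + \<eta>' * L'" and n2: "pi * n * \<eta>' > L'"
    using \<eta>'(1) by (auto simp: pos_divide_less_eq mult_ac)
  let ?h = "\<lambda>r. pi * n * r\<^sup>2 - r * L'"
  let ?a = "L' / (pi * n)"
  have a: "?a > 0" using n0 assms by simp
  have "\<exists>r\<ge>?a. r \<le> \<eta>' \<and> ?h r = H"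
  proof (rule IVT')
    have "?h ?a = 0" using n0 by (simp add: power2_eq_square field_simps)
    then show "?h ?a \<le> H" using assms by simp
    show "H \<le> ?h \<eta>'" using n1 by linarith
    show "?a \<le> \<eta>'" using n2 n0 by (simp add: pos_divide_le_eq mult_ac)
    show "continuous_on {?a..\<eta>'} ?h" by (intro continuous_intros)
  qed
  then obtain r where r: "?a \<le> r" "r \<le> \<eta>'" "?h r = H" by blast
  have r0: "r > 0" using a r by linarith
  have "8 * (L' / (2 * pi * n)) \<le> r"
  proof -
    have "4 * L' * r \<le> 4 * L' * (H / (4 * L'))" using r(2) \<eta>'(3) assms by (intro mult_left_mono) auto
    then have "4 * L' * r \<le> H" using assms by simp
    moreover have "0 \<le> r * L'" using r0 assms by simp
    ultimately have "4 * L' * r \<le> pi * n * r\<^sup>2" using r(3) by linarith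
    then have "(4 * L') * r \<le> (pi * n * r) * r" by (simp add: power2_eq_square mult_ac)
    then have "4 * L' \<le> pi * n * r" using r0 by simp
    then show ?thesis using n0 by (simp add: pos_divide_le_eq field_simps)
  qed
  then show ?thesis using that[of n r] n0 r \<eta>'(2) by auto
qed

lemma legendrian_strand:
  fixes A :: "real^3" and L m w Y \<alpha> \<eta> :: real
  assumes L: "0 < L" and m: "\<bar>m\<bar> \<le> 1/4" and w: "w \<noteq> 0" "4 * Y \<le> \<bar>w\<bar>"
    and Y: "\<And>u. 0 \<le> u \<Longrightarrow> u \<le> L \<Longrightarrow> \<bar>A$2 + m * u\<bar> \<le> Y" and small: "\<alpha> > 0" "\<eta> > 0"
  obtains \<Psi> C c l where "C > 0" "c > 0" "l > 0" "l \<le> L / 2"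
    "\<Psi> 0 = straight A m w 0" "\<Psi> L = straight A m w L"
    "\<And>u. u \<in> {0..L} \<Longrightarrow> u \<le> l \<or> L - l \<le> u \<Longrightarrow> \<Psi> u $ 1 = straight A m w u $ 1 \<and> \<Psi> u $ 2 = straight A m w u $ 2"
    "\<And>u. u \<in> {0..L} \<Longrightarrow> \<bar>\<Psi> u $ 1 - straight A m w u $ 1\<bar> \<le> \<alpha> * min u (L - u)"
    "\<And>u. u \<in> {0..L} \<Longrightarrow> \<bar>\<Psi> u $ 2 - straight A m w u $ 2\<bar> \<le> \<alpha> * min u (L - u)"
    "\<And>u. u \<in> {0..L} \<Longrightarrow> norm (\<Psi> u - straight A m w u) \<le> 2 * L * Y + \<eta>"
    "\<And>s u u'. u \<in> {0..L} \<Longrightarrow> u' \<in> {0..L} \<Longrightarrow> 0 \<le> s \<Longrightarrow> s \<le> 1 \<Longrightarrow> c * \<bar>u' - u\<bar> \<le>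
       norm ((straight A m w u' + s *\<^sub>R (\<Psi> u' - straight A m w u')) - (straight A m w u + s *\<^sub>R (\<Psi> u - straight A m w u)))"
    "\<And>u u'. u \<in> {0..L} \<Longrightarrow> u' \<in> {0..L} \<Longrightarrow> norm (\<Psi> u' - \<Psi> u) \<le> C * \<bar>u' - u\<bar>"
    "horizontal_on {0..L} \<Psi> C" "locally_expanding_on {0..L} \<Psi>"
proof -
  have Y0: "Y \<ge> 0" using Y[of 0] L by force
  define H where "H = w * L - (A$2 * L + m * L\<^sup>2 / 2)"
  define \<epsilon> where "\<epsilon> = - sgn w"
  define l where "l = min (L / 4) (\<eta> / (4 * (\<bar>w\<bar> + Y)))"
  have wY: "\<bar>w\<bar> + Y > 0" using w Y0 by linarith
  have l: "l > 0" "4 * l \<le> L" "2 * (\<bar>w\<bar> + Y) * l \<le> \<eta> / 2"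
  proof -
    show "l > 0" "4 * l \<le> L" using L small wY by (auto simp: l_def)
    have "2 * (\<bar>w\<bar> + Y) * l \<le> 2 * (\<bar>w\<bar> + Y) * (\<eta> / (4 * (\<bar>w\<bar> + Y)))"
      using wY by (intro mult_left_mono) (auto simp: l_def)
    also have "2 * q * (\<eta> / (4 * q)) = \<eta> / 2" if "q > 0" for q :: real using that by simp
    note this[OF wY]
    finally show "2 * (\<bar>w\<bar> + Y) * l \<le> \<eta> / 2" .
  qed
  \<comment> \<open>The rise \<open>w * L\<close> of the segment dominates the integral
    \<open>q\<close> of \<open>y dx\<close> along it, which is at most \<open>L * Y\<close> in
    absolute value; so \<open>H\<close> has the sign of \<open>w\<close>.\<close>
  have "- \<epsilon> * H > 0"
  proof -
    define q where "q = L * (A$2 + m * (L / 2))"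
    have q: "\<bar>q\<bar> \<le> L * Y"
      unfolding abs_mult q_def using Y[of "L/2"] L by (intro mult_mono) auto
    have "H = w * L - q" by (simp add: H_def q_def power2_eq_square algebra_simps)
    then have "- \<epsilon> * H = - \<epsilon> * (w * L - q)" by (rule arg_cong)
    also have "\<dots> = - \<epsilon> * (w * L) - (- \<epsilon> * q)" by (simp add: algebra_simps)
    finally have "- \<epsilon> * H = - \<epsilon> * (w * L) - (- \<epsilon> * q)" .
    moreover have "- \<epsilon> * (w * L) = L * \<bar>w\<bar>" by (simp add: \<epsilon>_def sgn_if)
    moreover have "\<bar>- \<epsilon> * q\<bar> = \<bar>q\<bar>" using w by (simp add: \<epsilon>_def abs_mult)
    moreover have "4 * (L * Y) \<le> L * \<bar>w\<bar>" using w L mult_left_mono[of "4 * Y" "\<bar>w\<bar>" L] by simp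
    moreover have "L * \<bar>w\<bar> > 0" using L w by simp
    ultimately show ?thesis using q by linarith
  qed
  moreover define \<eta>' where "\<eta>' = min (min l 1) (min (\<eta> / 20) (\<alpha> * l / 3))"
  moreover have "\<eta>' > 0" using l small by (simp add: \<eta>'_def)
  moreover have "L - 2 * l > 0" using l L by simp
  ultimately obtain n :: nat and r where nr: "n > 0" "r \<le> \<eta>'" "8 * ((L - 2 * l) / (2 * pi * n)) \<le> r"
    "pi * n * r\<^sup>2 - r * (L - 2 * l) = - \<epsilon> * H"
    using small_trochoid_radius by metis
  define \<beta> where "\<beta> = (L - 2 * l) / (2 * pi * n)"
  note l_small = l(3)
  interpret trochoid "A$1" "A$2" "A$3" L m w Y l r \<beta> H \<epsilon> n
    by unfold_locales (use l m w Y nr in \<open>auto simp: \<beta>_def H_def \<epsilon>_def \<eta>'_def\<close>)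
  have base: "straight A m w = base" by (auto simp: straight_def base_def fun_eq_iff)
  define C1 C2 where "C1 = (2 + Y) * (1 + r / \<beta>) + r / \<beta> + (2 * r * \<beta> + 2 * r\<^sup>2) / \<beta>"
    and "C2 = (1 + r / \<beta>)\<^sup>2 + r * (\<beta> + r) / \<beta>\<^sup>2 + r / \<beta>"
  have C12: "C1 > 0" "C2 > 0"
  proof -
    have rb: "r / \<beta> > 0" using r_pos \<beta>_pos by simp
    have "(2 + Y) * (1 + r / \<beta>) > 0" using rb Y_nonneg by (intro mult_pos_pos) auto
    moreover have "(2 * r * \<beta> + 2 * r\<^sup>2) / \<beta> > 0" using r_pos \<beta>_pos by (intro divide_pos_pos add_pos_pos) auto
    ultimately show "C1 > 0" unfolding C1_def using rb by linarith
    have "r * (\<beta> + r) / \<beta>\<^sup>2 > 0" using r_pos \<beta>_pos by (intro divide_pos_pos mult_pos_pos add_pos_pos) auto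
    moreover have "(1 + r / \<beta>)\<^sup>2 \<ge> 0" by simp
    ultimately show "C2 > 0" unfolding C2_def using rb by linarith
  qed
  have r3: "3 * r \<le> \<alpha> * l" "10 * r \<le> \<eta> / 2" using nr(2) by (auto simp: \<eta>'_def)
  have near: "\<bar>\<Psi> u $ i - base u $ i\<bar> \<le> \<alpha> * min u (L - u)" if u: "u \<in> {0..L}" and i: "i = 1 \<or> i = 2" for u i
  proof (cases "u \<le> l \<or> L - l \<le> u")
    case True
    then show ?thesis using \<Psi>_ends[OF True] i u small by auto
  next
    case False
    have "\<alpha> * l \<le> \<alpha> * min u (L - u)" using False small by (intro mult_left_mono) auto
    then show ?thesis using \<Psi>_near_xy[OF u] i r3 by fastforce
  qed
  show ?thesis
  proof (rule that[of "C1 + C2" "min \<beta> (min r 2) / (r + \<beta> + Y + 4)" l \<Psi>], unfold base)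
    show "0 < min \<beta> (min r 2) / (r + \<beta> + Y + 4)" using r_pos \<beta>_pos Y_nonneg by simp
    show "norm (\<Psi> u - base u) \<le> 2 * L * Y + \<eta>" if "u \<in> {0..L}" for u
      using \<Psi>_near[OF that] r3 l_small by linarith
    show "min \<beta> (min r 2) / (r + \<beta> + Y + 4) * \<bar>u' - u\<bar> \<le>
       norm ((base u' + s *\<^sub>R (\<Psi> u' - base u')) - (base u + s *\<^sub>R (\<Psi> u - base u)))"
      if "u \<in> {0..L}" "u' \<in> {0..L}" "0 \<le> s" "s \<le> 1" for s u u'
    proof -
      have "r + \<beta> + Y + 4 > 0" using r_pos \<beta>_pos Y_nonneg by simp
      then show ?thesis using interpolation_expanding[OF that] by (simp add: pos_divide_le_eq mult.commute)
    qed
    show "norm (\<Psi> u' - \<Psi> u) \<le> (C1 + C2) * \<bar>u' - u\<bar>" if "u \<in> {0..L}" "u' \<in> {0..L}" for u u'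
    proof -
      have "0 \<le> C2 * \<bar>u' - u\<bar>" using C12 by simp
      then show ?thesis using \<Psi>_lipschitz[OF that] unfolding C1_def by (simp only: distrib_right, (linarith)?)
    qed
    show "horizontal_on {0..L} \<Psi> (C1 + C2)"
      unfolding horizontal_on_def
    proof (intro ballI)
      fix u u'
      have "0 \<le> C1 * (u' - u)\<^sup>2" using C12 by simp
      then show "\<bar>\<Psi> u' $ 3 - \<Psi> u $ 3 - \<Psi> u $ 2 * (\<Psi> u' $ 1 - \<Psi> u $ 1)\<bar> \<le> (C1 + C2) * (u' - u)\<^sup>2"
        using \<Psi>_horizontal[of u' u] unfolding C2_def by (simp only: distrib_right, (linarith)?)
    qed
    show "locally_expanding_on {0..L} \<Psi>"
      unfolding locally_expanding_on_def using \<Psi>_locally_expanding by (metis (no_types))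
  qed (use l C12 \<Psi>_0 \<Psi>_L \<Psi>_ends near in auto)
qed

section \<open>Smoothing horizontal curves by Bernstein polynomials\<close>

lemma antiderivative_poly:
  fixes p :: "real poly"
  obtains q where "pderiv q = p" "poly q 0 = c"
proof -
  define q where "q = (\<Sum>i\<le>degree p. monom (coeff p i / real (Suc i)) (Suc i)) + [:c:]"
  have "pderiv q = (\<Sum>i\<le>degree p. monom (coeff p i) i)"
    unfolding q_def by (simp add: pderiv_add higher_pderiv_sum[of 1, simplified] pderiv_monom pderiv_pCons)
  also have "\<dots> = p" by (rule poly_as_sum_of_monoms)
  finally have "pderiv q = p" .
  moreover have "poly q 0 = c" by (simp add: q_def poly_sum poly_monom)
  ultimately show ?thesis using that by blast
qed

lemma poly_increment_bounds:
  fixes p :: "real poly"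
  assumes "a \<le> b" "\<And>x. a \<le> x \<Longrightarrow> x \<le> b \<Longrightarrow> poly (pderiv p) x \<le> poly (pderiv q) x"
  shows "poly p b - poly p a \<le> poly q b - poly q a"
proof -
  have "poly (q - p) a \<le> poly (q - p) b"
  proof (rule DERIV_nonneg_imp_nondecreasing[OF assms(1)])
    fix x assume "a \<le> x" "x \<le> b"
    then show "\<exists>y. (poly (q - p) has_real_derivative y) (at x) \<and> 0 \<le> y"
      using assms(2)[of x] by (intro exI[of _ "poly (pderiv (q - p)) x"] conjI poly_DERIV) (simp add: pderiv_diff)
  qed
  then show ?thesis by simp
qed

lemma poly_lipschitz:
  fixes p :: "real poly"
  assumes "\<And>x. x \<in> {0..1} \<Longrightarrow> \<bar>poly (pderiv p) x\<bar> \<le> K" "a \<in> {0..1}" "b \<in> {0..1}"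
  shows "\<bar>poly p b - poly p a\<bar> \<le> K * \<bar>b - a\<bar>"
  using field_differentiable_bound[of "{0..1}" "poly p" "poly (pderiv p)" K b a] assms
    poly_DERIV[of p, THEN has_field_derivative_at_within]
  by auto

section \<open>Bernstein averages\<close>

definition bern_poly :: "nat \<Rightarrow> (real \<Rightarrow> real) \<Rightarrow> real poly" where
  "bern_poly n f = (\<Sum>k\<le>n. smult (f (k / n) * real (n choose k)) ([:0, 1:] ^ k * [:1, -1:] ^ (n - k)))"

lemma poly_bern_poly: "poly (bern_poly n f) x = (\<Sum>k\<le>n. f (k / n) * Bernstein n k x)"
  by (simp add: bern_poly_def poly_sum Bernstein_def mult.assoc)

lemma DERIV_Bernstein:
  "(Bernstein (Suc m) k has_real_derivative
     real (Suc m) * ((if k = 0 then 0 else Bernstein m (k - 1) x) - Bernstein m k x)) (at x)"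
proof -
  have comp: "real (Suc m choose k) * real (Suc m - k) = real (Suc m) * real (m choose k)"
    using binomial_absorb_comp[of "Suc m" k] by (metis diff_Suc_1 mult.commute of_nat_mult)
  have D: "(Bernstein (Suc m) k has_real_derivative
     real (Suc m choose k) * (real k * x ^ (k - 1) * (1 - x) ^ (Suc m - k) -
        x ^ k * (real (Suc m - k) * (1 - x) ^ (Suc m - k - 1)))) (at x)"
    unfolding Bernstein_def[abs_def] by (auto intro!: derivative_eq_intros simp: algebra_simps)
  have e: "Suc m - k - 1 = m - k" by simp
  have "real (Suc m choose k) * (real k * x ^ (k - 1) * (1 - x) ^ (Suc m - k)) =
      real (Suc m) * (if k = 0 then 0 else Bernstein m (k - 1) x)"
  proof (cases k)
    case (Suc j)
    have "real (Suc m choose Suc j) * real (Suc j) = real (Suc m) * real (m choose j)"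
      using Suc_times_binomial[of j m] by (metis mult.commute of_nat_mult)
    then show ?thesis using Suc by (simp add: Bernstein_def mult.assoc[symmetric])
  qed simp
  moreover have "real (Suc m choose k) * (x ^ k * (real (Suc m - k) * (1 - x) ^ (m - k))) = real (Suc m) * Bernstein m k x"
  proof -
    have "real (Suc m choose k) * (x ^ k * (real (Suc m - k) * (1 - x) ^ (m - k))) =
       (real (Suc m choose k) * real (Suc m - k)) * (x ^ k * (1 - x) ^ (m - k))" by (simp only: mult_ac)
    then show ?thesis unfolding comp by (simp add: Bernstein_def mult_ac)
  qed
  ultimately show ?thesis using D unfolding e right_diff_distrib by simp
qed

text \<open>The derivative is again a Bernstein average, of one degree less, of the difference
  quotients of \<open>f\<close> on the grid of width \<open>1 / Suc m\<close>. Bounds on difference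
  quotients thereby become bounds on derivatives.\<close>

lemma poly_pderiv_bern_poly:
  "poly (pderiv (bern_poly (Suc m) f)) x =
     (\<Sum>k\<le>m. real (Suc m) * (f (real (Suc k) / real (Suc m)) - f (real k / real (Suc m))) * Bernstein m k x)"
proof -
  let ?c = "\<lambda>k. f (real k / real (Suc m))"
  have "((\<lambda>x. \<Sum>k\<le>Suc m. ?c k * Bernstein (Suc m) k x) has_real_derivative
      (\<Sum>k\<le>Suc m. ?c k * (real (Suc m) * ((if k = 0 then 0 else Bernstein m (k - 1) x) - Bernstein m k x)))) (at x)"
    by (intro DERIV_sum DERIV_cmult DERIV_Bernstein)
  moreover have "(poly (bern_poly (Suc m) f) has_real_derivative poly (pderiv (bern_poly (Suc m) f)) x) (at x)"
    by (rule poly_DERIV)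
  then have "((\<lambda>x. \<Sum>k\<le>Suc m. ?c k * Bernstein (Suc m) k x) has_real_derivative poly (pderiv (bern_poly (Suc m) f)) x) (at x)"
    by (subst (asm) poly_bern_poly[abs_def])
  ultimately have "poly (pderiv (bern_poly (Suc m) f)) x =
      (\<Sum>k\<le>Suc m. ?c k * (real (Suc m) * ((if k = 0 then 0 else Bernstein m (k - 1) x) - Bernstein m k x)))"
    using DERIV_unique by blast
  also have "\<dots> = real (Suc m) * ((\<Sum>k\<le>Suc m. ?c k * (if k = 0 then 0 else Bernstein m (k - 1) x))
      - (\<Sum>k\<le>Suc m. ?c k * Bernstein m k x))"
    by (simp only: sum_distrib_left sum_subtractf[symmetric] right_diff_distrib mult_ac)
  also have "(\<Sum>k\<le>Suc m. ?c k * (if k = 0 then 0 else Bernstein m (k - 1) x)) = (\<Sum>k\<le>m. ?c (Suc k) * Bernstein m k x)"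
    by (subst sum.atMost_Suc_shift) simp
  also have "(\<Sum>k\<le>Suc m. ?c k * Bernstein m k x) = (\<Sum>k\<le>m. ?c k * Bernstein m k x)"
    by (simp add: Bernstein_def)
  finally show ?thesis
    by (simp only: sum_distrib_left sum_subtractf[symmetric] right_diff_distrib left_diff_distrib mult.assoc)
qed

text \<open>The weights are binomial; this is the variance of the relative frequency, computed from
  the first two factorial moments.\<close>

lemma Bernstein_variance:
  assumes "m > 0"
  shows "(\<Sum>k\<le>m. (real k / m - t)\<^sup>2 * Bernstein m k t) = t * (1 - t) / m"
proof -
  have "(real k / m - t)\<^sup>2 * Bernstein m k t =
     (real k * (real k - 1) * Bernstein m k t) / m\<^sup>2 + (1 / m\<^sup>2 - 2 * t / m) * (real k * Bernstein m k t) + t\<^sup>2 * Bernstein m k t" for k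
    using assms by (simp add: power2_eq_square field_simps)
  then have "(\<Sum>k\<le>m. (real k / m - t)\<^sup>2 * Bernstein m k t) =
     real m * (real m - 1) * t\<^sup>2 / m\<^sup>2 + (1 / m\<^sup>2 - 2 * t / m) * (real m * t) + t\<^sup>2"
    by (simp add: sum.distrib flip: sum_divide_distrib sum_distrib_left)
  also have "\<dots> = t * (1 - t) / m" using assms by (simp add: power2_eq_square field_simps)
  finally show ?thesis .
qed

lemma Bernstein_variance_le:
  assumes "m > 0" "t \<in> {0..1}"
  shows "(\<Sum>k\<le>m. (real k / m - t)\<^sup>2 * Bernstein m k t) \<le> 1 / m"
proof -
  have "t * (1 - t) \<le> 1 * 1" using assms by (intro mult_mono) auto
  then show ?thesis unfolding Bernstein_variance[OF assms(1)] by (intro divide_right_mono) auto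
qed

text \<open>Chebyshev's argument: a parabola with peak \<open>c\<close> at \<open>t\<close> lies
  below all \<open>a k\<close>, since outside the window it has dropped to \<open>- K\<close> or
  further, and its average is known from the variance.\<close>

lemma Bernstein_average_ge:
  fixes a :: "nat \<Rightarrow> real"
  assumes m: "m > 0" and t: "t \<in> {0..1}" and \<delta>: "\<delta> > 0" and cK: "c + K \<ge> 0"
    and near: "\<And>k. k \<le> m \<Longrightarrow> \<bar>real k / m - t\<bar> < \<delta> \<Longrightarrow> c \<le> a k"
    and all: "\<And>k. k \<le> m \<Longrightarrow> - K \<le> a k"
  shows "c - (c + K) / (\<delta>\<^sup>2 * m) \<le> (\<Sum>k\<le>m. a k * Bernstein m k t)"
proof -
  have a: "c - (c + K) / \<delta>\<^sup>2 * (real k / m - t)\<^sup>2 \<le> a k" if "k \<le> m" for k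
  proof (cases "\<bar>real k / m - t\<bar> < \<delta>")
    case True
    have "0 \<le> (c + K) / \<delta>\<^sup>2 * (real k / m - t)\<^sup>2" using cK by simp
    then show ?thesis using near[OF that True] by linarith
  next
    case False
    then have "\<delta>\<^sup>2 \<le> (real k / m - t)\<^sup>2" using \<delta> by (simp add: abs_le_square_iff[symmetric])
    then have "(c + K) / \<delta>\<^sup>2 * \<delta>\<^sup>2 \<le> (c + K) / \<delta>\<^sup>2 * (real k / m - t)\<^sup>2"
      using cK by (intro mult_left_mono) auto
    then show ?thesis using all[OF that] \<delta> by simp
  qed
  have "c - (c + K) / (\<delta>\<^sup>2 * m) = c - (c + K) / \<delta>\<^sup>2 * (1 / m)" by simp
  also have "\<dots> \<le> c - (c + K) / \<delta>\<^sup>2 * (\<Sum>k\<le>m. (real k / m - t)\<^sup>2 * Bernstein m k t)"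
    using Bernstein_variance_le[OF m t] cK by (intro diff_left_mono mult_left_mono) auto
  also have "\<dots> = (\<Sum>k\<le>m. (c - (c + K) / \<delta>\<^sup>2 * (real k / m - t)\<^sup>2) * Bernstein m k t)"
    by (simp add: left_diff_distrib sum_subtractf sum_distrib_left mult.assoc flip: sum_distrib_left[of c])
  also have "\<dots> \<le> (\<Sum>k\<le>m. a k * Bernstein m k t)"
    using a t by (intro sum_mono mult_right_mono Bernstein_nonneg) auto
  finally show ?thesis .
qed

text \<open>Meant for the affine ends of a curve, where difference quotients near \<open>t\<close>
  are constant. The lower bound is used for \<open>a\<close> and for \<open>- a\<close>.\<close>

lemma Bernstein_average_near:
  fixes a :: "nat \<Rightarrow> real"
  assumes m: "m > 0" and t: "t \<in> {0..1}" and \<delta>: "\<delta> > 0"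
    and near: "\<And>k. k \<le> m \<Longrightarrow> \<bar>real k / m - t\<bar> < \<delta> \<Longrightarrow> a k = d"
    and all: "\<And>k. k \<le> m \<Longrightarrow> \<bar>a k\<bar> \<le> K" and d: "\<bar>d\<bar> \<le> K"
  shows "\<bar>(\<Sum>k\<le>m. a k * Bernstein m k t) - d\<bar> \<le> 2 * K / (\<delta>\<^sup>2 * m)"
proof -
  have K: "K \<ge> 0" using d by linarith
  have "d - (d + K) / (\<delta>\<^sup>2 * m) \<le> (\<Sum>k\<le>m. a k * Bernstein m k t)"
    by (rule Bernstein_average_ge[OF m t \<delta>]) (use near all d in \<open>auto simp: abs_le_iff minus_le_iff\<close>)
  moreover have "(d + K) / (\<delta>\<^sup>2 * m) \<le> 2 * K / (\<delta>\<^sup>2 * m)" using d by (intro divide_right_mono) auto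
  moreover have "- d - (- d + K) / (\<delta>\<^sup>2 * m) \<le> (\<Sum>k\<le>m. - a k * Bernstein m k t)"
    by (rule Bernstein_average_ge[OF m t \<delta>]) (use near all d in \<open>auto simp: abs_le_iff minus_le_iff\<close>)
  then have "(\<Sum>k\<le>m. a k * Bernstein m k t) \<le> d + (- d + K) / (\<delta>\<^sup>2 * m)"
    by (simp add: sum_negf)
  moreover have "(- d + K) / (\<delta>\<^sup>2 * m) \<le> 2 * K / (\<delta>\<^sup>2 * m)" using d by (intro divide_right_mono) auto
  ultimately show ?thesis by linarith
qed

lemma Bernstein_average_abs_le:
  fixes a :: "nat \<Rightarrow> real"
  assumes "t \<in> {0..1}" "\<And>k. k \<le> m \<Longrightarrow> \<bar>a k\<bar> \<le> K"
  shows "\<bar>\<Sum>k\<le>m. a k * Bernstein m k t\<bar> \<le> K"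
proof -
  have "\<bar>\<Sum>k\<le>m. a k * Bernstein m k t\<bar> \<le> (\<Sum>k\<le>m. K * Bernstein m k t)"
    using assms by (intro order_trans[OF sum_abs] sum_mono) (auto simp: abs_mult Bernstein_nonneg intro!: mult_right_mono)
  also have "\<dots> = K" by (simp flip: sum_distrib_left)
  finally show ?thesis .
qed

text \<open>Over \<open>Suc N\<close> equal steps the quadratic errors add up to at most
  \<open>B / Suc N\<close>, which disappears in the limit, while the linear ones add up to
  \<open>A * t\<close>.\<close>

lemma increment_le_of_quadratic_remainder:
  fixes E :: "real \<Rightarrow> real"
  assumes E: "\<And>a b. 0 \<le> a \<Longrightarrow> a \<le> b \<Longrightarrow> b \<le> 1 \<Longrightarrow> \<bar>E b - E a\<bar> \<le> A * (b - a) + B * (b - a)\<^sup>2"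
    and t: "t \<in> {0..1}" and B: "B \<ge> 0"
  shows "\<bar>E t - E 0\<bar> \<le> A * t"
proof -
  have step: "\<bar>E t - E 0\<bar> \<le> A * t + B / real (Suc N)" for N
  proof -
    define h where "h = t / real (Suc N)"
    have h: "h \<ge> 0" "real (Suc N) * h = t" using t by (auto simp: h_def)
    have "\<bar>E (real k * h) - E 0\<bar> \<le> real k * (A * h + B * h\<^sup>2)" if "k \<le> Suc N" for k
      using that
    proof (induction k)
      case (Suc k)
      have "real (Suc k) * h \<le> real (Suc N) * h" using Suc.prems h(1) by (intro mult_right_mono) auto
      then have "real (Suc k) * h \<le> 1" using t h(2) unfolding atLeastAtMost_iff by linarith
      moreover have "real (Suc k) * h - real k * h = h" "0 \<le> real k * h" using h by (simp_all add: algebra_simps)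
      ultimately have "\<bar>E (real (Suc k) * h) - E (real k * h)\<bar> \<le> A * h + B * h\<^sup>2"
        using E[of "real k * h" "real (Suc k) * h"] h(1) by simp
      moreover have "real (Suc k) * (A * h + B * h\<^sup>2) = real k * (A * h + B * h\<^sup>2) + (A * h + B * h\<^sup>2)"
        by (simp add: algebra_simps)
      ultimately show ?case using Suc by simp
    qed simp
    from this[of "Suc N"] have "\<bar>E t - E 0\<bar> \<le> real (Suc N) * (A * h + B * h\<^sup>2)" unfolding h(2) by simp
    also have "\<dots> = A * (real (Suc N) * h) + B * ((real (Suc N) * h) * h)" by (simp add: algebra_simps power2_eq_square)
    also have "\<dots> = A * t + B * t\<^sup>2 / real (Suc N)" unfolding h(2) by (simp add: h_def power2_eq_square)
    also have "\<dots> \<le> A * t + B * 1 / real (Suc N)"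
      using t B by (intro add_left_mono divide_right_mono mult_left_mono) (auto simp: power_le_one)
    finally show ?thesis by simp
  qed
  have "(\<lambda>N. A * t + B / real (Suc N)) \<longlonglongrightarrow> A * t + 0"
    by (intro tendsto_intros LIMSEQ_Suc[OF lim_const_over_n])
  then show ?thesis using LIMSEQ_le_const[of _ "A * t + 0" "\<bar>E t - E 0\<bar>"] step by auto
qed

text \<open>The height of a horizontal curve is continuous in its planar projection: the error
  \<open>Z - z - y (X - x)\<close> telescopes up to second-order terms.\<close>

lemma horizontal_height_close:
  fixes x y z X Y Z :: "real \<Rightarrow> real"
  assumes hz: "\<And>a b. a \<in> {0..1} \<Longrightarrow> b \<in> {0..1} \<Longrightarrow> \<bar>z b - z a - y a * (x b - x a)\<bar> \<le> B * (b - a)\<^sup>2"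
    and hZ: "\<And>a b. a \<in> {0..1} \<Longrightarrow> b \<in> {0..1} \<Longrightarrow> \<bar>Z b - Z a - Y a * (X b - X a)\<bar> \<le> B * (b - a)\<^sup>2"
    and lX: "\<And>a b. a \<in> {0..1} \<Longrightarrow> b \<in> {0..1} \<Longrightarrow> \<bar>X b - X a\<bar> \<le> K * \<bar>b - a\<bar>"
    and ly: "\<And>a b. a \<in> {0..1} \<Longrightarrow> b \<in> {0..1} \<Longrightarrow> \<bar>y b - y a\<bar> \<le> K * \<bar>b - a\<bar>"
    and cx: "\<And>t. t \<in> {0..1} \<Longrightarrow> \<bar>X t - x t\<bar> \<le> \<delta>" and cy: "\<And>t. t \<in> {0..1} \<Longrightarrow> \<bar>Y t - y t\<bar> \<le> \<delta>"
    and yb: "\<And>t. t \<in> {0..1} \<Longrightarrow> \<bar>y t\<bar> \<le> M"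
    and s: "X 0 = x 0" "Z 0 = z 0" and t: "t \<in> {0..1}" and B: "B \<ge> 0" and K: "K \<ge> 0"
  shows "\<bar>Z t - z t\<bar> \<le> (2 * K + M) * \<delta>"
proof -
  have \<delta>: "\<delta> \<ge> 0" using cx[of 0] by simp
  \<comment> \<open>With the correction \<open>y * (X - x)\<close> the first-order increment of the
    error is \<open>(Y - y) dX - (X - x) dy\<close>, and both terms are small with
    \<open>\<delta>\<close>. Otherwise the increments of \<open>X - x\<close> would enter, whereas
    only its size is known to be small.\<close>
  define E where "E t = Z t - z t - y t * (X t - x t)" for t
  have "\<bar>E b - E a\<bar> \<le> (2 * K * \<delta>) * (b - a) + (2 * B) * (b - a)\<^sup>2" if ab: "0 \<le> a" "a \<le> b" "b \<le> 1" for a b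
  proof -
    have m: "a \<in> {0..1}" "b \<in> {0..1}" using ab by auto
    have "E b - E a = (Z b - Z a - Y a * (X b - X a)) - (z b - z a - y a * (x b - x a))
       + (Y a - y a) * (X b - X a) - (y b - y a) * (X b - x b)"
      by (simp add: E_def algebra_simps)
    moreover have "\<bar>(Y a - y a) * (X b - X a)\<bar> \<le> \<delta> * (K * \<bar>b - a\<bar>)"
      unfolding abs_mult using cy[OF m(1)] lX[OF m] \<delta> by (intro mult_mono) auto
    moreover have "\<bar>(y b - y a) * (X b - x b)\<bar> \<le> (K * \<bar>b - a\<bar>) * \<delta>"
      unfolding abs_mult using cx[OF m(2)] ly[OF m] K by (intro mult_mono) auto
    ultimately have "\<bar>E b - E a\<bar> \<le> 2 * B * (b - a)\<^sup>2 + \<delta> * (K * \<bar>b - a\<bar>) + (K * \<bar>b - a\<bar>) * \<delta>"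
      using hz[OF m] hZ[OF m] by linarith
    then show ?thesis using ab by (simp add: algebra_simps)
  qed
  from increment_le_of_quadratic_remainder[OF this t] have "\<bar>E t - E 0\<bar> \<le> 2 * K * \<delta> * t" using B by simp
  also have "\<dots> \<le> 2 * K * \<delta> * 1" using t K \<delta> by (intro mult_left_mono) auto
  finally have "\<bar>E t\<bar> \<le> 2 * K * \<delta>" using s by (simp add: E_def)
  moreover have "\<bar>y t * (X t - x t)\<bar> \<le> M * \<delta>"
    unfolding abs_mult using yb[OF t] cx[OF t] by (intro mult_mono) auto
  ultimately show ?thesis unfolding E_def by (simp add: distrib_right)
qed

text \<open>Freezing \<open>Y\<close> at \<open>a\<close> leaves the derivative
  \<open>(Y - Y a) * pderiv X\<close>, at most \<open>K\<^sup>2 * \<bar>b - a\<bar>\<close> between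
  \<open>a\<close> and \<open>b\<close>.\<close>

lemma horizontal_poly:
  fixes X Y Z :: "real poly"
  assumes Z: "pderiv Z = Y * pderiv X"
    and KX: "\<And>t. t \<in> {0..1} \<Longrightarrow> \<bar>poly (pderiv X) t\<bar> \<le> K"
    and KY: "\<And>t. t \<in> {0..1} \<Longrightarrow> \<bar>poly (pderiv Y) t\<bar> \<le> K"
    and ab: "a \<in> {0..1}" "b \<in> {0..1}"
  shows "\<bar>poly Z b - poly Z a - poly Y a * (poly X b - poly X a)\<bar> \<le> K\<^sup>2 * (b - a)\<^sup>2"
proof -
  let ?h = "Z - smult (poly Y a) X"
  have K: "K \<ge> 0" using KX[OF ab(1)] by linarith
  have sub: "closed_segment a b \<subseteq> {0..1}" using ab by (auto simp: closed_segment_eq_real_ivl)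
  have "norm (poly ?h b - poly ?h a) \<le> (K * \<bar>b - a\<bar> * K) * norm (b - a)"
  proof (rule field_differentiable_bound[of "closed_segment a b"])
    fix t assume t: "t \<in> closed_segment a b"
    show "(poly ?h has_field_derivative poly (pderiv ?h) t) (at t within closed_segment a b)"
      by (rule has_field_derivative_at_within[OF poly_DERIV])
    have t01: "t \<in> {0..1}" using t sub by auto
    have "\<bar>poly Y t - poly Y a\<bar> \<le> K * \<bar>t - a\<bar>" by (rule poly_lipschitz[OF KY ab(1) t01])
    also have "\<dots> \<le> K * \<bar>b - a\<bar>" using t K
      by (intro mult_left_mono) (auto simp: closed_segment_eq_real_ivl split: if_splits)
    finally have "\<bar>(poly Y t - poly Y a) * poly (pderiv X) t\<bar> \<le> (K * \<bar>b - a\<bar>) * K"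
      unfolding abs_mult using KX[OF t01] K by (intro mult_mono) auto
    then show "norm (poly (pderiv ?h) t) \<le> K * \<bar>b - a\<bar> * K"
      by (simp add: pderiv_diff pderiv_smult Z left_diff_distrib)
  qed auto
  then show ?thesis by (simp add: power2_eq_square algebra_simps abs_mult_self_eq)
qed

text \<open>The polynomial \<open>t * (1 - t) ^ M\<close> vanishes at both ends and concentrates
  near 0, where \<open>X\<close> moves at speed at least \<open>a\<close>. For large
  \<open>M\<close> its weight beyond \<open>\<tau>\<close> is negligible against its total weight,
  so the integral against the derivative of \<open>X\<close> is bounded below by a
  \<open>\<kappa>\<close> that depends only on \<open>\<tau>\<close>, \<open>a\<close> and
  \<open>C\<close>, not on \<open>X\<close>.\<close>

lemma bump_poly_weight:
  fixes \<tau> a C :: real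
  assumes \<tau>: "0 < \<tau>" "\<tau> < 1" and a: "0 < a" and C: "0 \<le> C"
  obtains q :: "real poly" and \<kappa> where "\<kappa> > 0" "poly q 0 = 0" "poly q 1 = 0"
    "\<And>X A. pderiv A = q * pderiv X \<Longrightarrow> (\<And>t. t \<in> {0..\<tau>} \<Longrightarrow> a \<le> poly (pderiv X) t) \<Longrightarrow>
       (\<And>t. t \<in> {0..1} \<Longrightarrow> \<bar>poly (pderiv X) t\<bar> \<le> C) \<Longrightarrow> \<kappa> \<le> poly A 1 - poly A 0"
proof -
  define x where "x = 1 - \<tau>"
  have x: "0 < x" "x < 1" using \<tau> by (auto simp: x_def)
  \<comment> \<open>The total weight is the beta integral \<open>1 / ((M + 1) * (M + 2))\<close>,
    and the weight beyond \<open>\<tau>\<close> is at most \<open>x ^ M\<close>; the threshold lets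
    the tail consume at most half of the main term.\<close>
  have "(\<lambda>M. (real M + 1) * (real M + 2) * x ^ M) \<longlonglongrightarrow> 0" using x by real_asymp
  moreover have "a / (2 * (a + C)) > 0" using a C by simp
  ultimately have "\<forall>\<^sub>F M in sequentially. (real M + 1) * (real M + 2) * x ^ M < a / (2 * (a + C))"
    by (rule order_tendstoD)
  then obtain M where M: "(real M + 1) * (real M + 2) * x ^ M < a / (2 * (a + C))"
    by (auto simp: eventually_sequentially)
  define q where "q = [:0, 1:] * [:1, -1::real:] ^ M"
  \<comment> \<open>A primitive of \<open>q\<close>, found by writing the factor \<open>t\<close> as
    \<open>1 - (1 - t)\<close>.\<close>
  define Q where "Q = smult (1 / real (M + 2)) ([:1, -1::real:] ^ Suc (Suc M)) - smult (1 / real (M + 1)) ([:1, -1:] ^ Suc M)"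
  have q: "poly q t = t * (1 - t) ^ M" for t by (simp add: q_def)
  have Q: "poly (pderiv Q) t = poly q t" for t
  proof -
    have "poly (pderiv Q) t = (1 / real (M + 2)) * (real (M + 2) * ((1 - t) ^ Suc M * - 1)) -
        (1 / real (M + 1)) * (real (M + 1) * ((1 - t) ^ M * - 1))"
      by (simp add: Q_def pderiv_diff pderiv_smult pderiv_power_Suc pderiv_pCons del: power_Suc of_nat_add of_nat_Suc)
    also have "\<dots> = (1 - t) ^ Suc M * - 1 - (1 - t) ^ M * - 1"
      by (simp only: mult.assoc[symmetric] divide_self_if times_divide_eq_left mult_1_left) simp
    also have "\<dots> = poly q t" by (simp add: q algebra_simps)
    finally show ?thesis .
  qed
  have q0: "0 \<le> poly q t" if "t \<in> {0..1}" for t using that by (simp add: q)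
  define \<kappa> where "\<kappa> = a / (2 * ((real M + 1) * (real M + 2)))"
  have MM: "(real M + 1) * (real M + 2) > 0" by simp
  have Q01: "poly Q 1 - poly Q 0 = 1 / ((real M + 1) * (real M + 2))"
    by (simp add: Q_def field_simps)
  have Q1: "poly Q 1 - poly Q \<tau> \<le> x ^ M"
  proof -
    have "poly Q 1 - poly Q \<tau> = x ^ Suc M / real (M + 1) - x ^ Suc (Suc M) / real (M + 2)"
      by (simp add: Q_def x_def del: power_Suc)
    also have "\<dots> \<le> x ^ Suc M / 1 - 0"
      using x by (intro diff_mono divide_left_mono) auto
    also have "\<dots> \<le> x ^ M" using x by (simp add: mult_left_le_one_le)
    finally show ?thesis .
  qed
  have "(a + C) * x ^ M \<le> \<kappa>"
  proof -
    have "((real M + 1) * (real M + 2) * x ^ M) * (2 * (a + C)) < a"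
      using M a C by (simp add: pos_less_divide_eq)
    moreover have "(a + C) * x ^ M * (2 * ((real M + 1) * (real M + 2))) = ((real M + 1) * (real M + 2) * x ^ M) * (2 * (a + C))"
      by (simp only: mult_ac)
    ultimately have le: "(a + C) * x ^ M * (2 * ((real M + 1) * (real M + 2))) \<le> a" by linarith
    show ?thesis unfolding \<kappa>_def by (rule mult_imp_le_div_pos[OF _ le]) (use MM in simp)
  qed
  moreover have "a * (1 / ((real M + 1) * (real M + 2))) = 2 * \<kappa>" by (simp add: \<kappa>_def)
  moreover have "(a + C) * (poly Q 1 - poly Q \<tau>) \<le> (a + C) * x ^ M"
    using Q1 a C by (intro mult_left_mono) auto
  ultimately have key: "\<kappa> \<le> a * (poly Q 1 - poly Q 0) - (a + C) * (poly Q 1 - poly Q \<tau>)" unfolding Q01 by linarith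
  show ?thesis
  proof (rule that[of \<kappa> q])
    show "\<kappa> > 0" using a MM by (simp add: \<kappa>_def)
    show "poly q 0 = 0" by (simp add: q)
    have "poly q 1 = 0 \<or> M = 0" by (auto simp: q)
    moreover have "M \<noteq> 0"
    proof
      assume "M = 0"
      then have "2 * (2 * (a + C)) < a" using M a C by (simp add: pos_less_divide_eq)
      then show False using a C by simp
    qed
    ultimately show "poly q 1 = 0" by blast
    fix X A assume A: "pderiv A = q * pderiv X" and lo: "\<And>t. t \<in> {0..\<tau>} \<Longrightarrow> a \<le> poly (pderiv X) t"
      and ab: "\<And>t. t \<in> {0..1} \<Longrightarrow> \<bar>poly (pderiv X) t\<bar> \<le> C"
    have "poly (smult a Q) \<tau> - poly (smult a Q) 0 \<le> poly A \<tau> - poly A 0"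
    proof (rule poly_increment_bounds)
      fix t assume t: "0 \<le> t" "t \<le> \<tau>"
      have "poly q t * a \<le> poly q t * poly (pderiv X) t" using t lo[of t] q0[of t] \<tau> by (intro mult_left_mono) auto
      then show "poly (pderiv (smult a Q)) t \<le> poly (pderiv A) t" by (simp add: A pderiv_smult Q mult.commute)
    qed (use \<tau> in simp)
    moreover have "poly (smult (-C) Q) 1 - poly (smult (-C) Q) \<tau> \<le> poly A 1 - poly A \<tau>"
    proof (rule poly_increment_bounds)
      fix t assume t: "\<tau> \<le> t" "t \<le> 1"
      have "- C \<le> poly (pderiv X) t" using ab[of t] t \<tau> by (simp add: abs_le_iff)
      then have "poly q t * (- C) \<le> poly q t * poly (pderiv X) t" using t q0[of t] \<tau> by (intro mult_left_mono) auto
      then show "poly (pderiv (smult (-C) Q)) t \<le> poly (pderiv A) t"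
        by (simp add: A pderiv_smult pderiv_minus Q mult.commute)
    qed (use \<tau> in simp)
    moreover have "a * (poly Q \<tau> - poly Q 0) = a * (poly Q 1 - poly Q 0) - a * (poly Q 1 - poly Q \<tau>)"
      by (simp add: algebra_simps)
    ultimately show "\<kappa> \<le> poly A 1 - poly A 0" using key by (simp add: algebra_simps)
  qed
qed

text \<open>The sign \<open>\<sigma>\<close> admits edges that start in the direction of decreasing
  \<open>x\<close>.\<close>

lemma bump_poly_weight_abs:
  fixes \<tau> a C \<sigma> :: real
  assumes "0 < \<tau>" "\<tau> < 1" "0 < a" "0 \<le> C" "\<bar>\<sigma>\<bar> = 1"
  obtains q :: "real poly" and \<kappa> where "\<kappa> > 0" "poly q 0 = 0" "poly q 1 = 0"
    "\<And>X A. pderiv A = q * pderiv X \<Longrightarrow> (\<And>t. t \<in> {0..\<tau>} \<Longrightarrow> a \<le> \<sigma> * poly (pderiv X) t) \<Longrightarrow>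
       (\<And>t. t \<in> {0..1} \<Longrightarrow> \<bar>poly (pderiv X) t\<bar> \<le> C) \<Longrightarrow> \<kappa> \<le> \<bar>poly A 1 - poly A 0\<bar>"
proof -
  obtain q :: "real poly" and \<kappa> where q: "\<kappa> > 0" "poly q 0 = 0" "poly q 1 = 0"
    "\<And>X A. pderiv A = q * pderiv X \<Longrightarrow> (\<And>t. t \<in> {0..\<tau>} \<Longrightarrow> a \<le> poly (pderiv X) t) \<Longrightarrow>
       (\<And>t. t \<in> {0..1} \<Longrightarrow> \<bar>poly (pderiv X) t\<bar> \<le> C) \<Longrightarrow> \<kappa> \<le> poly A 1 - poly A 0"
    using bump_poly_weight[OF assms(1-4)] by metis
  show ?thesis
  proof (rule that[OF q(1-3)])
    fix X A assume A: "pderiv A = q * pderiv X" and lo: "\<And>t. t \<in> {0..\<tau>} \<Longrightarrow> a \<le> \<sigma> * poly (pderiv X) t"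
      and ab: "\<And>t. t \<in> {0..1} \<Longrightarrow> \<bar>poly (pderiv X) t\<bar> \<le> C"
    have "\<kappa> \<le> poly (smult \<sigma> A) 1 - poly (smult \<sigma> A) 0"
      by (rule q(4)[of _ "smult \<sigma> X"]) (use A lo ab assms(5) in \<open>auto simp: pderiv_smult abs_mult\<close>)
    also have "\<dots> \<le> \<bar>\<sigma> * (poly A 1 - poly A 0)\<bar>" by (simp add: right_diff_distrib)
    finally show "\<kappa> \<le> \<bar>poly A 1 - poly A 0\<bar>" using assms(5) by (simp add: abs_mult)
  qed
qed

lemma poly_bounded_unit_interval:
  fixes p :: "real poly"
  obtains K where "K > 0" "\<And>t. t \<in> {0..1} \<Longrightarrow> \<bar>poly p t\<bar> \<le> K"
proof -
  have "compact (poly p ` {0..1})" by (intro compact_continuous_image continuous_intros) auto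
  then obtain K where "K > 0" "\<forall>x\<in>poly p ` {0..1}. norm x \<le> K"
    using compact_imp_bounded bounded_pos by blast
  then show ?thesis using that by auto
qed

text \<open>Bernstein weights of degree \<open>m\<close> sit at \<open>k / m\<close>, but the
  difference quotients live on the grid of width \<open>1 / Suc m\<close>; both ends of the
  \<open>k\<close>-th grid interval are within one width of the node.\<close>

lemma grid_point_near:
  assumes m: "m > 0" and k: "k \<le> m"
  shows "\<bar>real k / real (Suc m) - real k / m\<bar> \<le> 1 / real (Suc m)"
    "\<bar>real (Suc k) / real (Suc m) - real k / m\<bar> \<le> 1 / real (Suc m)"
proof -
  have "real k / m - real k / real (Suc m) = (real k / m) * (1 / real (Suc m))" using m by (simp add: field_simps)
  moreover have "0 \<le> real k / m" "real k / m \<le> 1" using k m by auto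
  ultimately have *: "0 \<le> real k / m - real k / real (Suc m)" "real k / m - real k / real (Suc m) \<le> 1 / real (Suc m)"
    using mult_right_mono[of "real k / m" 1 "1 / real (Suc m)"] by auto
  then show "\<bar>real k / real (Suc m) - real k / m\<bar> \<le> 1 / real (Suc m)" by linarith
  have "real (Suc k) / real (Suc m) = real k / real (Suc m) + 1 / real (Suc m)" by (simp add: add_divide_distrib)
  then show "\<bar>real (Suc k) / real (Suc m) - real k / m\<bar> \<le> 1 / real (Suc m)" using * by linarith
qed

definition poly_curve :: "real poly \<Rightarrow> real poly \<Rightarrow> real poly \<Rightarrow> real \<Rightarrow> real^3" where
  "poly_curve X Y Z t = vector [poly X t, poly Y t, poly Z t]"

text \<open>\<open>X\<close> and the first version of \<open>Y\<close> are Bernstein polynomials and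
  \<open>Z\<close> is a primitive of \<open>Y * pderiv X\<close>, so the contact condition is exact
  but the final height slightly off. Adding \<open>\<eta> * q\<close> to \<open>Y\<close> moves this
  height by \<open>\<eta>\<close> times an integral bounded away from 0. As \<open>q\<close> is
  fixed before the degree, \<open>\<eta>\<close> and the disturbance of \<open>Y\<close> can be made
  as small as desired.\<close>

lemma smooth_horizontal_approximation:
  fixes F :: "real \<Rightarrow> real^3" and \<nu> :: "real \<Rightarrow> real^3"
  assumes lip: "\<And>a b. a \<in> {0..1} \<Longrightarrow> b \<in> {0..1} \<Longrightarrow> norm (F b - F a) \<le> C * \<bar>b - a\<bar>"
    and hor: "horizontal_on {0..1} F B"
    and expd: "\<And>u a b. u \<in> {0..1} \<Longrightarrow> a \<in> {0..1} \<Longrightarrow> b \<in> {0..1} \<Longrightarrow> \<bar>a - u\<bar> < \<rho> \<Longrightarrow> \<bar>b - u\<bar> < \<rho> \<Longrightarrow> a \<le> b \<Longrightarrow>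
        c * (b - a) \<le> \<nu> u \<bullet> (F b - F a)"
    and \<nu>: "\<And>u. u \<in> {0..1} \<Longrightarrow> norm (\<nu> u) \<le> 1" "\<And>u. u \<in> {0..1} \<Longrightarrow> \<nu> u $ 3 = 0"
    and pos: "\<rho> > 0" "c > 0" "0 < l" "l \<le> 1" "C > 0" "B \<ge> 0" "\<epsilon> > 0"
    and start: "\<And>t i. t \<in> {0..l} \<Longrightarrow> i = 1 \<or> i = 2 \<Longrightarrow> F t $ i = F 0 $ i + t * d0 $ i"
    and fin: "\<And>t i. t \<in> {0..l} \<Longrightarrow> i = 1 \<or> i = 2 \<Longrightarrow> F (1 - t) $ i = F 1 $ i + t * d1 $ i"
    and d0: "d0 $ 1 \<noteq> 0"
  obtains X Y Z :: "real poly" where "pderiv Z = Y * pderiv X" "poly_curve X Y Z 0 = F 0" "poly_curve X Y Z 1 = F 1"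
    "\<And>t. t \<in> {0..1} \<Longrightarrow> norm (poly_curve X Y Z t - F t) \<le> \<epsilon>"
    "\<And>u t. u \<in> {0..1} \<Longrightarrow> t \<in> {0..1} \<Longrightarrow> \<bar>t - u\<bar> \<le> \<rho> / 2 \<Longrightarrow>
       c / 2 \<le> \<nu> u \<bullet> poly_curve (pderiv X) (pderiv Y) (pderiv Z) t"
    "\<And>t i. t \<in> {0..l/2} \<Longrightarrow> i = 1 \<or> i = 2 \<Longrightarrow> \<bar>poly_curve (pderiv X) (pderiv Y) (pderiv Z) t $ i - d0 $ i\<bar> \<le> \<epsilon>"
    "\<And>t i. t \<in> {0..l/2} \<Longrightarrow> i = 1 \<or> i = 2 \<Longrightarrow> \<bar>poly_curve (pderiv X) (pderiv Y) (pderiv Z) (1 - t) $ i + d1 $ i\<bar> \<le> \<epsilon>"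
proof -
  \<comment> \<open>Half the initial speed in \<open>x\<close>; the approximation keeps at least
    this speed on \<open>{0..l/2}\<close>.\<close>
  define a where "a = \<bar>d0 $ 1\<bar> / 2"
  have a: "a > 0" using d0 by (simp add: a_def)
  obtain q :: "real poly" and \<kappa> where \<kappa>: "\<kappa> > 0" and q01: "poly q 0 = 0" "poly q 1 = 0"
    and qI: "\<And>X A. pderiv A = q * pderiv X \<Longrightarrow> (\<And>t. t \<in> {0..l/2} \<Longrightarrow> a \<le> sgn (d0 $ 1) * poly (pderiv X) t) \<Longrightarrow>
       (\<And>t. t \<in> {0..1} \<Longrightarrow> \<bar>poly (pderiv X) t\<bar> \<le> C) \<Longrightarrow> \<kappa> \<le> \<bar>poly A 1 - poly A 0\<bar>"
  proof -
    have pre: "0 < l / 2" "l / 2 < 1" "0 \<le> C" "\<bar>sgn (d0 $ 1)\<bar> = 1" using pos d0 by (auto simp: abs_sgn_eq)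
    show ?thesis using bump_poly_weight_abs[OF pre(1,2) a pre(3,4)] that by metis
  qed
  obtain K1 where K1: "K1 > 0" "\<And>t. t \<in> {0..1} \<Longrightarrow> \<bar>poly q t\<bar> \<le> K1" using poly_bounded_unit_interval by blast
  obtain K2 where K2: "K2 > 0" "\<And>t. t \<in> {0..1} \<Longrightarrow> \<bar>poly (pderiv q) t\<bar> \<le> K2" using poly_bounded_unit_interval by blast
  define Kq where "Kq = K1 + K2"
  have Kq: "Kq > 0" "\<And>t. t \<in> {0..1} \<Longrightarrow> \<bar>poly q t\<bar> \<le> Kq" "\<And>t. t \<in> {0..1} \<Longrightarrow> \<bar>poly (pderiv q) t\<bar> \<le> Kq"
  proof -
    show "Kq > 0" using K1 K2 by (simp add: Kq_def)
    show "\<bar>poly q t\<bar> \<le> Kq" "\<bar>poly (pderiv q) t\<bar> \<le> Kq" if "t \<in> {0..1}" for t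
      using K1(1) K1(2)[OF that] K2(1) K2(2)[OF that] by (simp_all add: Kq_def)
  qed
  define K where "K = C + Kq"
  define M where "M = norm (F 0) + C"
  have Mb: "\<bar>F t $ i\<bar> \<le> M" if t: "t \<in> {0..1}" for t i
  proof -
    have "norm (F t) \<le> norm (F 0) + norm (F t - F 0)" by (metis add_diff_cancel_left' add_diff_eq norm_triangle_ineq)
    also have "norm (F t - F 0) \<le> C * \<bar>t\<bar>" using lip[of 0 t] t by simp
    also have "\<dots> \<le> C * 1" using t pos by (intro mult_left_mono) auto
    finally show ?thesis using component_abs_le_norm[of "F t" i] by (simp add: M_def)
  qed
  have KM: "K > 0" "K \<ge> C" "M \<ge> 0" using pos Kq by (auto simp: K_def M_def)
  \<comment> \<open>A planar error \<open>\<delta>\<close> entails a height error of at most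
    \<open>(2 * K + M) * \<delta>\<close>; with the two planar coordinates the total is at most
    \<open>T * \<delta>\<close>.\<close>
  define T where "T = 2 * K + M + 2"
  have T: "T \<ge> 2" using KM by (simp add: T_def)
  \<comment> \<open>A reserve factor: the height defect will be at most \<open>e0 / g\<close>. Then
    \<open>g * \<kappa> \<ge> T\<close> makes \<open>\<eta>\<close> at most 1 in absolute value, and
    \<open>g * \<kappa> \<ge> T * Kq\<close> makes the correction cost at most
    \<open>e0\<close>.\<close>
  define g where "g = 1 + T * Kq / \<kappa> + T / \<kappa>"
  have g: "g \<ge> 1" "g * \<kappa> \<ge> T" "g * \<kappa> \<ge> T * Kq"
  proof -
    have "T * Kq / \<kappa> > 0" "T / \<kappa> > 0" using T Kq \<kappa> by auto
    then show "g \<ge> 1" by (simp add: g_def)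
    have "g * \<kappa> = \<kappa> + T * Kq + T" using \<kappa> by (simp add: g_def field_simps)
    then show "g * \<kappa> \<ge> T" "g * \<kappa> \<ge> T * Kq" using \<kappa> T Kq by auto
  qed
  \<comment> \<open>The expansion rate loses at most \<open>c / 4\<close> to the Bernstein tail and
    at most \<open>e0 / 2\<close> to the correction, so \<open>c / 2\<close> remains.\<close>
  define e0 where "e0 = min 1 (min (\<epsilon> / 2) (c / 4))"
  have e0: "e0 > 0" "e0 \<le> 1" "e0 \<le> \<epsilon> / 2" "e0 \<le> c / 4" using pos by (auto simp: e0_def)
  define \<delta> where "\<delta> = e0 / (T * g)"
  have \<delta>: "\<delta> > 0" "T * \<delta> = e0 / g" using e0 T g by (auto simp: \<delta>_def)
  have contF: "continuous_on {0..1} (\<lambda>t. F t $ i)" for i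
  proof (rule lipschitz_on_continuous_on[of C], rule lipschitz_onI)
    fix x y :: real assume xy: "x \<in> {0..1}" "y \<in> {0..1}"
    have "\<bar>(F x - F y) $ i\<bar> \<le> norm (F x - F y)" by (rule component_abs_le_norm)
    then show "dist (F x $ i) (F y $ i) \<le> C * dist x y"
      using lip[OF xy(2,1)] by (simp add: dist_real_def)
  qed (use pos in simp)
  obtain N1 where N1: "\<And>n x. N1 \<le> n \<Longrightarrow> x \<in> {0..1} \<Longrightarrow> \<bar>F x $ 1 - (\<Sum>k\<le>n. F (k/n) $ 1 * Bernstein n k x)\<bar> < \<delta>"
    using Bernstein_Weierstrass[OF contF \<delta>(1), of 1] by blast
  obtain N2 where N2: "\<And>n x. N2 \<le> n \<Longrightarrow> x \<in> {0..1} \<Longrightarrow> \<bar>F x $ 2 - (\<Sum>k\<le>n. F (k/n) $ 2 * Bernstein n k x)\<bar> < \<delta>"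
    using Bernstein_Weierstrass[OF contF \<delta>(1), of 2] by blast
  have ev: "\<forall>\<^sub>F m in sequentially. A / real m < e" if "e > 0" for A e :: real
    using order_tendstoD(2)[OF lim_const_over_n that] .
  have "\<forall>\<^sub>F m in sequentially. N1 \<le> m \<and> N2 \<le> m \<and> 0 < m \<and> 1 / real m < \<rho> / 4 \<and> 1 / real m < l / 4 \<and>
      ((c + C) / (\<rho>/4)\<^sup>2) / real m < c / 4 \<and> (2 * C / (l/4)\<^sup>2) / real m < min (\<epsilon> / 2) a"
    using pos a by (intro eventually_conj ev eventually_ge_at_top eventually_gt_at_top) auto
  then obtain m where m: "N1 \<le> m" "N2 \<le> m" "0 < m" "1 / real m < \<rho> / 4" "1 / real m < l / 4"
     "((c + C) / (\<rho>/4)\<^sup>2) / real m < c / 4" "(2 * C / (l/4)\<^sup>2) / real m < min (\<epsilon> / 2) a"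
    by (auto simp: eventually_sequentially)
  have Sm: "1 / real (Suc m) < \<rho> / 4" "1 / real (Suc m) < l / 4"
  proof -
    have "1 / real (Suc m) \<le> 1 / real m" using m(3) by (intro divide_left_mono) auto
    then show "1 / real (Suc m) < \<rho> / 4" "1 / real (Suc m) < l / 4" using m(4,5) by linarith+
  qed
  define b where "b i = bern_poly (Suc m) (\<lambda>t. F t $ i)" for i :: 3
  \<comment> \<open>Difference quotients of \<open>F\<close> on the grid; their Bernstein averages
    are the planar velocities of the approximation.\<close>
  define dq where "dq k = real (Suc m) *\<^sub>R (F (real (Suc k) / real (Suc m)) - F (real k / real (Suc m)))" for k
  have pb: "poly (pderiv (b i)) t = (\<Sum>k\<le>m. dq k $ i * Bernstein m k t)" for i t
    unfolding b_def poly_pderiv_bern_poly by (simp add: dq_def)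
  have grid: "real k / real (Suc m) \<in> {0..1}" "real (Suc k) / real (Suc m) \<in> {0..1}" if "k \<le> m" for k
    using that by (auto simp: divide_le_eq_1)
  have step: "real (Suc k) / real (Suc m) - real k / real (Suc m) = 1 / real (Suc m)" for k
    by (simp add: add_divide_distrib)
  have dqC: "norm (dq k) \<le> C" if "k \<le> m" for k
  proof -
    have "norm (dq k) = real (Suc m) * norm (F (real (Suc k) / real (Suc m)) - F (real k / real (Suc m)))"
      by (simp add: dq_def)
    also have "\<dots> \<le> real (Suc m) * (C * \<bar>1 / real (Suc m)\<bar>)"
      using lip[OF grid[OF that]] unfolding step by (intro mult_left_mono) auto
    also have "\<dots> = C" by simp
    finally show ?thesis .
  qed
  have dqCi: "\<bar>dq k $ i\<bar> \<le> C" if "k \<le> m" for k i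
    using dqC[OF that] component_abs_le_norm[of "dq k" i] by linarith
  have bd: "\<bar>poly (pderiv (b i)) t\<bar> \<le> C" if "t \<in> {0..1}" for i t
    unfolding pb using that dqCi by (rule Bernstein_average_abs_le)
  have close: "\<bar>poly (b i) t - F t $ i\<bar> \<le> \<delta>" if "t \<in> {0..1}" "i = 1 \<or> i = 2" for i t
    using that N1[of "Suc m" t] N2[of "Suc m" t] m(1,2) unfolding b_def poly_bern_poly by (auto simp: abs_minus_commute)
  have b0: "poly (b i) 0 = F 0 $ i" and b1: "poly (b i) 1 = F 1 $ i" for i
  proof -
    have "(\<Sum>k\<le>Suc m. F (k / Suc m) $ i * Bernstein (Suc m) k 0) = (\<Sum>k\<le>Suc m. if k = 0 then F 0 $ i else 0)"
      by (rule sum.cong) (auto simp: Bernstein_def)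
    then show "poly (b i) 0 = F 0 $ i" unfolding b_def poly_bern_poly by simp
    have "(\<Sum>k\<le>Suc m. F (k / Suc m) $ i * Bernstein (Suc m) k 1) = (\<Sum>k\<le>Suc m. if k = Suc m then F 1 $ i else 0)"
      by (rule sum.cong) (auto simp: Bernstein_def)
    then show "poly (b i) 1 = F 1 $ i" unfolding b_def poly_bern_poly by simp
  qed
  have bexp: "c * 3 / 4 \<le> \<nu> u $ 1 * poly (pderiv (b 1)) t + \<nu> u $ 2 * poly (pderiv (b 2)) t"
    if u: "u \<in> {0..1}" and t: "t \<in> {0..1}" "\<bar>t - u\<bar> \<le> \<rho> / 2" for u t
  proof -
    \<comment> \<open>Distances add up: from \<open>u\<close> to \<open>t\<close> at most
      \<open>\<rho> / 2\<close>, from \<open>t\<close> to the node less than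
      \<open>\<rho> / 4\<close>, from the node to the grid points less than
      \<open>\<rho> / 4\<close>. So everything stays in the window where \<open>F\<close> expands
      along \<open>\<nu> u\<close>.\<close>
    have "c - (c + C) / ((\<rho>/4)\<^sup>2 * m) \<le> (\<Sum>k\<le>m. (\<nu> u \<bullet> dq k) * Bernstein m k t)"
    proof (rule Bernstein_average_ge[OF m(3) t(1)])
      fix k assume k: "k \<le> m"
      have "\<bar>\<nu> u \<bullet> dq k\<bar> \<le> norm (\<nu> u) * norm (dq k)" by (rule Cauchy_Schwarz_ineq2)
      also have "\<dots> \<le> 1 * C" using \<nu>(1)[OF u] dqC[OF k] by (intro mult_mono) auto
      finally show "- C \<le> \<nu> u \<bullet> dq k" by linarith
      assume near: "\<bar>real k / real m - t\<bar> < \<rho> / 4"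
      have "\<bar>real k / real (Suc m) - u\<bar> < \<rho>" "\<bar>real (Suc k) / real (Suc m) - u\<bar> < \<rho>"
        using grid_point_near[OF m(3) k] near t(2) Sm(1) by linarith+
      from expd[OF u grid[OF k] this] have "c * (1 / real (Suc m)) \<le> \<nu> u \<bullet> (F (real (Suc k) / real (Suc m)) - F (real k / real (Suc m)))"
        using step[of k] by (simp add: divide_right_mono)
      then have "real (Suc m) * (c * (1 / real (Suc m))) \<le> real (Suc m) * (\<nu> u \<bullet> (F (real (Suc k) / real (Suc m)) - F (real k / real (Suc m))))"
        by (intro mult_left_mono) auto
      then show "c \<le> \<nu> u \<bullet> dq k" by (simp add: dq_def)
    qed (use pos in auto)
    also have "\<dots> = \<nu> u $ 1 * poly (pderiv (b 1)) t + \<nu> u $ 2 * poly (pderiv (b 2)) t"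
      unfolding pb inner_vec3 \<nu>(2)[OF u] by (simp add: sum_distrib_left sum.distrib[symmetric] algebra_simps)
    finally have "c - (c + C) / ((\<rho>/4)\<^sup>2 * m) \<le> \<nu> u $ 1 * poly (pderiv (b 1)) t + \<nu> u $ 2 * poly (pderiv (b 2)) t" .
    moreover have "(c + C) / ((\<rho>/4)\<^sup>2 * m) < c / 4" using m(6) by (simp only: divide_divide_eq_left)
    ultimately show ?thesis by linarith
  qed
  have mle: "2 * C / ((l/4)\<^sup>2 * m) < \<epsilon> / 2" "2 * C / ((l/4)\<^sup>2 * m) < a"
    using m(7) by (simp_all add: divide_divide_eq_left)
  \<comment> \<open>Near 0 the projection of \<open>F\<close> is affine, so for
    \<open>t \<le> l / 2\<close> all difference quotients close to \<open>t\<close> equal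
    \<open>d0\<close>, and only the tail of the average is in error.\<close>
  have bstart: "\<bar>poly (pderiv (b i)) t - d0 $ i\<bar> \<le> 2 * C / ((l/4)\<^sup>2 * m)"
    if t: "t \<in> {0..l/2}" and i: "i = 1 \<or> i = 2" for t i
    unfolding pb
  proof (rule Bernstein_average_near[OF m(3)])
    show "t \<in> {0..1}" using t pos by auto
    fix k assume k: "k \<le> m"
    show "\<bar>dq k $ i\<bar> \<le> C" by (rule dqCi[OF k])
    assume "\<bar>real k / real m - t\<bar> < l / 4"
    then have "real k / real (Suc m) \<le> l \<and> real (Suc k) / real (Suc m) \<le> l"
      using grid_point_near[OF m(3) k] t Sm(2) unfolding atLeastAtMost_iff by (intro conjI; linarith)
    then have m0: "real k / real (Suc m) \<in> {0..l}" "real (Suc k) / real (Suc m) \<in> {0..l}" using grid[OF k] by auto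
    have "F (real (Suc k) / real (Suc m)) $ i - F (real k / real (Suc m)) $ i =
        (real (Suc k) / real (Suc m) - real k / real (Suc m)) * d0 $ i"
      unfolding start[OF m0(1) i] start[OF m0(2) i] left_diff_distrib by (rule add_diff_cancel_left)
    then have "F (real (Suc k) / real (Suc m)) $ i - F (real k / real (Suc m)) $ i = (1 / real (Suc m)) * d0 $ i"
      unfolding step .
    then show "dq k $ i = d0 $ i" by (simp add: dq_def)
  next
    have "\<bar>l * d0 $ i\<bar> \<le> C * \<bar>l\<bar>"
      using lip[of 0 l] start[of l i] i pos component_abs_le_norm[of "F l - F 0" i] by simp
    then show "\<bar>d0 $ i\<bar> \<le> C" using pos by (simp add: abs_mult)
  qed (use pos in simp)
  have bfin: "\<bar>poly (pderiv (b i)) (1 - t) + d1 $ i\<bar> \<le> 2 * C / ((l/4)\<^sup>2 * m)"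
    if t: "t \<in> {0..l/2}" and i: "i = 1 \<or> i = 2" for t i
  proof -
    have "\<bar>(\<Sum>k\<le>m. dq k $ i * Bernstein m k (1 - t)) - (- d1 $ i)\<bar> \<le> 2 * C / ((l/4)\<^sup>2 * m)"
    proof (rule Bernstein_average_near[OF m(3)])
      show "1 - t \<in> {0..1}" using t pos by auto
      fix k assume k: "k \<le> m"
      show "\<bar>dq k $ i\<bar> \<le> C" by (rule dqCi[OF k])
      let ?s = "1 - real k / real (Suc m)" and ?s' = "1 - real (Suc k) / real (Suc m)"
      assume "\<bar>real k / real m - (1 - t)\<bar> < l / 4"
      then have "?s \<le> l \<and> ?s' \<le> l"
        using grid_point_near[OF m(3) k] t Sm(2) unfolding atLeastAtMost_iff by (intro conjI; linarith)
      then have m0: "?s \<in> {0..l}" "?s' \<in> {0..l}" using grid[OF k] by auto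
      have "F (1 - ?s') $ i - F (1 - ?s) $ i = (?s' - ?s) * d1 $ i"
        unfolding fin[OF m0(1) i] fin[OF m0(2) i] left_diff_distrib by (rule add_diff_cancel_left)
      moreover have "?s' - ?s = - (1 / real (Suc m))" using step[of k] by linarith
      ultimately have "F (1 - ?s') $ i - F (1 - ?s) $ i = - (1 / real (Suc m)) * d1 $ i" by simp
      then show "dq k $ i = - d1 $ i" by (simp add: dq_def)
    next
      have "\<bar>l * d1 $ i\<bar> \<le> C * \<bar>l\<bar>"
        using lip[of 1 "1 - l"] fin[of l i] i pos component_abs_le_norm[of "F (1 - l) - F 1" i] by simp
      then show "\<bar>- d1 $ i\<bar> \<le> C" using pos by (simp add: abs_mult)
    qed (use pos in simp)
    then show ?thesis unfolding pb by simp
  qed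
  define X where "X = b 1"
  have hz: "\<bar>F t' $ 3 - F t $ 3 - F t $ 2 * (F t' $ 1 - F t $ 1)\<bar> \<le> (B + K\<^sup>2) * (t' - t)\<^sup>2" if "t \<in> {0..1}" "t' \<in> {0..1}" for t t'
  proof -
    have "\<bar>F t' $ 3 - F t $ 3 - F t $ 2 * (F t' $ 1 - F t $ 1)\<bar> \<le> B * (t' - t)\<^sup>2"
      using hor that unfolding horizontal_on_def by blast
    moreover have "0 \<le> K\<^sup>2 * (t' - t)\<^sup>2" by simp
    ultimately show ?thesis unfolding distrib_right by linarith
  qed
  \<comment> \<open>Stated for variable \<open>Z\<close> and \<open>Y\<close> because it is applied
    both before and after the correction.\<close>
  have height: "\<bar>poly Z t - F t $ 3\<bar> \<le> (2 * K + M) * \<delta>'"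
    if Z: "pderiv Z = Y * pderiv X" "poly Z 0 = F 0 $ 3" and Y: "\<And>t. t \<in> {0..1} \<Longrightarrow> \<bar>poly (pderiv Y) t\<bar> \<le> K"
      "\<And>t. t \<in> {0..1} \<Longrightarrow> \<bar>poly Y t - F t $ 2\<bar> \<le> \<delta>'" and \<delta>': "\<delta> \<le> \<delta>'" and t: "t \<in> {0..1}" for Z Y \<delta>' t
  proof (rule horizontal_height_close[where x = "\<lambda>t. F t $ 1" and y = "\<lambda>t. F t $ 2" and z = "\<lambda>t. F t $ 3"
      and X = "poly X" and Y = "poly Y" and Z = "poly Z" and B = "B + K\<^sup>2"])
    have XK: "\<bar>poly (pderiv X) t\<bar> \<le> K" if "t \<in> {0..1}" for t using bd[OF that, of 1] KM unfolding X_def by linarith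
    show "\<bar>poly Z b - poly Z a - poly Y a * (poly X b - poly X a)\<bar> \<le> (B + K\<^sup>2) * (b - a)\<^sup>2" if "a \<in> {0..1}" "b \<in> {0..1}" for a b
    proof -
      have "0 \<le> B * (b - a)\<^sup>2" using pos by simp
      then show ?thesis using horizontal_poly[OF Z(1) XK Y(1) that] unfolding distrib_right by linarith
    qed
    show "\<bar>poly X b - poly X a\<bar> \<le> K * \<bar>b - a\<bar>" if "a \<in> {0..1}" "b \<in> {0..1}" for a b
      using poly_lipschitz[OF XK that] .
    show "\<bar>F b $ 2 - F a $ 2\<bar> \<le> K * \<bar>b - a\<bar>" if "a \<in> {0..1}" "b \<in> {0..1}" for a b
    proof -
      have "\<bar>(F b - F a) $ 2\<bar> \<le> C * \<bar>b - a\<bar>" using lip[OF that] component_abs_le_norm order_trans by blast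
      also have "\<dots> \<le> K * \<bar>b - a\<bar>" using KM by (intro mult_right_mono) auto
      finally show ?thesis by simp
    qed
    show "\<bar>poly X t - F t $ 1\<bar> \<le> \<delta>'" if "t \<in> {0..1}" for t using close[OF that, of 1] \<delta>' by (simp add: X_def)
  qed (use hz Y Mb Z b0 KM pos t in \<open>auto simp: X_def\<close>)
  obtain Z0 where Z0: "pderiv Z0 = b 2 * pderiv X" "poly Z0 0 = F 0 $ 3" using antiderivative_poly by blast
  obtain A where A: "pderiv A = q * pderiv X" "poly A 0 = 0" using antiderivative_poly by blast
  have I: "\<kappa> \<le> \<bar>poly A 1\<bar>"
  proof -
    have "\<kappa> \<le> \<bar>poly A 1 - poly A 0\<bar>"
    proof (rule qI[OF A(1)])
      fix t assume "t \<in> {0..l/2}"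
      from bstart[OF this, of 1] have "\<bar>poly (pderiv X) t - d0 $ 1\<bar> \<le> a" using mle(2) by (simp add: X_def)
      then show "a \<le> sgn (d0 $ 1) * poly (pderiv X) t"
        using d0 by (auto simp: a_def sgn_if abs_if split: if_splits)
    qed (use bd in \<open>auto simp: X_def\<close>)
    then show ?thesis using A by simp
  qed
  \<comment> \<open>The multiple of \<open>q\<close> that closes the height gap at 1; the bound
    \<open>I\<close> keeps the denominator away from 0.\<close>
  define \<eta> where "\<eta> = (F 1 $ 3 - poly Z0 1) / poly A 1"
  have "\<bar>poly Z0 1 - F 1 $ 3\<bar> \<le> (2 * K + M) * \<delta>"
  proof (rule height[OF Z0])
    show "\<bar>poly (pderiv (b 2)) t\<bar> \<le> K" if "t \<in> {0..1}" for t using bd[OF that, of 2] KM by linarith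
  qed (use close in auto)
  also have "\<dots> \<le> T * \<delta>" using \<delta> by (intro mult_right_mono) (auto simp: T_def)
  finally have "\<bar>F 1 $ 3 - poly Z0 1\<bar> \<le> e0 / g" unfolding \<delta>(2) by (simp add: abs_minus_commute)
  then have "\<bar>\<eta>\<bar> \<le> (e0 / g) / \<kappa>"
    unfolding \<eta>_def abs_divide using I \<kappa> e0 g by (intro frac_le) auto
  then have \<eta>0: "\<bar>\<eta>\<bar> \<le> e0 / (g * \<kappa>)" by simp
  have gk: "g * \<kappa> > 0" using g(1) \<kappa> by simp
  have "e0 / (g * \<kappa>) \<le> 1"
    using g(2) T e0 gk by (simp add: pos_divide_le_eq)
  then have \<eta>1: "\<bar>\<eta>\<bar> \<le> 1" using \<eta>0 by linarith
  have \<eta>Kq: "T * (\<bar>\<eta>\<bar> * Kq) \<le> e0"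
  proof -
    have "T * (\<bar>\<eta>\<bar> * Kq) = \<bar>\<eta>\<bar> * (T * Kq)" by simp
    also have "\<dots> \<le> (e0 / (g * \<kappa>)) * (g * \<kappa>)"
      by (rule mult_mono) (use \<eta>0 g(3) T Kq(1) e0 gk in auto)
    also have "\<dots> = e0" using gk by (intro nonzero_eq_divide_eq[THEN iffD1]) auto
    finally show ?thesis .
  qed
  have "2 * (\<bar>\<eta>\<bar> * Kq) \<le> T * (\<bar>\<eta>\<bar> * Kq)" using T Kq by (intro mult_right_mono) auto
  then have \<eta>Kq2: "\<bar>\<eta>\<bar> * Kq \<le> e0 / 2" using \<eta>Kq by linarith
  have Kq0: "0 \<le> \<bar>\<eta>\<bar> * Kq" using Kq by simp
  define Y where "Y = b 2 + smult \<eta> q"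
  define Z where "Z = Z0 + smult \<eta> A"
  have \<eta>q: "\<bar>\<eta> * poly q t\<bar> \<le> \<bar>\<eta>\<bar> * Kq" "\<bar>\<eta> * poly (pderiv q) t\<bar> \<le> \<bar>\<eta>\<bar> * Kq" if "t \<in> {0..1}" for t
    using Kq that by (auto simp: abs_mult intro!: mult_left_mono)
  have Z: "pderiv Z = Y * pderiv X" by (simp add: Z_def Y_def pderiv_add pderiv_smult Z0 A algebra_simps)
  have Yd: "poly (pderiv Y) t = poly (pderiv (b 2)) t + \<eta> * poly (pderiv q) t" for t
    by (simp add: Y_def pderiv_add pderiv_smult)
  have Yc: "\<bar>poly Y t - F t $ 2\<bar> \<le> \<delta> + \<bar>\<eta>\<bar> * Kq" if "t \<in> {0..1}" for t
    using close[OF that, of 2] \<eta>q(1)[OF that] by (simp add: Y_def)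
  show ?thesis
  proof (rule that[OF Z])
    show "poly_curve X Y Z 0 = F 0"
      by (simp add: vec_eq_iff forall_3 poly_curve_def X_def Y_def Z_def Z0 A b0 q01)
    have "poly A 1 \<noteq> 0" using I \<kappa> by auto
    then show "poly_curve X Y Z 1 = F 1"
      by (simp add: vec_eq_iff forall_3 poly_curve_def X_def Y_def Z_def b1 q01 \<eta>_def)
    fix t :: real assume t: "t \<in> {0..1}"
    have "\<bar>poly Z t - F t $ 3\<bar> \<le> (2 * K + M) * (\<delta> + \<bar>\<eta>\<bar> * Kq)"
    proof (rule height[OF Z _ _ Yc])
      fix t :: real assume t: "t \<in> {0..1}"
      have "\<bar>\<eta>\<bar> * Kq \<le> 1 * Kq" using \<eta>1 Kq by (intro mult_right_mono) auto
      then show "\<bar>poly (pderiv Y) t\<bar> \<le> K" unfolding Yd K_def using bd[OF t, of 2] \<eta>q(2)[OF t] by linarith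
    qed (use Kq0 t Z0 A in \<open>auto simp: Z_def\<close>)
    moreover have "\<bar>poly X t - F t $ 1\<bar> \<le> \<delta> + \<bar>\<eta>\<bar> * Kq" using close[OF t, of 1] Kq0 by (simp add: X_def)
    ultimately have "norm (poly_curve X Y Z t - F t) \<le> (2 * K + M) * (\<delta> + \<bar>\<eta>\<bar> * Kq) + 2 * (\<delta> + \<bar>\<eta>\<bar> * Kq)"
      using norm_le_sum_components3[of "poly_curve X Y Z t - F t"] Yc[OF t] by (simp add: poly_curve_def)
    also have "\<dots> = T * \<delta> + T * (\<bar>\<eta>\<bar> * Kq)" by (simp add: T_def algebra_simps)
    also have "T * \<delta> \<le> e0" unfolding \<delta>(2) using g(1) e0 by (simp add: pos_divide_le_eq)
    finally show "norm (poly_curve X Y Z t - F t) \<le> \<epsilon>" using \<eta>Kq e0 by linarith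
  next
    fix u t :: real assume u: "u \<in> {0..1}" and t: "t \<in> {0..1}" "\<bar>t - u\<bar> \<le> \<rho> / 2"
    have "\<bar>\<nu> u $ 2\<bar> \<le> 1" using \<nu>(1)[OF u] component_abs_le_norm[of "\<nu> u" 2] by linarith
    then have "\<bar>\<nu> u $ 2 * (\<eta> * poly (pderiv q) t)\<bar> \<le> 1 * (\<bar>\<eta>\<bar> * Kq)"
      unfolding abs_mult[of "\<nu> u $ 2"] using \<eta>q(2)[OF t(1)] by (intro mult_mono) auto
    moreover have "\<nu> u \<bullet> poly_curve (pderiv X) (pderiv Y) (pderiv Z) t =
        (\<nu> u $ 1 * poly (pderiv (b 1)) t + \<nu> u $ 2 * poly (pderiv (b 2)) t) + \<nu> u $ 2 * (\<eta> * poly (pderiv q) t)"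
      unfolding inner_vec3 \<nu>(2)[OF u] by (simp add: poly_curve_def Yd X_def algebra_simps)
    ultimately show "c / 2 \<le> \<nu> u \<bullet> poly_curve (pderiv X) (pderiv Y) (pderiv Z) t"
      using bexp[OF u t] \<eta>Kq2 e0 pos by linarith
  next
    fix t :: real and i :: 3 assume t: "t \<in> {0..l/2}" and i: "i = 1 \<or> i = 2"
    have t01: "t \<in> {0..1}" "1 - t \<in> {0..1}" using t pos by auto
    show "\<bar>poly_curve (pderiv X) (pderiv Y) (pderiv Z) t $ i - d0 $ i\<bar> \<le> \<epsilon>"
      using bstart[OF t i] mle(1) i \<eta>q(2)[OF t01(1)] \<eta>Kq2 e0 Kq0 pos
      by (auto simp: poly_curve_def X_def Yd)
    show "\<bar>poly_curve (pderiv X) (pderiv Y) (pderiv Z) (1 - t) $ i + d1 $ i\<bar> \<le> \<epsilon>"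
      using bfin[OF t i] mle(1) i \<eta>q(2)[OF t01(2)] \<eta>Kq2 e0 Kq0 pos
      by (auto simp: poly_curve_def X_def Yd)
  qed
qed

section \<open>Smoothing piecewise horizontal graphs\<close>

lemma finite_uniform_upper:
  fixes P :: "'a \<Rightarrow> real \<Rightarrow> bool"
  assumes "finite A" "\<And>e. e \<in> A \<Longrightarrow> \<exists>C. P e C" "\<And>e C C'. e \<in> A \<Longrightarrow> P e C \<Longrightarrow> C \<le> C' \<Longrightarrow> P e C'"
  obtains C where "C > 0" "\<And>e. e \<in> A \<Longrightarrow> P e C"
proof -
  obtain f where f: "\<And>e. e \<in> A \<Longrightarrow> P e (f e)" using assms(2) by metis
  define C where "C = Max (insert 1 (f ` A))"
  have "P e C" if "e \<in> A" for e
    by (rule assms(3)[OF that f[OF that]]) (use assms(1) that in \<open>auto simp: C_def\<close>)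
  moreover have "1 \<le> C" using assms(1) by (simp add: C_def)
  ultimately show ?thesis using that[of C] by auto
qed

lemma finite_uniform_lower:
  fixes P :: "'a \<Rightarrow> real \<Rightarrow> bool"
  assumes "finite A" "\<And>e. e \<in> A \<Longrightarrow> \<exists>c>0. P e c" "\<And>e c c'. e \<in> A \<Longrightarrow> P e c \<Longrightarrow> 0 < c' \<Longrightarrow> c' \<le> c \<Longrightarrow> P e c'"
  obtains c where "c > 0" "\<And>e. e \<in> A \<Longrightarrow> P e c"
proof -
  obtain f where f: "\<And>e. e \<in> A \<Longrightarrow> f e > 0 \<and> P e (f e)" using assms(2) by metis
  define c where "c = Min (insert 1 (f ` A))"
  have c0: "c > 0" using assms(1) f by (auto simp: c_def)
  have "P e c" if "e \<in> A" for e
    by (rule assms(3)[OF that _ c0]) (use assms(1) that f in \<open>auto simp: c_def\<close>)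
  then show ?thesis using that[of c] c0 by auto
qed

text \<open>By homogeneity it suffices to look at
  \<open>t *\<^sub>R d - (1 - t) *\<^sub>R d'\<close> for \<open>t\<close> in the unit interval.
  This compact segment avoids 0 because \<open>d\<close> is not a positive multiple of
  \<open>d'\<close>.\<close>

lemma rays_apart:
  fixes d d' :: "'a::real_normed_vector"
  assumes "d \<noteq> 0" "d' \<noteq> 0" "\<not> same_direction d d'"
  obtains c where "c > 0" "\<And>a a'. 0 \<le> a \<Longrightarrow> 0 \<le> a' \<Longrightarrow> c * (a + a') \<le> norm (a *\<^sub>R d - a' *\<^sub>R d')"
proof -
  let ?h = "\<lambda>t. norm (t *\<^sub>R d - (1 - t) *\<^sub>R d')"
  have "continuous_on {0..1::real} ?h" by (intro continuous_intros)
  then obtain t where t: "t \<in> {0..1}" "\<And>t'. t' \<in> {0..1} \<Longrightarrow> ?h t \<le> ?h t'"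
    using continuous_attains_inf[of "{0..1::real}" ?h] by auto
  have "?h t \<noteq> 0"
  proof
    assume "?h t = 0"
    then have eq: "t *\<^sub>R d = (1 - t) *\<^sub>R d'" by simp
    then have "t \<noteq> 0" "t \<noteq> 1" using assms by auto
    have "d = (1 / t) *\<^sub>R (t *\<^sub>R d)" using \<open>t \<noteq> 0\<close> by simp
    also have "\<dots> = ((1 - t) / t) *\<^sub>R d'" unfolding eq by simp
    finally have "d = ((1 - t) / t) *\<^sub>R d'" .
    moreover have "(1 - t) / t > 0" using t \<open>t \<noteq> 0\<close> \<open>t \<noteq> 1\<close> by simp
    ultimately show False using assms(3) by (auto simp: same_direction_def)
  qed
  then have pos: "?h t > 0" by simp
  have "?h t * (a + a') \<le> norm (a *\<^sub>R d - a' *\<^sub>R d')" if a: "0 \<le> a" "0 \<le> a'" for a a'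
  proof (cases "a + a' = 0")
    case False
    define s where "s = a / (a + a')"
    have s: "s \<in> {0..1}" "(a + a') * s = a" "(a + a') * (1 - s) = a'" using a False by (auto simp: s_def field_simps)
    have "a *\<^sub>R d - a' *\<^sub>R d' = (a + a') *\<^sub>R (s *\<^sub>R d - (1 - s) *\<^sub>R d')"
      unfolding scaleR_diff_right scaleR_scaleR s(2,3) ..
    then have "norm (a *\<^sub>R d - a' *\<^sub>R d') = (a + a') * ?h s" using a by simp
    then show ?thesis using mult_left_mono[OF t(2)[OF s(1)], of "a + a'"] a by (simp add: mult.commute)
  qed (use a in simp)
  then show ?thesis using that pos by blast
qed

text \<open>Finitely many windows of half radius cover the interval. Each point takes over the
  functional of a window around it, scaled to norm at most 1.\<close>

lemma locally_expanding_uniform: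
  assumes "locally_expanding_on {0..1} F"
  obtains c \<rho> \<nu> where "c > 0" "\<rho> > 0" "\<And>u. u \<in> {0..1} \<Longrightarrow> norm (\<nu> u) \<le> 1 \<and> \<nu> u $ 3 = 0"
    "\<And>u a b. u \<in> {0..1} \<Longrightarrow> a \<in> {0..1} \<Longrightarrow> b \<in> {0..1} \<Longrightarrow> \<bar>a - u\<bar> < \<rho> \<Longrightarrow> \<bar>b - u\<bar> < \<rho> \<Longrightarrow> a \<le> b \<Longrightarrow>
        c * (b - a) \<le> \<nu> u \<bullet> (F b - F a)"
proof -
  define P where "P u \<nu> c \<rho> \<longleftrightarrow> \<nu> $ 3 = 0 \<and> c > 0 \<and> \<rho> > 0 \<and>
        (\<forall>a\<in>{0..1}. \<forall>b\<in>{0..1}. \<bar>a - u\<bar> < \<rho> \<and> \<bar>b - u\<bar> < \<rho> \<and> a \<le> b \<longrightarrow> c * (b - a) \<le> \<nu> \<bullet> (F b - F a))" for u \<nu> c \<rho>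
  have "\<forall>u\<in>{0..1}. \<exists>\<nu> c \<rho>. P u \<nu> c \<rho>" using assms unfolding locally_expanding_on_def P_def by blast
  then obtain N C R where P: "\<And>u. u \<in> {0..1} \<Longrightarrow> P u (N u) (C u) (R u)" by metis
  have "{0..1} \<subseteq> (\<Union>u\<in>{0..1}. ball u (R u / 2))" using P by (force simp: P_def)
  then obtain U where U: "U \<subseteq> {0..1}" "finite U" "{0..1} \<subseteq> (\<Union>u\<in>U. ball u (R u / 2))"
    using compactE_image[of "{0..1::real}" "{0..1}" "\<lambda>u. ball u (R u / 2)"] by auto
  obtain \<rho> where \<rho>: "\<rho> > 0" "\<And>u. u \<in> U \<Longrightarrow> \<rho> \<le> R u / 2"
  proof (rule finite_uniform_lower[OF U(2), of "\<lambda>u \<rho>. \<rho> \<le> R u / 2"])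
    fix u assume "u \<in> U"
    then have "R u > 0" using P U(1) by (auto simp: P_def)
    then show "\<exists>c>0. c \<le> R u / 2" by (intro exI[of _ "R u / 2"]) auto
  qed auto
  obtain c where c: "c > 0" "\<And>u. u \<in> U \<Longrightarrow> c \<le> C u / (1 + norm (N u))"
  proof (rule finite_uniform_lower[OF U(2), of "\<lambda>u c. c \<le> C u / (1 + norm (N u))"])
    fix u assume "u \<in> U"
    then have "C u > 0" using P U(1) by (auto simp: P_def)
    moreover have "1 + norm (N u) > 0" by (simp add: add_pos_nonneg)
    ultimately show "\<exists>c>0. c \<le> C u / (1 + norm (N u))" by (intro exI[of _ "C u / (1 + norm (N u))"]) auto
  qed auto
  have "\<exists>u\<in>U. \<bar>t - u\<bar> < R u / 2" if "t \<in> {0..1}" for t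
    using U(3) that by (force simp: dist_real_def abs_minus_commute)
  then obtain h where h: "\<And>t. t \<in> {0..1} \<Longrightarrow> h t \<in> U \<and> \<bar>t - h t\<bar> < R (h t) / 2" by metis
  define \<nu> where "\<nu> t = (1 / (1 + norm (N (h t)))) *\<^sub>R N (h t)" for t
  show ?thesis
  proof (rule that[OF c(1) \<rho>(1), of \<nu>])
    fix t :: real assume t: "t \<in> {0..1}"
    have 1: "1 + norm (N (h t)) > 0" by (simp add: add_pos_nonneg)
    have "N (h t) $ 3 = 0" using P[of "h t"] h[OF t] U(1) by (auto simp: P_def)
    moreover have "norm (N (h t)) / (1 + norm (N (h t))) \<le> 1" using 1 by simp
    ultimately show "norm (\<nu> t) \<le> 1 \<and> \<nu> t $ 3 = 0" using 1 by (simp add: \<nu>_def)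
    fix a b assume ab: "a \<in> {0..1}" "b \<in> {0..1}" "\<bar>a - t\<bar> < \<rho>" "\<bar>b - t\<bar> < \<rho>" "a \<le> b"
    have "\<bar>a - h t\<bar> < R (h t)" "\<bar>b - h t\<bar> < R (h t)" using ab h[OF t] \<rho>(2)[of "h t"] by linarith+
    then have "C (h t) * (b - a) \<le> N (h t) \<bullet> (F b - F a)"
      using P[of "h t"] h[OF t] U(1) ab unfolding P_def by blast
    then have "C (h t) * (b - a) / (1 + norm (N (h t))) \<le> (N (h t) \<bullet> (F b - F a)) / (1 + norm (N (h t)))"
      using 1 by (intro divide_right_mono) auto
    moreover have "c * (b - a) \<le> C (h t) / (1 + norm (N (h t))) * (b - a)"
      using c(2)[of "h t"] h[OF t] ab by (intro mult_right_mono) auto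
    ultimately show "c * (b - a) \<le> \<nu> t \<bullet> (F b - F a)" by (simp add: \<nu>_def)
  qed
qed

lemma poly_increment_near:
  fixes p :: "real poly"
  assumes "\<And>x. x \<in> {a..b} \<Longrightarrow> \<bar>poly (pderiv p) x - k\<bar> \<le> \<epsilon>" "a \<le> b"
  shows "\<bar>poly p b - poly p a - k * (b - a)\<bar> \<le> \<epsilon> * (b - a)"
proof -
  let ?q = "p - smult k [:0, 1:]"
  have "norm (poly ?q b - poly ?q a) \<le> \<epsilon> * norm (b - a)"
  proof (rule field_differentiable_bound[of "{a..b}"])
    show "(poly ?q has_field_derivative poly (pderiv ?q) z) (at z within {a..b})" for z
      by (rule has_field_derivative_at_within[OF poly_DERIV])
    show "norm (poly (pderiv ?q) z) \<le> \<epsilon>" if "z \<in> {a..b}" for z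
      using assms(1)[OF that] by (simp add: pderiv_diff pderiv_smult pderiv_pCons)
  qed (use assms(2) in auto)
  then show ?thesis using assms(2) by (simp add: algebra_simps)
qed

lemma poly_curve_has_vector_derivative:
  "(poly_curve X Y Z has_vector_derivative poly_curve (pderiv X) (pderiv Y) (pderiv Z) t) (at t within S)"
proof -
  have e: "poly_curve A B C = (\<lambda>t. poly A t *\<^sub>R axis 1 1 + poly B t *\<^sub>R axis 2 1 + poly C t *\<^sub>R axis 3 1)" for A B C
    by (auto simp: fun_eq_iff poly_curve_def vec_eq_iff forall_3 axis_def)
  have d: "(poly A has_vector_derivative poly (pderiv A) t) (at t within S)" for A :: "real poly"
    by (simp add: has_real_derivative_iff_has_vector_derivative[symmetric] has_field_derivative_at_within[OF poly_DERIV])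
  show ?thesis unfolding e
    by (intro has_vector_derivative_add has_vector_derivative_scaleR[where f' = 0, simplified] d)
      (auto intro!: derivative_eq_intros)
qed

lemma poly_curve_smooth: "smooth_curve (poly_curve X Y Z)"
  unfolding smooth_curve_def
proof (intro exI[of _ "\<lambda>k. poly_curve ((pderiv ^^ k) X) ((pderiv ^^ k) Y) ((pderiv ^^ k) Z)"] conjI allI ballI)
  fix k t
  show "(poly_curve ((pderiv ^^ k) X) ((pderiv ^^ k) Y) ((pderiv ^^ k) Z) has_vector_derivative
     poly_curve ((pderiv ^^ Suc k) X) ((pderiv ^^ Suc k) Y) ((pderiv ^^ Suc k) Z) t) (at t within {0..1})"
    using poly_curve_has_vector_derivative by simp
qed simp

lemma poly_curve_velocity:
  assumes "t \<in> {0..1}"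
  shows "velocity (poly_curve X Y Z) t = poly_curve (pderiv X) (pderiv Y) (pderiv Z) t"
  unfolding velocity_def
  using vector_derivative_within_cbox[of 0 1 t] poly_curve_has_vector_derivative[of X Y Z t "{0..1}"] assms
  by (simp add: box_real)

section \<open>Separation of edges and vertices\<close>

text \<open>Parameter pairs with equal image lie on the diagonal or at two edge ends with the same
  vertex. Off an open neighbourhood \<open>N\<close> of these, the distance is a positive continuous
  function on a compact set.\<close>

lemma embedded_graph_separation:
  fixes F :: "'e \<Rightarrow> real \<Rightarrow> real^3" and G :: "('v, 'e) pre_digraph"
  assumes emb: "embedded_graph G q F" and \<rho>: "\<rho> > 0" and e: "e \<in> arcs G" "e' \<in> arcs G"
  obtains c where "c > 0" "\<And>t t'. t \<in> {0..1} \<Longrightarrow> t' \<in> {0..1} \<Longrightarrow> norm (F e t - F e' t') < c \<Longrightarrow>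
     (e = e' \<and> \<bar>t - t'\<bar> < \<rho>) \<or>
     (\<exists>b b'. (e, b) \<noteq> (e', b') \<and> end_vertex G (e, b) = end_vertex G (e', b') \<and>
        \<bar>t - of_bool b\<bar> < \<rho> \<and> \<bar>t' - of_bool b'\<bar> < \<rho>)"
proof -
  have wf: "tail G e \<in> verts G" "head G e \<in> verts G" if "e \<in> arcs G" for e
    using emb that by (auto simp: embedded_graph_def fin_digraph_def wf_digraph_def)
  have ends: "F e (of_bool b) = q (end_vertex G (e, b))" if "e \<in> arcs G" for e b
    using emb that by (auto simp: embedded_graph_def end_vertex_def pathstart_def pathfinish_def)
  have inj: "x = y" if "q x = q y" "x \<in> verts G" "y \<in> verts G" for x y
    using emb that by (auto simp: embedded_graph_def dest: inj_onD)
  have endv: "end_vertex G (e, b) \<in> verts G" if "e \<in> arcs G" for e b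
    using wf[OF that] by (simp add: end_vertex_def)
  have cont: "continuous_on {0..1} (F e)" if "e \<in> arcs G" for e
    using emb that by (auto simp: embedded_graph_def simple_path_def path_def)
  have disj: "F d ` {0<..<1} \<inter> F d' ` {0<..<1} = {}" if "d \<in> arcs G" "d' \<in> arcs G" "d \<noteq> d'" for d d'
    using emb that by (simp add: embedded_graph_def)
  have disjv: "F d ` {0<..<1} \<inter> q ` verts G = {}" if "d \<in> arcs G" for d
    using emb that by (simp add: embedded_graph_def)
  define N where "N = (if e = e' then {p. \<bar>fst p - snd p\<bar> < \<rho>} else {}) \<union>
     (\<Union>b\<in>UNIV. \<Union>b'\<in>UNIV. if (e, b) \<noteq> (e', b') \<and> end_vertex G (e, b) = end_vertex G (e', b')
        then {p. \<bar>fst p - of_bool b\<bar> < \<rho>} \<inter> {p. \<bar>snd p - of_bool b'\<bar> < \<rho>} else {})"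
  have opn: "open {p :: real \<times> real. \<bar>fst p - snd p\<bar> < \<rho>}" "open {p :: real \<times> real. \<bar>fst p - k\<bar> < \<rho>}"
    "open {p :: real \<times> real. \<bar>snd p - k\<bar> < \<rho>}" for k
    by (intro open_Collect_less continuous_intros)+
  have opn_if: "open (if c then A else {})" if "open A" for c and A :: "(real \<times> real) set" using that by simp
  have "open N" unfolding N_def by (intro open_Un open_UN ballI opn_if open_Int opn)
  then have cK: "compact ({0..1} \<times> {0..1} - N)" by (intro compact_diff compact_Times) auto
  have Nmem: "(t, t') \<in> N \<longleftrightarrow> (e = e' \<and> \<bar>t - t'\<bar> < \<rho>) \<or>
     (\<exists>b b'. (e, b) \<noteq> (e', b') \<and> end_vertex G (e, b) = end_vertex G (e', b') \<and>
        \<bar>t - of_bool b\<bar> < \<rho> \<and> \<bar>t' - of_bool b'\<bar> < \<rho>)" for t t'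
  proof -
    have i: "x \<in> (if c then A else {}) \<longleftrightarrow> c \<and> x \<in> A" for x c and A :: "(real \<times> real) set" by simp
    show ?thesis unfolding N_def Un_iff UN_iff i by simp
  qed
  have key: "(t, t') \<in> N" if t: "t \<in> {0..1}" "t' \<in> {0..1}" and eq: "F e t = F e' t'" for t t'
  proof -
    have bb: "(t, t') \<in> N" if "t = of_bool b" "t' = of_bool b'" "(e, b) \<noteq> (e', b')" for b b'
    proof -
      have "q (end_vertex G (e, b)) = q (end_vertex G (e', b'))"
        using ends e eq that by metis
      then have "end_vertex G (e, b) = end_vertex G (e', b')" using inj endv e by blast
      then show ?thesis unfolding Nmem using that \<rho>
        by (intro disjI2 exI[of _ b] exI[of _ b'] conjI) simp_all
    qed
    show ?thesis
    proof (cases "e = e'")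
      case True
      have "loop_free (F e)" using emb e by (simp add: embedded_graph_def simple_path_def)
      then have "t = t' \<or> t = 0 \<and> t' = 1 \<or> t = 1 \<and> t' = 0"
        using t eq True unfolding loop_free_def by simp
      then consider "t = t'" | "t = 0 \<and> t' = 1" | "t = 1 \<and> t' = 0" by blast
      then show ?thesis
      proof cases
        case 1
        then show ?thesis unfolding Nmem using True \<rho> by simp
      next
        case 2
        then show ?thesis by (intro bb[of False True]) simp_all
      next
        case 3
        then show ?thesis by (intro bb[of True False]) simp_all
      qed
    next
      case False
      have "\<not> (t \<in> {0<..<1} \<and> t' \<in> {0<..<1})"
        using disj[OF e False] eq by (metis disjoint_iff imageI)
      moreover have nv: "F d s \<notin> q ` verts G" if "d \<in> arcs G" "s \<in> {0<..<1}" for d s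
        using disjv[OF that(1)] that(2) by blast
      moreover have ev: "F d (of_bool b) \<in> q ` verts G" if "d \<in> arcs G" for d b
        using ends[OF that] endv[OF that] by auto
      moreover have bin: "\<exists>b. s = of_bool b" if "s \<in> {0..1}" "s \<notin> {0<..<1}" for s :: real
        using that by (intro exI[of _ "s = 1"]) auto
      ultimately have "\<exists>b b'. t = of_bool b \<and> t' = of_bool b'"
      proof (cases "t \<in> {0<..<1}")
        case True
        then have t': "t' \<notin> {0<..<1}" using \<open>\<not> (t \<in> {0<..<1} \<and> t' \<in> {0<..<1})\<close> by blast
        then obtain b' where "t' = of_bool b'" using bin t by blast
        then have "F e t \<in> q ` verts G" using ev[OF e(2), of b'] eq by simp
        then show ?thesis using nv[OF e(1) True] by blast
      next
        case False
        then obtain b where b: "t = of_bool b" using bin t by blast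
        then have "F e' t' \<in> q ` verts G" using ev[OF e(1), of b] eq by simp
        then have "t' \<notin> {0<..<1}" using nv[OF e(2), of t'] by blast
        then show ?thesis using bin t b by blast
      qed
      then show ?thesis using bb False by blast
    qed
  qed
  let ?h = "\<lambda>p. norm (F e (fst p) - F e' (snd p))"
  have ch: "continuous_on ({0..1} \<times> {0..1} - N) ?h"
    by (intro continuous_intros continuous_on_compose2[OF cont[OF e(1)] continuous_on_fst[OF continuous_on_id]]
        continuous_on_compose2[OF cont[OF e(2)] continuous_on_snd[OF continuous_on_id]]) auto
  have "\<exists>c>0. \<forall>p\<in>{0..1} \<times> {0..1} - N. c \<le> ?h p"
  proof (cases "{0..1} \<times> {0..1} - N = {}")
    case False
    then obtain p where p: "p \<in> {0..1} \<times> {0..1} - N" "\<And>p'. p' \<in> {0..1} \<times> {0..1} - N \<Longrightarrow> ?h p \<le> ?h p'"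
      using continuous_attains_inf[OF cK False ch] by blast
    have "?h p \<noteq> 0" using key[of "fst p" "snd p"] p(1) by auto
    then show ?thesis using p(2) by (intro exI[of _ "?h p"]) auto
  qed (intro exI[of _ 1], auto)
  then obtain c where c: "c > 0" "\<And>p. p \<in> {0..1} \<times> {0..1} - N \<Longrightarrow> c \<le> ?h p" by blast
  show ?thesis
  proof (rule that[OF c(1)])
    fix t t' assume t: "t \<in> {0..1}" "t' \<in> {0..1}" and lt: "norm (F e t - F e' t') < c"
    then have "(t, t') \<in> N" using c(2)[of "(t, t')"] by auto
    then show "(e = e' \<and> \<bar>t - t'\<bar> < \<rho>) \<or>
     (\<exists>b b'. (e, b) \<noteq> (e', b') \<and> end_vertex G (e, b) = end_vertex G (e', b') \<and>
        \<bar>t - of_bool b\<bar> < \<rho> \<and> \<bar>t' - of_bool b'\<bar> < \<rho>)" unfolding Nmem .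
  qed
qed

text \<open>Some vertices may be isolated, so the isotopy has to treat vertices separately from the
  edges; those not on \<open>e\<close> keep a positive distance from the compact edge.\<close>

lemma embedded_graph_vertex_separation:
  fixes F :: "'e \<Rightarrow> real \<Rightarrow> real^3" and G :: "('v, 'e) pre_digraph"
  assumes emb: "embedded_graph G q F" and e: "e \<in> arcs G" and v: "v \<in> verts G" "\<And>b. v \<noteq> end_vertex G (e, b)"
  obtains c where "c > 0" "\<And>t. t \<in> {0..1} \<Longrightarrow> c \<le> norm (q v - F e t)"
proof -
  have cl: "closed (path_image (F e))"
    using emb e by (intro closed_path_image) (auto simp: embedded_graph_def simple_path_def)
  have nin: "q v \<notin> path_image (F e)"
  proof
    assume "q v \<in> path_image (F e)"
    then obtain t where t: "t \<in> {0..1}" "q v = F e t" by (auto simp: path_image_def)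
    have "F e ` {0<..<1} \<inter> q ` verts G = {}" using emb e by (simp add: embedded_graph_def)
    then have "t \<notin> {0<..<1}" using v(1) t(2) by (metis disjoint_iff imageI)
    then have "t = 0 \<or> t = 1" using t by auto
    then have "q v = q (tail G e) \<or> q v = q (head G e)"
      using emb e t by (auto simp: embedded_graph_def pathstart_def pathfinish_def)
    moreover have "tail G e \<in> verts G" "head G e \<in> verts G"
      using emb e by (auto simp: embedded_graph_def fin_digraph_def wf_digraph_def)
    ultimately have "v = tail G e \<or> v = head G e"
      using emb v(1) by (auto simp: embedded_graph_def dest: inj_onD)
    then show False using v(2)[of True] v(2)[of False] by (auto simp: end_vertex_def)
  qed
  obtain c where c: "c > 0" "\<forall>x\<in>path_image (F e). c \<le> dist (q v) x"
    using separate_point_closed[OF cl nin] by blast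
  show ?thesis by (rule that[OF c(1)]) (use c(2) in \<open>auto simp: path_image_def dist_norm\<close>)
qed

lemma inner_derivative_increment:
  assumes "a \<le> b" "\<And>t. a \<le> t \<Longrightarrow> t \<le> b \<Longrightarrow> k \<le> \<nu> \<bullet> poly_curve (pderiv X) (pderiv Y) (pderiv Z) t"
    and \<nu>: "\<nu> $ 3 = 0"
  shows "k * (b - a) \<le> \<nu> \<bullet> (poly_curve X Y Z b - poly_curve X Y Z a)"
proof -
  let ?p = "smult (\<nu> $ 1) X + smult (\<nu> $ 2) Y"
  have "poly (smult k [:0, 1:]) b - poly (smult k [:0, 1:]) a \<le> poly ?p b - poly ?p a"
    by (rule poly_increment_bounds[OF assms(1)])
      (use assms(2) \<nu> in \<open>auto simp: pderiv_smult pderiv_add pderiv_pCons inner_vec3 poly_curve_def\<close>)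
  then show ?thesis using \<nu> by (simp add: inner_vec3 poly_curve_def algebra_simps)
qed

lemma poly_curve_lipschitz:
  obtains K where "K > 0" "\<And>a b. a \<in> {0..1} \<Longrightarrow> b \<in> {0..1} \<Longrightarrow> norm (poly_curve X Y Z b - poly_curve X Y Z a) \<le> K * \<bar>b - a\<bar>"
proof -
  obtain K1 where K1: "K1 > 0" "\<And>t. t \<in> {0..1} \<Longrightarrow> \<bar>poly (pderiv X) t\<bar> \<le> K1" using poly_bounded_unit_interval by blast
  obtain K2 where K2: "K2 > 0" "\<And>t. t \<in> {0..1} \<Longrightarrow> \<bar>poly (pderiv Y) t\<bar> \<le> K2" using poly_bounded_unit_interval by blast
  obtain K3 where K3: "K3 > 0" "\<And>t. t \<in> {0..1} \<Longrightarrow> \<bar>poly (pderiv Z) t\<bar> \<le> K3" using poly_bounded_unit_interval by blast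
  have "norm (poly_curve X Y Z b - poly_curve X Y Z a) \<le> (K1 + K2 + K3) * \<bar>b - a\<bar>" if "a \<in> {0..1}" "b \<in> {0..1}" for a b
    using norm_le_sum_components3[of "poly_curve X Y Z b - poly_curve X Y Z a"]
      poly_lipschitz[OF K1(2) that] poly_lipschitz[OF K2(2) that] poly_lipschitz[OF K3(2) that]
    by (simp add: poly_curve_def distrib_right)
  then show ?thesis using that[of "K1 + K2 + K3"] K1 K2 K3 by auto
qed

text \<open>The height of \<open>w\<close> is left uncontrolled: dropping it only decreases the
  norm.\<close>

lemma norm_ge_planar_part:
  fixes w u :: "real^3"
  assumes "u $ 3 = 0" "\<bar>w $ 1 - u $ 1\<bar> \<le> e" "\<bar>w $ 2 - u $ 2\<bar> \<le> e"
  shows "norm u - 2 * e \<le> norm w"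
proof -
  define w' :: "real^3" where "w' = vector [w $ 1, w $ 2, 0]"
  have "norm w' \<le> norm w"
    unfolding norm_vec_def L2_set_def by (simp add: sum_3 w'_def)
  moreover have "norm (w' - u) \<le> 2 * e"
    using norm_le_sum_components3[of "w' - u"] assms by (simp add: w'_def)
  moreover have "norm u \<le> norm w' + norm (w' - u)" by (metis norm_minus_commute norm_triangle_sub)
  ultimately show ?thesis by linarith
qed

text \<open>The polynomial curves are joined to \<open>F\<close> by the straight-line isotopy. Close
  pairs of points are of two kinds: on one edge, a common functional \<open>\<nu>\<close> expands
  both curves; at a common vertex, the planar rays spread while planar displacements are at most
  \<open>\<epsilon>\<close> times the distance to the vertex. All other pairs are farther apart than
  they are displaced.\<close>

lemma legendrian_smoothing:
  fixes G :: "('v, 'e) pre_digraph" and F :: "'e \<Rightarrow> real \<Rightarrow> real^3" and d :: "'e \<times> bool \<Rightarrow> real^3"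
  assumes emb: "embedded_graph G q F"
    and lip: "\<And>e. e \<in> arcs G \<Longrightarrow> \<exists>C. \<forall>a\<in>{0..1}. \<forall>b\<in>{0..1}. norm (F e b - F e a) \<le> C * \<bar>b - a\<bar>"
    and hor: "\<And>e. e \<in> arcs G \<Longrightarrow> \<exists>B. horizontal_on {0..1} (F e) B"
    and expd: "\<And>e. e \<in> arcs G \<Longrightarrow> locally_expanding_on {0..1} (F e)"
    and ends: "\<And>e. e \<in> arcs G \<Longrightarrow> \<exists>l>0. \<forall>t\<in>{0..l}. \<forall>i\<in>{1, 2}. F e t $ i = F e 0 $ i + t * d (e, False) $ i \<and>
        F e (1 - t) $ i = F e 1 $ i + t * d (e, True) $ i"
    and d: "\<And>a. fst a \<in> arcs G \<Longrightarrow> d a $ 1 \<noteq> 0 \<and> d a $ 3 = 0"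
    and dist: "\<And>a b. fst a \<in> arcs G \<Longrightarrow> fst b \<in> arcs G \<Longrightarrow> a \<noteq> b \<Longrightarrow> end_vertex G a = end_vertex G b \<Longrightarrow>
        \<not> same_direction (d a) (d b)"
  obtains q' \<delta> \<phi> where "legendrian_graph G q' \<delta>" "isotopic_id \<phi>" "\<phi> ` graph_image G q F = graph_image G q' \<delta>"
proof -
  have fin: "finite (arcs G)" "finite (verts G)"
    using emb by (auto simp: embedded_graph_def fin_digraph_def fin_digraph_axioms_def)
  have Fends: "F e (of_bool b) = q (end_vertex G (e, b))" if "e \<in> arcs G" for e b
    using emb that by (auto simp: embedded_graph_def end_vertex_def pathstart_def pathfinish_def)
  have endv: "end_vertex G (e, b) \<in> verts G" if "e \<in> arcs G" for e b
    using emb that by (auto simp: embedded_graph_def fin_digraph_def wf_digraph_def end_vertex_def)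
  obtain C where C: "C > 0" "\<And>e. e \<in> arcs G \<Longrightarrow> \<forall>a\<in>{0..1}. \<forall>b\<in>{0..1}. norm (F e b - F e a) \<le> C * \<bar>b - a\<bar>"
  proof (rule finite_uniform_upper[OF fin(1) lip])
    fix e C C' assume "\<forall>a\<in>{0..1}. \<forall>b\<in>{0..1}. norm (F e b - F e a) \<le> C * \<bar>b - a\<bar>" "C \<le> (C'::real)"
    then show "\<forall>a\<in>{0..1}. \<forall>b\<in>{0..1}. norm (F e b - F e a) \<le> C' * \<bar>b - a\<bar>"
      by (meson abs_ge_zero mult_right_mono order_trans)
  qed auto
  obtain l0 where l0: "l0 > 0" "\<And>e. e \<in> arcs G \<Longrightarrow> \<forall>t\<in>{0..l0}. \<forall>i\<in>{1, 2}. F e t $ i = F e 0 $ i + t * d (e, False) $ i \<and>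
        F e (1 - t) $ i = F e 1 $ i + t * d (e, True) $ i"
  proof (rule finite_uniform_lower[OF fin(1) ends])
    fix e and l l' :: real
    assume h: "\<forall>t\<in>{0..l}. \<forall>i\<in>{1, 2}. F e t $ i = F e 0 $ i + t * d (e, False) $ i \<and>
        F e (1 - t) $ i = F e 1 $ i + t * d (e, True) $ i" and "l' \<le> l"
    then have "{0..l'} \<subseteq> {0..l}" by simp
    then show "\<forall>t\<in>{0..l'}. \<forall>i\<in>{1, 2}. F e t $ i = F e 0 $ i + t * d (e, False) $ i \<and>
        F e (1 - t) $ i = F e 1 $ i + t * d (e, True) $ i" using h by (meson subsetD)
  qed auto
  define l where "l = min l0 1"
  have l: "0 < l" "l \<le> 1" using l0 by (auto simp: l_def)
  have lF: "F e t $ i = F e 0 $ i + t * d (e, False) $ i" "F e (1 - t) $ i = F e 1 $ i + t * d (e, True) $ i"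
    if "e \<in> arcs G" "t \<in> {0..l}" "i = 1 \<or> i = 2" for e t i
  proof -
    have "t \<in> {0..l0}" "i \<in> {1, 2}" using that(2,3) by (auto simp: l_def)
    then show "F e t $ i = F e 0 $ i + t * d (e, False) $ i" "F e (1 - t) $ i = F e 1 $ i + t * d (e, True) $ i"
      using l0(2)[OF that(1)] by blast+
  qed
  have "\<exists>c \<rho> \<nu>. c > 0 \<and> \<rho> > 0 \<and> (\<forall>u\<in>{0..1}. norm (\<nu> u) \<le> 1 \<and> \<nu> u $ 3 = 0) \<and>
     (\<forall>u\<in>{0..1}. \<forall>a\<in>{0..1}. \<forall>b\<in>{0..1}. \<bar>a - u\<bar> < \<rho> \<and> \<bar>b - u\<bar> < \<rho> \<and> a \<le> b \<longrightarrow> c * (b - a) \<le> \<nu> u \<bullet> (F e b - F e a))"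
    if e: "e \<in> arcs G" for e
  proof -
    obtain c \<rho> \<nu> where "c > 0" "\<rho> > 0" "\<And>u. u \<in> {0..1} \<Longrightarrow> norm (\<nu> u) \<le> 1 \<and> \<nu> u $ 3 = 0"
      "\<And>u a b. u \<in> {0..1} \<Longrightarrow> a \<in> {0..1} \<Longrightarrow> b \<in> {0..1} \<Longrightarrow> \<bar>a - u\<bar> < \<rho> \<Longrightarrow> \<bar>b - u\<bar> < \<rho> \<Longrightarrow> a \<le> b \<Longrightarrow>
        c * (b - a) \<le> \<nu> u \<bullet> (F e b - F e a)"
      by (rule locally_expanding_uniform[OF expd[OF e]]) blast
    then show ?thesis by (intro exI[of _ c] exI[of _ \<rho>] exI[of _ \<nu>] conjI ballI impI) simp_all
  qed
  then obtain c1 \<rho>1 \<nu> where E1: "\<And>e. e \<in> arcs G \<Longrightarrow> c1 e > 0 \<and> \<rho>1 e > 0 \<and> (\<forall>u\<in>{0..1}. norm (\<nu> e u) \<le> 1 \<and> \<nu> e u $ 3 = 0) \<and>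
     (\<forall>u\<in>{0..1}. \<forall>a\<in>{0..1}. \<forall>b\<in>{0..1}. \<bar>a - u\<bar> < \<rho>1 e \<and> \<bar>b - u\<bar> < \<rho>1 e \<and> a \<le> b \<longrightarrow> c1 e * (b - a) \<le> \<nu> e u \<bullet> (F e b - F e a))"
    by metis
  obtain c where c: "c > 0" "\<And>e. e \<in> arcs G \<Longrightarrow> c \<le> c1 e"
    by (rule finite_uniform_lower[OF fin(1), of "\<lambda>e c. c \<le> c1 e"]) (use E1 in auto)
  obtain \<rho> where \<rho>: "\<rho> > 0" "\<And>e. e \<in> arcs G \<Longrightarrow> \<rho> \<le> \<rho>1 e"
    by (rule finite_uniform_lower[OF fin(1), of "\<lambda>e c. c \<le> \<rho>1 e"]) (use E1 in auto)
  have \<nu>: "norm (\<nu> e u) \<le> 1" "\<nu> e u $ 3 = 0" if "e \<in> arcs G" "u \<in> {0..1}" for e u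
    using E1[OF that(1)] that(2) by auto
  have Fexp: "c * (b - a) \<le> \<nu> e u \<bullet> (F e b - F e a)"
    if "e \<in> arcs G" "u \<in> {0..1}" "a \<in> {0..1}" "b \<in> {0..1}" "\<bar>a - u\<bar> < \<rho>" "\<bar>b - u\<bar> < \<rho>" "a \<le> b" for e u a b
  proof -
    have "\<bar>a - u\<bar> < \<rho>1 e" "\<bar>b - u\<bar> < \<rho>1 e" using \<rho>(2)[OF that(1)] that by linarith+
    then have "c1 e * (b - a) \<le> \<nu> e u \<bullet> (F e b - F e a)" using E1[OF that(1)] that by blast
    moreover have "c * (b - a) \<le> c1 e * (b - a)" using c(2)[OF that(1)] that by (intro mult_right_mono) auto
    ultimately show ?thesis by linarith
  qed
  have finA: "finite {(a, b) \<in> (arcs G \<times> UNIV) \<times> (arcs G \<times> (UNIV :: bool set)). a \<noteq> b \<and> end_vertex G a = end_vertex G b}"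
    by (rule finite_subset[of _ "(arcs G \<times> UNIV) \<times> (arcs G \<times> UNIV)"]) (use fin in auto)
  obtain k where k: "k > 0" "\<And>p. p \<in> {(a, b) \<in> (arcs G \<times> UNIV) \<times> (arcs G \<times> (UNIV :: bool set)). a \<noteq> b \<and> end_vertex G a = end_vertex G b} \<Longrightarrow>
      \<forall>s\<ge>0. \<forall>s'\<ge>0. k * (s + s') \<le> norm (s *\<^sub>R d (fst p) - s' *\<^sub>R d (snd p))"
  proof (rule finite_uniform_lower[OF finA])
    fix p assume "p \<in> {(a, b) \<in> (arcs G \<times> UNIV) \<times> (arcs G \<times> (UNIV :: bool set)). a \<noteq> b \<and> end_vertex G a = end_vertex G b}"
    then have p: "fst (fst p) \<in> arcs G" "fst (snd p) \<in> arcs G" "fst p \<noteq> snd p" "end_vertex G (fst p) = end_vertex G (snd p)"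
      by auto
    have nz: "d (fst p) \<noteq> 0" "d (snd p) \<noteq> 0" using d[OF p(1)] d[OF p(2)] by auto
    obtain k where "k > 0" "\<And>s s'. 0 \<le> s \<Longrightarrow> 0 \<le> s' \<Longrightarrow> k * (s + s') \<le> norm (s *\<^sub>R d (fst p) - s' *\<^sub>R d (snd p))"
      by (rule rays_apart[OF nz dist[OF p]]) (rule that, assumption, blast)
    then show "\<exists>k>0. \<forall>s\<ge>0. \<forall>s'\<ge>0. k * (s + s') \<le> norm (s *\<^sub>R d (fst p) - s' *\<^sub>R d (snd p))"
      by (intro exI[of _ k] conjI allI impI) simp_all
  next
    fix p and k k' :: real
    assume h: "\<forall>s\<ge>0. \<forall>s'\<ge>0. k * (s + s') \<le> norm (s *\<^sub>R d (fst p) - s' *\<^sub>R d (snd p))" "k' \<le> k"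
    show "\<forall>s\<ge>0. \<forall>s'\<ge>0. k' * (s + s') \<le> norm (s *\<^sub>R d (fst p) - s' *\<^sub>R d (snd p))"
    proof (intro allI impI)
      fix s s' :: real assume s: "0 \<le> s" "0 \<le> s'"
      then have "k' * (s + s') \<le> k * (s + s')" using h(2) by (intro mult_right_mono) auto
      then show "k' * (s + s') \<le> norm (s *\<^sub>R d (fst p) - s' *\<^sub>R d (snd p))" using h(1) s by fastforce
    qed
  qed auto
  have rays: "k * (s + s') \<le> norm (s *\<^sub>R d a - s' *\<^sub>R d b)"
    if "fst a \<in> arcs G" "fst b \<in> arcs G" "a \<noteq> b" "end_vertex G a = end_vertex G b" "0 \<le> s" "0 \<le> s'" for a b s s'
    using k(2)[of "(a, b)"] that by (auto simp: mem_Times_iff)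
  \<comment> \<open>Short enough for nearby points of one edge to share a functional, and for the
    ends to lie where the approximate velocity is known, that is within
    \<open>l / 2\<close>.\<close>
  define \<rho>2 where "\<rho>2 = min (\<rho> / 2) (l / 2)"
  have \<rho>2: "\<rho>2 > 0" "\<rho>2 \<le> \<rho> / 2" "\<rho>2 \<le> l / 2" using \<rho> l by (auto simp: \<rho>2_def)
  define near where "near e t e' t' \<longleftrightarrow> (e = e' \<and> \<bar>t - t'\<bar> < \<rho>2) \<or>
     (\<exists>b b'. (e, b) \<noteq> (e', b') \<and> end_vertex G (e, b) = end_vertex G (e', b') \<and>
        \<bar>t - of_bool b\<bar> < \<rho>2 \<and> \<bar>t' - of_bool b'\<bar> < \<rho>2)" for e t e' t'
  obtain D1 where D1: "D1 > 0" "\<And>p. p \<in> arcs G \<times> arcs G \<Longrightarrow>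
     \<forall>t\<in>{0..1}. \<forall>t'\<in>{0..1}. norm (F (fst p) t - F (snd p) t') < D1 \<longrightarrow> near (fst p) t (snd p) t'"
  proof (rule finite_uniform_lower[of "arcs G \<times> arcs G"])
    fix p assume "p \<in> arcs G \<times> arcs G"
    then have p: "fst p \<in> arcs G" "snd p \<in> arcs G" by auto
    show "\<exists>D>0. \<forall>t\<in>{0..1}. \<forall>t'\<in>{0..1}. norm (F (fst p) t - F (snd p) t') < D \<longrightarrow> near (fst p) t (snd p) t'"
      unfolding near_def using embedded_graph_separation[OF emb \<rho>2(1) p] by metis
  qed (use fin in auto)
  obtain D2 where D2: "D2 > 0" "\<And>p. p \<in> arcs G \<times> verts G \<Longrightarrow>
     (\<forall>b. snd p \<noteq> end_vertex G (fst p, b)) \<longrightarrow> (\<forall>t\<in>{0..1}. D2 \<le> norm (q (snd p) - F (fst p) t))"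
  proof (rule finite_uniform_lower[of "arcs G \<times> verts G"])
    fix p assume "p \<in> arcs G \<times> verts G"
    then have p: "fst p \<in> arcs G" "snd p \<in> verts G" by auto
    show "\<exists>D>0. (\<forall>b. snd p \<noteq> end_vertex G (fst p, b)) \<longrightarrow> (\<forall>t\<in>{0..1}. D \<le> norm (q (snd p) - F (fst p) t))"
      using embedded_graph_vertex_separation[OF emb p] by (metis zero_less_one)
  qed (use fin in \<open>auto intro: order_trans\<close>)
  \<comment> \<open>A quarter of each gap: after the displacements at least
    \<open>2 * \<epsilon>\<close> is left of \<open>D1\<close> and of \<open>D2\<close>, and the
    planar error \<open>2 * \<epsilon>\<close> per unit of distance uses up only half of
    \<open>k\<close>.\<close>
  define \<epsilon> where "\<epsilon> = min (k / 4) (min (D1 / 4) (D2 / 4))"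
  have \<epsilon>: "\<epsilon> > 0" "4 * \<epsilon> \<le> k" "4 * \<epsilon> \<le> D1" "4 * \<epsilon> \<le> D2" using k D1 D2 by (auto simp: \<epsilon>_def)
  have "\<exists>X Y Z. pderiv Z = Y * pderiv X \<and> poly_curve X Y Z 0 = F e 0 \<and> poly_curve X Y Z 1 = F e 1 \<and>
    (\<forall>t\<in>{0..1}. norm (poly_curve X Y Z t - F e t) \<le> \<epsilon>) \<and>
    (\<forall>u\<in>{0..1}. \<forall>t\<in>{0..1}. \<bar>t - u\<bar> \<le> \<rho> / 2 \<longrightarrow> c / 2 \<le> \<nu> e u \<bullet> poly_curve (pderiv X) (pderiv Y) (pderiv Z) t) \<and>
    (\<forall>t\<in>{0..l/2}. \<forall>i. i = 1 \<or> i = 2 \<longrightarrow> \<bar>poly_curve (pderiv X) (pderiv Y) (pderiv Z) t $ i - d (e, False) $ i\<bar> \<le> \<epsilon> \<and>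
       \<bar>poly_curve (pderiv X) (pderiv Y) (pderiv Z) (1 - t) $ i + d (e, True) $ i\<bar> \<le> \<epsilon>)"
    if e: "e \<in> arcs G" for e
  proof -
    obtain B where B: "horizontal_on {0..1} (F e) B" using hor[OF e] by blast
    have B': "horizontal_on {0..1} (F e) (max B 0)" unfolding horizontal_on_def
    proof (intro ballI)
      fix u u' :: real assume "u \<in> {0..1}" "u' \<in> {0..1}"
      then have "\<bar>F e u' $ 3 - F e u $ 3 - F e u $ 2 * (F e u' $ 1 - F e u $ 1)\<bar> \<le> B * (u' - u)\<^sup>2"
        using B unfolding horizontal_on_def by blast
      also have "\<dots> \<le> max B 0 * (u' - u)\<^sup>2" by (intro mult_right_mono) auto
      finally show "\<bar>F e u' $ 3 - F e u $ 3 - F e u $ 2 * (F e u' $ 1 - F e u $ 1)\<bar> \<le> max B 0 * (u' - u)\<^sup>2" .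
    qed
    have lp: "\<And>a b. a \<in> {0..1} \<Longrightarrow> b \<in> {0..1} \<Longrightarrow> norm (F e b - F e a) \<le> C * \<bar>b - a\<bar>" using C(2)[OF e] by blast
    have d1: "d (e, False) $ 1 \<noteq> 0" using d[of "(e, False)"] e by simp
    have m0: "max B 0 \<ge> 0" by simp
    show ?thesis
    proof (rule smooth_horizontal_approximation[OF lp B' Fexp[OF e] \<nu>[OF e] \<rho>(1) c(1) l C(1) m0 \<epsilon>(1) lF[OF e] d1])
      fix X Y Z
      let ?V = "poly_curve (pderiv X) (pderiv Y) (pderiv Z)"
      assume h: "pderiv Z = Y * pderiv X" "poly_curve X Y Z 0 = F e 0" "poly_curve X Y Z 1 = F e 1"
        "\<And>t. t \<in> {0..1} \<Longrightarrow> norm (poly_curve X Y Z t - F e t) \<le> \<epsilon>"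
        "\<And>u t. u \<in> {0..1} \<Longrightarrow> t \<in> {0..1} \<Longrightarrow> \<bar>t - u\<bar> \<le> \<rho> / 2 \<Longrightarrow> c / 2 \<le> \<nu> e u \<bullet> ?V t"
        "\<And>t i. t \<in> {0..l/2} \<Longrightarrow> i = 1 \<or> i = 2 \<Longrightarrow> \<bar>?V t $ i - d (e, False) $ i\<bar> \<le> \<epsilon>"
        "\<And>t i. t \<in> {0..l/2} \<Longrightarrow> i = 1 \<or> i = 2 \<Longrightarrow> \<bar>?V (1 - t) $ i + d (e, True) $ i\<bar> \<le> \<epsilon>"
      show ?thesis
        by (intro exI[of _ X] exI[of _ Y] exI[of _ Z] conjI ballI allI impI h; assumption)
    qed
  qed
  then obtain X Y Z where R: "\<And>e. e \<in> arcs G \<Longrightarrow> pderiv (Z e) = Y e * pderiv (X e) \<and> poly_curve (X e) (Y e) (Z e) 0 = F e 0 \<and> poly_curve (X e) (Y e) (Z e) 1 = F e 1 \<and>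
    (\<forall>t\<in>{0..1}. norm (poly_curve (X e) (Y e) (Z e) t - F e t) \<le> \<epsilon>) \<and>
    (\<forall>u\<in>{0..1}. \<forall>t\<in>{0..1}. \<bar>t - u\<bar> \<le> \<rho> / 2 \<longrightarrow> c / 2 \<le> \<nu> e u \<bullet> poly_curve (pderiv (X e)) (pderiv (Y e)) (pderiv (Z e)) t) \<and>
    (\<forall>t\<in>{0..l/2}. \<forall>i. i = 1 \<or> i = 2 \<longrightarrow> \<bar>poly_curve (pderiv (X e)) (pderiv (Y e)) (pderiv (Z e)) t $ i - d (e, False) $ i\<bar> \<le> \<epsilon> \<and>
       \<bar>poly_curve (pderiv (X e)) (pderiv (Y e)) (pderiv (Z e)) (1 - t) $ i + d (e, True) $ i\<bar> \<le> \<epsilon>)"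
    by metis
  define R where "R e = poly_curve (X e) (Y e) (Z e)" for e
  define V where "V e = poly_curve (pderiv (X e)) (pderiv (Y e)) (pderiv (Z e))" for e
  have R01: "R e 0 = F e 0" "R e 1 = F e 1" if "e \<in> arcs G" for e using R[OF that] by (auto simp: R_def)
  have Rclose: "norm (R e t - F e t) \<le> \<epsilon>" if "e \<in> arcs G" "t \<in> {0..1}" for e t
    using R[OF that(1)] that(2) by (auto simp: R_def)
  have Vexp: "c / 2 \<le> \<nu> e u \<bullet> V e t" if "e \<in> arcs G" "u \<in> {0..1}" "t \<in> {0..1}" "\<bar>t - u\<bar> \<le> \<rho> / 2" for e u t
    using R[OF that(1)] that(2-4) by (auto simp: V_def)
  have Vend: "\<bar>V e t $ i - d (e, False) $ i\<bar> \<le> \<epsilon>" "\<bar>V e (1 - t) $ i + d (e, True) $ i\<bar> \<le> \<epsilon>"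
    if "e \<in> arcs G" "t \<in> {0..l/2}" "i = 1 \<or> i = 2" for e t i
    using R[OF that(1)] that(2-3) by (auto simp: V_def)
  obtain K where K: "K > 0" "\<And>e. e \<in> arcs G \<Longrightarrow> \<forall>a\<in>{0..1}. \<forall>b\<in>{0..1}. norm (R e b - R e a) \<le> K * \<bar>b - a\<bar>"
  proof (rule finite_uniform_upper[OF fin(1), of "\<lambda>e C. \<forall>a\<in>{0..1}. \<forall>b\<in>{0..1}. norm (R e b - R e a) \<le> C * \<bar>b - a\<bar>"])
    show "\<exists>C. \<forall>a\<in>{0..1}. \<forall>b\<in>{0..1}. norm (R e b - R e a) \<le> C * \<bar>b - a\<bar>" for e
      unfolding R_def using poly_curve_lipschitz by metis
    fix e C C' assume "\<forall>a\<in>{0..1}. \<forall>b\<in>{0..1}. norm (R e b - R e a) \<le> C * \<bar>b - a\<bar>" "C \<le> (C'::real)"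
    then show "\<forall>a\<in>{0..1}. \<forall>b\<in>{0..1}. norm (R e b - R e a) \<le> C' * \<bar>b - a\<bar>"
      by (meson abs_ge_zero mult_right_mono order_trans)
  qed auto
  define \<Delta> where "\<Delta> e t = R e t - F e t" for e t
  have \<Delta>lip: "norm (\<Delta> e b - \<Delta> e a) \<le> (K + C) * \<bar>b - a\<bar>" if "e \<in> arcs G" "a \<in> {0..1}" "b \<in> {0..1}" for e a b
  proof -
    have "norm (\<Delta> e b - \<Delta> e a) = norm ((R e b - R e a) - (F e b - F e a))" by (simp add: \<Delta>_def algebra_simps)
    also have "\<dots> \<le> norm (R e b - R e a) + norm (F e b - F e a)" by (rule norm_triangle_ineq4)
    also have "\<dots> \<le> K * \<bar>b - a\<bar> + C * \<bar>b - a\<bar>" using K(2) C(2) that by (intro add_mono) auto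
    finally show ?thesis by (simp add: distrib_right)
  qed
  have \<Delta>end: "\<Delta> e (of_bool b) = 0" if "e \<in> arcs G" for e b using R01[OF that] by (cases b) (auto simp: \<Delta>_def)
  have \<Delta>small: "norm (\<Delta> e t) \<le> \<epsilon>" if "e \<in> arcs G" "t \<in> {0..1}" for e t using Rclose[OF that] by (simp add: \<Delta>_def)
  \<comment> \<open>The planar displacement vanishes at the vertex and has derivative at most
    \<open>\<epsilon>\<close> nearby, because both curves have almost the same planar velocity
    there.\<close>
  have \<Delta>near: "\<bar>\<Delta> e t $ i\<bar> \<le> \<epsilon> * \<bar>t - of_bool b\<bar>" and Fnear: "F e t $ i = q (end_vertex G (e, b)) $ i + \<bar>t - of_bool b\<bar> * d (e, b) $ i"
    if e: "e \<in> arcs G" and t: "t \<in> {0..1}" "\<bar>t - of_bool b\<bar> < \<rho>2" and i: "i = 1 \<or> i = 2" for e t b i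
  proof -
    define s where "s = \<bar>t - of_bool b\<bar>"
    have s: "s \<in> {0..l/2}" "s \<in> {0..l}" using t \<rho>2 l by (auto simp: s_def)
    show F: "F e t $ i = q (end_vertex G (e, b)) $ i + \<bar>t - of_bool b\<bar> * d (e, b) $ i"
    proof (cases b)
      case True
      then have "t = 1 - s" using t by (simp add: s_def)
      then show ?thesis using lF(2)[OF e s(2) i] Fends[OF e, of True] True s by simp
    next
      case False
      then have "t = s" using t by (simp add: s_def)
      then show ?thesis using lF(1)[OF e s(2) i] Fends[OF e, of False] False s by simp
    qed
    define P where "P = (if i = 1 then X e else Y e)"
    have P: "R e t $ i = poly P t" "V e t $ i = poly (pderiv P) t" for t
      using i by (auto simp: P_def R_def V_def poly_curve_def)
    have "\<bar>R e t $ i - F e t $ i\<bar> \<le> \<epsilon> * s"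
    proof (cases b)
      case True
      then have ts: "t = 1 - s" using t by (simp add: s_def)
      have "\<bar>poly P 1 - poly P (1 - s) - (- d (e, True) $ i) * (1 - (1 - s))\<bar> \<le> \<epsilon> * (1 - (1 - s))"
      proof (rule poly_increment_near)
        fix x assume x: "x \<in> {1 - s..1}"
        then have "1 - x \<in> {0..l/2}" using s by auto
        from Vend(2)[OF e this i] show "\<bar>poly (pderiv P) x - - d (e, True) $ i\<bar> \<le> \<epsilon>" by (simp add: P)
      qed (use s in simp)
      then show ?thesis using F True s R01(2)[OF e] Fends[OF e, of True] P(1)[of 1]
        unfolding ts by (simp add: P algebra_simps)
    next
      case False
      then have ts: "t = s" using t by (simp add: s_def)
      have "\<bar>poly P s - poly P 0 - d (e, False) $ i * (s - 0)\<bar> \<le> \<epsilon> * (s - 0)"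
      proof (rule poly_increment_near)
        fix x assume x: "x \<in> {0..s}"
        then have "x \<in> {0..l/2}" using s by auto
        from Vend(1)[OF e this i] show "\<bar>poly (pderiv P) x - d (e, False) $ i\<bar> \<le> \<epsilon>" by (simp add: P)
      qed (use s in simp)
      then show ?thesis using F False s R01(1)[OF e] Fends[OF e, of False] P(1)[of 0]
        unfolding ts by (simp add: P algebra_simps)
    qed
    then show "\<bar>\<Delta> e t $ i\<bar> \<le> \<epsilon> * \<bar>t - of_bool b\<bar>" by (simp add: \<Delta>_def s_def)
  qed
  \<comment> \<open>The summands serve, in this order, pairs far apart, pairs on one edge and pairs
    near a common vertex.\<close>
  define KK where "KK = 1 + 2 * (K + C) / c + 2 * (K + C) / k"
  have KK: "KK \<ge> 1" "(K + C) \<le> KK * (c / 2)" "(K + C) \<le> KK * (k / 2)"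
  proof -
    have p: "2 * (K + C) / c > 0" "2 * (K + C) / k > 0" using K C c k by auto
    then show "KK \<ge> 1" by (simp add: KK_def)
    have "2 * (K + C) / c \<le> KK" "2 * (K + C) / k \<le> KK" using p by (auto simp: KK_def)
    then show "(K + C) \<le> KK * (c / 2)" "(K + C) \<le> KK * (k / 2)"
      using c(1) k(1) by (simp_all add: pos_divide_le_eq mult.commute)
  qed
  have edges: "norm (\<Delta> e t - \<Delta> e' t') \<le> KK * norm ((F e t + s *\<^sub>R \<Delta> e t) - (F e' t' + s *\<^sub>R \<Delta> e' t'))"
    if e: "e \<in> arcs G" "e' \<in> arcs G" and t: "t \<in> {0..1}" "t' \<in> {0..1}" and s: "0 \<le> s" "s \<le> 1" for e t e' t' s
  proof -
    let ?N = "norm ((F e t + s *\<^sub>R \<Delta> e t) - (F e' t' + s *\<^sub>R \<Delta> e' t'))"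
    have far: ?thesis if far: "\<not> near e t e' t'"
    proof -
      note far
      then have "D1 \<le> norm (F e t - F e' t')" using D1(2)[of "(e, e')"] e t by fastforce
      moreover have "norm (F e t - F e' t') \<le> ?N + s * norm (\<Delta> e t) + s * norm (\<Delta> e' t')"
      proof -
        have "F e t - F e' t' = ((F e t + s *\<^sub>R \<Delta> e t) - (F e' t' + s *\<^sub>R \<Delta> e' t')) - (s *\<^sub>R \<Delta> e t - s *\<^sub>R \<Delta> e' t')" by simp
        then have "norm (F e t - F e' t') \<le> ?N + norm (s *\<^sub>R \<Delta> e t - s *\<^sub>R \<Delta> e' t')" by (metis norm_triangle_ineq4)
        also have "norm (s *\<^sub>R \<Delta> e t - s *\<^sub>R \<Delta> e' t') \<le> s * norm (\<Delta> e t) + s * norm (\<Delta> e' t')"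
          using norm_triangle_ineq4[of "s *\<^sub>R \<Delta> e t" "s *\<^sub>R \<Delta> e' t'"] s by simp
        finally show ?thesis by simp
      qed
      moreover have "s * norm (\<Delta> e t) \<le> 1 * \<epsilon>" "s * norm (\<Delta> e' t') \<le> 1 * \<epsilon>"
        using s \<Delta>small e t \<epsilon> by (intro mult_mono; simp)+
      ultimately have N: "2 * \<epsilon> \<le> ?N" using \<epsilon> by linarith
      have "norm (\<Delta> e t - \<Delta> e' t') \<le> 2 * \<epsilon>"
        using norm_triangle_ineq4[of "\<Delta> e t" "\<Delta> e' t'"] \<Delta>small[OF e(1) t(1)] \<Delta>small[OF e(2) t(2)] by linarith
      also have "\<dots> \<le> 1 * ?N" using N by simp
      also have "\<dots> \<le> KK * ?N" using KK by (intro mult_right_mono) auto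
      finally show ?thesis .
    qed
    have same: ?thesis if same: "e = e'" "\<bar>t - t'\<bar> < \<rho>2"
    proof -
      have *: "norm (\<Delta> e b - \<Delta> e a) \<le> KK * norm ((F e b + s *\<^sub>R \<Delta> e b) - (F e a + s *\<^sub>R \<Delta> e a))"
        if ab: "a \<in> {0..1}" "b \<in> {0..1}" "a \<le> b" "b - a < \<rho>2" for a b
      proof -
        \<comment> \<open>The functional of the left point expands both \<open>F\<close> and
          \<open>R\<close> between \<open>a\<close> and \<open>b\<close>, hence every convex
          combination of the two curves.\<close>
        let ?n = "\<nu> e a"
        have f: "c * (b - a) \<le> ?n \<bullet> (F e b - F e a)" using Fexp[OF e(1) ab(1) ab(1,2)] ab \<rho>2 \<rho> by auto
        have "c / 2 * (b - a) \<le> ?n \<bullet> (R e b - R e a)" unfolding R_def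
        proof (rule inner_derivative_increment[OF ab(3)])
          fix x assume "a \<le> x" "x \<le> b"
          then show "c / 2 \<le> ?n \<bullet> poly_curve (pderiv (X e)) (pderiv (Y e)) (pderiv (Z e)) x"
            using Vexp[OF e(1) ab(1), of x] ab \<rho>2 unfolding V_def by auto
        qed (rule \<nu>(2)[OF e(1) ab(1)])
        then have "s * (c / 2 * (b - a)) \<le> s * (?n \<bullet> (R e b - R e a))" using s by (intro mult_left_mono)
        moreover have "c / 2 * (b - a) \<le> c * (b - a)" using c(1) ab by (intro mult_right_mono) auto
        then have "(1 - s) * (c / 2 * (b - a)) \<le> (1 - s) * (?n \<bullet> (F e b - F e a))" using f s by (intro mult_left_mono) auto
        moreover have eq: "(F e b + s *\<^sub>R \<Delta> e b) - (F e a + s *\<^sub>R \<Delta> e a) = (1 - s) *\<^sub>R (F e b - F e a) + s *\<^sub>R (R e b - R e a)"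
          by (simp add: \<Delta>_def algebra_simps)
        ultimately have "c / 2 * (b - a) \<le> ?n \<bullet> ((F e b + s *\<^sub>R \<Delta> e b) - (F e a + s *\<^sub>R \<Delta> e a))"
        proof -
          have "s * x + (1 - s) * x = x" for x :: real by (simp add: algebra_simps)
          from this[of "c / 2 * (b - a)"]
          have "s * (c / 2 * (b - a)) + (1 - s) * (c / 2 * (b - a)) = c / 2 * (b - a)" .
          moreover note \<open>s * (c / 2 * (b - a)) \<le> s * (?n \<bullet> (R e b - R e a))\<close>
            \<open>(1 - s) * (c / 2 * (b - a)) \<le> (1 - s) * (?n \<bullet> (F e b - F e a))\<close>
          ultimately show ?thesis unfolding eq inner_add_right inner_scaleR_right by linarith
        qed
        also have "\<dots> \<le> norm ?n * norm ((F e b + s *\<^sub>R \<Delta> e b) - (F e a + s *\<^sub>R \<Delta> e a))" by (rule norm_cauchy_schwarz)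
        also have "\<dots> \<le> 1 * norm ((F e b + s *\<^sub>R \<Delta> e b) - (F e a + s *\<^sub>R \<Delta> e a))"
          using \<nu>(1)[OF e(1) ab(1)] by (intro mult_right_mono) auto
        finally have low: "c / 2 * (b - a) \<le> norm ((F e b + s *\<^sub>R \<Delta> e b) - (F e a + s *\<^sub>R \<Delta> e a))" by simp
        have "norm (\<Delta> e b - \<Delta> e a) \<le> (K + C) * (b - a)" using \<Delta>lip[OF e(1) ab(1,2)] ab by simp
        also have "\<dots> \<le> KK * (c / 2) * (b - a)" using KK ab by (intro mult_right_mono) auto
        also have "\<dots> \<le> KK * norm ((F e b + s *\<^sub>R \<Delta> e b) - (F e a + s *\<^sub>R \<Delta> e a))"
          using mult_left_mono[OF low, of KK] KK by (simp add: mult.assoc)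
        finally show ?thesis .
      qed
      show ?thesis
      proof (cases "t \<le> t'")
        case True
        then show ?thesis using *[OF t True] same by (simp add: norm_minus_commute abs_less_iff)
      next
        case False
        then show ?thesis using *[OF t(2,1)] same by (simp add: abs_less_iff)
      qed
    qed
    have vertex: ?thesis if vertex: "(e, b) \<noteq> (e', b')" "end_vertex G (e, b) = end_vertex G (e', b')"
         "\<bar>t - of_bool b\<bar> < \<rho>2" "\<bar>t' - of_bool b'\<bar> < \<rho>2" for b b'
    proof -
      define a a' where "a = \<bar>t - of_bool b\<bar>" and "a' = \<bar>t' - of_bool b'\<bar>"
      have aa: "a \<ge> 0" "a' \<ge> 0" by (auto simp: a_def a'_def)
      \<comment> \<open>Seen from the common vertex in projection, the moving points lie on the two
        rays at parameters \<open>a\<close> and \<open>a'\<close>, up to the displacements.\<close>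
      have comp: "\<bar>((F e t + s *\<^sub>R \<Delta> e t) - (F e' t' + s *\<^sub>R \<Delta> e' t')) $ i - (a *\<^sub>R d (e, b) - a' *\<^sub>R d (e', b')) $ i\<bar> \<le> \<epsilon> * (a + a')"
        if i: "i = 1 \<or> i = 2" for i
      proof -
        have sm: "\<bar>s * x\<bar> \<le> y" if "\<bar>x\<bar> \<le> y" for x y :: real
        proof -
          have "s * \<bar>x\<bar> \<le> 1 * \<bar>x\<bar>" using s by (intro mult_right_mono) auto
          then show ?thesis using that s by (simp add: abs_mult)
        qed
        have "\<bar>s * \<Delta> e t $ i\<bar> \<le> \<epsilon> * a" "\<bar>s * \<Delta> e' t' $ i\<bar> \<le> \<epsilon> * a'"
          unfolding a_def a'_def by (rule sm[OF \<Delta>near[OF e(1) t(1) vertex(3) i]] sm[OF \<Delta>near[OF e(2) t(2) vertex(4) i]])+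
        moreover have "((F e t + s *\<^sub>R \<Delta> e t) - (F e' t' + s *\<^sub>R \<Delta> e' t')) $ i - (a *\<^sub>R d (e, b) - a' *\<^sub>R d (e', b')) $ i
            = s * \<Delta> e t $ i - s * \<Delta> e' t' $ i"
          using Fnear[OF e(1) t(1) vertex(3) i] Fnear[OF e(2) t(2) vertex(4) i] vertex(2) by (simp add: a_def a'_def)
        ultimately show ?thesis by (simp add: distrib_left abs_le_iff)
      qed
      have "norm (a *\<^sub>R d (e, b) - a' *\<^sub>R d (e', b')) - 2 * (\<epsilon> * (a + a')) \<le> ?N"
        by (rule norm_ge_planar_part) (use comp d[of "(e, b)"] d[of "(e', b')"] e in auto)
      moreover have "k * (a + a') \<le> norm (a *\<^sub>R d (e, b) - a' *\<^sub>R d (e', b'))"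
        using rays[OF _ _ vertex(1,2) aa] e by simp
      moreover have "4 * \<epsilon> * (a + a') \<le> k * (a + a')" using \<epsilon> aa by (intro mult_right_mono) auto
      ultimately have low: "k / 2 * (a + a') \<le> ?N" by (simp add: algebra_simps)
      have "norm (\<Delta> e t) \<le> (K + C) * a" "norm (\<Delta> e' t') \<le> (K + C) * a'"
        using \<Delta>lip[OF e(1) _ t(1), of "of_bool b"] \<Delta>lip[OF e(2) _ t(2), of "of_bool b'"] \<Delta>end e
        by (auto simp: a_def a'_def)
      then have "norm (\<Delta> e t - \<Delta> e' t') \<le> (K + C) * (a + a')"
        using norm_triangle_ineq4[of "\<Delta> e t" "\<Delta> e' t'"] by (simp add: distrib_left)
      also have "\<dots> \<le> KK * (k / 2) * (a + a')" using KK aa by (intro mult_right_mono) auto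
      also have "\<dots> \<le> KK * ?N" using mult_left_mono[OF low, of KK] KK by (simp add: mult.assoc)
      finally show ?thesis .
    qed
    show ?thesis
    proof (cases "near e t e' t'")
      case True
      then show ?thesis unfolding near_def by (elim disjE exE conjE) (rule same vertex; assumption)+
    qed (rule far)
  qed
  \<comment> \<open>A vertex on the edge is a point of the edge with displacement 0, so the previous
    estimate applies; any other vertex is at distance at least \<open>D2\<close>.\<close>
  have vertex_edge: "norm (\<Delta> e t) \<le> KK * norm (q v - (F e t + s *\<^sub>R \<Delta> e t))"
    if e: "e \<in> arcs G" and v: "v \<in> verts G" and t: "t \<in> {0..1}" and s: "0 \<le> s" "s \<le> 1" for e t v s
  proof (cases "\<exists>b. v = end_vertex G (e, b)")
    case True
    then obtain b where b: "v = end_vertex G (e, b)" ..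
    have "q v = F e (of_bool b)" using Fends[OF e] b by simp
    then show ?thesis using edges[OF e e _ t s, of "of_bool b"] \<Delta>end[OF e, of b] by simp
  next
    case False
    then have "D2 \<le> norm (q v - F e t)" using D2(2)[of "(e, v)"] e v t by auto
    moreover have "norm (q v - F e t) \<le> norm (q v - (F e t + s *\<^sub>R \<Delta> e t)) + s * norm (\<Delta> e t)"
      using norm_triangle_ineq[of "q v - (F e t + s *\<^sub>R \<Delta> e t)" "s *\<^sub>R \<Delta> e t"] s by (simp add: algebra_simps)
    moreover have "s * norm (\<Delta> e t) \<le> 1 * \<epsilon>" using s \<Delta>small[OF e t] \<epsilon> by (intro mult_mono) auto
    ultimately have "norm (\<Delta> e t) \<le> 1 * norm (q v - (F e t + s *\<^sub>R \<Delta> e t))" using \<Delta>small[OF e t] \<epsilon> by linarith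
    also have "\<dots> \<le> KK * norm (q v - (F e t + s *\<^sub>R \<Delta> e t))" using KK by (intro mult_right_mono) auto
    finally show ?thesis .
  qed
  \<comment> \<open>Vertices get indices of their own, with displacement 0, so that
    \<open>\<phi>\<close> is known to fix isolated vertices too.\<close>
  define I :: "('v + 'e \<times> real) set" where "I = Inl ` verts G \<union> Inr ` (arcs G \<times> {0..1})"
  define FF where "FF = case_sum q (\<lambda>(e, t). F e t)"
  define DD where "DD = case_sum (\<lambda>_ :: 'v. 0) (\<lambda>(e, t). \<Delta> e t)"
  have "norm (DD a - DD b) \<le> KK * norm ((FF a + s *\<^sub>R DD a) - (FF b + s *\<^sub>R DD b))"
    if "a \<in> I" "b \<in> I" and s: "0 \<le> s" "s \<le> 1" for a b and s :: real
    using that(1,2) edges[OF _ _ _ _ s] vertex_edge[OF _ _ _ s] KK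
    by (auto simp: I_def FF_def DD_def norm_minus_commute)
  then obtain \<phi> where \<phi>: "isotopic_id \<phi>" "\<And>a. a \<in> I \<Longrightarrow> \<phi> (FF a) = FF a + DD a"
    by (rule isotopic_id_straight_line[of I DD KK FF]) (assumption | rule that | blast)+
  have \<phi>q: "\<phi> (q v) = q v" if "v \<in> verts G" for v
    using \<phi>(2)[of "Inl v"] that by (auto simp: I_def FF_def DD_def)
  have \<phi>F: "\<phi> (F e t) = R e t" if "e \<in> arcs G" "t \<in> {0..1}" for e t
    using \<phi>(2)[of "Inr (e, t)"] that by (auto simp: I_def FF_def DD_def \<Delta>_def)
  obtain \<phi>' where h: "homeomorphism UNIV UNIV \<phi> \<phi>'" using isotopic_id_imp_homeomorphism[OF \<phi>(1)] by blast
  \<comment> \<open>\<open>R e\<close> agrees with \<open>\<phi> \<circ> F e\<close> only on the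
    unit interval, hence the passage through a trivial reparametrisation.\<close>
  have "embedded_graph G (\<phi> \<circ> q) R"
  proof (rule embedded_graph_reparametrisation[OF embedded_graph_homeomorphic_image[OF emb h], where \<theta> = "\<lambda>_ t. t"])
    fix e
    show "continuous_on {0..1} (R e)"
      unfolding R_def by (rule continuous_on_vector_derivative[OF poly_curve_has_vector_derivative])
  qed (use \<phi>F in auto)
  moreover have "legendrian_curve (R e)" if e: "e \<in> arcs G" for e
    unfolding legendrian_curve_def
  proof (intro conjI ballI)
    show "smooth_curve (R e)" unfolding R_def by (rule poly_curve_smooth)
    fix t :: real assume t: "t \<in> {0..1}"
    have v: "velocity (R e) t = V e t" unfolding R_def V_def by (rule poly_curve_velocity[OF t])
    show "velocity (R e) t \<noteq> 0" using Vexp[OF e t t] \<rho> c unfolding v by auto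
    show "velocity (R e) t \<in> xi_std (R e t)"
      unfolding v using R[OF e] by (simp add: xi_std_def V_def R_def poly_curve_def)
  qed
  moreover have "\<not> same_direction (outward_tangent R a) (outward_tangent R b)"
    if ab: "a \<in> arcs G \<times> UNIV" "b \<in> arcs G \<times> UNIV" "a \<noteq> b" "end_vertex G a = end_vertex G b" for a b
  proof
    assume "same_direction (outward_tangent R a) (outward_tangent R b)"
    then obtain \<kappa> where \<kappa>: "\<kappa> > 0" "outward_tangent R a = \<kappa> *\<^sub>R outward_tangent R b" by (auto simp: same_direction_def)
    have out: "\<bar>outward_tangent R a $ i - d a $ i\<bar> \<le> \<epsilon>" if "a \<in> arcs G \<times> UNIV" "i = 1 \<or> i = 2" for a i
    proof -
      obtain e b where a: "a = (e, b)" "e \<in> arcs G" using \<open>a \<in> arcs G \<times> UNIV\<close> by auto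
      have v: "velocity (R e) 0 = V e 0" "velocity (R e) 1 = V e 1"
        unfolding R_def V_def by (auto intro: poly_curve_velocity)
      show ?thesis
        using Vend(1)[OF a(2) _ that(2), of 0] Vend(2)[OF a(2) _ that(2), of 0] l v a
        by (cases b) (auto simp: outward_tangent_def abs_le_iff)
    qed
    \<comment> \<open>Outward tangents deviate from \<open>d\<close> by at most
      \<open>\<epsilon>\<close> in each planar coordinate, so tangents of equal direction would
      bring points of the rays along \<open>d a\<close> and \<open>d b\<close> closer together than
      \<open>k\<close> permits.\<close>
    have comp: "\<bar>(1 *\<^sub>R d a - \<kappa> *\<^sub>R d b) $ i\<bar> \<le> \<epsilon> * (1 + \<kappa>)" if i: "i = 1 \<or> i = 2" for i
    proof -
      have "\<bar>\<kappa> * (outward_tangent R b $ i - d b $ i)\<bar> \<le> \<kappa> * \<epsilon>"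
        unfolding abs_mult using out[OF ab(2) i] \<kappa> by (auto intro!: mult_left_mono)
      moreover have "(1 *\<^sub>R d a - \<kappa> *\<^sub>R d b) $ i = \<kappa> * (outward_tangent R b $ i - d b $ i) - (outward_tangent R a $ i - d a $ i)"
        using \<kappa>(2) by (simp add: algebra_simps)
      ultimately show ?thesis using out[OF ab(1) i] by (simp add: distrib_left abs_le_iff mult.commute)
    qed
    have "(1 *\<^sub>R d a - \<kappa> *\<^sub>R d b) $ 3 = 0" using d[of a] d[of b] ab by auto
    then have "norm (1 *\<^sub>R d a - \<kappa> *\<^sub>R d b) \<le> 2 * (\<epsilon> * (1 + \<kappa>))"
      using norm_le_sum_components3[of "1 *\<^sub>R d a - \<kappa> *\<^sub>R d b"] comp[OF disjI1[OF refl]] comp[OF disjI2[OF refl]] by linarith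
    moreover have "k * (1 + \<kappa>) \<le> norm (1 *\<^sub>R d a - \<kappa> *\<^sub>R d b)" using rays[of a b 1 \<kappa>] ab \<kappa> by auto
    moreover have "4 * \<epsilon> * (1 + \<kappa>) \<le> k * (1 + \<kappa>)" using \<epsilon> \<kappa> by (intro mult_right_mono) auto
    moreover have "\<epsilon> * (1 + \<kappa>) > 0" using \<epsilon> \<kappa> by simp
    ultimately show False by linarith
  qed
  ultimately have "legendrian_graph G (\<phi> \<circ> q) R" unfolding legendrian_graph_def by blast
  moreover have "\<phi> ` graph_image G q F = graph_image G (\<phi> \<circ> q) R"
  proof -
    have "(\<lambda>t. \<phi> (F e t)) ` {0..1} = R e ` {0..1}" if "e \<in> arcs G" for e
      using \<phi>F[OF that] by (rule image_cong[OF refl])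
    then show ?thesis
      by (simp add: graph_image_def image_Un image_UN path_image_def image_image)
  qed
  ultimately show ?thesis using that \<phi>(1) by blast
qed

section \<open>Generic position\<close>

definition planar_part :: "real^3 \<Rightarrow> real^3" where
  "planar_part v = vector [v$1, v$2, 0]"

lemma planar_part_nth [simp]: "planar_part v $ 1 = v$1" "planar_part v $ 2 = v$2" "planar_part v $ 3 = 0"
  by (simp_all add: planar_part_def)

lemma vec3_eqI: "(u::real^3)$1 = v$1 \<Longrightarrow> u$2 = v$2 \<Longrightarrow> u$3 = v$3 \<Longrightarrow> u = v"
  by (simp add: vec_eq_iff forall_3)

lemma linear_shears:
  "linear (\<lambda>v::real^3. vector [v$1 - s * v$3, v$2 - t * v$3, v$3] :: real^3)"
  "linear (\<lambda>v::real^3. vector [v$1 + s * v$2, v$2, v$3] :: real^3)"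
  "linear (\<lambda>v::real^3. vector [v$1, v$2, v$3 + s * v$1] :: real^3)"
  "linear (\<lambda>v::real^3. vector [s * v$1, t * v$2, v$3] :: real^3)"
  by (rule linearI; rule vec3_eqI; simp add: algebra_simps)+

text \<open>Every convex combination of the identity with a shear is a shear of the same kind, so
  none has a kernel.\<close>

lemma isotopic_id_shears:
  "isotopic_id (\<lambda>v::real^3. vector [v$1 - s * v$3, v$2 - t * v$3, v$3] :: real^3)"
  "isotopic_id (\<lambda>v::real^3. vector [v$1 + s * v$2, v$2, v$3] :: real^3)"
  "isotopic_id (\<lambda>v::real^3. vector [v$1, v$2, v$3 + s * v$1] :: real^3)"
proof -
  show "isotopic_id (\<lambda>v::real^3. vector [v$1 - s * v$3, v$2 - t * v$3, v$3] :: real^3)"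
  proof (rule isotopic_id_linear[OF linear_shears(1)])
    fix r and v :: "real^3" assume eq: "(1 - r) *\<^sub>R v + r *\<^sub>R vector [v$1 - s * v$3, v$2 - t * v$3, v$3] = 0"
    have "v$3 = 0" using arg_cong[OF eq, of "\<lambda>x. x $ 3"] by (simp add: algebra_simps)
    then show "v = 0"
      using arg_cong[OF eq, of "\<lambda>x. x $ 1"] arg_cong[OF eq, of "\<lambda>x. x $ 2"]
      by (intro vec3_eqI) (auto simp: algebra_simps)
  qed
  show "isotopic_id (\<lambda>v::real^3. vector [v$1 + s * v$2, v$2, v$3] :: real^3)"
  proof (rule isotopic_id_linear[OF linear_shears(2)])
    fix r and v :: "real^3" assume eq: "(1 - r) *\<^sub>R v + r *\<^sub>R vector [v$1 + s * v$2, v$2, v$3] = 0"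
    have "v$2 = 0" using arg_cong[OF eq, of "\<lambda>x. x $ 2"] by (simp add: algebra_simps)
    then show "v = 0"
      using arg_cong[OF eq, of "\<lambda>x. x $ 1"] arg_cong[OF eq, of "\<lambda>x. x $ 3"]
      by (intro vec3_eqI) (auto simp: algebra_simps)
  qed
  show "isotopic_id (\<lambda>v::real^3. vector [v$1, v$2, v$3 + s * v$1] :: real^3)"
  proof (rule isotopic_id_linear[OF linear_shears(3)])
    fix r and v :: "real^3" assume eq: "(1 - r) *\<^sub>R v + r *\<^sub>R vector [v$1, v$2, v$3 + s * v$1] = 0"
    have "v$1 = 0" using arg_cong[OF eq, of "\<lambda>x. x $ 1"] by (simp add: algebra_simps)
    then show "v = 0"
      using arg_cong[OF eq, of "\<lambda>x. x $ 2"] arg_cong[OF eq, of "\<lambda>x. x $ 3"]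
      by (intro vec3_eqI) (auto simp: algebra_simps)
  qed
qed

lemma isotopic_id_scaling:
  assumes "s > 0" "t > 0"
  shows "isotopic_id (\<lambda>v::real^3. vector [s * v$1, t * v$2, v$3] :: real^3)"
proof (rule isotopic_id_linear[OF linear_shears(4)])
  fix r and v :: "real^3" assume r: "0 \<le> r" "r \<le> 1"
    and eq: "(1 - r) *\<^sub>R v + r *\<^sub>R vector [s * v$1, t * v$2, v$3] = 0"
  have pos: "1 - r + r * k > 0" if "k > 0" for k
    using r that by (cases "r = 1") (auto intro!: add_pos_nonneg)
  have "(1 - r + r * s) * v$1 = 0" "(1 - r + r * t) * v$2 = 0" "v$3 = 0"
    using arg_cong[OF eq, of "\<lambda>x. x $ 1"] arg_cong[OF eq, of "\<lambda>x. x $ 2"] arg_cong[OF eq, of "\<lambda>x. x $ 3"]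
    by (auto simp: algebra_simps)
  then show "v = 0" using pos[OF assms(1)] pos[OF assms(2)] by (intro vec3_eqI) auto
qed

lemma finite_roots_quadratic:
  fixes a b c :: real
  assumes "\<not> (a = 0 \<and> b = 0 \<and> c = 0)"
  shows "finite {t. a + b * t + c * t\<^sup>2 = 0}"
proof -
  have "finite {t. poly [:a, b, c:] t = 0}" by (rule poly_roots_finite) (use assms in auto)
  moreover have "{t. poly [:a, b, c:] t = 0} = {t. a + b * t + c * t\<^sup>2 = 0}"
    by (auto simp: power2_eq_square algebra_simps)
  ultimately show ?thesis by simp
qed

lemma avoid_finitely_many:
  fixes P :: "'a \<Rightarrow> real \<Rightarrow> bool"
  assumes "finite A" "\<And>x. x \<in> A \<Longrightarrow> finite {t. P x t}"
  obtains t where "\<And>x. x \<in> A \<Longrightarrow> \<not> P x t"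
proof -
  have "finite (\<Union>x\<in>A. {t. P x t})" using assms by auto
  then obtain t where "t \<notin> (\<Union>x\<in>A. {t. P x t})" using ex_new_if_finite[OF infinite_UNIV_char_0] by blast
  then show ?thesis using that by auto
qed

text \<open>The first three hypotheses say that the cross product vanishes, in the form in which its
  entries occur as coefficients below.\<close>

lemma vec3_parallel:
  fixes v w :: "real^3"
  assumes "v$1 * w$2 = w$1 * v$2" "v$3 * w$2 = w$3 * v$2" "v$1 * w$3 = w$1 * v$3" "v \<noteq> 0"
  shows "\<exists>k. w = k *\<^sub>R v"
proof -
  consider "v$1 \<noteq> 0" | "v$2 \<noteq> 0" | "v$3 \<noteq> 0" using assms(4) by (metis vec3_eqI zero_index)
  then show ?thesis
  proof cases
    case 1
    then show ?thesis using assms by (intro exI[of _ "w$1 / v$1"] vec3_eqI) (auto simp: field_simps)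
  next
    case 2
    then show ?thesis using assms by (intro exI[of _ "w$2 / v$2"] vec3_eqI) (auto simp: field_simps)
  next
    case 3
    then show ?thesis using assms by (intro exI[of _ "w$3 / v$3"] vec3_eqI) (auto simp: field_simps)
  qed
qed

text \<open>The planar part of \<open>T1\<close> is the projection along
  \<open>(t, t\<^sup>2, 1)\<close>. These directions trace a curve that meets any plane through 0 in
  finitely many points, so non-parallel vectors get parallel projections for finitely many
  \<open>t\<close> only; the cubic terms of the determinant cancel. Two further shears make first
  the \<open>x\<close>- and then the \<open>z\<close>-coordinates nonzero without merging
  directions.\<close>

lemma generic_linear_map:
  fixes D :: "(real^3) set"
  assumes D: "finite D" "0 \<notin> D"
  obtains T where "linear T" "isotopic_id T" "\<And>w. w \<in> D \<Longrightarrow> T w $ 1 \<noteq> 0 \<and> T w $ 3 \<noteq> 0"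
    "\<And>v w. v \<in> D \<Longrightarrow> w \<in> D \<Longrightarrow> \<not> same_direction v w \<Longrightarrow> \<not> same_direction (planar_part (T v)) (planar_part (T w))"
proof -
  define parallel where "parallel v w \<longleftrightarrow> v$1 * w$2 = w$1 * v$2 \<and> v$3 * w$2 = w$3 * v$2 \<and> v$1 * w$3 = w$1 * v$3" for v w :: "real^3"
  define bad where "bad p t \<longleftrightarrow> (fst p $ 1 - t * fst p $ 3 = 0 \<and> fst p $ 2 - t\<^sup>2 * fst p $ 3 = 0) \<or>
     (\<not> parallel (fst p) (snd p) \<and> (fst p $ 1 - t * fst p $ 3) * (snd p $ 2 - t\<^sup>2 * snd p $ 3) =
        (snd p $ 1 - t * snd p $ 3) * (fst p $ 2 - t\<^sup>2 * fst p $ 3))" for p :: "(real^3) \<times> (real^3)" and t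
  obtain t where t: "\<And>p. p \<in> D \<times> D \<Longrightarrow> \<not> bad p t"
  proof (rule avoid_finitely_many[of "D \<times> D" bad])
    fix p assume "p \<in> D \<times> D"
    then obtain v w where p: "p = (v, w)" "v \<in> D" "w \<in> D" by auto
    have "v \<noteq> 0" using p D by auto
    have 1: "finite {t. v$1 - t * v$3 = 0 \<and> v$2 - t\<^sup>2 * v$3 = 0}"
    proof (cases "v$3 = 0")
      case True
      then have "v$1 \<noteq> 0 \<or> v$2 \<noteq> 0" using \<open>v \<noteq> 0\<close> by (metis vec3_eqI zero_index)
      then have "{t. v$1 - t * v$3 = 0 \<and> v$2 - t\<^sup>2 * v$3 = 0} \<subseteq> {}" using True by auto
      then show ?thesis by (rule finite_subset) simp
    next
      case False
      then have "{t. v$1 - t * v$3 = 0 \<and> v$2 - t\<^sup>2 * v$3 = 0} \<subseteq> {v$1 / v$3}" by (auto simp: field_simps)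
      then show ?thesis by (rule finite_subset) simp
    qed
    have 2: "finite {t. \<not> parallel v w \<and> (v$1 - t * v$3) * (w$2 - t\<^sup>2 * w$3) = (w$1 - t * w$3) * (v$2 - t\<^sup>2 * v$3)}"
    proof (cases "parallel v w")
      case False
      have "finite {t. (v$1 * w$2 - w$1 * v$2) + (w$3 * v$2 - v$3 * w$2) * t + (w$1 * v$3 - v$1 * w$3) * t\<^sup>2 = 0}"
        by (rule finite_roots_quadratic) (use False in \<open>auto simp: parallel_def\<close>)
      moreover have "(v$1 - t * v$3) * (w$2 - t\<^sup>2 * w$3) - (w$1 - t * w$3) * (v$2 - t\<^sup>2 * v$3) =
          (v$1 * w$2 - w$1 * v$2) + (w$3 * v$2 - v$3 * w$2) * t + (w$1 * v$3 - v$1 * w$3) * t\<^sup>2" for t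
        by (simp add: algebra_simps)
      then have "{t. \<not> parallel v w \<and> (v$1 - t * v$3) * (w$2 - t\<^sup>2 * w$3) = (w$1 - t * w$3) * (v$2 - t\<^sup>2 * v$3)} \<subseteq>
         {t. (v$1 * w$2 - w$1 * v$2) + (w$3 * v$2 - v$3 * w$2) * t + (w$1 * v$3 - v$1 * w$3) * t\<^sup>2 = 0}"
        by (smt (verit, best) Collect_mono)
      ultimately show ?thesis using finite_subset by blast
    qed simp
    have "{t. bad p t} = {t. v$1 - t * v$3 = 0 \<and> v$2 - t\<^sup>2 * v$3 = 0} \<union>
      {t. \<not> parallel v w \<and> (v$1 - t * v$3) * (w$2 - t\<^sup>2 * w$3) = (w$1 - t * w$3) * (v$2 - t\<^sup>2 * v$3)}"
      by (auto simp: bad_def p)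
    then show "finite {t. bad p t}" using 1 2 by simp
  qed (use D in auto)
  define T1 where "T1 v = (vector [v$1 - t * v$3, v$2 - t\<^sup>2 * v$3, v$3] :: real^3)" for v :: "real^3"
  have T1: "linear T1" "isotopic_id T1" unfolding T1_def by (rule linear_shears isotopic_id_shears)+
  have T1nz: "planar_part (T1 v) \<noteq> 0" if "v \<in> D" for v
  proof
    assume "planar_part (T1 v) = 0"
    then have "planar_part (T1 v) $ 1 = 0" "planar_part (T1 v) $ 2 = 0" by simp_all
    then show False using t[of "(v, v)"] that by (simp add: bad_def T1_def)
  qed
  have T1dir: "\<not> same_direction (planar_part (T1 v)) (planar_part (T1 w))"
    if vw: "v \<in> D" "w \<in> D" "\<not> same_direction v w" for v w
  proof
    assume "same_direction (planar_part (T1 v)) (planar_part (T1 w))"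
    then obtain c where c: "c > 0" "planar_part (T1 v) = c *\<^sub>R planar_part (T1 w)" by (auto simp: same_direction_def)
    have c12: "v$1 - t * v$3 = c * (w$1 - t * w$3)" "v$2 - t\<^sup>2 * v$3 = c * (w$2 - t\<^sup>2 * w$3)"
      using arg_cong[OF c(2), of "\<lambda>x. x $ 1"] arg_cong[OF c(2), of "\<lambda>x. x $ 2"] by (simp_all add: T1_def)
    then have "(v$1 - t * v$3) * (w$2 - t\<^sup>2 * w$3) = (w$1 - t * w$3) * (v$2 - t\<^sup>2 * v$3)"
      by (simp only: mult_ac)
    then have "parallel v w" using t[of "(v, w)"] vw unfolding bad_def fst_conv snd_conv by blast
    moreover have "v \<noteq> 0" "w \<noteq> 0" using vw D by auto
    ultimately obtain k where k: "w = k *\<^sub>R v" using vec3_parallel by (auto simp: parallel_def)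
    \<comment> \<open>Parallel vectors without a common direction are opposite, and a linear map
      keeps them opposite; as the image is nonzero, it cannot be a positive multiple of its
      negative.\<close>
    have "k \<noteq> 0" using k \<open>w \<noteq> 0\<close> by auto
    then have "v = (1/k) *\<^sub>R w" using k by simp
    then have "same_direction v w" if "k > 0"
      unfolding same_direction_def using that by (intro exI[of _ "1 / k"] conjI) auto
    then have "\<not> k > 0" using vw(3) by blast
    then have "k < 0" using \<open>k \<noteq> 0\<close> by simp
    have "planar_part (T1 w) = k *\<^sub>R planar_part (T1 v)" by (rule vec3_eqI) (simp_all add: k T1_def algebra_simps)
    then have "planar_part (T1 v) = c *\<^sub>R (k *\<^sub>R planar_part (T1 v))" using c(2) by metis
    then have "planar_part (T1 v) = (c * k) *\<^sub>R planar_part (T1 v)" by (simp only: scaleR_scaleR)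
    then have "(1 - c * k) *\<^sub>R planar_part (T1 v) = 0" unfolding scaleR_left_diff_distrib scaleR_one right_minus_eq .
    moreover have "c * k < 0" using c(1) \<open>k < 0\<close> by (simp add: mult_pos_neg)
    ultimately show False using T1nz[OF vw(1)] by simp
  qed
  obtain s where s: "\<And>v. v \<in> D \<Longrightarrow> \<not> T1 v $ 1 + s * T1 v $ 2 = 0"
  proof (rule avoid_finitely_many[OF D(1), of "\<lambda>v s. T1 v $ 1 + s * T1 v $ 2 = 0"])
    fix v assume v: "v \<in> D"
    have "\<not> (T1 v $ 1 = 0 \<and> T1 v $ 2 = 0)" using T1nz[OF v] by (metis planar_part_nth vec3_eqI zero_index)
    then have "finite {x. T1 v $ 1 + T1 v $ 2 * x + 0 * x\<^sup>2 = 0}" by (intro finite_roots_quadratic) auto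
    then show "finite {s. T1 v $ 1 + s * T1 v $ 2 = 0}" by (simp add: mult.commute)
  qed auto
  define T2 where "T2 v = (vector [v$1 + s * v$2, v$2, v$3] :: real^3)" for v :: "real^3"
  have T2: "linear T2" "isotopic_id T2" unfolding T2_def by (rule linear_shears isotopic_id_shears)+
  obtain r where r: "\<And>v. v \<in> D \<Longrightarrow> \<not> T2 (T1 v) $ 3 + r * T2 (T1 v) $ 1 = 0"
  proof (rule avoid_finitely_many[OF D(1), of "\<lambda>v r. T2 (T1 v) $ 3 + r * T2 (T1 v) $ 1 = 0"])
    fix v assume v: "v \<in> D"
    have "T2 (T1 v) $ 1 \<noteq> 0" using s[OF v] by (simp add: T2_def)
    then have "finite {x. T2 (T1 v) $ 3 + T2 (T1 v) $ 1 * x + 0 * x\<^sup>2 = 0}" by (intro finite_roots_quadratic) auto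
    then show "finite {r. T2 (T1 v) $ 3 + r * T2 (T1 v) $ 1 = 0}" by (simp add: mult.commute)
  qed auto
  define T3 where "T3 v = (vector [v$1, v$2, v$3 + r * v$1] :: real^3)" for v :: "real^3"
  have T3: "linear T3" "isotopic_id T3" unfolding T3_def by (rule linear_shears isotopic_id_shears)+
  have pT: "planar_part ((T3 \<circ> (T2 \<circ> T1)) v) = T2 (planar_part (T1 v))" for v
    by (rule vec3_eqI) (simp_all add: T2_def T3_def)
  have T2dir: "same_direction a b" if "same_direction (T2 a) (T2 b)" for a b
  proof -
    obtain c where c: "c > 0" "T2 a = c *\<^sub>R T2 b" using \<open>same_direction (T2 a) (T2 b)\<close> by (auto simp: same_direction_def)
    have "a $ 2 = c * b $ 2" "a $ 3 = c * b $ 3" "a $ 1 + s * a $ 2 = c * (b $ 1 + s * b $ 2)"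
      using arg_cong[OF c(2), of "\<lambda>x. x $ 2"] arg_cong[OF c(2), of "\<lambda>x. x $ 3"] arg_cong[OF c(2), of "\<lambda>x. x $ 1"]
      by (simp_all add: T2_def)
    then have "a = c *\<^sub>R b" by (intro vec3_eqI) (auto simp: algebra_simps)
    then show ?thesis using c(1) by (auto simp: same_direction_def)
  qed
  show ?thesis
  proof (rule that[of "T3 \<circ> (T2 \<circ> T1)"])
    show "linear (T3 \<circ> (T2 \<circ> T1))" by (intro linear_compose T1 T2 T3)
    show "isotopic_id (T3 \<circ> (T2 \<circ> T1))" by (intro isotopic_id_compose T1 T2 T3)
    show "(T3 \<circ> (T2 \<circ> T1)) w $ 1 \<noteq> 0 \<and> (T3 \<circ> (T2 \<circ> T1)) w $ 3 \<noteq> 0" if "w \<in> D" for w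
      using s[OF that] r[OF that] by (simp add: T2_def T3_def)
    show "\<not> same_direction (planar_part ((T3 \<circ> (T2 \<circ> T1)) v)) (planar_part ((T3 \<circ> (T2 \<circ> T1)) w))"
      if "v \<in> D" "w \<in> D" "\<not> same_direction v w" for v w
      unfolding pT using T1dir[OF that] T2dir by blast
  qed
qed

section \<open>Families of strands\<close>

definition strand_tip :: "real \<Rightarrow> bool \<Rightarrow> real" where
  "strand_tip l b = (if b then l else 0)"

text \<open>The planar direction pointing from the tip \<open>b\<close> into the strand.\<close>

definition strand_dir :: "real \<Rightarrow> bool \<Rightarrow> real^3" where
  "strand_dir m b = (if b then - 1 else 1) *\<^sub>R vector [1, m, 0]"

lemma strand_dir_nth [simp]:
  "strand_dir m b $ 1 = (if b then - 1 else 1)" "strand_dir m b $ 2 = (if b then - m else m)" "strand_dir m b $ 3 = 0"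
  by (simp_all add: strand_dir_def)

lemma straight_diff: "straight A m w u' - straight A m w u = (u' - u) *\<^sub>R vector [1, m, w]"
  by (rule vec3_eqI) (simp_all add: straight_def algebra_simps)

lemma straight_nth [simp]:
  "straight A m w u $ 1 = A $ 1 + u" "straight A m w u $ 2 = A $ 2 + m * u" "straight A m w u $ 3 = A $ 3 + w * u"
  by (simp_all add: straight_def)

text \<open>Disjoint strands are at least \<open>d0\<close> apart, and each is displaced by little
  more than \<open>2 * \<Lambda> * Y\<close>, whence \<open>4 * \<Lambda> * Y < d0\<close>. Strands
  that meet do so at tips; there the planar directions spread, and planar displacements are below
  \<open>\<alpha>\<close> times the distance to the tip.\<close>

lemma legendrian_strands:
  fixes A :: "'j \<Rightarrow> real^3" and L m w :: "'j \<Rightarrow> real" and \<Lambda> Y d0 :: real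
  assumes fin: "finite J"
    and L: "\<And>j. j \<in> J \<Longrightarrow> 0 < L j \<and> L j \<le> \<Lambda>"
    and m: "\<And>j. j \<in> J \<Longrightarrow> \<bar>m j\<bar> \<le> 1/4" and w: "\<And>j. j \<in> J \<Longrightarrow> w j \<noteq> 0 \<and> 4 * Y \<le> \<bar>w j\<bar>"
    and Y: "\<And>j u. j \<in> J \<Longrightarrow> 0 \<le> u \<Longrightarrow> u \<le> L j \<Longrightarrow> \<bar>A j $ 2 + m j * u\<bar> \<le> Y"
    and meet: "\<And>j j' u u'. j \<in> J \<Longrightarrow> j' \<in> J \<Longrightarrow> j \<noteq> j' \<Longrightarrow> u \<in> {0..L j} \<Longrightarrow> u' \<in> {0..L j'} \<Longrightarrow>
      straight (A j) (m j) (w j) u = straight (A j') (m j') (w j') u' \<Longrightarrow>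
      \<exists>b b'. u = strand_tip (L j) b \<and> u' = strand_tip (L j') b' \<and> \<not> same_direction (strand_dir (m j) b) (strand_dir (m j') b')"
    and sep: "\<And>j j' u u'. j \<in> J \<Longrightarrow> j' \<in> J \<Longrightarrow> u \<in> {0..L j} \<Longrightarrow> u' \<in> {0..L j'} \<Longrightarrow>
      (\<forall>t\<in>{0..L j}. \<forall>t'\<in>{0..L j'}. straight (A j) (m j) (w j) t \<noteq> straight (A j') (m j') (w j') t') \<Longrightarrow>
      d0 \<le> norm (straight (A j) (m j) (w j) u - straight (A j') (m j') (w j') u')"
    and d0: "4 * \<Lambda> * Y < d0"
  obtains \<Psi> \<phi> where "isotopic_id \<phi>" "\<And>j u. j \<in> J \<Longrightarrow> u \<in> {0..L j} \<Longrightarrow> \<phi> (straight (A j) (m j) (w j) u) = \<Psi> j u"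
    "\<And>j. j \<in> J \<Longrightarrow> \<exists>C. \<forall>a\<in>{0..L j}. \<forall>b\<in>{0..L j}. norm (\<Psi> j b - \<Psi> j a) \<le> C * \<bar>b - a\<bar>"
    "\<And>j. j \<in> J \<Longrightarrow> \<exists>B. horizontal_on {0..L j} (\<Psi> j) B"
    "\<And>j. j \<in> J \<Longrightarrow> locally_expanding_on {0..L j} (\<Psi> j)"
    "\<And>j. j \<in> J \<Longrightarrow> \<exists>l>0. \<forall>u\<in>{0..L j}. u \<le> l \<or> L j - l \<le> u \<longrightarrow>
       \<Psi> j u $ 1 = A j $ 1 + u \<and> \<Psi> j u $ 2 = A j $ 2 + m j * u"
proof -
  define S where "S j = straight (A j) (m j) (w j)" for j
  define P where "P = {((j, b), (j', b')) | j b j' b'. j \<in> J \<and> j' \<in> J \<and> \<not> same_direction (strand_dir (m j) b) (strand_dir (m j') b')}"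
  have "P \<subseteq> (J \<times> UNIV) \<times> (J \<times> UNIV)" by (auto simp: P_def)
  then have finP: "finite P" by (rule finite_subset) (simp add: fin)
  have dir0: "strand_dir x b \<noteq> 0" for x b
  proof
    assume "strand_dir x b = 0"
    then have "strand_dir x b $ 1 = 0" by simp
    then show False by (simp split: if_splits)
  qed
  obtain k where k: "k > 0" "\<And>p. p \<in> P \<Longrightarrow> \<forall>a\<ge>0. \<forall>a'\<ge>0. k * (a + a') \<le>
     norm (a *\<^sub>R strand_dir (m (fst (fst p))) (snd (fst p)) - a' *\<^sub>R strand_dir (m (fst (snd p))) (snd (snd p)))"
  proof (rule finite_uniform_lower[OF finP, where P = "\<lambda>p k. \<forall>a\<ge>0. \<forall>a'\<ge>0. k * (a + a') \<le>
     norm (a *\<^sub>R strand_dir (m (fst (fst p))) (snd (fst p)) - a' *\<^sub>R strand_dir (m (fst (snd p))) (snd (snd p)))"])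
    fix p assume "p \<in> P"
    then have "\<not> same_direction (strand_dir (m (fst (fst p))) (snd (fst p))) (strand_dir (m (fst (snd p))) (snd (snd p)))"
      by (auto simp: P_def)
    from rays_apart[OF dir0 dir0 this]
    show "\<exists>k>0. \<forall>a\<ge>0. \<forall>a'\<ge>0. k * (a + a') \<le>
     norm (a *\<^sub>R strand_dir (m (fst (fst p))) (snd (fst p)) - a' *\<^sub>R strand_dir (m (fst (snd p))) (snd (snd p)))" by metis
  next
    fix p and c c' :: real
    assume *: "\<forall>a\<ge>0. \<forall>a'\<ge>0. c * (a + a') \<le>
     norm (a *\<^sub>R strand_dir (m (fst (fst p))) (snd (fst p)) - a' *\<^sub>R strand_dir (m (fst (snd p))) (snd (snd p)))" and "c' \<le> c"
    show "\<forall>a\<ge>0. \<forall>a'\<ge>0. c' * (a + a') \<le>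
     norm (a *\<^sub>R strand_dir (m (fst (fst p))) (snd (fst p)) - a' *\<^sub>R strand_dir (m (fst (snd p))) (snd (snd p)))"
    proof (intro allI impI)
      fix a a' :: real assume a: "0 \<le> a" "0 \<le> a'"
      have "c' * (a + a') \<le> c * (a + a')" using a \<open>c' \<le> c\<close> by (intro mult_right_mono) auto
      then show "c' * (a + a') \<le>
     norm (a *\<^sub>R strand_dir (m (fst (fst p))) (snd (fst p)) - a' *\<^sub>R strand_dir (m (fst (snd p))) (snd (snd p)))"
        using *[rule_format, OF a] by (rule order_trans)
    qed
  qed auto
  \<comment> \<open>The planar errors of two strands then use up half of the spreading rate
    \<open>k\<close>.\<close>
  define \<alpha> where "\<alpha> = k / 4"
  \<comment> \<open>A quarter of the surplus of \<open>d0\<close>: two displacements together are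
    then at most \<open>(d0 + 4 * \<Lambda> * Y) / 2\<close>, which is less than
    \<open>d0\<close>.\<close>
  define \<eta> where "\<eta> = (d0 - 4 * \<Lambda> * Y) / 4"
  have \<alpha>: "\<alpha> > 0" and \<eta>: "\<eta> > 0" using k(1) d0 by (auto simp: \<alpha>_def \<eta>_def)
  \<comment> \<open>Curve and constants have to be chosen simultaneously for each strand, hence one
    predicate on quadruples.\<close>
  define good where "good j x = (case x of (\<Psi>, C, c, l) \<Rightarrow> C > 0 \<and> c > 0 \<and> l > 0 \<and> \<Psi> 0 = S j 0 \<and> \<Psi> (L j) = S j (L j) \<and>
    (\<forall>u\<in>{0..L j}. u \<le> l \<or> L j - l \<le> u \<longrightarrow> \<Psi> u $ 1 = S j u $ 1 \<and> \<Psi> u $ 2 = S j u $ 2) \<and>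
    (\<forall>u\<in>{0..L j}. \<bar>\<Psi> u $ 1 - S j u $ 1\<bar> \<le> \<alpha> * min u (L j - u) \<and> \<bar>\<Psi> u $ 2 - S j u $ 2\<bar> \<le> \<alpha> * min u (L j - u) \<and>
       norm (\<Psi> u - S j u) \<le> 2 * L j * Y + \<eta>) \<and>
    (\<forall>u\<in>{0..L j}. \<forall>u'\<in>{0..L j}. norm (\<Psi> u' - \<Psi> u) \<le> C * \<bar>u' - u\<bar> \<and> (\<forall>s. 0 \<le> s \<longrightarrow> s \<le> 1 \<longrightarrow>
       c * \<bar>u' - u\<bar> \<le> norm ((S j u' + s *\<^sub>R (\<Psi> u' - S j u')) - (S j u + s *\<^sub>R (\<Psi> u - S j u))))) \<and>
    horizontal_on {0..L j} \<Psi> C \<and> locally_expanding_on {0..L j} \<Psi>)" for j x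
  have "\<exists>x. good j x" if j: "j \<in> J" for j
  proof -
    have 1: "0 < L j" "\<bar>m j\<bar> \<le> 1/4" "w j \<noteq> 0" "4 * Y \<le> \<bar>w j\<bar>" using L m w j by auto
    show ?thesis
    proof (rule legendrian_strand[of "L j" "m j" "w j" Y "A j" \<alpha> \<eta>, OF 1 Y[OF j] \<alpha> \<eta>], assumption+, goal_cases)
      case prems: (1 \<Psi> C c l)
      have "good j (\<Psi>, C, c, l)" unfolding good_def prod.case S_def
        by (intro conjI ballI allI impI) (rule prems prems(7)[THEN conjunct1] prems(7)[THEN conjunct2] | assumption)+
      then show ?case ..
    qed
  qed
  then have "\<forall>j\<in>J. \<exists>x. good j x" by blast
  from bchoice[OF this] obtain f where f: "\<And>j. j \<in> J \<Longrightarrow> good j (f j)" by blast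
  define \<Psi> where "\<Psi> j = fst (f j)" for j
  define C where "C j = fst (snd (f j))" for j
  define c where "c j = fst (snd (snd (f j)))" for j
  define l where "l j = snd (snd (snd (f j)))" for j
  have "good j (\<Psi> j, C j, c j, l j)" if "j \<in> J" for j using f[OF that] by (simp add: \<Psi>_def C_def c_def l_def)
  note g = this[unfolded good_def prod.case]
  define \<Delta> where "\<Delta> j u = \<Psi> j u - S j u" for j u
  have \<Delta>tip: "\<Delta> j (strand_tip (L j) b) = 0" if "j \<in> J" for j b using g[OF that] by (auto simp: \<Delta>_def strand_tip_def)
  have tip: "strand_tip (L j) b \<in> {0..L j}" if "j \<in> J" for j b using L[OF that] by (auto simp: strand_tip_def)
  obtain K where K: "K > 0" "\<And>j. j \<in> J \<Longrightarrow> \<forall>u\<in>{0..L j}. \<forall>u'\<in>{0..L j}. norm (\<Delta> j u' - \<Delta> j u) \<le> K * \<bar>u' - u\<bar>"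
  proof (rule finite_uniform_upper[OF fin, where P = "\<lambda>j K. \<forall>u\<in>{0..L j}. \<forall>u'\<in>{0..L j}. norm (\<Delta> j u' - \<Delta> j u) \<le> K * \<bar>u' - u\<bar>"])
    fix j assume j: "j \<in> J"
    show "\<exists>K. \<forall>u\<in>{0..L j}. \<forall>u'\<in>{0..L j}. norm (\<Delta> j u' - \<Delta> j u) \<le> K * \<bar>u' - u\<bar>"
    proof (intro exI[of _ "C j + norm (vector [1, m j, w j] :: real^3)"] ballI)
      fix u u' assume u: "u \<in> {0..L j}" "u' \<in> {0..L j}"
      have "\<Delta> j u' - \<Delta> j u = (\<Psi> j u' - \<Psi> j u) - (u' - u) *\<^sub>R vector [1, m j, w j]"
        unfolding straight_diff[of "A j", symmetric] by (simp add: \<Delta>_def S_def)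
      then have "norm (\<Delta> j u' - \<Delta> j u) \<le> norm (\<Psi> j u' - \<Psi> j u) + \<bar>u' - u\<bar> * norm (vector [1, m j, w j] :: real^3)"
        by (metis norm_triangle_ineq4 norm_scaleR)
      moreover have "norm (\<Psi> j u' - \<Psi> j u) \<le> C j * \<bar>u' - u\<bar>" using g[OF j] u by blast
      ultimately show "norm (\<Delta> j u' - \<Delta> j u) \<le> (C j + norm (vector [1, m j, w j] :: real^3)) * \<bar>u' - u\<bar>"
        by (simp add: algebra_simps)
    qed
  next
    fix j and C C' :: real
    assume *: "\<forall>u\<in>{0..L j}. \<forall>u'\<in>{0..L j}. norm (\<Delta> j u' - \<Delta> j u) \<le> C * \<bar>u' - u\<bar>" and "C \<le> C'"
    have "C * \<bar>x\<bar> \<le> C' * \<bar>x\<bar>" for x using \<open>C \<le> C'\<close> by (intro mult_right_mono) auto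
    then show "\<forall>u\<in>{0..L j}. \<forall>u'\<in>{0..L j}. norm (\<Delta> j u' - \<Delta> j u) \<le> C' * \<bar>u' - u\<bar>" using * by (meson order_trans)
  qed auto
  obtain c0 where c0: "c0 > 0" "\<And>j. j \<in> J \<Longrightarrow> c0 \<le> c j"
  proof (rule finite_uniform_lower[OF fin, where P = "\<lambda>j x. x \<le> c j"])
    fix j assume "j \<in> J"
    then show "\<exists>x>0. x \<le> c j" using g by blast
  qed auto
  \<comment> \<open>After the 1, there is one summand for each kind of pair: on a single strand, on
    strands meeting at a tip, on disjoint strands. The maximum with 0 keeps
    \<open>KK \<ge> 1\<close> also for empty \<open>J\<close>, when the signs of the constants are
    unknown.\<close>
  define KK where "KK = 1 + K / c0 + 2 * K / k + max 0 ((d0 + 4 * \<Lambda> * Y) / (d0 - 4 * \<Lambda> * Y))"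
  have KK: "K \<le> KK * c0" "K \<le> KK * (k / 2)" "KK \<ge> 1" "(d0 + 4 * \<Lambda> * Y) / 2 \<le> KK * ((d0 - 4 * \<Lambda> * Y) / 2)"
  proof -
    have p: "K / c0 > 0" "2 * K / k > 0" using K c0 k by auto
    then show "KK \<ge> 1" by (auto simp: KK_def)
    have "K / c0 \<le> KK" "2 * K / k \<le> KK" "(d0 + 4 * \<Lambda> * Y) / (d0 - 4 * \<Lambda> * Y) \<le> KK" using p by (auto simp: KK_def)
    then have "K \<le> KK * c0" "2 * K \<le> KK * k" "d0 + 4 * \<Lambda> * Y \<le> KK * (d0 - 4 * \<Lambda> * Y)"
      using c0(1) k(1) d0 by (simp_all add: pos_divide_le_eq)
    then show "K \<le> KK * c0" "K \<le> KK * (k / 2)" "(d0 + 4 * \<Lambda> * Y) / 2 \<le> KK * ((d0 - 4 * \<Lambda> * Y) / 2)" by simp_all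
  qed
  have small: "norm (\<Delta> j u) \<le> (d0 + 4 * \<Lambda> * Y) / 4" if j: "j \<in> J" and u: "u \<in> {0..L j}" for j u
  proof -
    have "Y \<ge> 0" using Y[OF j, of 0] L[OF j] by auto
    then have "L j * Y \<le> \<Lambda> * Y" using L[OF j] by (intro mult_right_mono) auto
    moreover have "norm (\<Delta> j u) \<le> 2 * L j * Y + \<eta>" using g[OF j] u unfolding \<Delta>_def by blast
    moreover have "n \<le> (d0 + 4 * y) / 4" if "x \<le> y" "n \<le> 2 * x + (d0 - 4 * y) / 4" for n x y :: real
      using that by (simp add: field_simps)
    ultimately show ?thesis unfolding \<eta>_def mult.assoc by blast
  qed
  have smalls: "norm (s *\<^sub>R \<Delta> j u) \<le> (d0 + 4 * \<Lambda> * Y) / 4" if "j \<in> J" "u \<in> {0..L j}" "0 \<le> s" "s \<le> 1" for j u s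
  proof -
    have "s * norm (\<Delta> j u) \<le> 1 * norm (\<Delta> j u)" using that by (intro mult_right_mono) auto
    then show ?thesis using small[OF that(1,2)] that(3) by simp
  qed
  have pair: "norm (\<Delta> j u - \<Delta> j' u') \<le> KK * norm ((S j u + s *\<^sub>R \<Delta> j u) - (S j' u' + s *\<^sub>R \<Delta> j' u'))"
    if j: "j \<in> J" "j' \<in> J" and u: "u \<in> {0..L j}" "u' \<in> {0..L j'}" and s: "0 \<le> s" "s \<le> 1" for j u j' u' s
  proof -
    let ?N = "norm ((S j u + s *\<^sub>R \<Delta> j u) - (S j' u' + s *\<^sub>R \<Delta> j' u'))"
    consider "j = j'" | t t' where "j \<noteq> j'" "t \<in> {0..L j}" "t' \<in> {0..L j'}" "S j t = S j' t'"
      | "\<forall>t\<in>{0..L j}. \<forall>t'\<in>{0..L j'}. S j t \<noteq> S j' t'" by blast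
    then show ?thesis
    proof cases
      case 1
      have u'': "u' \<in> {0..L j}" using u 1 by simp
      have low: "c j * \<bar>u - u'\<bar> \<le> ?N" using g[OF j(1)] u(1) u'' s unfolding \<Delta>_def 1[symmetric] by blast
      have "norm (\<Delta> j u - \<Delta> j' u') \<le> K * \<bar>u - u'\<bar>" using K(2)[OF j(1)] u(1) u'' unfolding 1[symmetric] by blast
      also have "\<dots> \<le> KK * c0 * \<bar>u - u'\<bar>" using KK by (intro mult_right_mono) auto
      also have "\<dots> = KK * (c0 * \<bar>u - u'\<bar>)" by simp
      also have "c0 * \<bar>u - u'\<bar> \<le> c j * \<bar>u - u'\<bar>" using c0(2)[OF j(1)] by (intro mult_right_mono) auto
      also note low
      finally show ?thesis using KK by simp
    next
      case (2 t t')
      obtain b b' where b: "t = strand_tip (L j) b" "t' = strand_tip (L j') b'"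
        "\<not> same_direction (strand_dir (m j) b) (strand_dir (m j') b')"
        using meet[OF j 2(1-3)] 2(4) unfolding S_def by blast
      define a a' where "a = \<bar>u - strand_tip (L j) b\<bar>" and "a' = \<bar>u' - strand_tip (L j') b'\<bar>"
      have aa: "a \<ge> 0" "a' \<ge> 0" by (auto simp: a_def a'_def)
      have ub: "u = strand_tip (L j) b + (if b then - a else a)" "u' = strand_tip (L j') b' + (if b' then - a' else a')"
        "min u (L j - u) \<le> a" "min u' (L j' - u') \<le> a'"
        using u by (auto simp: a_def a'_def strand_tip_def)
      have comp: "\<bar>((S j u + s *\<^sub>R \<Delta> j u) - (S j' u' + s *\<^sub>R \<Delta> j' u')) $ i -
          (a *\<^sub>R strand_dir (m j) b - a' *\<^sub>R strand_dir (m j') b') $ i\<bar> \<le> \<alpha> * (a + a')"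
        if i: "i = 1 \<or> i = 2" for i
      proof -
        have sm: "\<bar>s * x\<bar> \<le> y" if "\<bar>x\<bar> \<le> y" for x y :: real
        proof -
          have "s * \<bar>x\<bar> \<le> 1 * \<bar>x\<bar>" using s by (intro mult_right_mono) auto
          then show ?thesis using that s by (simp add: abs_mult)
        qed
        have "\<alpha> * min u (L j - u) \<le> \<alpha> * a" "\<alpha> * min u' (L j' - u') \<le> \<alpha> * a'"
          using ub \<alpha> by (simp_all add: mult_left_mono del: min_less_iff_conj)
        moreover have "\<bar>\<Delta> j u $ i\<bar> \<le> \<alpha> * min u (L j - u)" using g[OF j(1)] u(1) i by (auto simp: \<Delta>_def)
        moreover have "\<bar>\<Delta> j' u' $ i\<bar> \<le> \<alpha> * min u' (L j' - u')" using g[OF j(2)] u(2) i by (auto simp: \<Delta>_def)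
        ultimately have "\<bar>s * \<Delta> j u $ i\<bar> \<le> \<alpha> * a" "\<bar>s * \<Delta> j' u' $ i\<bar> \<le> \<alpha> * a'" using sm by (meson order_trans)+
        moreover have "S j u $ i = S j t $ i + a * strand_dir (m j) b $ i" "S j' u' $ i = S j' t' $ i + a' * strand_dir (m j') b' $ i"
          unfolding b(1,2) using i by (auto simp: S_def algebra_simps ub(1) ub(2))
        then have "((S j u + s *\<^sub>R \<Delta> j u) - (S j' u' + s *\<^sub>R \<Delta> j' u')) $ i -
          (a *\<^sub>R strand_dir (m j) b - a' *\<^sub>R strand_dir (m j') b') $ i = s * \<Delta> j u $ i - s * \<Delta> j' u' $ i"
          using 2(4) by simp
        ultimately show ?thesis by (simp add: distrib_left abs_le_iff)
      qed
      have "norm (a *\<^sub>R strand_dir (m j) b - a' *\<^sub>R strand_dir (m j') b') - 2 * (\<alpha> * (a + a')) \<le> ?N"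
        by (rule norm_ge_planar_part) (simp, rule comp, simp, rule comp, simp)
      moreover have "((j, b), (j', b')) \<in> P" using j b by (auto simp: P_def)
      from k(2)[OF this] aa have "k * (a + a') \<le> norm (a *\<^sub>R strand_dir (m j) b - a' *\<^sub>R strand_dir (m j') b')" by simp
      moreover have "4 * (\<alpha> * (a + a')) = k * (a + a')" by (simp add: \<alpha>_def)
      ultimately have low: "k / 2 * (a + a') \<le> ?N" by (simp add: algebra_simps)
      have "norm (\<Delta> j u - \<Delta> j (strand_tip (L j) b)) \<le> K * a" using K(2)[OF j(1)] u(1) tip[OF j(1), of b] unfolding a_def by blast
      moreover have "norm (\<Delta> j' u' - \<Delta> j' (strand_tip (L j') b')) \<le> K * a'" using K(2)[OF j(2)] u(2) tip[OF j(2), of b'] unfolding a'_def by blast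
      ultimately have "norm (\<Delta> j u - \<Delta> j' u') \<le> K * (a + a')"
        using norm_triangle_ineq4[of "\<Delta> j u" "\<Delta> j' u'"] \<Delta>tip[OF j(1), of b] \<Delta>tip[OF j(2), of b'] by (simp add: distrib_left)
      also have "\<dots> \<le> KK * (k / 2) * (a + a')" using KK aa by (intro mult_right_mono) auto
      also have "\<dots> \<le> KK * ?N" using mult_left_mono[OF low, of KK] KK by (simp add: mult.assoc)
      finally show ?thesis .
    next
      case 3
      then have "d0 \<le> norm (S j u - S j' u')" using sep[OF j u] unfolding S_def by blast
      moreover have "S j u - S j' u' = ((S j u + s *\<^sub>R \<Delta> j u) - (S j' u' + s *\<^sub>R \<Delta> j' u')) - (s *\<^sub>R \<Delta> j u - s *\<^sub>R \<Delta> j' u')" by simp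
      then have "norm (S j u - S j' u') \<le> ?N + norm (s *\<^sub>R \<Delta> j u - s *\<^sub>R \<Delta> j' u')" by (metis norm_triangle_ineq4)
      moreover have "norm (s *\<^sub>R \<Delta> j u - s *\<^sub>R \<Delta> j' u') \<le> (d0 + 4 * \<Lambda> * Y) / 2"
        using norm_triangle_ineq4[of "s *\<^sub>R \<Delta> j u" "s *\<^sub>R \<Delta> j' u'"] smalls[OF j(1) u(1) s] smalls[OF j(2) u(2) s] by simp
      ultimately have low: "(d0 - 4 * \<Lambda> * Y) / 2 \<le> ?N" by (simp add: field_simps)
      have "norm (\<Delta> j u - \<Delta> j' u') \<le> (d0 + 4 * \<Lambda> * Y) / 2"
        using norm_triangle_ineq4[of "\<Delta> j u" "\<Delta> j' u'"] small[OF j(1) u(1)] small[OF j(2) u(2)] by simp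
      also note KK(4)
      also have "KK * ((d0 - 4 * \<Lambda> * Y) / 2) \<le> KK * ?N" using low KK(3) by (intro mult_left_mono) auto
      finally show ?thesis .
    qed
  qed
  define I where "I = (SIGMA j:J. {0..L j})"
  define FF where "FF = (\<lambda>(j, u). S j u)"
  define DD where "DD = (\<lambda>(j, u). \<Delta> j u)"
  have "norm (DD a - DD b) \<le> KK * norm ((FF a + s *\<^sub>R DD a) - (FF b + s *\<^sub>R DD b))"
    if "a \<in> I" "b \<in> I" and s: "0 \<le> s" "s \<le> 1" for a b and s :: real
    using that(1,2) pair[OF _ _ _ _ s] by (auto simp: I_def FF_def DD_def)
  then obtain \<phi> where \<phi>: "isotopic_id \<phi>" "\<And>a. a \<in> I \<Longrightarrow> \<phi> (FF a) = FF a + DD a"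
    by (rule isotopic_id_straight_line[of I DD KK FF]) (assumption | rule that | blast)+
  show ?thesis
  proof (rule that[of \<phi> \<Psi>])
    show "\<phi> (straight (A j) (m j) (w j) u) = \<Psi> j u" if "j \<in> J" "u \<in> {0..L j}" for j u
      using \<phi>(2)[of "(j, u)"] that by (auto simp: I_def FF_def DD_def \<Delta>_def S_def)
    fix j assume j: "j \<in> J"
    show "\<exists>C. \<forall>a\<in>{0..L j}. \<forall>b\<in>{0..L j}. norm (\<Psi> j b - \<Psi> j a) \<le> C * \<bar>b - a\<bar>" using g[OF j] by blast
    show "\<exists>B. horizontal_on {0..L j} (\<Psi> j) B" using g[OF j] by blast
    show "locally_expanding_on {0..L j} (\<Psi> j)" using g[OF j] by blast
    show "\<exists>l>0. \<forall>u\<in>{0..L j}. u \<le> l \<or> L j - l \<le> u \<longrightarrow>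
       \<Psi> j u $ 1 = A j $ 1 + u \<and> \<Psi> j u $ 2 = A j $ 2 + m j * u"
      using g[OF j] unfolding S_def straight_nth by blast
  qed (rule \<phi>(1))
qed

section \<open>Gluing strands\<close>

definition orient :: "bool \<Rightarrow> real^3 \<Rightarrow> real^3" where
  "orient c v = (if c then - v else v)"

lemma orient_nth [simp]: "orient c v $ i = (if c then - (v $ i) else v $ i)"
  by (simp add: orient_def)

text \<open>The regularity that the smoothing demands of an edge. The three parts are bundled
  because gluing uses the Lipschitz bound to preserve horizontality.\<close>

definition gentle_on :: "real set \<Rightarrow> (real \<Rightarrow> real^3) \<Rightarrow> bool" where
  "gentle_on T F \<longleftrightarrow> (\<exists>C. \<forall>a\<in>T. \<forall>b\<in>T. norm (F b - F a) \<le> C * \<bar>b - a\<bar>) \<and>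
     (\<exists>B. horizontal_on T F B) \<and> locally_expanding_on T F"

lemma gentle_on_affine:
  assumes F: "gentle_on T F" and \<beta>: "\<beta> \<noteq> 0"
    and G: "\<And>t. t \<in> T' \<Longrightarrow> \<alpha> + \<beta> * t \<in> T \<and> G t = F (\<alpha> + \<beta> * t)"
  shows "gentle_on T' G"
  unfolding gentle_on_def
proof (intro conjI)
  obtain C where C: "\<And>a b. a \<in> T \<Longrightarrow> b \<in> T \<Longrightarrow> norm (F b - F a) \<le> C * \<bar>b - a\<bar>" using F unfolding gentle_on_def by blast
  show "\<exists>C. \<forall>a\<in>T'. \<forall>b\<in>T'. norm (G b - G a) \<le> C * \<bar>b - a\<bar>"
  proof (intro exI[of _ "C * \<bar>\<beta>\<bar>"] ballI)
    fix a b assume ab: "a \<in> T'" "b \<in> T'"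
    have "(\<alpha> + \<beta> * b) - (\<alpha> + \<beta> * a) = \<beta> * (b - a)" by (simp add: algebra_simps)
    then show "norm (G b - G a) \<le> C * \<bar>\<beta>\<bar> * \<bar>b - a\<bar>"
      using C[of "\<alpha> + \<beta> * a" "\<alpha> + \<beta> * b"] G[OF ab(1)] G[OF ab(2)] by (simp add: abs_mult mult.assoc)
  qed
  obtain B where B: "horizontal_on T F B" using F unfolding gentle_on_def by blast
  show "\<exists>B. horizontal_on T' G B"
  proof (intro exI[of _ "B * \<beta>\<^sup>2"])
    show "horizontal_on T' G (B * \<beta>\<^sup>2)" unfolding horizontal_on_def
    proof (intro ballI)
      fix u u' assume u: "u \<in> T'" "u' \<in> T'"
      have "(\<alpha> + \<beta> * u') - (\<alpha> + \<beta> * u) = \<beta> * (u' - u)" by (simp add: algebra_simps)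
      moreover have "\<bar>F (\<alpha> + \<beta> * u') $ 3 - F (\<alpha> + \<beta> * u) $ 3 - F (\<alpha> + \<beta> * u) $ 2 * (F (\<alpha> + \<beta> * u') $ 1 - F (\<alpha> + \<beta> * u) $ 1)\<bar>
          \<le> B * ((\<alpha> + \<beta> * u') - (\<alpha> + \<beta> * u))\<^sup>2"
        using B G[OF u(1)] G[OF u(2)] unfolding horizontal_on_def by blast
      ultimately show "\<bar>G u' $ 3 - G u $ 3 - G u $ 2 * (G u' $ 1 - G u $ 1)\<bar> \<le> B * \<beta>\<^sup>2 * (u' - u)\<^sup>2"
        using G[OF u(1)] G[OF u(2)] by (simp add: power_mult_distrib mult.assoc)
    qed
  qed
  show "locally_expanding_on T' G" unfolding locally_expanding_on_def
  proof
    fix u assume u: "u \<in> T'"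
    then have "\<alpha> + \<beta> * u \<in> T" using G by blast
    then obtain \<nu> c \<rho> where e: "\<nu> $ 3 = 0" "c > 0" "\<rho> > 0"
      "\<And>a b. a \<in> T \<Longrightarrow> b \<in> T \<Longrightarrow> \<bar>a - (\<alpha> + \<beta> * u)\<bar> < \<rho> \<Longrightarrow> \<bar>b - (\<alpha> + \<beta> * u)\<bar> < \<rho> \<Longrightarrow> a \<le> b \<Longrightarrow> c * (b - a) \<le> \<nu> \<bullet> (F b - F a)"
      using F unfolding gentle_on_def locally_expanding_on_def by blast
    have near: "\<bar>(\<alpha> + \<beta> * a) - (\<alpha> + \<beta> * u)\<bar> < \<rho>" if "\<bar>a - u\<bar> < \<rho> / \<bar>\<beta>\<bar>" for a
    proof -
      have "(\<alpha> + \<beta> * a) - (\<alpha> + \<beta> * u) = \<beta> * (a - u)" by (simp add: algebra_simps)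
      then show ?thesis using that \<beta> by (simp add: abs_mult pos_less_divide_eq mult.commute)
    qed
    show "\<exists>\<nu> c \<rho>. \<nu> $ 3 = 0 \<and> 0 < c \<and> 0 < \<rho> \<and> (\<forall>a\<in>T'. \<forall>b\<in>T'. \<bar>a - u\<bar> < \<rho> \<and> \<bar>b - u\<bar> < \<rho> \<and> a \<le> b \<longrightarrow> c * (b - a) \<le> \<nu> \<bullet> (G b - G a))"
    \<comment> \<open>For \<open>\<beta> < 0\<close> the curve is run backwards, and the functional
      changes its sign.\<close>
    proof (rule exI[of _ "sgn \<beta> *\<^sub>R \<nu>"], rule exI[of _ "c * \<bar>\<beta>\<bar>"], rule exI[of _ "\<rho> / \<bar>\<beta>\<bar>"], intro conjI ballI impI)
      fix a b assume ab: "a \<in> T'" "b \<in> T'" "\<bar>a - u\<bar> < \<rho> / \<bar>\<beta>\<bar> \<and> \<bar>b - u\<bar> < \<rho> / \<bar>\<beta>\<bar> \<and> a \<le> b"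
      note Ga = G[OF ab(1)] and Gb = G[OF ab(2)]
      have n: "\<bar>(\<alpha> + \<beta> * a) - (\<alpha> + \<beta> * u)\<bar> < \<rho>" "\<bar>(\<alpha> + \<beta> * b) - (\<alpha> + \<beta> * u)\<bar> < \<rho>" using near ab(3) by blast+
      show "c * \<bar>\<beta>\<bar> * (b - a) \<le> (sgn \<beta> *\<^sub>R \<nu>) \<bullet> (G b - G a)"
      proof (cases "\<beta> > 0")
        case True
        then have "\<alpha> + \<beta> * a \<le> \<alpha> + \<beta> * b" using ab(3) by simp
        then have "c * ((\<alpha> + \<beta> * b) - (\<alpha> + \<beta> * a)) \<le> \<nu> \<bullet> (G b - G a)" using e(4) Ga Gb n by metis
        moreover have "c * ((\<alpha> + \<beta> * b) - (\<alpha> + \<beta> * a)) = c * \<bar>\<beta>\<bar> * (b - a)" using True by (simp add: algebra_simps)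
        moreover have "(sgn \<beta> *\<^sub>R \<nu>) \<bullet> (G b - G a) = \<nu> \<bullet> (G b - G a)" using True by simp
        ultimately show ?thesis by metis
      next
        case False
        then have "\<beta> < 0" using \<beta> by simp
        then have "\<alpha> + \<beta> * b \<le> \<alpha> + \<beta> * a" using ab(3) by simp
        then have "c * ((\<alpha> + \<beta> * a) - (\<alpha> + \<beta> * b)) \<le> \<nu> \<bullet> (G a - G b)" using e(4) Ga Gb n by metis
        moreover have "c * ((\<alpha> + \<beta> * a) - (\<alpha> + \<beta> * b)) = c * \<bar>\<beta>\<bar> * (b - a)" using \<open>\<beta> < 0\<close> by (simp add: algebra_simps)
        moreover have "(sgn \<beta> *\<^sub>R \<nu>) \<bullet> (G b - G a) = \<nu> \<bullet> (G a - G b)" using \<open>\<beta> < 0\<close> by (simp add: inner_diff_right)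
        ultimately show ?thesis by metis
      qed
    qed (use e \<beta> in auto)
  qed
qed

text \<open>The bisector \<open>norm v *\<^sub>R u + norm u *\<^sub>R v\<close> has positive inner
  product with both vectors unless \<open>v\<close> points opposite to \<open>u\<close>, which is an
  equality case of Cauchy-Schwarz.\<close>

lemma corner_functional:
  fixes u v :: "real^3"
  assumes u: "u \<noteq> 0" "u $ 3 = 0" and v: "v \<noteq> 0" "v $ 3 = 0" and uv: "\<not> same_direction (- u) v"
  obtains \<nu> c where "\<nu> $ 3 = 0" "c > 0" "c \<le> \<nu> \<bullet> u" "c \<le> \<nu> \<bullet> v"
proof -
  have lt: "- u \<bullet> v < norm u * norm v"
  proof (rule ccontr)
    assume "\<not> ?thesis"
    then have "(- u) \<bullet> v = norm (- u) * norm v" using norm_cauchy_schwarz[of "- u" v] by simp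
    then have eq: "norm (- u) *\<^sub>R v = norm v *\<^sub>R (- u)" by (simp only: norm_cauchy_schwarz_eq)
    have "- u = (1 / norm v) *\<^sub>R (norm v *\<^sub>R (- u))" using v by simp
    also have "\<dots> = (norm u / norm v) *\<^sub>R v" unfolding eq[symmetric] by simp
    finally have "same_direction (- u) v" unfolding same_direction_def using u v by (intro exI[of _ "norm u / norm v"]) simp
    then show False using uv by blast
  qed
  define \<nu> where "\<nu> = norm v *\<^sub>R u + norm u *\<^sub>R v"
  have "\<nu> \<bullet> u = norm u * (norm u * norm v - (- u \<bullet> v))" "\<nu> \<bullet> v = norm v * (norm u * norm v - (- u \<bullet> v))"
    by (simp_all add: \<nu>_def inner_add_left dot_square_norm power2_eq_square inner_commute algebra_simps)
  then have "\<nu> \<bullet> u > 0" "\<nu> \<bullet> v > 0" using lt u v by simp_all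
  then show ?thesis using that[of \<nu> "min (\<nu> \<bullet> u) (\<nu> \<bullet> v)"] u v by (simp add: \<nu>_def)
qed

text \<open>Across the corner, horizontality costs only the product of a \<open>y\<close>-increment
  on one side and an \<open>x\<close>-increment on the other, which the Lipschitz bound makes
  quadratic. At the corner itself a functional positive on both directions expands, since the
  projection does not turn straight back.\<close>

lemma gentle_on_glue:
  assumes F: "gentle_on {x..p} F" "gentle_on {p..y} F" and p: "x < p" "p < y" and l: "l > 0"
    and u: "u \<noteq> 0" "u $ 3 = 0" and v: "v \<noteq> 0" "v $ 3 = 0" and uv: "\<not> same_direction (- u) v"
    and left: "\<And>t k. 0 \<le> t \<Longrightarrow> t \<le> l \<Longrightarrow> k = 1 \<or> k = 2 \<Longrightarrow> F (p - t) $ k = F p $ k - t * u $ k"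
    and right: "\<And>t k. 0 \<le> t \<Longrightarrow> t \<le> l \<Longrightarrow> k = 1 \<or> k = 2 \<Longrightarrow> F (p + t) $ k = F p $ k + t * v $ k"
  shows "gentle_on {x..y} F"
proof -
  obtain C1 where C1: "\<And>a b. a \<in> {x..p} \<Longrightarrow> b \<in> {x..p} \<Longrightarrow> norm (F b - F a) \<le> C1 * \<bar>b - a\<bar>" using F(1) unfolding gentle_on_def by blast
  obtain C2 where C2: "\<And>a b. a \<in> {p..y} \<Longrightarrow> b \<in> {p..y} \<Longrightarrow> norm (F b - F a) \<le> C2 * \<bar>b - a\<bar>" using F(2) unfolding gentle_on_def by blast
  define C where "C = \<bar>C1\<bar> + \<bar>C2\<bar>"
  have C0: "C \<ge> 0" by (simp add: C_def)
  have "C1 * \<bar>t\<bar> \<le> C * \<bar>t\<bar>" "C2 * \<bar>t\<bar> \<le> C * \<bar>t\<bar>" for t by (intro mult_right_mono; simp add: C_def)+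
  then have side: "norm (F b - F a) \<le> C * \<bar>b - a\<bar>" if "a \<in> {x..p} \<and> b \<in> {x..p} \<or> a \<in> {p..y} \<and> b \<in> {p..y}" for a b
    using C1 C2 that by (meson order_trans)
  obtain B1 B2 where B12: "horizontal_on {x..p} F B1" "horizontal_on {p..y} F B2" using F unfolding gentle_on_def by blast
  define B where "B = \<bar>B1\<bar> + \<bar>B2\<bar>"
  have B0: "B \<ge> 0" by (simp add: B_def)
  have "B1 * t\<^sup>2 \<le> B * t\<^sup>2" "B2 * t\<^sup>2 \<le> B * t\<^sup>2" for t by (intro mult_right_mono; simp add: B_def)+
  then have hside: "\<bar>F b $ 3 - F a $ 3 - F a $ 2 * (F b $ 1 - F a $ 1)\<bar> \<le> B * (b - a)\<^sup>2"
    if "a \<in> {x..p} \<and> b \<in> {x..p} \<or> a \<in> {p..y} \<and> b \<in> {p..y}" for a b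
    using B12 that unfolding horizontal_on_def by (meson order_trans)
  have across: "a \<in> {x..p} \<and> b \<in> {p..y} \<or> a \<in> {p..y} \<and> b \<in> {x..p} \<or> (a \<in> {x..p} \<and> b \<in> {x..p} \<or> a \<in> {p..y} \<and> b \<in> {p..y})"
    if "a \<in> {x..y}" "b \<in> {x..y}" for a b using that by auto
  have pp: "p \<in> {x..p}" "p \<in> {p..y}" using p by auto
  have lip: "norm (F b - F a) \<le> C * \<bar>b - a\<bar>" if ab: "a \<in> {x..p} \<and> b \<in> {p..y} \<or> a \<in> {p..y} \<and> b \<in> {x..p}" for a b
  proof -
    have "norm (F b - F a) \<le> norm (F b - F p) + norm (F p - F a)" using norm_triangle_ineq[of "F b - F p" "F p - F a"] by simp
    also have "\<dots> \<le> C * \<bar>b - p\<bar> + C * \<bar>p - a\<bar>" using side[of p b] side[of a p] ab pp by (meson add_mono)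
    also have "\<dots> = C * (\<bar>b - p\<bar> + \<bar>p - a\<bar>)" by (simp add: distrib_left)
    also have "\<bar>b - p\<bar> + \<bar>p - a\<bar> = \<bar>b - a\<bar>" using ab by auto
    finally show ?thesis .
  qed
  have hor: "\<bar>F b $ 3 - F a $ 3 - F a $ 2 * (F b $ 1 - F a $ 1)\<bar> \<le> (B + C\<^sup>2) * (b - a)\<^sup>2"
    if ab: "a \<in> {x..p} \<and> b \<in> {p..y} \<or> a \<in> {p..y} \<and> b \<in> {x..p}" for a b
  proof -
    let ?h = "\<lambda>a b. F b $ 3 - F a $ 3 - F a $ 2 * (F b $ 1 - F a $ 1)"
    have "\<bar>F p $ 2 - F a $ 2\<bar> \<le> C * \<bar>p - a\<bar>" "\<bar>F b $ 1 - F p $ 1\<bar> \<le> C * \<bar>b - p\<bar>"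
      using side[of a p] side[of p b] ab pp component_abs_le_norm[of "F p - F a" 2] component_abs_le_norm[of "F b - F p" 1]
      unfolding vector_minus_component by (meson order_trans)+
    then have "\<bar>(F p $ 2 - F a $ 2) * (F b $ 1 - F p $ 1)\<bar> \<le> (C * \<bar>p - a\<bar>) * (C * \<bar>b - p\<bar>)"
      unfolding abs_mult by (rule mult_mono) (use C0 in auto)
    moreover have "\<bar>?h a p\<bar> \<le> B * (p - a)\<^sup>2" "\<bar>?h p b\<bar> \<le> B * (b - p)\<^sup>2" using hside[of a p] hside[of p b] ab pp by blast+
    moreover have "?h a b = ?h a p + ?h p b + (F p $ 2 - F a $ 2) * (F b $ 1 - F p $ 1)" by (simp add: algebra_simps)
    ultimately have 1: "\<bar>?h a b\<bar> \<le> B * (p - a)\<^sup>2 + B * (b - p)\<^sup>2 + (C * \<bar>p - a\<bar>) * (C * \<bar>b - p\<bar>)" by linarith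
    define q r where "q = \<bar>p - a\<bar>" and "r = \<bar>b - p\<bar>"
    have qr: "q \<ge> 0" "r \<ge> 0" "(b - a)\<^sup>2 = (q + r)\<^sup>2" "(p - a)\<^sup>2 = q\<^sup>2" "(b - p)\<^sup>2 = r\<^sup>2"
    proof -
      have "\<bar>b - a\<bar> = q + r" using ab by (auto simp: q_def r_def)
      then show "(b - a)\<^sup>2 = (q + r)\<^sup>2" by (metis power2_abs)
    qed (simp_all add: q_def r_def)
    have "B * q\<^sup>2 + B * r\<^sup>2 + (C * q) * (C * r) + (B * (2 * q * r) + C\<^sup>2 * (q\<^sup>2 + q * r + r\<^sup>2)) = (B + C\<^sup>2) * (q + r)\<^sup>2"
      by (simp add: power2_eq_square algebra_simps)
    moreover have "B * (2 * q * r) + C\<^sup>2 * (q\<^sup>2 + q * r + r\<^sup>2) \<ge> 0" using qr B0 by simp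
    moreover have "\<bar>?h a b\<bar> \<le> B * q\<^sup>2 + B * r\<^sup>2 + (C * q) * (C * r)" using 1 unfolding qr(4,5) q_def[symmetric] r_def[symmetric] .
    ultimately show ?thesis unfolding qr(3) by linarith
  qed
  show ?thesis unfolding gentle_on_def
  proof (intro conjI)
    show "\<exists>C. \<forall>a\<in>{x..y}. \<forall>b\<in>{x..y}. norm (F b - F a) \<le> C * \<bar>b - a\<bar>"
    proof (rule exI[of _ C], intro ballI)
      fix a b assume "a \<in> {x..y}" "b \<in> {x..y}"
      then show "norm (F b - F a) \<le> C * \<bar>b - a\<bar>" using across[of a b] lip[of a b] side[of a b] by blast
    qed
    have "B * t\<^sup>2 \<le> (B + C\<^sup>2) * t\<^sup>2" for t by (intro mult_right_mono) auto
    then have weaker: "B * (b - a)\<^sup>2 \<le> (B + C\<^sup>2) * (b - a)\<^sup>2" for a b .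
    have "horizontal_on {x..y} F (B + C\<^sup>2)" unfolding horizontal_on_def
    proof (intro ballI)
      fix a b assume "a \<in> {x..y}" "b \<in> {x..y}"
      then show "\<bar>F b $ 3 - F a $ 3 - F a $ 2 * (F b $ 1 - F a $ 1)\<bar> \<le> (B + C\<^sup>2) * (b - a)\<^sup>2"
        using across[of a b] hor[of a b] order_trans[OF hside[of a b] weaker[of b a]] by blast
    qed
    then show "\<exists>B. horizontal_on {x..y} F B" ..
    obtain \<nu> c where \<nu>: "\<nu> $ 3 = 0" "c > 0" "c \<le> \<nu> \<bullet> u" "c \<le> \<nu> \<bullet> v" using corner_functional[OF u v uv] .
    show "locally_expanding_on {x..y} F" unfolding locally_expanding_on_def
    proof
      fix t assume t: "t \<in> {x..y}"
      consider "t < p" | "t > p" | "t = p" by linarith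
      then show "\<exists>\<nu> c \<rho>. \<nu> $ 3 = 0 \<and> 0 < c \<and> 0 < \<rho> \<and> (\<forall>a\<in>{x..y}. \<forall>b\<in>{x..y}. \<bar>a - t\<bar> < \<rho> \<and> \<bar>b - t\<bar> < \<rho> \<and> a \<le> b \<longrightarrow> c * (b - a) \<le> \<nu> \<bullet> (F b - F a))"
      proof cases
        case 1
        then have "t \<in> {x..p}" using t by simp
        then obtain \<nu> c \<rho> where e: "\<nu> $ 3 = 0" "c > 0" "\<rho> > 0"
          "\<And>a b. a \<in> {x..p} \<Longrightarrow> b \<in> {x..p} \<Longrightarrow> \<bar>a - t\<bar> < \<rho> \<Longrightarrow> \<bar>b - t\<bar> < \<rho> \<Longrightarrow> a \<le> b \<Longrightarrow> c * (b - a) \<le> \<nu> \<bullet> (F b - F a)"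
          using F(1) unfolding gentle_on_def locally_expanding_on_def by blast
        show ?thesis
          by (rule exI[of _ \<nu>], rule exI[of _ c], rule exI[of _ "min \<rho> (p - t)"], intro conjI ballI impI e) (use e(3) 1 in \<open>auto simp: abs_less_iff\<close>)
      next
        case 2
        then have "t \<in> {p..y}" using t by simp
        then obtain \<nu> c \<rho> where e: "\<nu> $ 3 = 0" "c > 0" "\<rho> > 0"
          "\<And>a b. a \<in> {p..y} \<Longrightarrow> b \<in> {p..y} \<Longrightarrow> \<bar>a - t\<bar> < \<rho> \<Longrightarrow> \<bar>b - t\<bar> < \<rho> \<Longrightarrow> a \<le> b \<Longrightarrow> c * (b - a) \<le> \<nu> \<bullet> (F b - F a)"
          using F(2) unfolding gentle_on_def locally_expanding_on_def by blast
        show ?thesis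
          by (rule exI[of _ \<nu>], rule exI[of _ c], rule exI[of _ "min \<rho> (t - p)"], intro conjI ballI impI e) (use e(3) 2 in \<open>auto simp: abs_less_iff\<close>)
      next
        case 3
        have hl: "\<nu> \<bullet> (F a - F p) = (a - p) * (\<nu> \<bullet> u)" if "a \<le> p" "p - a \<le> l" for a
        proof -
          have "F a $ k - F p $ k = (a - p) * u $ k" if "k = 1 \<or> k = 2" for k
            using left[of "p - a", OF _ _ that] \<open>a \<le> p\<close> \<open>p - a \<le> l\<close> by (simp add: left_diff_distrib)
          from this[of 1] this[of 2] show ?thesis using \<nu>(1) u(2) by (simp add: inner_vec3 distrib_left mult_ac)
        qed
        have hr: "\<nu> \<bullet> (F a - F p) = (a - p) * (\<nu> \<bullet> v)" if "p \<le> a" "a - p \<le> l" for a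
        proof -
          have "F a $ k - F p $ k = (a - p) * v $ k" if "k = 1 \<or> k = 2" for k
            using right[of "a - p", OF _ _ that] \<open>p \<le> a\<close> \<open>a - p \<le> l\<close> by simp
          from this[of 1] this[of 2] show ?thesis using \<nu>(1) v(2) by (simp add: inner_vec3 distrib_left mult_ac)
        qed
        have "c * (b - a) \<le> \<nu> \<bullet> (F b - F a)" if ab: "\<bar>a - p\<bar> < l" "\<bar>b - p\<bar> < l" "a \<le> b" for a b
        proof -
          have split: "\<nu> \<bullet> (F b - F a) = \<nu> \<bullet> (F b - F p) - \<nu> \<bullet> (F a - F p)" by (simp add: inner_diff_right)
          consider "b \<le> p" | "p \<le> a" | "a \<le> p" "p \<le> b" by linarith
          then show ?thesis
          proof cases
            case 1
            have "(b - a) * c \<le> (b - a) * (\<nu> \<bullet> u)" using \<nu> ab by (intro mult_left_mono) auto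
            then show ?thesis using hl[of a] hl[of b] ab 1 unfolding split by (simp add: algebra_simps)
          next
            case 2
            have "(b - a) * c \<le> (b - a) * (\<nu> \<bullet> v)" using \<nu> ab by (intro mult_left_mono) auto
            then show ?thesis using hr[of a] hr[of b] ab 2 unfolding split by (simp add: algebra_simps)
          next
            case 3
            have "(p - a) * c \<le> (p - a) * (\<nu> \<bullet> u)" "(b - p) * c \<le> (b - p) * (\<nu> \<bullet> v)" using \<nu> 3 by (intro mult_left_mono; simp)+
            then show ?thesis using hl[of a] hr[of b] ab 3 unfolding split by (simp add: algebra_simps)
          qed
        qed
        note * = this
        show ?thesis unfolding 3
          by (rule exI[of _ \<nu>], rule exI[of _ c], rule exI[of _ l]) (use \<nu> l * in auto)
      qed
    qed
  qed
qed

text \<open>A diagonal scaling of the plane does not change which directions coincide; the factors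
  \<open>\<xi>\<close> and \<open>\<mu>\<close> absorb the normalisation of strand directions by
  their first coordinate.\<close>

lemma same_direction_scaled:
  fixes u v x y :: "real^3"
  assumes uv: "same_direction u v" and pos: "\<xi> > 0" "\<mu> > 0" "s > 0" "t > 0"
    and u: "u $ 1 = \<xi> * s * x $ 1" "u $ 2 = \<xi> * t * x $ 2" and v: "v $ 1 = \<mu> * s * y $ 1" "v $ 2 = \<mu> * t * y $ 2"
    and xy: "x $ 3 = 0" "y $ 3 = 0"
  shows "same_direction x y"
proof -
  obtain \<kappa> where \<kappa>: "\<kappa> > 0" "u = \<kappa> *\<^sub>R v" using uv by (auto simp: same_direction_def)
  have "\<xi> * s * x $ 1 = \<kappa> * (\<mu> * s * y $ 1)" "\<xi> * t * x $ 2 = \<kappa> * (\<mu> * t * y $ 2)"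
    unfolding u[symmetric] v[symmetric] using \<kappa>(2) by simp_all
  then have "x = (\<kappa> * \<mu> / \<xi>) *\<^sub>R y" using pos xy by (intro vec3_eqI) (simp_all add: field_simps)
  then show ?thesis unfolding same_direction_def using pos \<kappa> by (intro exI[of _ "\<kappa> * \<mu> / \<xi>"]) simp
qed

text \<open>Scaling by \<open>s\<close> and \<open>t\<close> brings arbitrary segments into the
  range of the strand construction: slopes become small through \<open>t / s\<close>, and both sides
  of the separation inequality carry one factor \<open>t\<close>, so that \<open>s\<close> alone
  decides it.\<close>

lemma legendrian_segments:
  fixes a D :: "'j \<Rightarrow> real^3"
  assumes fin: "finite J"
    and D: "\<And>j. j \<in> J \<Longrightarrow> D j $ 1 \<noteq> 0 \<and> D j $ 3 \<noteq> 0"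
    and meet: "\<And>j j' \<tau> \<tau>'. j \<in> J \<Longrightarrow> j' \<in> J \<Longrightarrow> j \<noteq> j' \<Longrightarrow> \<tau> \<in> {0..1} \<Longrightarrow> \<tau>' \<in> {0..1} \<Longrightarrow>
      a j + \<tau> *\<^sub>R D j = a j' + \<tau>' *\<^sub>R D j' \<Longrightarrow>
      \<exists>c c'. \<tau> = of_bool c \<and> \<tau>' = of_bool c' \<and> \<not> same_direction (planar_part (orient c (D j))) (planar_part (orient c' (D j')))"
  obtains \<Phi> \<Psi> \<delta> where "isotopic_id \<Phi>" "\<And>j \<tau>. j \<in> J \<Longrightarrow> \<tau> \<in> {0..1} \<Longrightarrow> \<Phi> (a j + \<tau> *\<^sub>R D j) = \<Psi> j \<tau>"
    "\<And>j. j \<in> J \<Longrightarrow> gentle_on {0..1} (\<Psi> j)"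
    "\<And>j. j \<in> J \<Longrightarrow> \<delta> j $ 1 \<noteq> 0 \<and> \<delta> j $ 3 = 0"
    "\<And>j. j \<in> J \<Longrightarrow> \<exists>l>0. l \<le> 1 \<and> (\<forall>\<tau>\<in>{0..l}. \<forall>k\<in>{1, 2}. \<Psi> j \<tau> $ k = \<Psi> j 0 $ k + \<tau> * \<delta> j $ k \<and> \<Psi> j (1 - \<tau>) $ k = \<Psi> j 1 $ k - \<tau> * \<delta> j $ k)"
    "\<And>j j' c c'. j \<in> J \<Longrightarrow> j' \<in> J \<Longrightarrow> j \<noteq> j' \<Longrightarrow> a j + of_bool c *\<^sub>R D j = a j' + of_bool c' *\<^sub>R D j' \<Longrightarrow>
      \<not> same_direction (orient c (\<delta> j)) (orient c' (\<delta> j'))"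
proof -
  define seg where "seg j \<tau> = a j + \<tau> *\<^sub>R D j" for j \<tau>
  obtain R where R: "R > 0" "\<And>j. j \<in> J \<Longrightarrow> norm (D j) \<le> R \<and> norm (a j) \<le> R"
  proof (rule finite_uniform_upper[OF fin, where P = "\<lambda>j R. norm (D j) \<le> R \<and> norm (a j) \<le> R"])
    show "\<exists>R. norm (D j) \<le> R \<and> norm (a j) \<le> R" for j by (rule exI[of _ "max (norm (D j)) (norm (a j))"]) simp
  qed auto
  obtain r where r: "r > 0" "\<And>j. j \<in> J \<Longrightarrow> r \<le> \<bar>D j $ 1\<bar> \<and> r \<le> \<bar>D j $ 3\<bar>"
  proof (rule finite_uniform_lower[OF fin, where P = "\<lambda>j r. r \<le> \<bar>D j $ 1\<bar> \<and> r \<le> \<bar>D j $ 3\<bar>"])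
    show "\<exists>r>0. r \<le> \<bar>D j $ 1\<bar> \<and> r \<le> \<bar>D j $ 3\<bar>" if "j \<in> J" for j
      by (rule exI[of _ "min \<bar>D j $ 1\<bar> \<bar>D j $ 3\<bar>"]) (use D[OF that] in auto)
  qed auto
  have "finite (J \<times> J)" using fin by simp
  then obtain d1 where d1: "d1 > 0" "\<And>p. p \<in> J \<times> J \<Longrightarrow> (\<forall>t\<in>{0..1}. \<forall>t'\<in>{0..1}. seg (fst p) t \<noteq> seg (snd p) t') \<longrightarrow>
      (\<forall>t\<in>{0..1}. \<forall>t'\<in>{0..1}. d1 \<le> norm (seg (fst p) t - seg (snd p) t'))"
  proof (rule finite_uniform_lower[where P = "\<lambda>p d. (\<forall>t\<in>{0..1}. \<forall>t'\<in>{0..1}. seg (fst p) t \<noteq> seg (snd p) t') \<longrightarrow>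
      (\<forall>t\<in>{0..1}. \<forall>t'\<in>{0..1}. d \<le> norm (seg (fst p) t - seg (snd p) t'))"])
    fix p assume "p \<in> J \<times> J"
    have cpt: "compact (seg j ` {0..1})" for j
      unfolding seg_def by (intro compact_continuous_image continuous_intros) simp
    show "\<exists>d>0. (\<forall>t\<in>{0..1}. \<forall>t'\<in>{0..1}. seg (fst p) t \<noteq> seg (snd p) t') \<longrightarrow>
      (\<forall>t\<in>{0..1}. \<forall>t'\<in>{0..1}. d \<le> norm (seg (fst p) t - seg (snd p) t'))"
    proof (cases "\<forall>t\<in>{0..1}. \<forall>t'\<in>{0..1}. seg (fst p) t \<noteq> seg (snd p) t'")
      case True
      then have "seg (fst p) ` {0..1} \<inter> seg (snd p) ` {0..1} = {}" by blast
      from separate_compact_closed[OF cpt compact_imp_closed[OF cpt] this]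
      show ?thesis unfolding dist_norm by blast
    next
      case False
      then show ?thesis by (intro exI[of _ 1]) auto
    qed
  next
    fix p and d d' :: real
    assume "(\<forall>t\<in>{0..1}. \<forall>t'\<in>{0..1}. seg (fst p) t \<noteq> seg (snd p) t') \<longrightarrow>
      (\<forall>t\<in>{0..1}. \<forall>t'\<in>{0..1}. d \<le> norm (seg (fst p) t - seg (snd p) t'))" "d' \<le> d"
    then show "(\<forall>t\<in>{0..1}. \<forall>t'\<in>{0..1}. seg (fst p) t \<noteq> seg (snd p) t') \<longrightarrow>
      (\<forall>t\<in>{0..1}. \<forall>t'\<in>{0..1}. d' \<le> norm (seg (fst p) t - seg (snd p) t'))" by (meson order_trans)
  qed auto
  \<comment> \<open>\<open>\<rho>\<close> is the ratio \<open>t / s\<close> and brings the slopes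
    \<open>m\<close> to at most 1/4. In \<open>s\<close>, the bound with \<open>r\<close> yields
    \<open>4 * Y \<le> \<bar>w\<bar>\<close>, the one with \<open>d1\<close> the separation of
    disjoint strands.\<close>
  define \<rho> where "\<rho> = min 1 (r / (4 * R))"
  define s where "s = min 1 (min d1 r / (16 * R\<^sup>2))"
  define t where "t = s * \<rho>"
  have \<rho>: "\<rho> > 0" "\<rho> \<le> 1" "\<rho> * (4 * R) \<le> r" using R(1) r(1) by (auto simp: \<rho>_def min_def field_simps)
  have s: "s > 0" "s \<le> 1" using R(1) r(1) d1(1) by (auto simp: s_def)
  have "s * (16 * R\<^sup>2) \<le> min d1 r" using R(1) by (auto simp: s_def min_def field_simps)
  then have s16: "s * (16 * R\<^sup>2) \<le> d1" "s * (16 * R\<^sup>2) \<le> r" by auto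
  have t: "t > 0" "t \<le> s" "t \<le> 1"
  proof -
    show "t > 0" using s \<rho> by (simp add: t_def)
    show "t \<le> s" using mult_left_mono[OF \<rho>(2), of s] s by (simp add: t_def)
    then show "t \<le> 1" using s by simp
  qed
  define T where "T v = (vector [s * v$1, t * v$2, v$3] :: real^3)" for v :: "real^3"
  have T_nth [simp]: "T v $ 1 = s * v $ 1" "T v $ 2 = t * v $ 2" "T v $ 3 = v $ 3" for v by (simp_all add: T_def)
  have T_iso: "isotopic_id T" unfolding T_def by (rule isotopic_id_scaling[OF s(1) t(1)])
  have T_inj: "x = y" if "T x = T y" for x y
  proof -
    have "s * x $ 1 = s * y $ 1" "t * x $ 2 = t * y $ 2" "x $ 3 = y $ 3" using that by (metis T_nth)+
    then show ?thesis using s t by (intro vec3_eqI) auto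
  qed
  \<comment> \<open>As \<open>t \<le> s \<le> 1\<close>, distances shrink at most by the factor
    \<open>t\<close>.\<close>
  have T_norm: "t * norm v \<le> norm (T u - T u')" if "v = u - u'" for u u' v
  proof (rule power2_le_imp_le)
    have "(t * v $ 1)\<^sup>2 \<le> (s * v $ 1)\<^sup>2" "(t * v $ 3)\<^sup>2 \<le> (v $ 3)\<^sup>2"
      unfolding power_mult_distrib using s t by (auto intro!: mult_right_mono mult_left_le_one_le power_mono power_le_one)
    moreover have "(t * norm v)\<^sup>2 = (t * v $ 1)\<^sup>2 + (t * v $ 2)\<^sup>2 + (t * v $ 3)\<^sup>2"
      unfolding power_mult_distrib power2_norm_eq_inner inner_vec3 by (simp add: power2_eq_square algebra_simps)
    moreover have "(norm (T u - T u'))\<^sup>2 = (s * v $ 1)\<^sup>2 + (t * v $ 2)\<^sup>2 + (v $ 3)\<^sup>2"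
      unfolding power2_norm_eq_inner inner_vec3 by (simp add: that power2_eq_square algebra_simps)
    ultimately show "(t * norm v)\<^sup>2 \<le> (norm (T u - T u'))\<^sup>2" by linarith
  qed simp
  \<comment> \<open>Strands run towards increasing \<open>x\<close>, so a segment with
    \<open>D j $ 1 < 0\<close> is traversed from its other end;
    \<open>\<alpha> j + \<beta> j * \<tau>\<close> converts the parameters.\<close>
  define A where "A j = T (if D j $ 1 > 0 then a j else a j + D j)" for j
  define L where "L j = s * \<bar>D j $ 1\<bar>" for j
  define m where "m j = (t / s) * (D j $ 2 / D j $ 1)" for j
  define w where "w j = D j $ 3 / (s * D j $ 1)" for j
  define \<alpha> where "\<alpha> j = (if D j $ 1 > 0 then 0 else L j)" for j
  define \<beta> where "\<beta> j = s * D j $ 1" for j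
  have key: "T (seg j \<tau>) = straight (A j) (m j) (w j) (\<alpha> j + \<beta> j * \<tau>)" if "j \<in> J" for j \<tau>
    using D[OF that] s by (intro vec3_eqI) (auto simp: seg_def A_def m_def w_def \<alpha>_def \<beta>_def L_def field_simps)
  have range: "\<alpha> j + \<beta> j * \<tau> \<in> {0..L j}" if \<tau>: "\<tau> \<in> {0..1}" for j \<tau>
  proof -
    have "s * \<bar>D j $ 1\<bar> * \<tau> \<ge> 0" "s * \<bar>D j $ 1\<bar> * \<tau> \<le> s * \<bar>D j $ 1\<bar>" using \<tau> s by (auto intro!: mult_left_le)
    then show ?thesis by (auto simp: \<alpha>_def \<beta>_def L_def)
  qed
  have onto: "\<exists>\<tau>\<in>{0..1}. u = \<alpha> j + \<beta> j * \<tau>" if j: "j \<in> J" and u: "u \<in> {0..L j}" for j u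
  proof -
    have "\<beta> j \<noteq> 0" using D[OF j] s by (simp add: \<beta>_def)
    then have "u = \<alpha> j + \<beta> j * ((u - \<alpha> j) / \<beta> j)" by simp
    moreover have "(u - \<alpha> j) / \<beta> j \<in> {0..1}"
      using u s D[OF j] by (auto simp: \<alpha>_def \<beta>_def L_def divide_simps mult_neg_pos mult_pos_neg)
    ultimately show ?thesis by blast
  qed
  \<comment> \<open>The tip of the strand that corresponds to the end \<open>c\<close> of the
    segment.\<close>
  define en where "en j c = (if D j $ 1 > 0 then c else \<not> c)" for j c
  have tip: "\<alpha> j + \<beta> j * of_bool c = strand_tip (L j) (en j c)" for j c
    by (auto simp: \<alpha>_def \<beta>_def L_def strand_tip_def en_def)
  have dir: "strand_dir (m j) (en j c) $ 1 = 1 / (s * \<bar>D j $ 1\<bar>) * s * planar_part (orient c (D j)) $ 1"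
    "strand_dir (m j) (en j c) $ 2 = 1 / (s * \<bar>D j $ 1\<bar>) * t * planar_part (orient c (D j)) $ 2" if "j \<in> J" for j c
    using D[OF that] s by (auto simp: en_def m_def divide_simps)
  \<comment> \<open>On the unscaled segments the second coordinate is at most \<open>2 * R\<close>
    in absolute value.\<close>
  define Y where "Y = 2 * R * t"
  have comp: "\<bar>D j $ i\<bar> \<le> R" "\<bar>a j $ i\<bar> \<le> R" if "j \<in> J" for j i
    using R(2)[OF that] component_abs_le_norm[of "D j" i] component_abs_le_norm[of "a j" i] by linarith+
  have seg_y: "\<bar>seg j \<tau> $ 2\<bar> \<le> 2 * R" if "j \<in> J" "\<tau> \<in> {0..1}" for j \<tau>
  proof -
    have "\<bar>\<tau> * D j $ 2\<bar> \<le> 1 * R" unfolding abs_mult using comp[OF that(1), of 2] that(2) by (intro mult_mono) auto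
    then show ?thesis using comp(2)[OF that(1), of 2] by (simp add: seg_def)
  qed
  have J0: "r \<le> R" if "j \<in> J" for j using comp[OF that, of 1] r(2)[OF that] by linarith
  obtain \<Psi> \<phi> where \<phi>: "isotopic_id \<phi>" "\<And>j u. j \<in> J \<Longrightarrow> u \<in> {0..L j} \<Longrightarrow> \<phi> (straight (A j) (m j) (w j) u) = \<Psi> j u"
    and \<Psi>lip: "\<And>j. j \<in> J \<Longrightarrow> \<exists>C. \<forall>a\<in>{0..L j}. \<forall>b\<in>{0..L j}. norm (\<Psi> j b - \<Psi> j a) \<le> C * \<bar>b - a\<bar>"
    and \<Psi>hor: "\<And>j. j \<in> J \<Longrightarrow> \<exists>B. horizontal_on {0..L j} (\<Psi> j) B"
    and \<Psi>exp: "\<And>j. j \<in> J \<Longrightarrow> locally_expanding_on {0..L j} (\<Psi> j)"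
    and \<Psi>end: "\<And>j. j \<in> J \<Longrightarrow> \<exists>l>0. \<forall>u\<in>{0..L j}. u \<le> l \<or> L j - l \<le> u \<longrightarrow> \<Psi> j u $ 1 = A j $ 1 + u \<and> \<Psi> j u $ 2 = A j $ 2 + m j * u"
  proof (rule legendrian_strands[of J L "s * R" m w Y A "d1 * t"])
    fix j assume j: "j \<in> J"
    show "0 < L j \<and> L j \<le> s * R" using D[OF j] comp[OF j] s by (simp add: L_def)
    have D1: "r \<le> \<bar>D j $ 1\<bar>" "r \<le> \<bar>D j $ 3\<bar>" "\<bar>D j $ 1\<bar> > 0" using r D[OF j] j by auto
    have "\<bar>m j\<bar> = \<rho> * \<bar>D j $ 2\<bar> / \<bar>D j $ 1\<bar>" using s \<rho> by (simp add: m_def t_def abs_mult)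
    moreover have "\<rho> * \<bar>D j $ 2\<bar> \<le> \<rho> * R" using comp[OF j] \<rho> by (intro mult_left_mono) auto
    then have "4 * (\<rho> * \<bar>D j $ 2\<bar>) \<le> \<bar>D j $ 1\<bar>" using \<rho>(3) D1(1) by (simp add: mult_ac)
    ultimately show "\<bar>m j\<bar> \<le> 1/4" using D1 by (simp add: pos_divide_le_eq)
    have "w j \<noteq> 0" using D[OF j] s by (simp add: w_def)
    moreover have "4 * Y \<le> \<bar>w j\<bar>"
    proof -
      have "s * \<bar>D j $ 1\<bar> \<le> s * R" using comp[OF j] s by simp
      then have "4 * Y * (s * \<bar>D j $ 1\<bar>) \<le> 4 * Y * (s * R)" using R(1) t by (intro mult_left_mono) (auto simp: Y_def)
      also have "\<dots> = t * (s * (8 * R\<^sup>2))" by (simp add: Y_def power2_eq_square)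
      also have "\<dots> \<le> 1 * (s * (8 * R\<^sup>2))" using t s by (intro mult_right_mono) auto
      also have "\<dots> \<le> \<bar>D j $ 3\<bar>" using s16(2) D1(2) r(1) by simp
      finally show ?thesis using D1(3) s by (simp add: w_def abs_mult pos_le_divide_eq)
    qed
    ultimately show "w j \<noteq> 0 \<and> 4 * Y \<le> \<bar>w j\<bar>" ..
    fix u assume u: "0 \<le> u" "u \<le> L j"
    then obtain \<tau> where \<tau>: "\<tau> \<in> {0..1}" "u = \<alpha> j + \<beta> j * \<tau>" using onto[OF j, of u] by auto
    have "T (seg j \<tau>) $ 2 = A j $ 2 + m j * u" unfolding key[OF j] \<tau>(2) by simp
    moreover have "\<bar>t * seg j \<tau> $ 2\<bar> \<le> t * (2 * R)" unfolding abs_mult using seg_y[OF j \<tau>(1)] t by (intro mult_mono) auto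
    ultimately show "\<bar>A j $ 2 + m j * u\<bar> \<le> Y" by (simp add: Y_def mult_ac)
  next
    fix j j' u u' assume j: "j \<in> J" "j' \<in> J" "j \<noteq> j'" and u: "u \<in> {0..L j}" "u' \<in> {0..L j'}"
      and eq: "straight (A j) (m j) (w j) u = straight (A j') (m j') (w j') u'"
    obtain \<tau> \<tau>' where \<tau>: "\<tau> \<in> {0..1}" "u = \<alpha> j + \<beta> j * \<tau>" "\<tau>' \<in> {0..1}" "u' = \<alpha> j' + \<beta> j' * \<tau>'"
      using onto[OF j(1) u(1)] onto[OF j(2) u(2)] by blast
    have "seg j \<tau> = seg j' \<tau>'" by (rule T_inj) (use eq key[OF j(1)] key[OF j(2)] \<tau> in simp)
    then obtain c c' where c: "\<tau> = of_bool c" "\<tau>' = of_bool c'"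
      "\<not> same_direction (planar_part (orient c (D j))) (planar_part (orient c' (D j')))"
      using meet[OF j \<tau>(1,3)] unfolding seg_def by blast
    have pos: "1 / (s * \<bar>D j $ 1\<bar>) > 0" "1 / (s * \<bar>D j' $ 1\<bar>) > 0" using s D[OF j(1)] D[OF j(2)] by auto
    have "\<not> same_direction (strand_dir (m j) (en j c)) (strand_dir (m j') (en j' c'))"
      using same_direction_scaled[OF _ pos s(1) t(1) dir[OF j(1)] dir[OF j(2)]] c(3) by auto
    then show "\<exists>b b'. u = strand_tip (L j) b \<and> u' = strand_tip (L j') b' \<and> \<not> same_direction (strand_dir (m j) b) (strand_dir (m j') b')"
      unfolding \<tau>(2,4) c(1,2) tip by blast
  next
    fix j j' u u' assume j: "j \<in> J" "j' \<in> J" and u: "u \<in> {0..L j}" "u' \<in> {0..L j'}"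
      and ne: "\<forall>t\<in>{0..L j}. \<forall>t'\<in>{0..L j'}. straight (A j) (m j) (w j) t \<noteq> straight (A j') (m j') (w j') t'"
    obtain \<tau> \<tau>' where \<tau>: "\<tau> \<in> {0..1}" "u = \<alpha> j + \<beta> j * \<tau>" "\<tau>' \<in> {0..1}" "u' = \<alpha> j' + \<beta> j' * \<tau>'"
      using onto[OF j(1) u(1)] onto[OF j(2) u(2)] by blast
    have "seg j x \<noteq> seg j' x'" if "x \<in> {0..1}" "x' \<in> {0..1}" for x x'
    proof
      assume "seg j x = seg j' x'"
      then have "T (seg j x) = T (seg j' x')" by simp
      then show False using ne range[OF that(1), of j] range[OF that(2), of j'] unfolding key[OF j(1)] key[OF j(2)] by blast
    qed
    then have "d1 \<le> norm (seg j \<tau> - seg j' \<tau>')" using d1(2)[of "(j, j')"] j \<tau> by auto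
    then have "t * d1 \<le> t * norm (seg j \<tau> - seg j' \<tau>')" using t by (intro mult_left_mono) auto
    also have "\<dots> \<le> norm (T (seg j \<tau>) - T (seg j' \<tau>'))" by (rule T_norm) simp
    finally show "d1 * t \<le> norm (straight (A j) (m j) (w j) u - straight (A j') (m j') (w j') u')"
      unfolding key[OF j(1)] key[OF j(2)] \<tau>(2,4) by (simp add: mult.commute)
  next
    have "s * (8 * R\<^sup>2) < d1" using s16(1) s R(1) d1(1) by (simp add: algebra_simps)
    then have "s * (8 * R\<^sup>2) * t < d1 * t" using t by simp
    then show "4 * (s * R) * Y < d1 * t" by (simp add: Y_def power2_eq_square mult_ac)
  next
    fix \<Psi> \<phi>
    assume h: "isotopic_id \<phi>" "\<And>j u. j \<in> J \<Longrightarrow> u \<in> {0..L j} \<Longrightarrow> \<phi> (straight (A j) (m j) (w j) u) = \<Psi> j u"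
      "\<And>j. j \<in> J \<Longrightarrow> \<exists>C. \<forall>a\<in>{0..L j}. \<forall>b\<in>{0..L j}. norm (\<Psi> j b - \<Psi> j a) \<le> C * \<bar>b - a\<bar>"
      "\<And>j. j \<in> J \<Longrightarrow> \<exists>B. horizontal_on {0..L j} (\<Psi> j) B"
      "\<And>j. j \<in> J \<Longrightarrow> locally_expanding_on {0..L j} (\<Psi> j)"
      "\<And>j. j \<in> J \<Longrightarrow> \<exists>l>0. \<forall>u\<in>{0..L j}. u \<le> l \<or> L j - l \<le> u \<longrightarrow> \<Psi> j u $ 1 = A j $ 1 + u \<and> \<Psi> j u $ 2 = A j $ 2 + m j * u"
    show thesis by (rule that, (fact h)+)
  qed (rule fin)
  define \<delta> where "\<delta> j = (vector [s * D j $ 1, t * D j $ 2, 0] :: real^3)" for j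
  define \<Psi>' where "\<Psi>' j \<tau> = \<Psi> j (\<alpha> j + \<beta> j * \<tau>)" for j \<tau>
  show ?thesis
  proof (rule that[of "\<phi> \<circ> T" \<Psi>' \<delta>])
    show "isotopic_id (\<phi> \<circ> T)" by (rule isotopic_id_compose[OF T_iso \<phi>(1)])
    show "(\<phi> \<circ> T) (a j + \<tau> *\<^sub>R D j) = \<Psi>' j \<tau>" if "j \<in> J" "\<tau> \<in> {0..1}" for j \<tau>
      using \<phi>(2)[OF that(1) range[OF that(2)]] key[OF that(1), of \<tau>] by (simp add: seg_def \<Psi>'_def)
    fix j assume j: "j \<in> J"
    show "\<delta> j $ 1 \<noteq> 0 \<and> \<delta> j $ 3 = 0" using D[OF j] s by (simp add: \<delta>_def)
    have "gentle_on {0..L j} (\<Psi> j)" unfolding gentle_on_def by (intro conjI \<Psi>lip[OF j] \<Psi>hor[OF j] \<Psi>exp[OF j])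
    moreover have \<beta>0: "\<beta> j \<noteq> 0" using D[OF j] s by (simp add: \<beta>_def)
    ultimately show "gentle_on {0..1} (\<Psi>' j)"
      by (rule gentle_on_affine[where \<alpha> = "\<alpha> j" and \<beta> = "\<beta> j"]) (use range in \<open>auto simp: \<Psi>'_def\<close>)
    obtain l where l: "l > 0" "\<And>u. u \<in> {0..L j} \<Longrightarrow> u \<le> l \<or> L j - l \<le> u \<Longrightarrow> \<Psi> j u $ 1 = A j $ 1 + u \<and> \<Psi> j u $ 2 = A j $ 2 + m j * u"
      using \<Psi>end[OF j] by blast
    have L0: "L j > 0" using D[OF j] s by (simp add: L_def)
    define l' where "l' = min 1 (l / L j)"
    have l': "l' > 0" "l' \<le> 1" "L j * \<tau> \<le> l" if "\<tau> \<le> l'" for \<tau>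
    proof -
      have "\<tau> \<le> l / L j" using that by (simp add: l'_def)
      then show "L j * \<tau> \<le> l" using L0 by (simp add: pos_le_divide_eq mult.commute)
    qed (use l(1) L0 in \<open>auto simp: l'_def\<close>)
    have \<beta>L: "\<beta> j = L j \<or> \<beta> j = - L j" by (auto simp: \<beta>_def L_def)
    have near: "\<Psi>' j \<tau> $ k = T (seg j \<tau>) $ k" if \<tau>: "\<tau> \<in> {0..1}" "\<tau> \<le> l' \<or> 1 - \<tau> \<le> l'" and k: "k = 1 \<or> k = 2" for \<tau> k
    proof -
      have "L j * \<tau> \<le> l \<or> L j * (1 - \<tau>) \<le> l" using l'(3) \<tau>(2) by blast
      then have "\<alpha> j + \<beta> j * \<tau> \<le> l \<or> L j - l \<le> \<alpha> j + \<beta> j * \<tau>"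
        by (auto simp: \<alpha>_def \<beta>_def L_def algebra_simps abs_if split: if_splits)
      from l(2)[OF range[OF \<tau>(1)] this] show ?thesis using k unfolding key[OF j] \<Psi>'_def by auto
    qed
    have lin: "T (seg j \<tau>) $ k = T (seg j \<sigma>) $ k + (\<tau> - \<sigma>) * \<delta> j $ k" if "k = 1 \<or> k = 2" for \<tau> \<sigma> k
      using that by (auto simp: seg_def \<delta>_def algebra_simps)
    show "\<exists>l>0. l \<le> 1 \<and> (\<forall>\<tau>\<in>{0..l}. \<forall>k\<in>{1, 2}. \<Psi>' j \<tau> $ k = \<Psi>' j 0 $ k + \<tau> * \<delta> j $ k \<and> \<Psi>' j (1 - \<tau>) $ k = \<Psi>' j 1 $ k - \<tau> * \<delta> j $ k)"
    proof (rule exI[of _ l'], intro conjI ballI)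
      show "l' > 0" "l' \<le> 1" using l' by blast+
      fix \<tau> k assume "\<tau> \<in> {0..l'}" "k \<in> {1, 2 :: 3}"
      then have \<tau>: "0 \<le> \<tau>" "\<tau> \<le> l'" and k: "k = 1 \<or> k = 2" by auto
      have "\<tau> \<le> 1" using \<tau> l'(2)[of \<tau>] by simp
      show "\<Psi>' j \<tau> $ k = \<Psi>' j 0 $ k + \<tau> * \<delta> j $ k"
        using near[of \<tau> k] near[of 0 k] lin[OF k, of \<tau> 0] \<tau> k \<open>\<tau> \<le> 1\<close> \<open>l' > 0\<close> by simp
      show "\<Psi>' j (1 - \<tau>) $ k = \<Psi>' j 1 $ k - \<tau> * \<delta> j $ k"
        using near[of "1 - \<tau>" k] near[of 1 k] lin[OF k, of "1 - \<tau>" 1] \<tau> k \<open>\<tau> \<le> 1\<close> \<open>l' > 0\<close> by simp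
    qed
  next
    fix j j' c c' assume j: "j \<in> J" "j' \<in> J" "j \<noteq> j'" and eq: "a j + of_bool c *\<^sub>R D j = a j' + of_bool c' *\<^sub>R D j'"
    obtain b b' where b: "of_bool c = (of_bool b :: real)" "of_bool c' = (of_bool b' :: real)"
      "\<not> same_direction (planar_part (orient b (D j))) (planar_part (orient b' (D j')))"
      using meet[OF j _ _ eq] by auto
    then have "b = c" "b' = c'" by (auto simp: of_bool_def split: if_splits)
    moreover have "same_direction (planar_part (orient c (D j))) (planar_part (orient c' (D j')))"
      if "same_direction (orient c (\<delta> j)) (orient c' (\<delta> j'))"
      by (rule same_direction_scaled[OF that, of 1 1 s t]) (use s t in \<open>auto simp: \<delta>_def\<close>)
    ultimately show "\<not> same_direction (orient c (\<delta> j)) (orient c' (\<delta> j'))" using b(3) by blast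
  qed
qed

lemma same_direction_scaleR:
  assumes "same_direction (x *\<^sub>R u) (y *\<^sub>R v)" "x > 0" "y > 0"
  shows "same_direction u v"
proof -
  obtain c where c: "c > 0" "x *\<^sub>R u = c *\<^sub>R (y *\<^sub>R v)" using assms by (auto simp: same_direction_def)
  have "u = (1 / x) *\<^sub>R (x *\<^sub>R u)" using assms by simp
  also have "\<dots> = (c * y / x) *\<^sub>R v" unfolding c(2) by simp
  finally show ?thesis unfolding same_direction_def using c assms by (intro exI[of _ "c * y / x"]) simp
qed

section \<open>Corners of a polygonal graph and the assembly of all steps\<close>

text \<open>Distinct parameters of embedded edges share a point only at edge ends. The remaining
  coincidence, of two pieces of one edge at one parameter, is at their common breakpoint.\<close>

lemma embedded_plpath_meet:
  assumes emb: "embedded_graph G p (\<lambda>e. plpath (n e) (W e))"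
    and e: "e \<in> arcs G" "e' \<in> arcs G" and i: "i < n e" "i' < n e'" and ne: "(e, i) \<noteq> (e', i')"
    and \<tau>: "\<tau> \<in> {0..1}" "\<tau>' \<in> {0..1}"
    and eq: "W e i + \<tau> *\<^sub>R (W e (Suc i) - W e i) = W e' i' + \<tau>' *\<^sub>R (W e' (Suc i') - W e' i')"
  shows "\<tau> \<in> {0, 1} \<and> \<tau>' \<in> {0, 1}"
proof -
  define g where "g = (\<lambda>e. plpath (n e) (W e))"
  have embg: "embedded_graph G p g" using emb unfolding g_def .
  have n0: "real (n e) > 0" "real (n e') > 0" using i by auto
  define t t' where "t = (real i + \<tau>) / real (n e)" and "t' = (real i' + \<tau>') / real (n e')"
  have nt: "real (n e) * t = real i + \<tau>" "real (n e') * t' = real i' + \<tau>'" using n0 by (simp_all add: t_def t'_def)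
  have t01: "t \<in> {0..1}" "t' \<in> {0..1}" using i \<tau> n0 by (auto simp: t_def t'_def field_simps)
  have gt: "g e t = W e i + \<tau> *\<^sub>R (W e (Suc i) - W e i)" "g e' t' = W e' i' + \<tau>' *\<^sub>R (W e' (Suc i') - W e' i')"
    unfolding g_def using plpath_piece[of i "n e" t "W e"] plpath_piece[of i' "n e'" t' "W e'"] i \<tau> nt by simp_all
  have gg: "g e t = g e' t'" unfolding gt by (rule eq)
  have endp: "\<tau> \<in> {0, 1}" if "t = 0 \<or> t = 1" using that nt(1) i(1) \<tau>(1) by auto
  have endp': "\<tau>' \<in> {0, 1}" if "t' = 0 \<or> t' = 1" using that nt(2) i(2) \<tau>(2) by auto
  show ?thesis
  proof (cases "e = e'")
    case True
    then have ii: "i \<noteq> i'" using ne by simp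
    have "simple_path (g e)" using embg e by (auto simp: embedded_graph_def)
    then have "t = t' \<or> t = 0 \<and> t' = 1 \<or> t = 1 \<and> t' = 0"
      using gg t01 True unfolding simple_path_def loop_free_def by blast
    moreover have ?thesis if "t = t'"
    proof -
      have eq: "real i + \<tau> = real i' + \<tau>'" using nt that True by simp
      consider "real i + 1 \<le> real i'" | "real i' + 1 \<le> real i" using ii by linarith
      then show ?thesis using eq \<tau> by cases auto
    qed
    ultimately show ?thesis using endp endp' by blast
  next
    case False
    have vert: "g f s \<in> p ` verts G" if "f \<in> arcs G" "s = 0 \<or> s = 1" for f s
      using embg that unfolding embedded_graph_def fin_digraph_def wf_digraph_def pathstart_def pathfinish_def by fastforce
    have *: "s = 0 \<or> s = 1" if "f \<in> arcs G" "f' \<in> arcs G" "f \<noteq> f'" "s \<in> {0..1}" "s' \<in> {0..1}" "g f s = g f' s'" for f f' s s'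
    proof (rule ccontr)
      assume "\<not> ?thesis"
      then have s: "s \<in> {0<..<1}" using that(4) by auto
      have 1: "g f ` {0<..<1} \<inter> p ` verts G = {}" "g f ` {0<..<1} \<inter> g f' ` {0<..<1} = {}"
        using embg that(1-3) unfolding embedded_graph_def by blast+
      have "g f' s' \<in> g f ` {0<..<1}" using s that(6)[symmetric] by blast
      moreover have "s' \<in> {0<..<1} \<or> s' = 0 \<or> s' = 1" using that(5) by auto
      ultimately show False using 1 vert[OF that(2), of s'] by blast
    qed
    show ?thesis using *[OF e False t01 gg] *[OF e(2,1) False[symmetric] t01(2,1) gg[symmetric]] endp endp' by blast
  qed
qed

text \<open>Two segments leaving a common node in the same direction would overlap near it and so
  meet at interior points.\<close>

lemma embedded_plpath_directions:
  assumes emb: "embedded_graph G p (\<lambda>e. plpath (n e) (W e))"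
    and e: "e \<in> arcs G" "e' \<in> arcs G" and i: "i < n e" "i' < n e'" and ne: "(e, i) \<noteq> (e', i')"
    and eq: "W e i + of_bool c *\<^sub>R (W e (Suc i) - W e i) = W e' i' + of_bool c' *\<^sub>R (W e' (Suc i') - W e' i')"
  shows "\<not> same_direction (orient c (W e (Suc i) - W e i)) (orient c' (W e' (Suc i') - W e' i'))"
proof
  let ?D = "W e (Suc i) - W e i" and ?D' = "W e' (Suc i') - W e' i'"
  assume "same_direction (orient c ?D) (orient c' ?D')"
  then obtain \<kappa> where \<kappa>: "\<kappa> > 0" "orient c ?D = \<kappa> *\<^sub>R orient c' ?D'" by (auto simp: same_direction_def)
  \<comment> \<open>Advancing by \<open>s\<close> on one segment and by \<open>s * \<kappa>\<close>
    on the other leads to the same point; both amounts are positive and at most 1/2, so this point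
    is no end of either segment.\<close>
  define s where "s = min (1 / 2) (1 / (2 * \<kappa>))"
  have s: "s > 0" "s \<le> 1 / 2" "s * \<kappa> \<le> 1 / 2" "s * \<kappa> > 0" using \<kappa>(1) by (auto simp: s_def min_def field_simps)
  define move where "move b r = (if b then 1 - r else r)" for b and r :: real
  have mv: "of_bool b *\<^sub>R v + r *\<^sub>R orient b v = move b r *\<^sub>R v" for b r and v :: "real^3"
    by (simp add: orient_def move_def algebra_simps)
  have "W e i + move c s *\<^sub>R ?D = (W e i + of_bool c *\<^sub>R ?D) + s *\<^sub>R orient c ?D" unfolding mv[symmetric] by simp
  also have "\<dots> = (W e' i' + of_bool c' *\<^sub>R ?D') + (s * \<kappa>) *\<^sub>R orient c' ?D'" unfolding eq \<kappa>(2) by simp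
  also have "\<dots> = W e' i' + move c' (s * \<kappa>) *\<^sub>R ?D'" unfolding mv[symmetric] by simp
  finally have "move c s \<in> {0, 1}"
    using embedded_plpath_meet[where n = n and W = W, OF emb e i ne, of "move c s" "move c' (s * \<kappa>)"] s by (auto simp: move_def)
  then show False using s by (auto simp: move_def split: if_splits)
qed

theorem proposition3p2:
  fixes G :: "('v, 'e) pre_digraph"
    and p :: "'v \<Rightarrow> real^3"
    and \<gamma> :: "'e \<Rightarrow> real \<Rightarrow> real^3"
  assumes "embedded_graph G p \<gamma>"
    and "tame (graph_image G p \<gamma>)"
  shows "\<exists>(q :: 'v \<Rightarrow> real^3) (\<delta> :: 'e \<Rightarrow> real \<Rightarrow> real^3).
           legendrian_graph G q \<delta> \<and>
           ambient_isotopic (graph_image G p \<gamma>) (graph_image G q \<delta>)"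
proof -
  obtain S :: "((real^3) \<times> (real^3)) set" and \<phi>1 where S: "finite S" "isotopic_id \<phi>1"
    "\<phi>1 ` graph_image G p \<gamma> = (\<Union>(a, b)\<in>S. closed_segment a b)"
    using assms(2) unfolding tame_def ambient_isotopic_iff by blast
  obtain \<phi>1' where "homeomorphism UNIV UNIV \<phi>1 \<phi>1'" using isotopic_id_imp_homeomorphism[OF S(2)] by blast
  note emb1 = embedded_graph_homeomorphic_image[OF assms(1) this]
  define p1 where "p1 = \<phi>1 \<circ> p"
  obtain n W where n: "\<And>e. e \<in> arcs G \<Longrightarrow> n e > 0"
    and W: "\<And>e i. e \<in> arcs G \<Longrightarrow> i < n e \<Longrightarrow> W e i \<noteq> W e (Suc i)"
    and emb: "embedded_graph G p1 (\<lambda>e. plpath (n e) (W e))"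
    and img: "graph_image G p1 (\<lambda>e. plpath (n e) (W e)) = \<phi>1 ` graph_image G p \<gamma>"
  proof (rule embedded_graph_polygonal[OF emb1 S(1)])
    show "graph_image G (\<phi>1 \<circ> p) (\<lambda>e. \<phi>1 \<circ> \<gamma> e) = (\<Union>(a, b)\<in>S. closed_segment a b)"
      unfolding graph_image_comp by (rule S(3))
  next
    fix n W
    assume h: "\<And>e. e \<in> arcs G \<Longrightarrow> 0 < n e" "\<And>e i. e \<in> arcs G \<Longrightarrow> i < n e \<Longrightarrow> W e i \<noteq> W e (Suc i)"
      "embedded_graph G (\<phi>1 \<circ> p) (\<lambda>e. plpath (n e) (W e))"
      "graph_image G (\<phi>1 \<circ> p) (\<lambda>e. plpath (n e) (W e)) = graph_image G (\<phi>1 \<circ> p) (\<lambda>e. \<phi>1 \<circ> \<gamma> e)"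
    show thesis
      by (rule that[of n W]) (use h in \<open>auto simp: p1_def graph_image_comp\<close>)
  qed
  have fin: "finite (arcs G)" using emb by (auto simp: embedded_graph_def fin_digraph_def fin_digraph_axioms_def)
  define J where "J = (SIGMA e:arcs G. {..<n e})"
  have finJ: "finite J" unfolding J_def using fin by simp
  define D0 where "D0 j = W (fst j) (Suc (snd j)) - W (fst j) (snd j)" for j
  \<comment> \<open>Both orientations are included, since a node may be either end of a segment;
    opposite directions at a node are allowed, equal ones are to be excluded.\<close>
  define DS where "DS = (\<lambda>(j, c). orient c (D0 j)) ` (J \<times> UNIV)"
  have DS: "finite DS" "0 \<notin> DS" "\<And>j c. j \<in> J \<Longrightarrow> orient c (D0 j) \<in> DS"
  proof -
    show "finite DS" unfolding DS_def using finJ by simp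
    have "D0 j \<noteq> 0" if "j \<in> J" for j
      using W[of "fst j" "snd j"] that by (auto simp: J_def D0_def)
    then have "orient c (D0 j) \<noteq> 0" if "j \<in> J" for c j using that by (simp add: orient_def)
    then show "0 \<notin> DS" unfolding DS_def by force
    show "orient c (D0 j) \<in> DS" if "j \<in> J" for j c
      unfolding DS_def by (rule image_eqI[of _ _ "(j, c)"]) (use that in auto)
  qed
  obtain T where T: "linear T" "isotopic_id T" "\<And>w. w \<in> DS \<Longrightarrow> T w $ 1 \<noteq> 0 \<and> T w $ 3 \<noteq> 0"
    "\<And>v w. v \<in> DS \<Longrightarrow> w \<in> DS \<Longrightarrow> \<not> same_direction v w \<Longrightarrow> \<not> same_direction (planar_part (T v)) (planar_part (T w))"
  proof (rule generic_linear_map[OF DS(1,2)])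
    fix T
    assume h: "linear T" "isotopic_id T" "\<And>w. w \<in> DS \<Longrightarrow> T w $ 1 \<noteq> 0 \<and> T w $ 3 \<noteq> 0"
      "\<And>v w. v \<in> DS \<Longrightarrow> w \<in> DS \<Longrightarrow> \<not> same_direction v w \<Longrightarrow> \<not> same_direction (planar_part (T v)) (planar_part (T w))"
    show thesis by (rule that, (fact h)+)
  qed
  have T_orient: "T (orient c v) = orient c (T v)" for c v by (simp add: orient_def linear_neg[OF T(1)])
  obtain T' where "homeomorphism UNIV UNIV T T'" using isotopic_id_imp_homeomorphism[OF T(2)] by blast
  then have T_inj: "inj T" by (auto simp: homeomorphism_def intro: inj_on_inverseI)
  define a where "a j = T (W (fst j) (snd j))" for j
  define D where "D j = T (D0 j)" for j
  have aD: "a j + \<tau> *\<^sub>R D j = T (W (fst j) (snd j) + \<tau> *\<^sub>R D0 j)" for j \<tau>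
    by (simp add: a_def D_def linear_add[OF T(1)] linear_cmul[OF T(1)])
  have D13: "D j $ 1 \<noteq> 0 \<and> D j $ 3 \<noteq> 0" if "j \<in> J" for j
    using T(3)[OF DS(3)[OF that, of False]] by (simp add: D_def orient_def)
  have meet: "\<exists>c c'. \<tau> = of_bool c \<and> \<tau>' = of_bool c' \<and> \<not> same_direction (planar_part (orient c (D j))) (planar_part (orient c' (D j')))"
    if j: "j \<in> J" "j' \<in> J" "j \<noteq> j'" and \<tau>: "\<tau> \<in> {0..1}" "\<tau>' \<in> {0..1}" and eq: "a j + \<tau> *\<^sub>R D j = a j' + \<tau>' *\<^sub>R D j'" for j j' \<tau> \<tau>'
  proof -
    obtain e i where ji1: "j = (e, i)" by (cases j)
    obtain e' i' where ji2: "j' = (e', i')" by (cases j')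
    note ji = ji1 ji2
    have e: "e \<in> arcs G" "e' \<in> arcs G" "i < n e" "i' < n e'" "(e, i) \<noteq> (e', i')" using j by (auto simp: ji J_def)
    have eqW: "W e i + \<tau> *\<^sub>R (W e (Suc i) - W e i) = W e' i' + \<tau>' *\<^sub>R (W e' (Suc i') - W e' i')"
      using eq injD[OF T_inj] unfolding aD by (simp add: ji D0_def)
    from embedded_plpath_meet[where n = n and W = W, OF emb e \<tau> eqW]
    obtain c c' where c: "\<tau> = of_bool c" "\<tau>' = of_bool c'" by (metis insertE of_bool_eq(1,2) singletonD)
    have "\<not> same_direction (orient c (D0 j)) (orient c' (D0 j'))"
      using embedded_plpath_directions[where n = n and W = W, OF emb e eqW[unfolded c]] by (simp add: D0_def ji)
    then have "\<not> same_direction (planar_part (orient c (D j))) (planar_part (orient c' (D j')))"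
      using T(4)[OF DS(3)[OF j(1)] DS(3)[OF j(2)]] unfolding D_def T_orient by blast
    then show ?thesis using c by blast
  qed
  obtain \<Phi> \<Psi> \<delta> where \<Phi>: "isotopic_id \<Phi>" "\<And>j \<tau>. j \<in> J \<Longrightarrow> \<tau> \<in> {0..1} \<Longrightarrow> \<Phi> (a j + \<tau> *\<^sub>R D j) = \<Psi> j \<tau>"
    and \<Psi>: "\<And>j. j \<in> J \<Longrightarrow> gentle_on {0..1} (\<Psi> j)"
    and \<delta>: "\<And>j. j \<in> J \<Longrightarrow> \<delta> j $ 1 \<noteq> 0 \<and> \<delta> j $ 3 = 0"
    and \<Psi>end: "\<And>j. j \<in> J \<Longrightarrow> \<exists>l>0. l \<le> 1 \<and> (\<forall>\<tau>\<in>{0..l}. \<forall>k\<in>{1, 2}. \<Psi> j \<tau> $ k = \<Psi> j 0 $ k + \<tau> * \<delta> j $ k \<and> \<Psi> j (1 - \<tau>) $ k = \<Psi> j 1 $ k - \<tau> * \<delta> j $ k)"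
    and \<delta>dir: "\<And>j j' c c'. j \<in> J \<Longrightarrow> j' \<in> J \<Longrightarrow> j \<noteq> j' \<Longrightarrow> a j + of_bool c *\<^sub>R D j = a j' + of_bool c' *\<^sub>R D j' \<Longrightarrow>
      \<not> same_direction (orient c (\<delta> j)) (orient c' (\<delta> j'))"
  proof (rule legendrian_segments[of J D a])
    fix \<Phi> \<Psi> \<delta>
    assume h: "isotopic_id \<Phi>" "\<And>j \<tau>. j \<in> J \<Longrightarrow> \<tau> \<in> {0..1} \<Longrightarrow> \<Phi> (a j + \<tau> *\<^sub>R D j) = \<Psi> j \<tau>"
      "\<And>j. j \<in> J \<Longrightarrow> gentle_on {0..1} (\<Psi> j)"
      "\<And>j. j \<in> J \<Longrightarrow> \<delta> j $ 1 \<noteq> 0 \<and> \<delta> j $ 3 = 0"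
      "\<And>j. j \<in> J \<Longrightarrow> \<exists>l>0. l \<le> 1 \<and> (\<forall>\<tau>\<in>{0..l}. \<forall>k\<in>{1, 2}. \<Psi> j \<tau> $ k = \<Psi> j 0 $ k + \<tau> * \<delta> j $ k \<and> \<Psi> j (1 - \<tau>) $ k = \<Psi> j 1 $ k - \<tau> * \<delta> j $ k)"
      "\<And>j j' c c'. j \<in> J \<Longrightarrow> j' \<in> J \<Longrightarrow> j \<noteq> j' \<Longrightarrow> a j + of_bool c *\<^sub>R D j = a j' + of_bool c' *\<^sub>R D j' \<Longrightarrow>
        \<not> same_direction (orient c (\<delta> j)) (orient c' (\<delta> j'))"
    show thesis by (rule that, (fact h)+)
  qed (rule finJ D13 meet | assumption)+
  define F where "F e = (\<Phi> \<circ> T) \<circ> plpath (n e) (W e)" for e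
  define q where "q = (\<Phi> \<circ> T) \<circ> p1"
  have iso: "isotopic_id (\<Phi> \<circ> T)" by (rule isotopic_id_compose[OF T(2) \<Phi>(1)])
  then obtain k where "homeomorphism UNIV UNIV (\<Phi> \<circ> T) k" using isotopic_id_imp_homeomorphism by blast
  note embF = embedded_graph_homeomorphic_image[OF emb this, folded F_def q_def]
  have piece: "F e t = \<Psi> (e, i) (real (n e) * t - i)"
    if e: "e \<in> arcs G" "i < n e" and t: "real i \<le> real (n e) * t" "real (n e) * t \<le> real (Suc i)" for e i t
  proof -
    have "F e t = \<Phi> (a (e, i) + (real (n e) * t - i) *\<^sub>R D (e, i))"
      unfolding aD using plpath_piece[OF e(2) t, of "W e"] by (simp add: F_def D0_def)
    also have "\<dots> = \<Psi> (e, i) (real (n e) * t - i)" by (rule \<Phi>(2)) (use e t in \<open>auto simp: J_def\<close>)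
    finally show ?thesis .
  qed
  \<comment> \<open>A segment is now run through in time \<open>1 / n e\<close> instead of 1, which
    multiplies its planar velocity by \<open>n e\<close>.\<close>
  have near_start: "\<exists>l>0. l \<le> 1 / real (n e) \<and> (\<forall>t k. 0 \<le> t \<longrightarrow> t \<le> l \<longrightarrow> k = 1 \<or> k = 2 \<longrightarrow>
      F e (real i / real (n e) + t) $ k = F e (real i / real (n e)) $ k + t * (real (n e) *\<^sub>R \<delta> (e, i)) $ k \<and>
      F e (real (Suc i) / real (n e) - t) $ k = F e (real (Suc i) / real (n e)) $ k - t * (real (n e) *\<^sub>R \<delta> (e, i)) $ k)"
    if e: "e \<in> arcs G" "i < n e" for e i
  proof -
    have j: "(e, i) \<in> J" using e by (simp add: J_def)
    have n0: "real (n e) > 0" using e by simp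
    obtain l where l: "l > 0" "l \<le> 1" "\<And>\<tau> k. \<tau> \<in> {0..l} \<Longrightarrow> k \<in> {1, 2} \<Longrightarrow>
      \<Psi> (e, i) \<tau> $ k = \<Psi> (e, i) 0 $ k + \<tau> * \<delta> (e, i) $ k \<and> \<Psi> (e, i) (1 - \<tau>) $ k = \<Psi> (e, i) 1 $ k - \<tau> * \<delta> (e, i) $ k"
      using \<Psi>end[OF j] by blast
    have F01: "F e (real i / real (n e)) = \<Psi> (e, i) 0" "F e (real (Suc i) / real (n e)) = \<Psi> (e, i) 1"
      using piece[OF e, of "real i / real (n e)"] piece[OF e, of "real (Suc i) / real (n e)"] n0 by simp_all
    show ?thesis
    proof (rule exI[of _ "l / real (n e)"], intro conjI allI impI)
      show "l / real (n e) > 0" "l / real (n e) \<le> 1 / real (n e)" using l n0 by (auto intro: divide_right_mono)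
      fix t and k :: 3 assume t: "0 \<le> t" "t \<le> l / real (n e)" and k: "k = 1 \<or> k = 2"
      have nt: "real (n e) * t \<in> {0..l}" using t n0 by (simp add: pos_le_divide_eq mult.commute)
      have e1: "real (n e) * (real i / real (n e) + t) = real i + real (n e) * t"
        "real (n e) * (real (Suc i) / real (n e) - t) = real (Suc i) - real (n e) * t" using n0 by (simp_all add: field_simps)
      have "F e (real i / real (n e) + t) = \<Psi> (e, i) (real (n e) * t)"
        using piece[OF e, of "real i / real (n e) + t"] nt l(2) unfolding e1 by simp
      then show "F e (real i / real (n e) + t) $ k = F e (real i / real (n e)) $ k + t * (real (n e) *\<^sub>R \<delta> (e, i)) $ k"
        using l(3)[OF nt, of k] k F01 by auto
      have "F e (real (Suc i) / real (n e) - t) = \<Psi> (e, i) (1 - real (n e) * t)"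
        using piece[OF e, of "real (Suc i) / real (n e) - t"] nt l(2) unfolding e1 by simp
      then show "F e (real (Suc i) / real (n e) - t) $ k = F e (real (Suc i) / real (n e)) $ k - t * (real (n e) *\<^sub>R \<delta> (e, i)) $ k"
        using l(3)[OF nt, of k] k F01 by auto
    qed
  qed
  have gentle_piece: "gentle_on {real i / real (n e)..real (Suc i) / real (n e)} (F e)" if e: "e \<in> arcs G" "i < n e" for e i
  proof (rule gentle_on_affine[OF \<Psi>[of "(e, i)"], of "real (n e)" _ "- real i"])
    show "(e, i) \<in> J" using e by (simp add: J_def)
    show "real (n e) \<noteq> 0" using e by simp
    fix t assume "t \<in> {real i / real (n e)..real (Suc i) / real (n e)}"
    then have "real i \<le> real (n e) * t" "real (n e) * t \<le> real (Suc i)"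
      using e by (simp_all add: pos_divide_le_eq pos_le_divide_eq mult.commute)
    then show "- real i + real (n e) * t \<in> {0..1} \<and> F e t = \<Psi> (e, i) (- real i + real (n e) * t)"
      using piece[OF e, of t] by simp
  qed
  have gentle: "gentle_on {0..1} (F e)" if e: "e \<in> arcs G" for e
  proof -
    have n0: "real (n e) > 0" using n[OF e] by simp
    have "gentle_on {0..real (Suc k) / real (n e)} (F e)" if "k < n e" for k
      using that
    proof (induction k)
      case 0
      then show ?case using gentle_piece[OF e, of 0] by simp
    next
      case (Suc k)
      then have k: "k < n e" "Suc k < n e" by auto
      obtain l1 where l1: "l1 > 0" "\<And>t i. 0 \<le> t \<Longrightarrow> t \<le> l1 \<Longrightarrow> i = 1 \<or> i = 2 \<Longrightarrow>
         F e (real (Suc k) / real (n e) - t) $ i = F e (real (Suc k) / real (n e)) $ i - t * (real (n e) *\<^sub>R \<delta> (e, k)) $ i"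
        using near_start[OF e k(1)] by blast
      obtain l2 where l2: "l2 > 0" "\<And>t i. 0 \<le> t \<Longrightarrow> t \<le> l2 \<Longrightarrow> i = 1 \<or> i = 2 \<Longrightarrow>
         F e (real (Suc k) / real (n e) + t) $ i = F e (real (Suc k) / real (n e)) $ i + t * (real (n e) *\<^sub>R \<delta> (e, Suc k)) $ i"
        using near_start[OF e k(2)] by blast
      have j: "(e, k) \<in> J" "(e, Suc k) \<in> J" using e k by (auto simp: J_def)
      have \<delta>0: "\<delta> j \<noteq> 0" if "j \<in> J" for j using \<delta>[OF that] by (metis zero_index)
      \<comment> \<open>Consecutive segments share the node between them, so their directions away
        from it differ; this is the condition for gluing.\<close>
      have "a (e, k) + of_bool True *\<^sub>R D (e, k) = a (e, Suc k) + of_bool False *\<^sub>R D (e, Suc k)"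
        unfolding aD by (simp add: D0_def)
      then have dir: "\<not> same_direction (orient True (\<delta> (e, k))) (orient False (\<delta> (e, Suc k)))"
        by (rule \<delta>dir[OF j, rotated]) simp
      have nsd: "\<not> same_direction (- (real (n e) *\<^sub>R \<delta> (e, k))) (real (n e) *\<^sub>R \<delta> (e, Suc k))"
        using same_direction_scaleR[of "real (n e)" "- \<delta> (e, k)" "real (n e)" "\<delta> (e, Suc k)"] dir n0
        by (auto simp: orient_def)
      show ?case
      proof (rule gentle_on_glue[where p = "real (Suc k) / real (n e)" and l = "min l1 l2" and
            u = "real (n e) *\<^sub>R \<delta> (e, k)" and v = "real (n e) *\<^sub>R \<delta> (e, Suc k)"])
        show "gentle_on {0..real (Suc k) / real (n e)} (F e)" by (rule Suc.IH[OF k(1)])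
        show "gentle_on {real (Suc k) / real (n e)..real (Suc (Suc k)) / real (n e)} (F e)" by (rule gentle_piece[OF e k(2)])
        show "real (Suc k) / real (n e) < real (Suc (Suc k)) / real (n e)" using n0 by (intro divide_strict_right_mono) auto
        show "0 < real (Suc k) / real (n e)" using n0 by simp
        show "min l1 l2 > 0" using l1(1) l2(1) by simp
      qed (use \<delta>0 \<delta> j n0 nsd l1(2) l2(2) in auto)
    qed
    from this[of "n e - 1"] show ?thesis using n[OF e] n0 by simp
  qed
  \<comment> \<open>The outward planar direction at an end of an edge comes from its first segment
    at the tail and from its reversed last segment at the head.\<close>
  define d where "d x = real (n (fst x)) *\<^sub>R orient (snd x) (\<delta> (fst x, if snd x then n (fst x) - 1 else 0))" for x
  have jend: "(e, if b then n e - 1 else 0) \<in> J" if "e \<in> arcs G" for e b using n[OF that] that by (auto simp: J_def)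
  obtain q' \<delta>' \<phi> where leg: "legendrian_graph G q' \<delta>'" "isotopic_id \<phi>" "\<phi> ` graph_image G q F = graph_image G q' \<delta>'"
  proof (rule legendrian_smoothing[of G q F d])
    show "embedded_graph G q F" by (rule embF)
    fix e assume e: "e \<in> arcs G"
    show "\<exists>C. \<forall>a\<in>{0..1}. \<forall>b\<in>{0..1}. norm (F e b - F e a) \<le> C * \<bar>b - a\<bar>" "\<exists>B. horizontal_on {0..1} (F e) B"
      "locally_expanding_on {0..1} (F e)" using gentle[OF e] unfolding gentle_on_def by blast+
    have n0: "0 < n e" "n e - 1 < n e" using n[OF e] by auto
    have n1: "real (Suc (n e - 1)) / real (n e) = 1" using n0 by simp
    obtain l1 where l1: "l1 > 0" "\<And>t i. 0 \<le> t \<Longrightarrow> t \<le> l1 \<Longrightarrow> i = 1 \<or> i = 2 \<Longrightarrow>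
       F e (real 0 / real (n e) + t) $ i = F e (real 0 / real (n e)) $ i + t * (real (n e) *\<^sub>R \<delta> (e, 0)) $ i"
      using near_start[OF e n0(1)] by blast
    obtain l2 where l2: "l2 > 0" "\<And>t i. 0 \<le> t \<Longrightarrow> t \<le> l2 \<Longrightarrow> i = 1 \<or> i = 2 \<Longrightarrow>
       F e (real (Suc (n e - 1)) / real (n e) - t) $ i = F e (real (Suc (n e - 1)) / real (n e)) $ i - t * (real (n e) *\<^sub>R \<delta> (e, n e - 1)) $ i"
      using near_start[OF e n0(2)] by blast
    show "\<exists>l>0. \<forall>t\<in>{0..l}. \<forall>i\<in>{1, 2}. F e t $ i = F e 0 $ i + t * d (e, False) $ i \<and> F e (1 - t) $ i = F e 1 $ i + t * d (e, True) $ i"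
    proof (rule exI[of _ "min l1 l2"], intro conjI ballI)
      show "min l1 l2 > 0" using l1 l2 by simp
      fix t and i :: 3 assume t: "t \<in> {0..min l1 l2}" and "i \<in> {1, 2}"
      then have i: "i = 1 \<or> i = 2" by auto
      show "F e t $ i = F e 0 $ i + t * d (e, False) $ i" using l1(2)[OF _ _ i, of t] t by (simp add: d_def)
      show "F e (1 - t) $ i = F e 1 $ i + t * d (e, True) $ i" using l2(2)[OF _ _ i, of t] t unfolding n1 by (simp add: d_def)
    qed
  next
    fix x :: "'e \<times> bool" assume x: "fst x \<in> arcs G"
    show "d x $ 1 \<noteq> 0 \<and> d x $ 3 = 0" using \<delta>[OF jend[OF x, of "snd x"]] n[OF x] by (cases "snd x") (simp_all add: d_def)
  next
    fix x y :: "'e \<times> bool" assume x: "fst x \<in> arcs G" and y: "fst y \<in> arcs G" and xy: "x \<noteq> y" "end_vertex G x = end_vertex G y"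
    define j where "j z = (fst z, if snd z then n (fst z) - 1 else 0)" for z :: "'e \<times> bool"
    have jJ: "j x \<in> J" "j y \<in> J" unfolding j_def by (rule jend x y)+
    have tip: "a (j z) + of_bool (snd z) *\<^sub>R D (j z) = T (p1 (end_vertex G z))" if z: "fst z \<in> arcs G" for z
    proof -
      have "plpath (n (fst z)) (W (fst z)) 0 = p1 (tail G (fst z)) \<and> plpath (n (fst z)) (W (fst z)) 1 = p1 (head G (fst z))"
        using emb z by (simp add: embedded_graph_def pathstart_def pathfinish_def)
      then have "W (fst z) 0 = p1 (tail G (fst z))" "W (fst z) (n (fst z)) = p1 (head G (fst z))"
        using plpath_ends[OF n[OF z], of "W (fst z)"] by simp_all
      then show ?thesis unfolding aD using n[OF z] by (cases z) (auto simp: j_def D0_def end_vertex_def)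
    qed
    show "\<not> same_direction (d x) (d y)"
    proof
      assume "same_direction (d x) (d y)"
      then have sd: "same_direction (orient (snd x) (\<delta> (j x))) (orient (snd y) (\<delta> (j y)))"
        unfolding d_def j_def by (rule same_direction_scaleR) (use n[OF x] n[OF y] in auto)
      show False
      proof (cases "j x = j y")
        case False
        have "a (j x) + of_bool (snd x) *\<^sub>R D (j x) = a (j y) + of_bool (snd y) *\<^sub>R D (j y)"
          unfolding tip[OF x] tip[OF y] xy(2) ..
        from \<delta>dir[OF jJ False this] sd show False by blast
      next
        \<comment> \<open>Both ends belong to one and the same segment; their directions are then
          opposite, and the nonzero first coordinate excludes that they coincide.\<close>
        case True
        then have "snd x \<noteq> snd y" using xy(1) by (auto simp: j_def prod_eq_iff)
        obtain \<kappa> where \<kappa>: "\<kappa> > 0" "orient (snd x) (\<delta> (j x)) = \<kappa> *\<^sub>R orient (snd y) (\<delta> (j y))" using sd by (auto simp: same_direction_def)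
        have "orient (snd x) (\<delta> (j y)) $ 1 = \<kappa> * orient (snd y) (\<delta> (j y)) $ 1" using \<kappa>(2) True by simp
        then have "(1 + \<kappa>) * \<delta> (j y) $ 1 = 0" using \<open>snd x \<noteq> snd y\<close> by (auto simp: algebra_simps split: if_splits)
        then show False using \<kappa>(1) \<delta>[OF jJ(2)] by simp
      qed
    qed
  qed (rule that, assumption+)
  have "graph_image G q F = (\<Phi> \<circ> T) ` (\<phi>1 ` graph_image G p \<gamma>)"
    unfolding q_def F_def graph_image_comp img ..
  then have "(\<phi> \<circ> ((\<Phi> \<circ> T) \<circ> \<phi>1)) ` graph_image G p \<gamma> = graph_image G q' \<delta>'"
    using leg(3) by (simp add: image_comp)
  moreover have "isotopic_id (\<phi> \<circ> ((\<Phi> \<circ> T) \<circ> \<phi>1))"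
    by (rule isotopic_id_compose[OF isotopic_id_compose[OF S(2) iso] leg(2)])
  ultimately have "ambient_isotopic (graph_image G p \<gamma>) (graph_image G q' \<delta>')" unfolding ambient_isotopic_iff by blast
  then show ?thesis using leg(1) by blast
qed

end
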